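(* Let $\mathbb M$ be a connected non-empty $(d+1)$-dimensional manifold with a system of fields $\mathcal C$, linearly enriched over a commutative unital ring $R$, and local relations $\mathcal U$, and let $b\in\mathcal C(\partial\mathbb M)$ be a fixed boundary field. Let $\overline{\mathcal F}$ be the associated operad of fields over the unary operadic category $\overline{\mathtt{Blob}}(\mathcal C)$, $\overline{\mathcal M}$ the associated $\overline{\mathcal F}$-module over the left operadic module $\overline{\mathtt M}(\mathcal C)$, and $\mathcal F$, $\mathcal M$ their restrictions to $\mathtt{Blob}(\mathcal C)$ and $\mathtt M(\mathcal C)$. (1) The augmented un-normalized bar complex $\beta_*(\overline{\mathcal F},\overline{\mathcal M})\big((\mathbb M;b)\to\varnothing\big)\to\mathcal C(\mathbb M;b)$ is a component (the one at the object $(\mathbb M;b)\to\varnothing$ of $\overline{\mathtt M}(\mathcal C)$) of an acyclic resolution of $\overline{\mathcal M}$ via free unital $\overline{\mathcal F}$-modules. In particular $$H_0\big(\beta_*(\overline{\mathcal F},\overline{\mathcal M})((\mathbb M;b)\to\varnothing)\big)\cong\mathcal C(\mathbb M;b).$$ (2) The augmented complex $\beta_*(\mathcal F,\mathcal M)(\mathbb M;b)\to\mathcal C(\mathbb M;b)$ resolves the skein module $A(\mathbb M;b)=\mathcal C(\mathbb M;b)/\mathcal U(\mathbb M;b)$, namely $$H_{-1}\big(\beta_*(\mathcal F,\mathcal M)(\mathbb M;b)\to\mathcal C(\mathbb M;b)\big)\cong A(\mathbb M;b),$$ where $H_{-1}$ denotes the homology at $\mathcal C(\mathbb M;b)$.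 The analogous statements hold for the normalized bar constructions $B_*$ in place of $\beta_*$.
   Context: **Fields.** A system of fields assigns to each manifold $X$ of dimension $\le d+1$ a set $\mathcal C(X)$, with functorial restrictions $\mathcal C(X)\to\mathcal C(Z)$ to codimension-zero submanifolds $Z\subset\partial X$, and with glueing: fields on $X'$ and $X''$ agreeing on a common (here closed) boundary piece $Z$ glue to a field on $X'\sqcup_ZX''$ restricting to the given ones. $\mathcal C(X;c)$ is the set of fields on $X$ restricting to $c$ on the boundary. Linear enrichment: for $(d+1)$-dimensional (codimension zero) $X\subset\mathbb M$ the sets $\mathcal C(X;c)$, $c\in\mathcal C(\partial X)$, are $R$-modules, glueing is $R$-bilinear, and disjoint unions correspond to tensor products over $R$. **Blobs.** A blob in a $(d+1)$-manifold $X$ is an embedded closed $(d+1)$-ball $D\subset X$ that either lies in the interior of $X$ with $X\setminus\mathring D$ a manifold with boundary $\partial X\cup\partial D$, or is a connected component of $X$. A blob configuration $\mathscr D$ in $X$ is a nonempty finite unordered set of pairwise disjoint blobs; $\mathscr D$ also denotes the union. If a blob $D$ is a component of $X$, the corresponding component of $X\setminus\mathring D$ is the sphere $\partial D$, regarded as a degenerate $(d+1)$-manifold; in this case the boundary fields on both sides are required to be the same field $c$ and the module of fields on it is $R\cdot c$, free of rank one. **Local relations.** Submodules $\mathcal U(D;c)\subset\mathcal C(D;c)$ for all blobs $D$ and $c\in\mathcal C(\partial D)$, such that if $D'\subset\mathring D$ are blobs, $u\in\mathcal U(D';c')$ and $r\in\mathcal C(D\setminus\mathring D';c\sqcup c')$,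 then $u\sqcup_{\partial D'}r\in\mathcal U(D;c)$. $\mathcal U(\mathbb M;b)\subset\mathcal C(\mathbb M;b)$ is the span of all glueings $u\sqcup_{\partial D}r$ with $D\subset\mathbb M$ a blob, $u\in\mathcal U(D;c)$, $r\in\mathcal C(\mathbb M\setminus\mathring D;b\sqcup c)$. **Unary operadic category.** A category $\mathtt O$ with functors $\mathscr F_S:\mathtt O/S\to\mathtt O$; $\mathrm{Fib}(f):=\mathscr F_S(f)$ for $f:X\to S$, and $\varphi_S:\mathrm{Fib}(f''\varphi)\to\mathrm{Fib}(f'')$ denotes the induced map for $\varphi:X'\to X''$, $f'':X''\to S$. Axioms: $\mathrm{Fib}(\varphi_S)=\mathrm{Fib}(\varphi)$, and $(\varphi_T)_{\mathrm{Fib}(c)}=\varphi_S$ for $Y\xrightarrow{\varphi}X\xrightarrow{a}S\xrightarrow{c}T$. A *left operadic $\mathtt O$-module* $\mathtt M$ has objects $L$, arrows $\alpha:L\to S$ to objects $S$ of $\mathtt O$ that can be postcomposed with morphisms of $\mathtt O$ (associatively and unitally), fibers $\mathrm{Fib}(\alpha)$ that are objects of $\mathtt M$, and induced arrows $\alpha_S:\mathrm{Fib}(g\alpha)\to\mathrm{Fib}(g)$ with the same axioms. **Operads, modules.** An $\mathtt O$-operad $\mathcal P$ in $R$-modules: maps $\gamma_h:\mathcal P(F)\otimes\mathcal P(B)\to\mathcal P(A)$ for $h:A\to B$ with fiber $F$, such that $\gamma_f(\mathrm{id}\otimes\gamma_g)=\gamma_{gf}(\gamma_{f_C}\otimes\mathrm{id})$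 for $A\xrightarrow fB\xrightarrow gC$. It is unital with units $1_T\in\mathcal P(\mathrm{Fib}(\mathrm{id}_T))$ if $\gamma_{\mathrm{id}_T}(1_T,x)=x$ and $\gamma_{f_T}(x,1_T)=x$ for all $f:S\to T$, $x\in\mathcal P(\mathrm{Fib}(f))$. A $\mathcal P$-module over $\mathtt M$: maps $\nu_\alpha:\mathcal M(G)\otimes\mathcal P(S)\to\mathcal M(L)$ for arrows $\alpha:L\to S$ with fiber $G$, with $\nu_\alpha(\mathrm{id}\otimes\gamma_g)=\nu_{g\alpha}(\nu_{\alpha_C}\otimes\mathrm{id})$ for $L\xrightarrow{\alpha}B\xrightarrow{g}C$; unital if $\nu_{\alpha_T}(x,1_T)=x$ for all $\alpha:L\to T$, $x\in\mathcal M(\mathrm{Fib}(\alpha))$. Free unital modules are values of the left adjoint to the forgetful functor to collections indexed by objects of $\mathtt M$. **Bar construction.** $\beta_n(\mathcal P,\mathcal M)(L)=\bigoplus\mathcal P(T_0)\otimes\mathcal P(F_1)\otimes\cdots\otimes\mathcal P(F_n)\otimes\mathcal M(N)$ over towers $T_0\xleftarrow{f_1}T_1\leftarrow\cdots\xleftarrow{f_n}T_n\xleftarrow{\alpha}L$, $F_i=\mathrm{Fib}(f_i)$, $N=\mathrm{Fib}(\alpha)$; $\partial_n=\sum_{i=0}^n(-1)^id_i$ where $d_i$ deletes $T_i$ and replaces $t_0\otimes p_1$ by $\gamma_{f_1}(p_1,t_0)$ ($i=0$), $p_i\otimes p_{i+1}$ by $\gamma_{(f_{i+1})_{T_{i-1}}}(p_{i+1},p_i)$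 ($0<i<n$), $p_n\otimes m$ by $\nu_{\alpha_{T_{n-1}}}(m,p_n)$ ($i=n$). Augmentation $\epsilon:\beta_0(\mathcal P,\mathcal M)(L)\to\mathcal M(L)$, $\epsilon(t_0\otimes m)=\nu_\alpha(m,t_0)$. $B_*$ is the quotient of $\beta_*$ by the images of the degeneracies $s_j$ inserting $\mathrm{id}_{T_j}$ and $1_{T_j}$. **Categories of blobs.** Decorated configurations are pairs $(\mathscr D;c)$ with $\mathscr D$ a blob configuration in $\mathbb M$, $c\in\mathcal C(\partial\mathscr D)$; in addition there is the empty configuration $\varnothing$. Write $(\mathscr D';c')\hookleftarrow(\mathscr D;c)$ if $\mathscr D$ is a blob configuration in $\bigcup\mathscr D'$ and $c,c'$ agree on the boundary of each blob common to $\mathscr D$ and $\mathscr D'$; also $X\hookleftarrow\varnothing$ for every $X$ (including $\varnothing$). Objects of $\overline{\mathtt{Blob}}(\mathcal C)$ are all such relations $X'\hookleftarrow X$; there is a unique morphism $(X'\hookleftarrow X)\to(X''\hookleftarrow X)$ whenever $X'\hookleftarrow X''\hookleftarrow X$, its fiber is $X'\hookleftarrow X''$, and there are no other morphisms. $\mathtt{Blob}(\mathcal C)$ is the full operadic subcategory on all objects except $\varnothing\hookleftarrow\varnothing$. Objects of $\overline{\mathtt M}(\mathcal C)$ are $(\mathbb M;b)\hookleftarrow X$ with $X=\varnothing$ or $X=(\mathscr D;c)$, $\mathscr D$ a blob configuration in $\mathbb M$ (with $c=b$ if $\mathbb M$ is a ball and $\mathscr D=\{\mathbb M\}$); there is a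 unique arrow from $(\mathbb M;b)\hookleftarrow X$ to $X'\hookleftarrow X$ whenever $(\mathbb M;b)\hookleftarrow X'\hookleftarrow X$, with fiber $(\mathbb M;b)\hookleftarrow X'$. $\mathtt M(\mathcal C)$ has the same objects, and the arrows whose target is not $\varnothing\hookleftarrow\varnothing$. The object $(\mathbb M;b)\hookleftarrow\varnothing$ is denoted $(\mathbb M;b)\to\varnothing$ in $\overline{\mathtt M}(\mathcal C)$ and $(\mathbb M;b)$ in $\mathtt M(\mathcal C)$. **Operad and module of fields.** For $X'=(\mathscr D';c')$ and $X=(\mathscr D;c)$ or $\varnothing$, and $E\in\mathscr D'$, let $\mathscr D_E$ be the set of blobs of $\mathscr D$ contained in $E$. Then $\overline{\mathcal F}(X'\hookleftarrow X)$ is the tensor product over $E\in\mathscr D'$ of $\mathcal C(E\setminus\mathring{\mathscr D}_E;\,c'|_{\partial E}\sqcup c|_{\partial\mathscr D_E})$ if $\mathscr D_E\ne\emptyset$ and of $\mathcal U(E;c'|_{\partial E})$ if $\mathscr D_E=\emptyset$; and $\overline{\mathcal F}(\varnothing\hookleftarrow\varnothing):=R$. Further $\overline{\mathcal M}((\mathbb M;b)\hookleftarrow(\mathscr D;c)):=\mathcal C(\mathbb M\setminus\mathring{\mathscr D};b\sqcup c)$, $\overline{\mathcal M}((\mathbb M;b)\hookleftarrow\varnothing):=\mathcal C(\mathbb M;b)$. Structure operations are given by glueing of fields along the boundaries of the intermediate blobs; the units are $c\in\overline{\mathcal F}((\mathscr D;c)\hookleftarrow(\mathscr D;c))$ and $1\in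 R$. *)

theory Defs
  imports "HOL-Analysis.Analysis" "HOL-Homology.Homology" "HOL-Algebra.Module" "HOL-Algebra.AbelCoset"
begin

section \<open>Modules over a commutative ring\<close>

definition mk_module ::
  "'b set \<Rightarrow> ('b \<Rightarrow> 'b \<Rightarrow> 'b) \<Rightarrow> 'b \<Rightarrow> ('a \<Rightarrow> 'b \<Rightarrow> 'b) \<Rightarrow> ('a, 'b) module" where
  "mk_module A p z s =
     \<lparr>carrier = A, monoid.mult = (\<lambda>_ _. z), one = z, zero = z, add = p, smult = s\<rparr>"

definition zero_module :: "('r, unit) module" where
  "zero_module = mk_module {()} (\<lambda>_ _. ()) () (\<lambda>_ _. ())"

definition mlinear :: "'r ring \<Rightarrow> ('r, 'a) module \<Rightarrow> ('r, 'b) module \<Rightarrow> ('a \<Rightarrow> 'b) \<Rightarrow> bool" where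
  "mlinear R A B f \<longleftrightarrow>
     f \<in> carrier A \<rightarrow> carrier B \<and>
     (\<forall>x\<in>carrier A. \<forall>y\<in>carrier A. f (x \<oplus>\<^bsub>A\<^esub> y) = f x \<oplus>\<^bsub>B\<^esub> f y) \<and>
     (\<forall>a\<in>carrier R. \<forall>x\<in>carrier A. f (a \<odot>\<^bsub>A\<^esub> x) = a \<odot>\<^bsub>B\<^esub> f x)"

definition mbilinear ::
  "'r ring \<Rightarrow> ('r, 'a) module \<Rightarrow> ('r, 'b) module \<Rightarrow> ('r, 'c) module \<Rightarrow> ('a \<Rightarrow> 'b \<Rightarrow> 'c) \<Rightarrow> bool" where
  "mbilinear R A B C f \<longleftrightarrow>
     (\<forall>x\<in>carrier A. mlinear R B C (f x)) \<and>
     (\<forall>y\<in>carrier B. mlinear R A C (\<lambda>x. f x y))"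

definition module_iso :: "'r ring \<Rightarrow> ('r, 'a) module \<Rightarrow> ('r, 'b) module \<Rightarrow> bool" where
  "module_iso R A B \<longleftrightarrow> (\<exists>h. mlinear R A B h \<and> bij_betw h (carrier A) (carrier B))"

definition mspan :: "'r ring \<Rightarrow> ('r, 'a) module \<Rightarrow> 'a set \<Rightarrow> 'a set" where
  "mspan R M S = \<Inter>{N. submodule N R M \<and> S \<subseteq> N}"

definition mquot :: "('r, 'a) module \<Rightarrow> 'a set \<Rightarrow> ('r, 'a set) module" where
  "mquot M N = mk_module (a_rcosets\<^bsub>M\<^esub> N) (\<lambda>K L. K <+>\<^bsub>M\<^esub> L) N
     (\<lambda>a K. \<Union>x\<in>K. N +>\<^bsub>M\<^esub> (a \<odot>\<^bsub>M\<^esub> x))"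

text \<open>The map between quotients by \<^term>\<open>N\<close> and \<^term>\<open>N'\<close> induced by a linear map into
  \<^term>\<open>M'\<close> sending the first submodule into the second.\<close>

definition mquot_map :: "('r, 'b) module \<Rightarrow> 'b set \<Rightarrow> ('a \<Rightarrow> 'b) \<Rightarrow> 'a set \<Rightarrow> 'b set" where
  "mquot_map M' N' f K = (\<Union>x\<in>K. N' +>\<^bsub>M'\<^esub> f x)"

text \<open>Transport of a module structure along an injection, used to place modules with
  different carrier types into a common sum type.\<close>

definition tag_module :: "('a \<Rightarrow> 'b) \<Rightarrow> ('r, 'a) module \<Rightarrow> ('r, 'b) module" where
  "tag_module t M = mk_module (t ` carrier M)
     (\<lambda>u v. t (inv_into (carrier M) t u \<oplus>\<^bsub>M\<^esub> inv_into (carrier M) t v))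
     (t \<zero>\<^bsub>M\<^esub>)
     (\<lambda>a u. t (a \<odot>\<^bsub>M\<^esub> inv_into (carrier M) t u))"

definition direct_sum :: "'i set \<Rightarrow> ('i \<Rightarrow> ('r, 'a) module) \<Rightarrow> ('r, 'i \<Rightarrow> 'a) module" where
  "direct_sum I A = mk_module
     {x \<in> (\<Pi>\<^sub>E i\<in>I. carrier (A i)). finite {i \<in> I. x i \<noteq> \<zero>\<^bsub>A i\<^esub>}}
     (\<lambda>x y. \<lambda>i\<in>I. x i \<oplus>\<^bsub>A i\<^esub> y i)
     (\<lambda>i\<in>I. \<zero>\<^bsub>A i\<^esub>)
     (\<lambda>a x. \<lambda>i\<in>I. a \<odot>\<^bsub>A i\<^esub> x i)"

definition summand_incl :: "'i set \<Rightarrow> ('i \<Rightarrow> ('r, 'a) module) \<Rightarrow> 'i \<Rightarrow> 'a \<Rightarrow> 'i \<Rightarrow> 'a" where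
  "summand_incl I A j u = (\<lambda>i\<in>I. if i = j then u else \<zero>\<^bsub>A i\<^esub>)"

definition free_module :: "'r ring \<Rightarrow> 'g set \<Rightarrow> ('r, 'g \<Rightarrow> 'r) module" where
  "free_module R G = mk_module
     {\<xi>. (\<forall>g. \<xi> g \<in> carrier R) \<and> (\<forall>g. g \<notin> G \<longrightarrow> \<xi> g = \<zero>\<^bsub>R\<^esub>) \<and> finite {g. \<xi> g \<noteq> \<zero>\<^bsub>R\<^esub>}}
     (\<lambda>\<xi> \<eta> g. \<xi> g \<oplus>\<^bsub>R\<^esub> \<eta> g) (\<lambda>_. \<zero>\<^bsub>R\<^esub>) (\<lambda>a \<xi> g. a \<otimes>\<^bsub>R\<^esub> \<xi> g)"

definition basis_elem :: "'r ring \<Rightarrow> 'g \<Rightarrow> 'g \<Rightarrow> 'r" where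
  "basis_elem R g = (\<lambda>h. if h = g then \<one>\<^bsub>R\<^esub> else \<zero>\<^bsub>R\<^esub>)"

text \<open>The tensor product over \<^term>\<open>R\<close> of a finite family of modules: formal linear
  combinations of families, modulo multilinearity. For empty \<^term>\<open>I\<close> there is exactly one
  family and no relation, so the result is free of rank one on the empty tensor.\<close>

definition multilinear_relations ::
  "'r ring \<Rightarrow> 'i set \<Rightarrow> ('i \<Rightarrow> ('r, 'a) module) \<Rightarrow> (('i \<Rightarrow> 'a) \<Rightarrow> 'r) set" where
  "multilinear_relations R I A =
     (let F = free_module R (\<Pi>\<^sub>E i\<in>I. carrier (A i)); \<delta> = basis_elem R in
     {\<delta> (x(i := u \<oplus>\<^bsub>A i\<^esub> v)) \<ominus>\<^bsub>F\<^esub> (\<delta> (x(i := u)) \<oplus>\<^bsub>F\<^esub> \<delta> (x(i := v))) |x i u v.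
        x \<in> (\<Pi>\<^sub>E i\<in>I. carrier (A i)) \<and> i \<in> I \<and> u \<in> carrier (A i) \<and> v \<in> carrier (A i)} \<union>
     {\<delta> (x(i := a \<odot>\<^bsub>A i\<^esub> u)) \<ominus>\<^bsub>F\<^esub> a \<odot>\<^bsub>F\<^esub> \<delta> (x(i := u)) |x i a u.
        x \<in> (\<Pi>\<^sub>E i\<in>I. carrier (A i)) \<and> i \<in> I \<and> a \<in> carrier R \<and> u \<in> carrier (A i)})"

definition tensor ::
  "'r ring \<Rightarrow> 'i set \<Rightarrow> ('i \<Rightarrow> ('r, 'a) module) \<Rightarrow> ('r, (('i \<Rightarrow> 'a) \<Rightarrow> 'r) set) module" where
  "tensor R I A =
     (let F = free_module R (\<Pi>\<^sub>E i\<in>I. carrier (A i))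
      in mquot F (mspan R F (multilinear_relations R I A)))"

definition pure_tensor ::
  "'r ring \<Rightarrow> 'i set \<Rightarrow> ('i \<Rightarrow> ('r, 'a) module) \<Rightarrow> ('i \<Rightarrow> 'a) \<Rightarrow> (('i \<Rightarrow> 'a) \<Rightarrow> 'r) set" where
  "pure_tensor R I A x =
     (let F = free_module R (\<Pi>\<^sub>E i\<in>I. carrier (A i))
      in mspan R F (multilinear_relations R I A) +>\<^bsub>F\<^esub> basis_elem R x)"

definition exhibits_tensor ::
  "'r ring \<Rightarrow> ('r, 'a) module \<Rightarrow> ('r, 'a) module \<Rightarrow> ('r, 'b) module \<Rightarrow> ('a \<Rightarrow> 'a \<Rightarrow> 'b) \<Rightarrow> bool" where
  "exhibits_tensor R A B C f \<longleftrightarrow>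
     (let I = {False, True}; AB = (\<lambda>i. if i then B else A) in
      \<exists>h. mlinear R (tensor R I AB) C h \<and>
          bij_betw h (carrier (tensor R I AB)) (carrier C) \<and>
          (\<forall>x\<in>carrier A. \<forall>y\<in>carrier B.
             h (pure_tensor R I AB (\<lambda>i\<in>I. if i then y else x)) = f x y))"

text \<open>The unique linear, respectively bilinear, map with prescribed values on generators.\<close>

definition linear_ext ::
  "'r ring \<Rightarrow> ('r, 'a) module \<Rightarrow> ('r, 'b) module \<Rightarrow> 'g set \<Rightarrow> ('g \<Rightarrow> 'a) \<Rightarrow> ('g \<Rightarrow> 'b) \<Rightarrow> 'a \<Rightarrow> 'b" where
  "linear_ext R A B G gen v =
     (THE h. mlinear R A B h \<and> h \<in> extensional (carrier A) \<and> (\<forall>g\<in>G. h (gen g) = v g))"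

definition bilinear_ext ::
  "'r ring \<Rightarrow> ('r, 'a) module \<Rightarrow> ('r, 'b) module \<Rightarrow> ('r, 'c) module \<Rightarrow>
   'g set \<Rightarrow> ('g \<Rightarrow> 'a) \<Rightarrow> 'h set \<Rightarrow> ('h \<Rightarrow> 'b) \<Rightarrow> ('g \<Rightarrow> 'h \<Rightarrow> 'c) \<Rightarrow> 'a \<Rightarrow> 'b \<Rightarrow> 'c" where
  "bilinear_ext R A B C G gen H gen' v =
     (THE f. mbilinear R A B C f \<and>
        f \<in> extensional (carrier A) \<and> (\<forall>x\<in>carrier A. f x \<in> extensional (carrier B)) \<and>
        (\<forall>g\<in>G. \<forall>h\<in>H. f (gen g) (gen' h) = v g h))"

text \<open>The homology at \<^term>\<open>B\<close> of \<open>A \<rightarrow> B \<rightarrow> C\<close>.\<close>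

definition homology_at ::
  "('r, 'a) module \<Rightarrow> ('a \<Rightarrow> 'b) \<Rightarrow> ('r, 'b) module \<Rightarrow> ('b \<Rightarrow> 'c) \<Rightarrow> ('r, 'c) module \<Rightarrow>
   ('r, 'b set) module" where
  "homology_at A f B g C =
     mquot (B\<lparr>carrier := {x \<in> carrier B. g x = \<zero>\<^bsub>C\<^esub>}\<rparr>) (f ` carrier A)"

definition exact_at ::
  "('r, 'a) module \<Rightarrow> ('a \<Rightarrow> 'b) \<Rightarrow> ('r, 'b) module \<Rightarrow> ('b \<Rightarrow> 'c) \<Rightarrow> ('r, 'c) module \<Rightarrow> bool" where
  "exact_at A f B g C \<longleftrightarrow> f ` carrier A = {x \<in> carrier B. g x = \<zero>\<^bsub>C\<^esub>}"


section \<open>Unary operadic categories, operads and modules\<close>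

text \<open>\<open>Cmp g f\<close> is \<open>g \<circ> f\<close>; for \<open>\<phi> : X' \<rightarrow> X''\<close> and \<open>f : X'' \<rightarrow> S\<close>, \<open>Ind f \<phi>\<close> is the induced
  morphism \<open>\<phi>\<^sub>S : Fib (f \<circ> \<phi>) \<rightarrow> Fib f\<close>.\<close>

record ('o, 'm) opcat =
  Obj :: "'o set"
  Arr :: "'m set"
  Dom :: "'m \<Rightarrow> 'o"
  Cod :: "'m \<Rightarrow> 'o"
  Idn :: "'o \<Rightarrow> 'm"
  Cmp :: "'m \<Rightarrow> 'm \<Rightarrow> 'm"
  Fib :: "'m \<Rightarrow> 'o"
  Ind :: "'m \<Rightarrow> 'm \<Rightarrow> 'm"

definition hom_opcat :: "('o, 'm) opcat \<Rightarrow> 'o \<Rightarrow> 'o \<Rightarrow> 'm set" where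
  "hom_opcat Op S T = {f \<in> Arr Op. Dom Op f = S \<and> Cod Op f = T}"

locale unary_operadic_category =
  fixes Op :: "('o, 'm) opcat"
  assumes dom: "f \<in> Arr Op \<Longrightarrow> Dom Op f \<in> Obj Op"
    and cod: "f \<in> Arr Op \<Longrightarrow> Cod Op f \<in> Obj Op"
    and idn: "T \<in> Obj Op \<Longrightarrow> Idn Op T \<in> hom_opcat Op T T"
    and cmp: "\<lbrakk>f \<in> hom_opcat Op A B; g \<in> hom_opcat Op B C\<rbrakk> \<Longrightarrow> Cmp Op g f \<in> hom_opcat Op A C"
    and cmp_idn: "f \<in> hom_opcat Op A B \<Longrightarrow> Cmp Op f (Idn Op A) = f"
    and idn_cmp: "f \<in> hom_opcat Op A B \<Longrightarrow> Cmp Op (Idn Op B) f = f"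
    and cmp_assoc: "\<lbrakk>f \<in> hom_opcat Op A B; g \<in> hom_opcat Op B C; h \<in> hom_opcat Op C D\<rbrakk>
           \<Longrightarrow> Cmp Op h (Cmp Op g f) = Cmp Op (Cmp Op h g) f"
    and fib: "f \<in> Arr Op \<Longrightarrow> Fib Op f \<in> Obj Op"
    and ind: "\<lbrakk>\<phi> \<in> hom_opcat Op X' X; f \<in> hom_opcat Op X S\<rbrakk>
           \<Longrightarrow> Ind Op f \<phi> \<in> hom_opcat Op (Fib Op (Cmp Op f \<phi>)) (Fib Op f)"
    and ind_idn: "f \<in> hom_opcat Op X S \<Longrightarrow> Ind Op f (Idn Op X) = Idn Op (Fib Op f)"
    and ind_cmp: "\<lbrakk>\<phi> \<in> hom_opcat Op X'' X'; \<psi> \<in> hom_opcat Op X' X; f \<in> hom_opcat Op X S\<rbrakk>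
           \<Longrightarrow> Ind Op f (Cmp Op \<psi> \<phi>) = Cmp Op (Ind Op f \<psi>) (Ind Op (Cmp Op f \<psi>) \<phi>)"
    and fib_ind: "\<lbrakk>\<phi> \<in> hom_opcat Op X' X; f \<in> hom_opcat Op X S\<rbrakk> \<Longrightarrow> Fib Op (Ind Op f \<phi>) = Fib Op \<phi>"
    and ind_ind: "\<lbrakk>\<phi> \<in> hom_opcat Op Y X; a \<in> hom_opcat Op X S; c \<in> hom_opcat Op S T\<rbrakk>
           \<Longrightarrow> Ind Op (Ind Op c a) (Ind Op (Cmp Op c a) \<phi>) = Ind Op a \<phi>"

definition full_suboperadic :: "('o, 'm) opcat \<Rightarrow> 'o set \<Rightarrow> ('o, 'm) opcat" where
  "full_suboperadic Op S =
     Op\<lparr>Obj := Obj Op \<inter> S, Arr := {f \<in> Arr Op. Dom Op f \<in> S \<and> Cod Op f \<in> S}\<rparr>"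

text \<open>Left operadic modules: for an arrow \<open>\<alpha> : L \<rightarrow> S\<close> and a morphism \<open>g : S \<rightarrow> T\<close>, \<open>Post g \<alpha>\<close>
  is \<open>g \<circ> \<alpha>\<close> and \<open>MInd g \<alpha>\<close> is the induced arrow \<open>\<alpha>\<^sub>T : Fib (g \<circ> \<alpha>) \<rightarrow> Fib g\<close>.\<close>

record ('l, 'a, 'o, 'm) opmod =
  MObj :: "'l set"
  MArr :: "'a set"
  Src :: "'a \<Rightarrow> 'l"
  Tgt :: "'a \<Rightarrow> 'o"
  Post :: "'m \<Rightarrow> 'a \<Rightarrow> 'a"
  MFib :: "'a \<Rightarrow> 'l"
  MInd :: "'m \<Rightarrow> 'a \<Rightarrow> 'a"

definition hom_opmod :: "('l, 'a, 'o, 'm) opmod \<Rightarrow> 'l \<Rightarrow> 'o \<Rightarrow> 'a set" where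
  "hom_opmod M L S = {\<alpha> \<in> MArr M. Src M \<alpha> = L \<and> Tgt M \<alpha> = S}"

locale left_operadic_module = unary_operadic_category Op
  for Op :: "('o, 'm) opcat" +
  fixes M :: "('l, 'a, 'o, 'm) opmod"
  assumes src: "\<alpha> \<in> MArr M \<Longrightarrow> Src M \<alpha> \<in> MObj M"
    and tgt: "\<alpha> \<in> MArr M \<Longrightarrow> Tgt M \<alpha> \<in> Obj Op"
    and post: "\<lbrakk>\<alpha> \<in> hom_opmod M L S; g \<in> hom_opcat Op S T\<rbrakk> \<Longrightarrow> Post M g \<alpha> \<in> hom_opmod M L T"
    and post_idn: "\<alpha> \<in> hom_opmod M L S \<Longrightarrow> Post M (Idn Op S) \<alpha> = \<alpha>"
    and post_cmp: "\<lbrakk>\<alpha> \<in> hom_opmod M L A; g \<in> hom_opcat Op A B; h \<in> hom_opcat Op B C\<rbrakk>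
           \<Longrightarrow> Post M (Cmp Op h g) \<alpha> = Post M h (Post M g \<alpha>)"
    and mfib: "\<alpha> \<in> MArr M \<Longrightarrow> MFib M \<alpha> \<in> MObj M"
    and mind: "\<lbrakk>\<alpha> \<in> hom_opmod M L S; g \<in> hom_opcat Op S T\<rbrakk>
           \<Longrightarrow> MInd M g \<alpha> \<in> hom_opmod M (MFib M (Post M g \<alpha>)) (Fib Op g)"
    and mind_post: "\<lbrakk>\<alpha> \<in> hom_opmod M L X'; \<phi> \<in> hom_opcat Op X' X; f \<in> hom_opcat Op X S\<rbrakk>
           \<Longrightarrow> MInd M f (Post M \<phi> \<alpha>) = Post M (Ind Op f \<phi>) (MInd M (Cmp Op f \<phi>) \<alpha>)"
    and mfib_mind: "\<lbrakk>\<alpha> \<in> hom_opmod M L S; g \<in> hom_opcat Op S T\<rbrakk> \<Longrightarrow> MFib M (MInd M g \<alpha>) = MFib M \<alpha>"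
    and mind_mind: "\<lbrakk>\<alpha> \<in> hom_opmod M L X; a \<in> hom_opcat Op X S; c \<in> hom_opcat Op S T\<rbrakk>
           \<Longrightarrow> MInd M (Ind Op c a) (MInd M (Cmp Op c a) \<alpha>) = MInd M a \<alpha>"

text \<open>\<open>Gam h x y\<close> is \<open>\<gamma>\<^sub>h (x \<otimes> y)\<close> for \<open>x \<in> P(Fib h)\<close> and \<open>y \<in> P(Cod h)\<close>; \<open>Unt T\<close> is the unit in
  \<open>P(Fib(id\<^sub>T))\<close>. Linear maps out of a tensor product of two modules are given as bilinear maps.\<close>

record ('o, 'm, 'r, 'v) operad =
  Val :: "'o \<Rightarrow> ('r, 'v) module"
  Gam :: "'m \<Rightarrow> 'v \<Rightarrow> 'v \<Rightarrow> 'v"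
  Unt :: "'o \<Rightarrow> 'v"

locale unital_operad = unary_operadic_category Op
  for Op :: "('o, 'm) opcat" +
  fixes R :: "'r ring" and P :: "('o, 'm, 'r, 'v) operad"
  assumes val: "T \<in> Obj Op \<Longrightarrow> Module.module R (Val P T)"
    and gam: "h \<in> hom_opcat Op A B
           \<Longrightarrow> mbilinear R (Val P (Fib Op h)) (Val P B) (Val P A) (Gam P h)"
    and gam_assoc: "\<lbrakk>f \<in> hom_opcat Op A B; g \<in> hom_opcat Op B C; x \<in> carrier (Val P (Fib Op f));
             y \<in> carrier (Val P (Fib Op g)); z \<in> carrier (Val P C)\<rbrakk>
           \<Longrightarrow> Gam P f x (Gam P g y z) = Gam P (Cmp Op g f) (Gam P (Ind Op g f) x y) z"
    and unt: "T \<in> Obj Op \<Longrightarrow> Unt P T \<in> carrier (Val P (Fib Op (Idn Op T)))"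
    and unt_gam: "\<lbrakk>T \<in> Obj Op; x \<in> carrier (Val P T)\<rbrakk> \<Longrightarrow> Gam P (Idn Op T) (Unt P T) x = x"
    and gam_unt: "\<lbrakk>f \<in> hom_opcat Op S T; x \<in> carrier (Val P (Fib Op f))\<rbrakk>
           \<Longrightarrow> Gam P (Ind Op (Idn Op T) f) x (Unt P T) = x"

text \<open>\<open>Act \<alpha> x p\<close> is \<open>\<nu>\<^sub>\<alpha> (x \<otimes> p)\<close> for \<open>x \<in> M(Fib \<alpha>)\<close> and \<open>p \<in> P(Tgt \<alpha>)\<close>.\<close>

record ('l, 'a, 'r, 'v, 'w) pmodule =
  MVal :: "'l \<Rightarrow> ('r, 'w) module"
  Act :: "'a \<Rightarrow> 'w \<Rightarrow> 'v \<Rightarrow> 'w"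

locale unital_pmodule = unital_operad Op R P + left_operadic_module Op M
  for Op :: "('o, 'm) opcat" and M :: "('l, 'a, 'o, 'm) opmod"
    and R :: "'r ring" and P :: "('o, 'm, 'r, 'v) operad" +
  fixes N :: "('l, 'a, 'r, 'v, 'w) pmodule"
  assumes mval: "L \<in> MObj M \<Longrightarrow> Module.module R (MVal N L)"
    and act: "\<alpha> \<in> hom_opmod M L S
           \<Longrightarrow> mbilinear R (MVal N (MFib M \<alpha>)) (Val P S) (MVal N L) (Act N \<alpha>)"
    and act_gam: "\<lbrakk>\<alpha> \<in> hom_opmod M L B; g \<in> hom_opcat Op B C; x \<in> carrier (MVal N (MFib M \<alpha>));
             y \<in> carrier (Val P (Fib Op g)); z \<in> carrier (Val P C)\<rbrakk>
           \<Longrightarrow> Act N \<alpha> x (Gam P g y z) = Act N (Post M g \<alpha>) (Act N (MInd M g \<alpha>) x y) z"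
    and act_unt: "\<lbrakk>\<alpha> \<in> hom_opmod M L T; x \<in> carrier (MVal N (MFib M \<alpha>))\<rbrakk>
           \<Longrightarrow> Act N (MInd M (Idn Op T) \<alpha>) x (Unt P T) = x"

definition pmodule_hom ::
  "('l, 'a, 'o, 'm) opmod \<Rightarrow> 'r ring \<Rightarrow> ('o, 'm, 'r, 'v) operad \<Rightarrow>
   ('l, 'a, 'r, 'v, 'w) pmodule \<Rightarrow> ('l, 'a, 'r, 'v, 'k) pmodule \<Rightarrow> ('l \<Rightarrow> 'w \<Rightarrow> 'k) \<Rightarrow> bool" where
  "pmodule_hom M R P N K f \<longleftrightarrow>
     (\<forall>L\<in>MObj M. mlinear R (MVal N L) (MVal K L) (f L)) \<and>
     (\<forall>\<alpha>\<in>MArr M. \<forall>x\<in>carrier (MVal N (MFib M \<alpha>)). \<forall>p\<in>carrier (Val P (Tgt M \<alpha>)).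
        f (Src M \<alpha>) (Act N \<alpha> x p) = Act K \<alpha> (f (MFib M \<alpha>) x) p)"

text \<open>\<^term>\<open>N\<close> is the free unital module on the collection \<^term>\<open>E\<close>: the map \<^term>\<open>\<eta>\<close> is the
  unit of the adjunction. As HOL has no quantification over types, the type of the carriers of
  the test modules \<open>K\<close> is a parameter, to be left as a type variable in theorems.\<close>

definition free_unital_pmodule_on ::
  "'k itself \<Rightarrow> ('o, 'm) opcat \<Rightarrow> ('l, 'a, 'o, 'm) opmod \<Rightarrow> 'r ring \<Rightarrow> ('o, 'm, 'r, 'v) operad \<Rightarrow>
   ('l, 'a, 'r, 'v, 'w) pmodule \<Rightarrow> ('l \<Rightarrow> ('r, 'e) module) \<Rightarrow> ('l \<Rightarrow> 'e \<Rightarrow> 'w) \<Rightarrow> bool" where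
  "free_unital_pmodule_on _ Op M R P N E \<eta> \<longleftrightarrow>
     unital_pmodule Op M R P N \<and>
     (\<forall>L\<in>MObj M. Module.module R (E L) \<and> mlinear R (E L) (MVal N L) (\<eta> L)) \<and>
     (\<forall>(K :: ('l, 'a, 'r, 'v, 'k) pmodule) \<phi>.
        unital_pmodule Op M R P K \<longrightarrow>
        (\<forall>L\<in>MObj M. mlinear R (E L) (MVal K L) (\<phi> L)) \<longrightarrow>
        (\<exists>f. pmodule_hom M R P N K f \<and>
             (\<forall>L\<in>MObj M. \<forall>e\<in>carrier (E L). f L (\<eta> L e) = \<phi> L e)) \<and>
        (\<forall>f g. pmodule_hom M R P N K f \<and> pmodule_hom M R P N K g \<and>
             (\<forall>L\<in>MObj M. \<forall>e\<in>carrier (E L). f L (\<eta> L e) = \<phi> L e \<and> g L (\<eta> L e) = \<phi> L e) \<longrightarrow>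
             (\<forall>L\<in>MObj M. \<forall>x\<in>carrier (MVal N L). f L x = g L x)))"

definition free_unital_pmodule ::
  "'k itself \<Rightarrow> ('o, 'm) opcat \<Rightarrow> ('l, 'a, 'o, 'm) opmod \<Rightarrow> 'r ring \<Rightarrow> ('o, 'm, 'r, 'v) operad \<Rightarrow>
   ('l, 'a, 'r, 'v, 'w) pmodule \<Rightarrow> bool" where
  "free_unital_pmodule k Op M R P N \<longleftrightarrow>
     (\<exists>(E :: 'l \<Rightarrow> ('r, 'w) module) \<eta>. free_unital_pmodule_on k Op M R P N E \<eta>)"

text \<open>The augmented complexes \<open>\<dots> \<rightarrow> K 1 L \<rightarrow> K 0 L \<rightarrow> MVal N L\<close>, with differentials
  \<open>\<delta> n L : K n L \<rightarrow> K (n - 1) L\<close> and augmentation \<open>\<epsilon> L\<close>, are the components of an acyclic resolution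
  of \<^term>\<open>N\<close> by free unital modules.\<close>

definition free_acyclic_resolution ::
  "'k itself \<Rightarrow> ('o, 'm) opcat \<Rightarrow> ('l, 'a, 'o, 'm) opmod \<Rightarrow> 'r ring \<Rightarrow> ('o, 'm, 'r, 'v) operad \<Rightarrow>
   ('l, 'a, 'r, 'v, 'w) pmodule \<Rightarrow> (nat \<Rightarrow> 'l \<Rightarrow> ('r, 'x) module) \<Rightarrow> (nat \<Rightarrow> 'l \<Rightarrow> 'x \<Rightarrow> 'x) \<Rightarrow>
   ('l \<Rightarrow> 'x \<Rightarrow> 'w) \<Rightarrow> bool" where
  "free_acyclic_resolution k Op M R P N K \<delta> \<epsilon> \<longleftrightarrow>
     unital_pmodule Op M R P N \<and>
     (\<exists>act. (let F = (\<lambda>n. \<lparr>MVal = K n, Act = act n\<rparr>) in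
        (\<forall>n. free_unital_pmodule k Op M R P (F n)) \<and>
        (\<forall>n. pmodule_hom M R P (F (Suc n)) (F n) (\<delta> (Suc n))) \<and>
        pmodule_hom M R P (F 0) N \<epsilon>)) \<and>
     (\<forall>L\<in>MObj M.
        exact_at (K 0 L) (\<epsilon> L) (MVal N L) (\<lambda>_. ()) (zero_module :: ('r, unit) module) \<and>
        exact_at (K 1 L) (\<delta> 1 L) (K 0 L) (\<epsilon> L) (MVal N L) \<and>
        (\<forall>n. exact_at (K (n + 2) L) (\<delta> (n + 2) L) (K (n + 1) L) (\<delta> (n + 1) L) (K n L)))"


section \<open>The bar construction\<close>

text \<open>A tower \<open>T\<^sub>0 \<leftarrow> T\<^sub>1 \<leftarrow> \<dots> \<leftarrow> T\<^sub>n \<leftarrow> L\<close> is encoded as the list \<open>[f\<^sub>1, \<dots>, f\<^sub>n]\<close> together with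
  \<open>\<alpha>\<close>; so \<open>f\<^sub>i\<close> is the list entry with index \<open>i - 1\<close>.\<close>

type_synonym ('m, 'a) tower = "'m list \<times> 'a"

definition level :: "('o, 'm) opcat \<Rightarrow> ('l, 'a, 'o, 'm) opmod \<Rightarrow> ('m, 'a) tower \<Rightarrow> nat \<Rightarrow> 'o" where
  "level Op M t i = (if i < length (fst t) then Cod Op (fst t ! i) else Tgt M (snd t))"

definition towers ::
  "('o, 'm) opcat \<Rightarrow> ('l, 'a, 'o, 'm) opmod \<Rightarrow> nat \<Rightarrow> 'l \<Rightarrow> ('m, 'a) tower set" where
  "towers Op M n L = {t. snd t \<in> MArr M \<and> Src M (snd t) = L \<and>
     length (fst t) = n \<and> set (fst t) \<subseteq> Arr Op \<and>
     (\<forall>i<n. Dom Op (fst t ! i) = level Op M t (i + 1))}"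

text \<open>The tensor factors \<open>P(T\<^sub>0), P(F\<^sub>1), \<dots>, P(F\<^sub>n), M(N)\<close>, in positions \<open>0, \<dots>, n + 1\<close>.\<close>

definition bar_factor ::
  "('o, 'm) opcat \<Rightarrow> ('l, 'a, 'o, 'm) opmod \<Rightarrow> ('o, 'm, 'r, 'v) operad \<Rightarrow>
   ('l, 'a, 'r, 'v, 'w) pmodule \<Rightarrow> ('m, 'a) tower \<Rightarrow> nat \<Rightarrow> ('r, 'v + 'w) module" where
  "bar_factor Op M P N t i =
     (if i = 0 then tag_module Inl (Val P (level Op M t 0))
      else if i \<le> length (fst t) then tag_module Inl (Val P (Fib Op (fst t ! (i - 1))))
      else tag_module Inr (MVal N (MFib M (snd t))))"

type_synonym ('m, 'a, 'r, 'v, 'w) bar_elem =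
  "('m, 'a) tower \<Rightarrow> ((nat \<Rightarrow> 'v + 'w) \<Rightarrow> 'r) set"

definition bar_summand ::
  "('o, 'm) opcat \<Rightarrow> ('l, 'a, 'o, 'm) opmod \<Rightarrow> 'r ring \<Rightarrow> ('o, 'm, 'r, 'v) operad \<Rightarrow>
   ('l, 'a, 'r, 'v, 'w) pmodule \<Rightarrow> ('m, 'a) tower \<Rightarrow>
   ('r, ((nat \<Rightarrow> 'v + 'w) \<Rightarrow> 'r) set) module" where
  "bar_summand Op M R P N t = tensor R {..length (fst t) + 1} (bar_factor Op M P N t)"

definition bar ::
  "('o, 'm) opcat \<Rightarrow> ('l, 'a, 'o, 'm) opmod \<Rightarrow> 'r ring \<Rightarrow> ('o, 'm, 'r, 'v) operad \<Rightarrow>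
   ('l, 'a, 'r, 'v, 'w) pmodule \<Rightarrow> nat \<Rightarrow> 'l \<Rightarrow> ('r, ('m, 'a, 'r, 'v, 'w) bar_elem) module" where
  "bar Op M R P N n L = direct_sum (towers Op M n L) (bar_summand Op M R P N)"

definition bar_gens ::
  "('o, 'm) opcat \<Rightarrow> ('l, 'a, 'o, 'm) opmod \<Rightarrow> ('o, 'm, 'r, 'v) operad \<Rightarrow>
   ('l, 'a, 'r, 'v, 'w) pmodule \<Rightarrow> nat \<Rightarrow> 'l \<Rightarrow> (('m, 'a) tower \<times> (nat \<Rightarrow> 'v + 'w)) set" where
  "bar_gens Op M P N n L =
     (SIGMA t : towers Op M n L. \<Pi>\<^sub>E i\<in>{..n + 1}. carrier (bar_factor Op M P N t i))"

definition bar_gen ::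
  "('o, 'm) opcat \<Rightarrow> ('l, 'a, 'o, 'm) opmod \<Rightarrow> 'r ring \<Rightarrow> ('o, 'm, 'r, 'v) operad \<Rightarrow>
   ('l, 'a, 'r, 'v, 'w) pmodule \<Rightarrow> nat \<Rightarrow> 'l \<Rightarrow> ('m, 'a) tower \<times> (nat \<Rightarrow> 'v + 'w) \<Rightarrow>
   ('m, 'a, 'r, 'v, 'w) bar_elem" where
  "bar_gen Op M R P N n L g =
     summand_incl (towers Op M n L) (bar_summand Op M R P N) (fst g)
       (pure_tensor R {..n + 1} (bar_factor Op M P N (fst g)) (snd g))"

definition face_tower ::
  "('o, 'm) opcat \<Rightarrow> ('l, 'a, 'o, 'm) opmod \<Rightarrow> nat \<Rightarrow> ('m, 'a) tower \<Rightarrow> ('m, 'a) tower" where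
  "face_tower Op M i t = (let fs = fst t; \<alpha> = snd t; n = length fs in
     (if i = 0 then tl fs
      else if i < n then take (i - 1) fs @ [Cmp Op (fs ! (i - 1)) (fs ! i)] @ drop (i + 1) fs
      else butlast fs,
      if i < n then \<alpha> else Post M (fs ! (n - 1)) \<alpha>))"

definition face_merge ::
  "('o, 'm) opcat \<Rightarrow> ('l, 'a, 'o, 'm) opmod \<Rightarrow> ('o, 'm, 'r, 'v) operad \<Rightarrow>
   ('l, 'a, 'r, 'v, 'w) pmodule \<Rightarrow> nat \<Rightarrow> ('m, 'a) tower \<Rightarrow> (nat \<Rightarrow> 'v + 'w) \<Rightarrow> 'v + 'w" where
  "face_merge Op M P N i t x = (let fs = fst t; \<alpha> = snd t; n = length fs in
     if i = 0 then Inl (Gam P (fs ! 0) (projl (x 1)) (projl (x 0)))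
     else if i < n then
       Inl (Gam P (Ind Op (fs ! (i - 1)) (fs ! i)) (projl (x (i + 1))) (projl (x i)))
     else Inr (Act N (MInd M (fs ! (n - 1)) \<alpha>) (projr (x (n + 1))) (projl (x n))))"

definition bar_face ::
  "('o, 'm) opcat \<Rightarrow> ('l, 'a, 'o, 'm) opmod \<Rightarrow> 'r ring \<Rightarrow> ('o, 'm, 'r, 'v) operad \<Rightarrow>
   ('l, 'a, 'r, 'v, 'w) pmodule \<Rightarrow> nat \<Rightarrow> 'l \<Rightarrow> nat \<Rightarrow>
   ('m, 'a, 'r, 'v, 'w) bar_elem \<Rightarrow> ('m, 'a, 'r, 'v, 'w) bar_elem" where
  "bar_face Op M R P N n L i =
     linear_ext R (bar Op M R P N n L) (bar Op M R P N (n - 1) L)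
       (bar_gens Op M P N n L) (bar_gen Op M R P N n L)
       (\<lambda>(t, x). bar_gen Op M R P N (n - 1) L
          (face_tower Op M i t,
           \<lambda>j\<in>{..n}. if j < i then x j
                     else if j = i then face_merge Op M P N i t x else x (j + 1)))"

definition bar_diff ::
  "('o, 'm) opcat \<Rightarrow> ('l, 'a, 'o, 'm) opmod \<Rightarrow> 'r ring \<Rightarrow> ('o, 'm, 'r, 'v) operad \<Rightarrow>
   ('l, 'a, 'r, 'v, 'w) pmodule \<Rightarrow> nat \<Rightarrow> 'l \<Rightarrow>
   ('m, 'a, 'r, 'v, 'w) bar_elem \<Rightarrow> ('m, 'a, 'r, 'v, 'w) bar_elem" where
  "bar_diff Op M R P N n L x = (let B = bar Op M R P N (n - 1) L in
     finsum B (\<lambda>i. if even i then bar_face Op M R P N n L i x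
                   else \<ominus>\<^bsub>B\<^esub> bar_face Op M R P N n L i x) {..n})"

definition bar_aug ::
  "('o, 'm) opcat \<Rightarrow> ('l, 'a, 'o, 'm) opmod \<Rightarrow> 'r ring \<Rightarrow> ('o, 'm, 'r, 'v) operad \<Rightarrow>
   ('l, 'a, 'r, 'v, 'w) pmodule \<Rightarrow> 'l \<Rightarrow> ('m, 'a, 'r, 'v, 'w) bar_elem \<Rightarrow> 'w" where
  "bar_aug Op M R P N L =
     linear_ext R (bar Op M R P N 0 L) (MVal N L)
       (bar_gens Op M P N 0 L) (bar_gen Op M R P N 0 L)
       (\<lambda>(t, x). Act N (snd t) (projr (x 1)) (projl (x 0)))"

text \<open>The degeneracy \<open>s\<^sub>j : \<beta>\<^sub>n \<rightarrow> \<beta>\<^sub>n\<^sub>+\<^sub>1\<close>.\<close>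

definition bar_degen ::
  "('o, 'm) opcat \<Rightarrow> ('l, 'a, 'o, 'm) opmod \<Rightarrow> 'r ring \<Rightarrow> ('o, 'm, 'r, 'v) operad \<Rightarrow>
   ('l, 'a, 'r, 'v, 'w) pmodule \<Rightarrow> nat \<Rightarrow> 'l \<Rightarrow> nat \<Rightarrow>
   ('m, 'a, 'r, 'v, 'w) bar_elem \<Rightarrow> ('m, 'a, 'r, 'v, 'w) bar_elem" where
  "bar_degen Op M R P N n L j =
     linear_ext R (bar Op M R P N n L) (bar Op M R P N (n + 1) L)
       (bar_gens Op M P N n L) (bar_gen Op M R P N n L)
       (\<lambda>(t, x). bar_gen Op M R P N (n + 1) L
          ((take j (fst t) @ [Idn Op (level Op M t j)] @ drop j (fst t), snd t),
           \<lambda>k\<in>{..n + 2}. if k \<le> j then x k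
                     else if k = j + 1 then Inl (Unt P (level Op M t j)) else x (k - 1)))"

definition degenerate_part ::
  "('o, 'm) opcat \<Rightarrow> ('l, 'a, 'o, 'm) opmod \<Rightarrow> 'r ring \<Rightarrow> ('o, 'm, 'r, 'v) operad \<Rightarrow>
   ('l, 'a, 'r, 'v, 'w) pmodule \<Rightarrow> nat \<Rightarrow> 'l \<Rightarrow> ('m, 'a, 'r, 'v, 'w) bar_elem set" where
  "degenerate_part Op M R P N n L = mspan R (bar Op M R P N n L)
     (\<Union>j<n. bar_degen Op M R P N (n - 1) L j ` carrier (bar Op M R P N (n - 1) L))"

definition nbar ::
  "('o, 'm) opcat \<Rightarrow> ('l, 'a, 'o, 'm) opmod \<Rightarrow> 'r ring \<Rightarrow> ('o, 'm, 'r, 'v) operad \<Rightarrow>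
   ('l, 'a, 'r, 'v, 'w) pmodule \<Rightarrow> nat \<Rightarrow> 'l \<Rightarrow> ('r, ('m, 'a, 'r, 'v, 'w) bar_elem set) module" where
  "nbar Op M R P N n L = mquot (bar Op M R P N n L) (degenerate_part Op M R P N n L)"

definition nbar_diff ::
  "('o, 'm) opcat \<Rightarrow> ('l, 'a, 'o, 'm) opmod \<Rightarrow> 'r ring \<Rightarrow> ('o, 'm, 'r, 'v) operad \<Rightarrow>
   ('l, 'a, 'r, 'v, 'w) pmodule \<Rightarrow> nat \<Rightarrow> 'l \<Rightarrow>
   ('m, 'a, 'r, 'v, 'w) bar_elem set \<Rightarrow> ('m, 'a, 'r, 'v, 'w) bar_elem set" where
  "nbar_diff Op M R P N n L =
     mquot_map (bar Op M R P N (n - 1) L) (degenerate_part Op M R P N (n - 1) L)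
       (bar_diff Op M R P N n L)"

text \<open>There are no degeneracies in degree \<open>0\<close>, so the cosets making up \<open>B\<^sub>0\<close> are singletons.\<close>

definition nbar_aug ::
  "('o, 'm) opcat \<Rightarrow> ('l, 'a, 'o, 'm) opmod \<Rightarrow> 'r ring \<Rightarrow> ('o, 'm, 'r, 'v) operad \<Rightarrow>
   ('l, 'a, 'r, 'v, 'w) pmodule \<Rightarrow> 'l \<Rightarrow> ('m, 'a, 'r, 'v, 'w) bar_elem set \<Rightarrow> 'w" where
  "nbar_aug Op M R P N L K = the_elem (bar_aug Op M R P N L ` K)"


section \<open>Manifolds\<close>

text \<open>Topological manifolds with boundary, modelled on half-spaces. The half-space of
  dimension \<open>0\<close> is \<open>Euclidean_space 0\<close>, i.e. the point \<open>0\<close>.\<close>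

definition half_space :: "nat \<Rightarrow> (nat \<Rightarrow> real) topology" where
  "half_space k = subtopology (Euclidean_space k) {x. 0 \<le> x 0}"

definition unit_ball :: "nat \<Rightarrow> (nat \<Rightarrow> real) topology" where
  "unit_ball k = subtopology (Euclidean_space k) {x. (\<Sum>i<k. (x i)\<^sup>2) \<le> 1}"

definition chart_at :: "(nat \<Rightarrow> real) topology \<Rightarrow> 'p topology \<Rightarrow> 'p \<Rightarrow> bool" where
  "chart_at E X p \<longleftrightarrow> (\<exists>U V. openin X U \<and> p \<in> U \<and> openin E V \<and>
     subtopology X U homeomorphic_space subtopology E V)"

definition manifold :: "nat \<Rightarrow> 'p topology \<Rightarrow> bool" where
  "manifold k X \<longleftrightarrow> Hausdorff_space X \<and> second_countable X \<and>
     (\<forall>p\<in>topspace X. chart_at (half_space k) X p)"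

definition mboundary :: "nat \<Rightarrow> 'p topology \<Rightarrow> 'p set" where
  "mboundary k X = {p \<in> topspace X. \<not> chart_at (Euclidean_space k) X p}"

definition bdry :: "nat \<Rightarrow> 'p topology \<Rightarrow> 'p topology" where
  "bdry k X = subtopology X (mboundary k X)"

definition codim0 :: "nat \<Rightarrow> 'p topology \<Rightarrow> 'p set \<Rightarrow> bool" where
  "codim0 k Y Z \<longleftrightarrow> closedin Y Z \<and> manifold k (subtopology Y Z)"

text \<open>\<open>W = A \<squnion>\<^sub>Z B\<close> for a closed (compact, without boundary) common piece \<open>Z = A \<inter> B\<close> of the
  boundaries of \<^term>\<open>A\<close> and \<^term>\<open>B\<close>; the case \<open>Z = {}\<close> is that of disjoint unions.\<close>

definition glues_to :: "nat \<Rightarrow> 'p topology \<Rightarrow> 'p set \<Rightarrow> 'p set \<Rightarrow> bool" where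
  "glues_to k W A B \<longleftrightarrow> manifold k W \<and> topspace W = A \<union> B \<and>
     codim0 k W A \<and> codim0 k W B \<and> compactin W (A \<inter> B) \<and>
     openin (bdry k (subtopology W A)) (A \<inter> B) \<and>
     openin (bdry k (subtopology W B)) (A \<inter> B)"


section \<open>Systems of fields\<close>

text \<open>\<open>Fld k X\<close> is the set of fields on the \<open>k\<close>-manifold \<open>X\<close>, \<open>Bdr k X\<close> the restriction of fields
  on a \<open>(k + 1)\<close>-manifold \<open>X\<close> to its boundary, and \<open>Res k Y Z\<close> the restriction of fields on a
  \<open>k\<close>-manifold \<open>Y\<close> to a codimension-zero submanifold \<open>Z\<close>; so the restriction from \<open>X\<close> to
  \<open>Z \<subseteq> \<partial>X\<close> is the composite of the two. \<open>Glue k W A B x y\<close> is the glueing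
  of \<open>x\<close> on \<open>A\<close> and \<open>y\<close> on \<open>B\<close> to a field on \<open>W = A \<union> B\<close>. \<open>Fmod X c\<close> is \<open>C(X;c)\<close> with its module
  structure.\<close>

record ('p, 'f, 'r) fields =
  Fld :: "nat \<Rightarrow> 'p topology \<Rightarrow> 'f set"
  Bdr :: "nat \<Rightarrow> 'p topology \<Rightarrow> 'f \<Rightarrow> 'f"
  Res :: "nat \<Rightarrow> 'p topology \<Rightarrow> 'p set \<Rightarrow> 'f \<Rightarrow> 'f"
  Glue :: "nat \<Rightarrow> 'p topology \<Rightarrow> 'p set \<Rightarrow> 'p set \<Rightarrow> 'f \<Rightarrow> 'f \<Rightarrow> 'f"
  Fmod :: "'p topology \<Rightarrow> 'f \<Rightarrow> ('r, 'f) module"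

text \<open>Fields on \<open>A\<close> and \<open>B\<close> restrict to the same field on \<open>A \<inter> B\<close>. In dimension \<open>0\<close>
  boundaries are empty and there is nothing to compare.\<close>

definition agree ::
  "('p, 'f, 'r) fields \<Rightarrow> nat \<Rightarrow> 'p topology \<Rightarrow> 'p set \<Rightarrow> 'p set \<Rightarrow> 'f \<Rightarrow> 'f \<Rightarrow> bool" where
  "agree C k W A B x y \<longleftrightarrow> (\<forall>j. k = Suc j \<longrightarrow>
     Res C j (bdry k (subtopology W A)) (A \<inter> B) (Bdr C j (subtopology W A) x) =
     Res C j (bdry k (subtopology W B)) (A \<inter> B) (Bdr C j (subtopology W B) y))"

locale system_of_fields =
  fixes d :: nat and C :: "('p, 'f, 'r) fields"
  assumes Bdr: "\<lbrakk>k \<le> d; manifold (Suc k) X; x \<in> Fld C (Suc k) X\<rbrakk>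
           \<Longrightarrow> Bdr C k X x \<in> Fld C k (bdry (Suc k) X)"
    and Res: "\<lbrakk>k \<le> d; manifold k Y; codim0 k Y Z; y \<in> Fld C k Y\<rbrakk>
           \<Longrightarrow> Res C k Y Z y \<in> Fld C k (subtopology Y Z)"
    and Res_id: "\<lbrakk>k \<le> d; manifold k Y; y \<in> Fld C k Y\<rbrakk> \<Longrightarrow> Res C k Y (topspace Y) y = y"
    and Res_Res: "\<lbrakk>k \<le> d; manifold k Y; codim0 k Y Z; codim0 k Y Z'; Z' \<subseteq> Z; y \<in> Fld C k Y\<rbrakk>
           \<Longrightarrow> Res C k (subtopology Y Z) Z' (Res C k Y Z y) = Res C k Y Z' y"
    and Glue: "\<lbrakk>k \<le> Suc d; glues_to k W A B; x \<in> Fld C k (subtopology W A);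
             y \<in> Fld C k (subtopology W B); agree C k W A B x y\<rbrakk>
           \<Longrightarrow> Glue C k W A B x y \<in> Fld C k W"
    and Bdr_Glue: "\<lbrakk>k \<le> d; glues_to (Suc k) W A B; x \<in> Fld C (Suc k) (subtopology W A);
             y \<in> Fld C (Suc k) (subtopology W B); agree C (Suc k) W A B x y\<rbrakk>
           \<Longrightarrow> Res C k (bdry (Suc k) W) (mboundary (Suc k) (subtopology W A) - B)
                  (Bdr C k W (Glue C (Suc k) W A B x y)) =
                Res C k (bdry (Suc k) (subtopology W A)) (mboundary (Suc k) (subtopology W A) - B)
                  (Bdr C k (subtopology W A) x)"
    and Res_Glue: "\<lbrakk>k \<le> d; glues_to k W A B; x \<in> Fld C k (subtopology W A);
             y \<in> Fld C k (subtopology W B); agree C k W A B x y\<rbrakk>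
           \<Longrightarrow> Res C k W A (Glue C k W A B x y) = x"
    and Glue_sym: "\<lbrakk>k \<le> Suc d; glues_to k W A B; x \<in> Fld C k (subtopology W A);
             y \<in> Fld C k (subtopology W B); agree C k W A B x y\<rbrakk>
           \<Longrightarrow> Glue C k W A B x y = Glue C k W B A y x"
    and Glue_assoc: "\<lbrakk>k \<le> Suc d;
             glues_to k (subtopology W (A \<union> B)) A B; glues_to k W (A \<union> B) D;
             glues_to k (subtopology W (B \<union> D)) B D; glues_to k W A (B \<union> D);
             x \<in> Fld C k (subtopology W A); y \<in> Fld C k (subtopology W B);
             z \<in> Fld C k (subtopology W D);
             agree C k W A B x y; agree C k W B D y z;
             agree C k W (A \<union> B) D (Glue C k (subtopology W (A \<union> B)) A B x y) z;
             agree C k W A (B \<union> D) x (Glue C k (subtopology W (B \<union> D)) B D y z)\<rbrakk>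
           \<Longrightarrow> Glue C k W (A \<union> B) D (Glue C k (subtopology W (A \<union> B)) A B x y) z =
                Glue C k W A (B \<union> D) x (Glue C k (subtopology W (B \<union> D)) B D y z)"
    and disjoint_union: "\<lbrakk>k \<le> d; glues_to k W A B; A \<inter> B = {}; w \<in> Fld C k W\<rbrakk>
           \<Longrightarrow> Glue C k W A B (Res C k W A w) (Res C k W B w) = w"

locale linearly_enriched = system_of_fields d C
  for d :: nat and C :: "('p, 'f, 'r) fields" +
  fixes R :: "'r ring" and M :: "'p topology"
  assumes Fmod: "\<lbrakk>codim0 (Suc d) M X; c \<in> Fld C d (bdry (Suc d) (subtopology M X))\<rbrakk>
           \<Longrightarrow> Module.module R (Fmod C (subtopology M X) c)"
    and carrier_Fmod: "\<lbrakk>codim0 (Suc d) M X; c \<in> Fld C d (bdry (Suc d) (subtopology M X))\<rbrakk>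
           \<Longrightarrow> carrier (Fmod C (subtopology M X) c) =
                {x \<in> Fld C (Suc d) (subtopology M X). Bdr C d (subtopology M X) x = c}"
    and Glue_bilinear: "\<lbrakk>codim0 (Suc d) M X; W = subtopology M X; glues_to (Suc d) W A B;
             cA \<in> Fld C d (bdry (Suc d) (subtopology W A));
             cB \<in> Fld C d (bdry (Suc d) (subtopology W B));
             Res C d (bdry (Suc d) (subtopology W A)) (A \<inter> B) cA =
               Res C d (bdry (Suc d) (subtopology W B)) (A \<inter> B) cB;
             c \<in> Fld C d (bdry (Suc d) W);
             Res C d (bdry (Suc d) W) (mboundary (Suc d) (subtopology W A) - B) c =
               Res C d (bdry (Suc d) (subtopology W A)) (mboundary (Suc d) (subtopology W A) - B) cA;
             Res C d (bdry (Suc d) W) (mboundary (Suc d) (subtopology W B) - A) c =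
               Res C d (bdry (Suc d) (subtopology W B)) (mboundary (Suc d) (subtopology W B) - A) cB\<rbrakk>
           \<Longrightarrow> mbilinear R (Fmod C (subtopology W A) cA) (Fmod C (subtopology W B) cB) (Fmod C W c)
                  (Glue C (Suc d) W A B)"
    and Glue_tensor: "\<lbrakk>codim0 (Suc d) M X; W = subtopology M X; glues_to (Suc d) W A B; A \<inter> B = {};
             cA \<in> Fld C d (bdry (Suc d) (subtopology W A));
             cB \<in> Fld C d (bdry (Suc d) (subtopology W B));
             c \<in> Fld C d (bdry (Suc d) W);
             Res C d (bdry (Suc d) W) (mboundary (Suc d) (subtopology W A)) c = cA;
             Res C d (bdry (Suc d) W) (mboundary (Suc d) (subtopology W B)) c = cB\<rbrakk>
           \<Longrightarrow> exhibits_tensor R (Fmod C (subtopology W A) cA) (Fmod C (subtopology W B) cB)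
                  (Fmod C W c) (Glue C (Suc d) W A B)"


section \<open>Blobs\<close>

text \<open>Decorated blob configurations, together with the empty configuration.\<close>

datatype ('p, 'f) dconf = Empty | Conf "'p set set" 'f

primrec blobs :: "('p, 'f) dconf \<Rightarrow> 'p set set" where
  "blobs Empty = {}"
| "blobs (Conf D c) = D"

primrec deco :: "('p, 'f) dconf \<Rightarrow> 'f" where
  "deco Empty = undefined"
| "deco (Conf D c) = c"

text \<open>\<open>Field x\<close> is a genuine field; \<open>Degen a c\<close> is the element \<open>a \<cdot> c\<close> of the free module \<open>R \<cdot> c\<close>
  of fields on a degenerate manifold.\<close>

datatype ('f, 'r) gfield = Field 'f | Degen 'r 'f

context
  fixes d :: nat and R :: "'r ring" and M :: "'p topology" and C :: "('p, 'f, 'r) fields"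
    and U :: "'p set \<Rightarrow> 'f \<Rightarrow> 'f set" and b :: 'f
begin

definition bd :: "'p set \<Rightarrow> 'p set" where
  "bd S = mboundary (Suc d) (subtopology M S)"

definition bds :: "'p set set \<Rightarrow> 'p set" where
  "bds \<D> = (\<Union>D\<in>\<D>. bd D)"

text \<open>\<open>S\<close> without the interiors of the blobs in \<open>\<D>\<close>.\<close>

definition cut :: "'p set \<Rightarrow> 'p set set \<Rightarrow> 'p set" where
  "cut S \<D> = S - (\<Union>D\<in>\<D>. D - bd D)"

definition blob :: "'p set \<Rightarrow> 'p set \<Rightarrow> bool" where
  "blob S D \<longleftrightarrow> D \<subseteq> S \<and> subtopology M D homeomorphic_space unit_ball (Suc d) \<and>
     (D \<subseteq> S - bd S \<and> manifold (Suc d) (subtopology M (cut S {D})) \<and>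
        bd (cut S {D}) = bd S \<union> bd D \<or>
      D \<in> connected_components_of (subtopology M S))"

definition blob_config :: "'p set \<Rightarrow> 'p set set \<Rightarrow> bool" where
  "blob_config S \<D> \<longleftrightarrow> finite \<D> \<and> \<D> \<noteq> {} \<and> (\<forall>D\<in>\<D>. blob S D) \<and> pairwise disjnt \<D>"

definition decorated :: "('p, 'f) dconf \<Rightarrow> bool" where
  "decorated X \<longleftrightarrow> X = Empty \<or>
     blob_config (topspace M) (blobs X) \<and> deco X \<in> Fld C d (subtopology M (bds (blobs X)))"

definition deco_on :: "('p, 'f) dconf \<Rightarrow> 'p set \<Rightarrow> 'f" where
  "deco_on X Z = Res C d (subtopology M (bds (blobs X))) Z (deco X)"

definition inside :: "('p, 'f) dconf \<Rightarrow> 'p set \<Rightarrow> 'p set set" where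
  "inside X E = {D \<in> blobs X. D \<subseteq> E}"

text \<open>The relations \<open>X' \<hookleftarrow> X\<close> and \<open>(M;b) \<hookleftarrow> X\<close>.\<close>

definition contains_conf :: "('p, 'f) dconf \<Rightarrow> ('p, 'f) dconf \<Rightarrow> bool" where
  "contains_conf X' X \<longleftrightarrow> decorated X' \<and> decorated X \<and>
     (X = Empty \<or>
      X' \<noteq> Empty \<and> blob_config (\<Union>(blobs X')) (blobs X) \<and>
      (\<forall>E \<in> blobs X \<inter> blobs X'. deco_on X (bd E) = deco_on X' (bd E)))"

definition top_contains :: "('p, 'f) dconf \<Rightarrow> bool" where
  "top_contains X \<longleftrightarrow> decorated X \<and> (blobs X = {topspace M} \<longrightarrow> deco X = b)"

text \<open>The object \<open>X' \<hookleftarrow> X\<close> is the pair \<open>(X', X)\<close>; the triple \<open>(X', X'', X)\<close> is the morphism from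
  \<open>X' \<hookleftarrow> X\<close> to \<open>X'' \<hookleftarrow> X\<close>.\<close>

definition Blob_bar ::
  "(('p, 'f) dconf \<times> ('p, 'f) dconf, ('p, 'f) dconf \<times> ('p, 'f) dconf \<times> ('p, 'f) dconf) opcat" where
  "Blob_bar = \<lparr>
     Obj = {(X', X). contains_conf X' X},
     Arr = {(X', X'', X). contains_conf X' X'' \<and> contains_conf X'' X},
     Dom = (\<lambda>(X', X'', X). (X', X)),
     Cod = (\<lambda>(X', X'', X). (X'', X)),
     Idn = (\<lambda>(X', X). (X', X', X)),
     Cmp = (\<lambda>(X'', Y, X) (X', _, _). (X', Y, X)),
     Fib = (\<lambda>(X', X'', X). (X', X'')),
     Ind = (\<lambda>(X'', Y, X) (X', _, _). (X', X'', Y))\<rparr>"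

definition Blob ::
  "(('p, 'f) dconf \<times> ('p, 'f) dconf, ('p, 'f) dconf \<times> ('p, 'f) dconf \<times> ('p, 'f) dconf) opcat" where
  "Blob = full_suboperadic Blob_bar (- {(Empty, Empty)})"

text \<open>The object \<open>(M;b) \<hookleftarrow> X\<close> is represented by \<open>X\<close>, so the distinguished one
  \<open>(M;b) \<hookleftarrow> \<emptyset>\<close> by \<^const>\<open>Empty\<close>; the pair \<open>(X', X)\<close> is the arrow from \<open>(M;b) \<hookleftarrow> X\<close> to
  \<open>X' \<hookleftarrow> X\<close>.\<close>

definition Mdl_bar ::
  "(('p, 'f) dconf, ('p, 'f) dconf \<times> ('p, 'f) dconf,
    ('p, 'f) dconf \<times> ('p, 'f) dconf, ('p, 'f) dconf \<times> ('p, 'f) dconf \<times> ('p, 'f) dconf) opmod" where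
  "Mdl_bar = \<lparr>
     MObj = {X. top_contains X},
     MArr = {(X', X). top_contains X' \<and> contains_conf X' X \<and> top_contains X},
     Src = (\<lambda>(X', X). X),
     Tgt = (\<lambda>(X', X). (X', X)),
     Post = (\<lambda>(X', X'', X) _. (X'', X)),
     MFib = (\<lambda>(X', X). X'),
     MInd = (\<lambda>(X', X'', X) _. (X', X''))\<rparr>"

definition Mdl ::
  "(('p, 'f) dconf, ('p, 'f) dconf \<times> ('p, 'f) dconf,
    ('p, 'f) dconf \<times> ('p, 'f) dconf, ('p, 'f) dconf \<times> ('p, 'f) dconf \<times> ('p, 'f) dconf) opmod" where
  "Mdl = Mdl_bar\<lparr>MArr := {\<alpha> \<in> MArr Mdl_bar. Tgt Mdl_bar \<alpha> \<noteq> (Empty, Empty)}\<rparr>"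


section \<open>Fields on complements of blobs\<close>

definition degen_module :: "'f \<Rightarrow> ('r, ('f, 'r) gfield) module" where
  "degen_module c = tag_module (\<lambda>a. Degen a c)
     (mk_module (carrier R) (\<lambda>x y. x \<oplus>\<^bsub>R\<^esub> y) \<zero>\<^bsub>R\<^esub> (\<lambda>x y. x \<otimes>\<^bsub>R\<^esub> y))"

text \<open>Fields on \<open>S\<close> minus the interiors of the blobs of \<open>\<D>\<close> (a nonempty subset of the blobs of \<open>X\<close>),
  with boundary field \<open>c\<close> on \<open>\<partial>S\<close> and the decoration of \<open>X\<close> on \<open>\<partial>\<D>\<close>. Here \<open>S\<close> is connected, so
  that a degenerate component occurs only if \<open>\<D> = {S}\<close>.\<close>

definition cut_fields ::
  "'p set \<Rightarrow> 'f \<Rightarrow> 'p set set \<Rightarrow> ('p, 'f) dconf \<Rightarrow> ('r, ('f, 'r) gfield) module" where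
  "cut_fields S c \<D> X =
     (if S \<in> \<D> then degen_module c
      else tag_module Field (Fmod C (subtopology M (cut S \<D>))
        (Glue C d (subtopology M (bd S \<union> bds \<D>)) (bd S) (bds \<D>) c (deco_on X (bds \<D>)))))"

definition gscale :: "'r \<Rightarrow> 'p set \<Rightarrow> ('f, 'r) gfield \<Rightarrow> ('f, 'r) gfield" where
  "gscale a S g = (case g of
     Field x \<Rightarrow> Field (a \<odot>\<^bsub>Fmod C (subtopology M S) (Bdr C d (subtopology M S) x)\<^esub> x)
   | Degen a' c \<Rightarrow> Degen (a \<otimes>\<^bsub>R\<^esub> a') c)"

text \<open>\<open>fill \<D> S (T, r) E\<close>: glue to the field \<open>r\<close> on \<open>T\<close> the field \<open>x E\<close> on \<open>E\<close> minus the interiors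
  of the blobs of \<open>X\<close> inside \<open>E\<close>; glueing the degenerate field \<open>a \<cdot> c\<close> is multiplication by \<open>a\<close>.\<close>

definition fill ::
  "('p, 'f) dconf \<Rightarrow> ('p set \<Rightarrow> ('f, 'r) gfield) \<Rightarrow> 'p set \<times> ('f, 'r) gfield \<Rightarrow> 'p set \<Rightarrow>
   'p set \<times> ('f, 'r) gfield" where
  "fill X x = (\<lambda>(T, r) E. case (r, x E) of
     (Field \<rho>, Field \<xi>) \<Rightarrow> (let E' = cut E (inside X E) in
        (T \<union> E', Field (Glue C (Suc d) (subtopology M (T \<union> E')) T E' \<rho> \<xi>)))
   | (Field \<rho>, Degen a c) \<Rightarrow> (T, gscale a T r)
   | (Degen a c, _) \<Rightarrow> (cut E (inside X E), gscale a (cut E (inside X E)) (x E)))"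

text \<open>The glueing of a field \<open>r\<close> on \<open>S\<close> minus the interiors of the blobs in \<open>\<D>\<close> with the fields
  \<open>x E\<close> for all \<open>E \<in> \<D>\<close>. The order of the glueings is immaterial.\<close>

definition fill_all ::
  "'p set \<Rightarrow> 'p set set \<Rightarrow> ('p, 'f) dconf \<Rightarrow> ('f, 'r) gfield \<Rightarrow> ('p set \<Rightarrow> ('f, 'r) gfield) \<Rightarrow>
   ('f, 'r) gfield" where
  "fill_all S \<D> X r x =
     snd (foldl (fill X x) (cut S \<D>, r) (SOME Es. distinct Es \<and> set Es = \<D>))"


section \<open>Local relations and the skein module\<close>

definition local_relations :: bool where
  "local_relations \<longleftrightarrow>
     (\<forall>D c. blob (topspace M) D \<longrightarrow> c \<in> Fld C d (subtopology M (bd D)) \<longrightarrow>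
        submodule (U D c) R (Fmod C (subtopology M D) c)) \<and>
     (\<forall>D D' c c' u r.
        blob (topspace M) D \<longrightarrow> blob (topspace M) D' \<longrightarrow> D' \<subseteq> D - bd D \<longrightarrow>
        c \<in> Fld C d (subtopology M (bd D)) \<longrightarrow> c' \<in> Fld C d (subtopology M (bd D')) \<longrightarrow>
        u \<in> U D' c' \<longrightarrow>
        r \<in> carrier (Fmod C (subtopology M (cut D {D'}))
              (Glue C d (subtopology M (bd D \<union> bd D')) (bd D) (bd D') c c')) \<longrightarrow>
        Glue C (Suc d) (subtopology M D) D' (cut D {D'}) u r \<in> U D c)"

text \<open>The generators \<open>u \<squnion> r\<close> of \<open>U(M;b)\<close>. If \<open>M\<close> itself is the blob, then \<open>r = a \<cdot> b\<close>
  and \<open>u \<squnion> r = a u\<close>.\<close>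

definition skein_generators :: "'f set" where
  "skein_generators =
     {Glue C (Suc d) M D (cut (topspace M) {D}) u r |D c u r.
        blob (topspace M) D \<and> D \<noteq> topspace M \<and> c \<in> Fld C d (subtopology M (bd D)) \<and> u \<in> U D c \<and>
        r \<in> carrier (Fmod C (subtopology M (cut (topspace M) {D}))
              (Glue C d (subtopology M (bd (topspace M) \<union> bd D)) (bd (topspace M)) (bd D) b c))} \<union>
     {a \<odot>\<^bsub>Fmod C M b\<^esub> u |a u.
        blob (topspace M) (topspace M) \<and> a \<in> carrier R \<and> u \<in> U (topspace M) b}"

definition skein_module :: "('r, 'f set) module" where
  "skein_module = mquot (Fmod C M b) (mspan R (Fmod C M b) skein_generators)"


section \<open>The operad and the module of fields\<close>

text \<open>Operads and modules do not carry the indexing category, so the restrictions to \<open>Blob\<close>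
  and \<open>Mdl\<close> are given by the same data as \<open>F_bar\<close> and \<open>M_bar\<close>.\<close>

definition field_factor ::
  "('p, 'f) dconf \<Rightarrow> ('p, 'f) dconf \<Rightarrow> 'p set \<Rightarrow> ('r, ('f, 'r) gfield) module" where
  "field_factor X' X E = (let c' = deco_on X' (bd E) in
     if inside X E = {} then tag_module Field ((Fmod C (subtopology M E) c')\<lparr>carrier := U E c'\<rparr>)
     else cut_fields E c' (inside X E) X)"

definition field_families ::
  "('p, 'f) dconf \<Rightarrow> ('p, 'f) dconf \<Rightarrow> ('p set \<Rightarrow> ('f, 'r) gfield) set" where
  "field_families X' X = (\<Pi>\<^sub>E E\<in>blobs X'. carrier (field_factor X' X E))"

definition field_pure ::
  "('p, 'f) dconf \<Rightarrow> ('p, 'f) dconf \<Rightarrow> ('p set \<Rightarrow> ('f, 'r) gfield) \<Rightarrow>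
   (('p set \<Rightarrow> ('f, 'r) gfield) \<Rightarrow> 'r) set" where
  "field_pure X' X = pure_tensor R (blobs X') (field_factor X' X)"

definition field_tensor ::
  "('p, 'f) dconf \<Rightarrow> ('p, 'f) dconf \<Rightarrow> ('r, (('p set \<Rightarrow> ('f, 'r) gfield) \<Rightarrow> 'r) set) module" where
  "field_tensor X' X = tensor R (blobs X') (field_factor X' X)"

text \<open>The value at \<open>(Empty, Empty)\<close> is the empty tensor product, i.e. \<open>R\<close>, and the unit there is
  the empty tensor, i.e. \<open>1\<close>.\<close>

definition F_bar ::
  "(('p, 'f) dconf \<times> ('p, 'f) dconf, ('p, 'f) dconf \<times> ('p, 'f) dconf \<times> ('p, 'f) dconf,
    'r, (('p set \<Rightarrow> ('f, 'r) gfield) \<Rightarrow> 'r) set) operad" where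
  "F_bar = \<lparr>
     Val = (\<lambda>(X', X). field_tensor X' X),
     Gam = (\<lambda>(X', X'', X).
       bilinear_ext R (field_tensor X' X'') (field_tensor X'' X) (field_tensor X' X)
         (field_families X' X'') (field_pure X' X'')
         (field_families X'' X) (field_pure X'' X)
         (\<lambda>r x. field_pure X' X (\<lambda>E\<in>blobs X'. fill_all E (inside X'' E) X (r E) x))),
     Unt = (\<lambda>(X', X). field_pure X' X' (\<lambda>E\<in>blobs X'. Degen \<one>\<^bsub>R\<^esub> (deco_on X' (bd E))))\<rparr>"

definition M_val :: "('p, 'f) dconf \<Rightarrow> ('r, ('f, 'r) gfield) module" where
  "M_val X = (if X = Empty then tag_module Field (Fmod C M b)
     else cut_fields (topspace M) b (blobs X) X)"

definition M_bar ::
  "(('p, 'f) dconf, ('p, 'f) dconf \<times> ('p, 'f) dconf, 'r,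
    (('p set \<Rightarrow> ('f, 'r) gfield) \<Rightarrow> 'r) set, ('f, 'r) gfield) pmodule" where
  "M_bar = \<lparr>
     MVal = M_val,
     Act = (\<lambda>(X', X).
       bilinear_ext R (M_val X') (field_tensor X' X) (M_val X)
         (carrier (M_val X')) (\<lambda>r. r)
         (field_families X' X) (field_pure X' X)
         (\<lambda>r x. fill_all (topspace M) (blobs X') X r x))\<rparr>"

end

end

theory Submission
 imports Defs
begin

text \<open>Inserting the object itself, decorated by its unit, at the inner end of a tower is an extra degeneracy. It
 contracts the augmented bar complex over the preorder of configurations and exhibits each degree as a free
 module on the image of that degeneracy, so the bar construction of every unital module is an acyclic
 resolution. It remains to see that fields form a unital operad and module: since all boundary fields are
 prescribed, a field on a complement of blobs is glued along one blob at a time, and associativity and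
 symmetry of glueing make the order irrelevant. Over the restricted categories the image of the augmentation
 is spanned by glueings of a local relation into a single blob, i.e. by the generators of \<open>U(M;b)\<close>.\<close>

text \<open>No identity between two faces is ever proved. From \<open>d h = id - h d\<close>,
  compatibility of \<open>d\<close> with the action, and generation by acting on images of
  \<open>h\<close>, both \<open>d d = 0\<close> and exactness follow formally. These facts pass to
  the quotient by degeneracies, so the two complexes are instances of one locale. On the quotient
  \<open>h h\<close> vanishes and \<open>h\<close> need not be injective, which is why freeness is
  stated relative to a map that may have a kernel. The obstacle on the side of fields is that
  composition is glueing along a list chosen by \<open>SOME\<close>, with degenerate pieces acting
  as scalars, and that decorations are single fields on unions of spheres. Decorations are therefore
  replaced by one function from blobs to boundary fields, which serves a whole nested chain at once
  and makes every compatibility condition automatic. The topological input (a blob in a blob is a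
  blob, complements have the expected boundary) is local and rests on invariance of domain. Over the
  restricted categories the claim concerns only the end of the complex, so degree zero is computed
  there directly.\<close>

abbreviation "cr \<equiv> carrier"
abbreviation "rmod \<equiv> Module.module"
abbreviation "subt \<equiv> subtopology"

section \<open>Linear algebra\<close>

lemma mk_module_simps [simp]:
 "cr (mk_module A p z s) = A" "add (mk_module A p z s) = p"
 "zero (mk_module A p z s) = z" "smult (mk_module A p z s) = s"
by (simp_all add: mk_module_def)

text \<open>Additive inverses need not be supplied: the scalar \<open>\<ominus> 1\<close> provides
  them, because \<open>1\<close> acts as the identity and \<open>0\<close> as the constant
  \<open>z\<close>. Free modules, quotients, direct sums and tagged copies are all checked through
  this list.\<close>

lemma module_mk_module:
 fixes R :: "'r ring"
 assumes R: "cring R"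
and cl: "!!x y. x : A ==> y : A ==> p x y : A" "z : A"
 "!!a x. a : cr R ==> x : A ==> s a x : A"
and ax: "!!x y u. x : A ==> y : A ==> u : A ==> p (p x y) u = p x (p y u)"
 "!!x y. x : A ==> y : A ==> p x y = p y x"
 "!!x. x : A ==> p z x = x"
 "!!a b x. a : cr R ==> b : cr R ==> x : A ==> s (a \<oplus>\<^bsub>R\<^esub> b) x = p (s a x) (s b x)"
 "!!a x y. a : cr R ==> x : A ==> y : A ==> s a (p x y) = p (s a x) (s a y)"
 "!!a b x. a : cr R ==> b : cr R ==> x : A ==> s (a \<otimes>\<^bsub>R\<^esub> b) x = s a (s b x)"
 "!!x. x : A ==> s \<one>\<^bsub>R\<^esub> x = x"
 "!!x. x : A ==> s \<zero>\<^bsub>R\<^esub> x = z"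
 shows "rmod R (mk_module A p z s)"
proof (rule moduleI[OF R])
 interpret cring R by fact
 have inv: "EX y:A. p y x = z" if "x : A" for x
 proof
 show "s (\<ominus>\<^bsub>R\<^esub> \<one>\<^bsub>R\<^esub>) x : A" using that cl(3) by simp
 have "p (s (\<ominus>\<^bsub>R\<^esub> \<one>\<^bsub>R\<^esub>) x) x = p (s (\<ominus>\<^bsub>R\<^esub> \<one>\<^bsub>R\<^esub>) x) (s \<one>\<^bsub>R\<^esub> x)" using that ax(7) by simp
 also have "\<dots> = s \<zero>\<^bsub>R\<^esub> x" using that by (simp add: ax(4)[symmetric] l_neg)
 finally show "p (s (\<ominus>\<^bsub>R\<^esub> \<one>\<^bsub>R\<^esub>) x) x = z" using that ax(8) by simp
 qed
 show "abelian_group (mk_module A p z s)"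
by (rule abelian_groupI) (use cl ax inv in auto)
qed (use cl ax in auto)

lemma module_axiomsD:
 assumes "rmod R A"
 shows "cring R" "abelian_group A"
using assms by (auto simp: Module.module_def)

lemma mlinearI:
 assumes "!!x. x : cr A ==> f x : cr B"
and "!!x y. x : cr A ==> y : cr A ==> f (x \<oplus>\<^bsub>A\<^esub> y) = f x \<oplus>\<^bsub>B\<^esub> f y"
and "!!a x. a : cr R ==> x : cr A ==> f (a \<odot>\<^bsub>A\<^esub> x) = a \<odot>\<^bsub>B\<^esub> f x"
 shows "mlinear R A B f"
using assms by (auto simp: mlinear_def)

lemma lin_in: "mlinear R A B f ==> x : cr A ==> f x : cr B"
and lin_add: "mlinear R A B f ==> x : cr A ==> y : cr A ==>
 f (x \<oplus>\<^bsub>A\<^esub> y) = f x \<oplus>\<^bsub>B\<^esub> f y"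
and lin_smult: "mlinear R A B f ==> a : cr R ==> x : cr A ==>
 f (a \<odot>\<^bsub>A\<^esub> x) = a \<odot>\<^bsub>B\<^esub> f x"
by (auto simp: mlinear_def)

lemma minus_simps:
 assumes "rmod R A"
 shows "x : cr A ==> x \<ominus>\<^bsub>A\<^esub> \<zero>\<^bsub>A\<^esub> = x"
and "x : cr A ==> y : cr A ==> x \<ominus>\<^bsub>A\<^esub> y = \<zero>\<^bsub>A\<^esub> \<longleftrightarrow> x = y"
and "x : cr A ==> y : cr A ==> (x \<ominus>\<^bsub>A\<^esub> y) \<oplus>\<^bsub>A\<^esub> y = x"
and "x : cr A ==> y : cr A ==> x \<oplus>\<^bsub>A\<^esub> y \<ominus>\<^bsub>A\<^esub> y = x"
and "x : cr A ==> y : cr A ==> x \<ominus>\<^bsub>A\<^esub> (x \<ominus>\<^bsub>A\<^esub> y) = y"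
and "x : cr A ==> y : cr A ==> x \<ominus>\<^bsub>A\<^esub> y : cr A"
proof -
 interpret A: Module.module R A by fact
 show "x : cr A ==> x \<ominus>\<^bsub>A\<^esub> \<zero>\<^bsub>A\<^esub> = x"
by (simp add: A.minus_eq A.add.inv_one)
 show 3: "x : cr A ==> y : cr A ==> (x \<ominus>\<^bsub>A\<^esub> y) \<oplus>\<^bsub>A\<^esub> y = x"
by (simp add: A.minus_eq A.add.m_assoc A.l_neg)
 show "x \<ominus>\<^bsub>A\<^esub> y = \<zero>\<^bsub>A\<^esub> \<longleftrightarrow> x = y" if "x : cr A" "y : cr A"
 proof
 assume "x \<ominus>\<^bsub>A\<^esub> y = \<zero>\<^bsub>A\<^esub>"
 thus "x = y" using 3[OF that] that by simp
 qed (use that in "simp add: A.minus_eq A.r_neg")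
 show "x : cr A ==> y : cr A ==> x \<oplus>\<^bsub>A\<^esub> y \<ominus>\<^bsub>A\<^esub> y = x"
by (simp add: A.minus_eq A.add.m_assoc A.r_neg)
 show "x : cr A ==> y : cr A ==> x \<ominus>\<^bsub>A\<^esub> (x \<ominus>\<^bsub>A\<^esub> y) = y"
by (simp add: A.minus_eq A.minus_add A.r_neg A.add.m_assoc[symmetric])
 show "x : cr A ==> y : cr A ==> x \<ominus>\<^bsub>A\<^esub> y : cr A"
by simp
qed

lemma lin_zero:
 assumes "rmod R A" "rmod R B" "mlinear R A B f"
 shows "f \<zero>\<^bsub>A\<^esub> = \<zero>\<^bsub>B\<^esub>"
proof -
 interpret A: Module.module R A by fact
 interpret B: Module.module R B by fact
 have "f (\<zero>\<^bsub>R\<^esub> \<odot>\<^bsub>A\<^esub> \<zero>\<^bsub>A\<^esub>) = \<zero>\<^bsub>R\<^esub> \<odot>\<^bsub>B\<^esub> f \<zero>\<^bsub>A\<^esub>"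
using assms(3) by (intro lin_smult) auto
 thus ?thesis using lin_in[OF assms(3), of "\<zero>\<^bsub>A\<^esub>"] by (simp add: A.smult_l_null B.smult_l_null)
qed

lemma module_neg_smult:
 assumes "rmod R A" "x : cr A"
 shows "\<ominus>\<^bsub>A\<^esub> x = (\<ominus>\<^bsub>R\<^esub> \<one>\<^bsub>R\<^esub>) \<odot>\<^bsub>A\<^esub> x"
proof -
 interpret A: Module.module R A by fact
 show ?thesis using assms(2) by (simp add: A.smult_l_minus)
qed

lemma mlinear_neg:
 assumes "rmod R A" "rmod R B" "mlinear R A B f" "x : cr A"
 shows "f (\<ominus>\<^bsub>A\<^esub> x) = \<ominus>\<^bsub>B\<^esub> f x"
proof -
 interpret A: Module.module R A by fact
 show ?thesis
using assms by (simp add: module_neg_smult[OF assms(1)] module_neg_smult[OF assms(2)]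
 lin_smult[OF assms(3)] lin_in[OF assms(3)])
qed

lemma mlinear_minus:
 assumes "rmod R A" "rmod R B" "mlinear R A B f" "x : cr A" "y : cr A"
 shows "f (x \<ominus>\<^bsub>A\<^esub> y) = f x \<ominus>\<^bsub>B\<^esub> f y"
proof -
 interpret A: Module.module R A by fact
 show ?thesis using assms by (simp add: a_minus_def lin_add[OF assms(3)] mlinear_neg[OF assms(1-3)])
qed

lemma mlinear_finsum:
 assumes "rmod R A" "rmod R B" "mlinear R A B f" "g : I \<rightarrow> cr A"
 shows "f (finsum A g I) = finsum B (%i. f (g i)) I"
proof -
 interpret A: Module.module R A by fact
 interpret B: Module.module R B by fact
 show ?thesis
 proof (cases "finite I")
 case True
 thus ?thesis using assms(4)
 proof (induction I rule: finite_induct)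
 case empty thus ?case by (simp add: lin_zero[OF assms(1-3)])
 next
 case (insert i I)
 hence "g : I \<rightarrow> cr A" "g i : cr A" by auto
 moreover from this have "(%i. f (g i)) : I \<rightarrow> cr B" "f (g i) : cr B"
using lin_in[OF assms(3)] by auto
 ultimately show ?case using insert
by (simp add: lin_add[OF assms(3)] A.finsum_closed)
 qed
 next
 case False
 thus ?thesis by (simp add: lin_zero[OF assms(1-3)])
 qed
qed

lemma lin_id: "mlinear R A A (%x. x)"
by (auto simp: mlinear_def)

lemma lin_comp: "mlinear R A B f ==> mlinear R B C g ==> mlinear R A C (%x. g (f x))"
by (auto simp: mlinear_def Pi_iff)

lemma mlinear_cong:
 assumes "rmod R A" "!!x. x : cr A ==> f x = g x"
 shows "mlinear R A B f = mlinear R A B g"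
proof -
 interpret A: Module.module R A by fact
 show ?thesis using assms(2) by (auto simp: mlinear_def Pi_iff)
qed

lemma mlinear_const_zero: "rmod R B ==> mlinear R A B (%x. \<zero>\<^bsub>B\<^esub>)"
proof -
 assume "rmod R B"
 then interpret B: Module.module R B .
 show ?thesis by (auto simp: mlinear_def B.smult_r_null)
qed

lemma mlinear_plus:
 assumes "rmod R B" "mlinear R A B f" "mlinear R A B g"
 shows "mlinear R A B (%x. f x \<oplus>\<^bsub>B\<^esub> g x)"
proof -
 interpret B: Module.module R B by fact
 show ?thesis
using assms(2,3) by (auto simp: mlinear_def Pi_iff B.smult_r_distr B.add.m_ac)
qed

lemma mlinear_scale:
 assumes "rmod R B" "mlinear R A B f" "a : cr R"
 shows "mlinear R A B (%x. a \<odot>\<^bsub>B\<^esub> f x)"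
proof -
 interpret B: Module.module R B by fact
 show ?thesis
using assms(2,3) by (auto simp: mlinear_def Pi_iff B.smult_r_distr B.smult_assoc1[symmetric] B.R.m_comm)
qed

lemma mlinear_uminus:
 assumes "rmod R B" "mlinear R A B f"
 shows "mlinear R A B (%x. \<ominus>\<^bsub>B\<^esub> f x)"
proof -
 interpret B: Module.module R B by fact
 show ?thesis
using assms(2) by (auto simp: mlinear_def Pi_iff B.minus_add B.smult_r_minus)
qed

lemma mlinear_finsum_fun:
 assumes B: "rmod R B" and f: "!!i. i : I ==> mlinear R A B (f i)"
 shows "mlinear R A B (%x. finsum B (%i. f i x) I)"
proof -
 interpret B: Module.module R B by fact
 show ?thesis
 proof (cases "finite I")
 case True
 show ?thesis
 proof (rule mlinearI)
 show "finsum B (%i. f i x) I : cr B" if "x : cr A" for x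
using that f lin_in by (intro B.finsum_closed) fast
 show "finsum B (%i. f i (x \<oplus>\<^bsub>A\<^esub> y)) I = finsum B (%i. f i x) I \<oplus>\<^bsub>B\<^esub> finsum B (%i. f i y) I"
 if "x : cr A" "y : cr A" for x y
 proof -
 have c: "(%i. f i x) : I \<rightarrow> cr B" "(%i. f i y) : I \<rightarrow> cr B"
using that f lin_in by fast+
 have "finsum B (%i. f i (x \<oplus>\<^bsub>A\<^esub> y)) I = finsum B (%i. f i x \<oplus>\<^bsub>B\<^esub> f i y) I"
using that c by (intro B.finsum_cong' funcsetI) (auto simp: Pi_iff lin_add[OF f])
 thus ?thesis using c by (simp add: B.finsum_addf)
 qed
 show "finsum B (%i. f i (a \<odot>\<^bsub>A\<^esub> x)) I = a \<odot>\<^bsub>B\<^esub> finsum B (%i. f i x) I"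
 if "a : cr R" "x : cr A" for a x
 proof -
 have c: "(%i. f i x) : I \<rightarrow> cr B" using that f lin_in by fast
 have "finsum B (%i. f i (a \<odot>\<^bsub>A\<^esub> x)) I = finsum B (%i. a \<odot>\<^bsub>B\<^esub> f i x) I"
using that c by (intro B.finsum_cong' funcsetI) (auto simp: Pi_iff lin_smult[OF f])
 also have "\<dots> = a \<odot>\<^bsub>B\<^esub> finsum B (%i. f i x) I"
using mlinear_finsum[OF B B mlinear_scale[OF B lin_id that(1)] c] by simp
 finally show ?thesis .
 qed
 qed
 next
 case False
 thus ?thesis by (simp add: mlinear_const_zero[OF B])
 qed
qed

lemma mlinear_carrier_update:
 assumes "V \<subseteq> cr B"
 shows "mlinear R A (B\<lparr>carrier := V\<rparr>) f \<longleftrightarrow> mlinear R A B f & f ` cr A \<subseteq> V"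
using assms by (auto simp: mlinear_def Pi_iff)

lemma mlinear_sub_source:
 assumes "mlinear R A B f" "V \<subseteq> cr A"
 shows "mlinear R (A\<lparr>carrier := V\<rparr>) B f"
using assms by (auto simp: mlinear_def Pi_iff subset_iff)

subsection \<open>Submodules, spans and quotients\<close>

lemma submoduleI':
 assumes A: "rmod R A"
and "N \<subseteq> cr A" "\<zero>\<^bsub>A\<^esub> : N"
and "!!x y. x : N ==> y : N ==> x \<oplus>\<^bsub>A\<^esub> y : N"
and sm: "!!a x. a : cr R ==> x : N ==> a \<odot>\<^bsub>A\<^esub> x : N"
 shows "submodule N R A"
proof -
 interpret A: Module.module R A by fact
 show ?thesis
 proof (rule A.submoduleI)
 show "\<ominus>\<^bsub>A\<^esub> x : N" if "x : N" for x
using that assms by (auto simp: module_neg_smult[OF A])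
 qed (use assms in auto)
qed

lemma submodule_zero: "rmod R A ==> submodule N R A ==> \<zero>\<^bsub>A\<^esub> : N"
using subgroup.one_closed[OF submodule.axioms(1)] by fastforce

lemma submodule_subset: "submodule N R A ==> N \<subseteq> cr A"
using subgroup.subset[OF submodule.axioms(1)] by fastforce

lemma submodule_add: "submodule N R A ==> x : N ==> y : N ==> x \<oplus>\<^bsub>A\<^esub> y : N"
using subgroup.m_closed[OF submodule.axioms(1)] by fastforce

lemma submodule_smult: "submodule N R A ==> a : cr R ==> x : N ==> a \<odot>\<^bsub>A\<^esub> x : N"
by (rule submodule.smult_closed)

lemma submodule_neg: "rmod R A ==> submodule N R A ==> x : N ==> \<ominus>\<^bsub>A\<^esub> x : N"
by (rule module.submoduleE(3))

lemma submodule_minus: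
 "rmod R A ==> submodule N R A ==> x : N ==> y : N ==> x \<ominus>\<^bsub>A\<^esub> y : N"
by (simp add: a_minus_def submodule_add submodule_neg)

lemma submodule_module:
 "rmod R A ==> submodule N R A ==> rmod R (A\<lparr>carrier := N\<rparr>)"
by (rule submodule.submodule_is_module)

lemma submodule_carrier: "rmod R A ==> submodule (cr A) R A"
by (rule module.carrier_is_submodule)

lemma submodule_singleton_zero:
 assumes "rmod R A" shows "submodule {\<zero>\<^bsub>A\<^esub>} R A"
proof -
 interpret A: Module.module R A by fact
 show ?thesis by (rule submoduleI'[OF assms]) (auto simp: A.smult_r_null)
qed

lemma submodule_preimage:
 assumes A: "rmod R A" and B: "rmod R B" and f: "mlinear R A B f"
and N: "submodule N R B"
 shows "submodule {x : cr A. f x : N} R A"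
proof -
 interpret A: Module.module R A by fact
 show ?thesis
by (rule submoduleI'[OF A])
 (auto simp: lin_zero[OF A B f] submodule_zero[OF B N] lin_add[OF f]
 lin_smult[OF f] submodule_add[OF N] submodule_smult[OF N])
qed

lemma submodule_kernel:
 assumes A: "rmod R A" and B: "rmod R B" and f: "mlinear R A B f"
 shows "submodule {x : cr A. f x = \<zero>\<^bsub>B\<^esub>} R A"
using submodule_preimage[OF A B f submodule_singleton_zero[OF B]] by simp

lemma submodule_image:
 assumes A: "rmod R A" and B: "rmod R B" and f: "mlinear R A B f"
and N: "submodule N R A"
 shows "submodule (f ` N) R B"
proof (rule submoduleI'[OF B])
 show "f ` N \<subseteq> cr B" using submodule_subset[OF N] lin_in[OF f] by auto
 show "\<zero>\<^bsub>B\<^esub> : f ` N" using lin_zero[OF A B f] submodule_zero[OF A N] by (metis image_eqI)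
 fix x y assume "x : f ` N" "y : f ` N"
 thus "x \<oplus>\<^bsub>B\<^esub> y : f ` N" using submodule_subset[OF N] submodule_add[OF N]
by (auto simp: lin_add[OF f, symmetric] subset_iff)
next
 fix a x assume "a : cr R" "x : f ` N"
 thus "a \<odot>\<^bsub>B\<^esub> x : f ` N" using submodule_subset[OF N] submodule_smult[OF N]
by (auto simp: lin_smult[OF f, symmetric] subset_iff)
qed

lemma submodule_equalizer:
 assumes A: "rmod R A" and B: "rmod R B"
and f: "mlinear R A B f" and g: "mlinear R A B g"
 shows "submodule {x : cr A. f x = g x} R A"
proof -
 interpret A: Module.module R A by fact
 show ?thesis
by (rule submoduleI'[OF A])
 (auto simp: lin_zero[OF A B f] lin_zero[OF A B g]  lin_add[OF f] lin_add[OF g]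
 lin_smult[OF f] lin_smult[OF g])
qed

text \<open>Phrased as an induction principle rather than through \<open>mspan\<close>: a property
  of all elements follows once it cuts out a submodule containing the generators. Linear maps are
  compared in this way, via their equalizer.\<close>

definition spans :: "'r ring => ('r, 'a) module => 'a set => bool" where
 "spans R A S \<longleftrightarrow> S \<subseteq> cr A & (ALL N. submodule N R A --> S \<subseteq> N --> cr A \<subseteq> N)"

lemma spans_subset: "spans R A S ==> S \<subseteq> cr A"
by (simp add: spans_def)

lemma spansD: "spans R A S ==> submodule N R A ==> S \<subseteq> N ==> x : cr A ==> x : N"
by (auto simp: spans_def)

lemma spans_eqI:
 assumes "rmod R A" "rmod R B" "spans R A S" "mlinear R A B f" "mlinear R A B g"
and "!!x. x : S ==> f x = g x" "x : cr A"
 shows "f x = g x"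
using spansD[OF assms(3) submodule_equalizer[OF assms(1,2,4,5)]] assms(6,7) spans_subset[OF assms(3)]
by auto

lemma spans_mono: "spans R A S ==> S \<subseteq> T ==> T \<subseteq> cr A ==> spans R A T"
by (auto simp: spans_def)

lemma submodule_mspan:
 assumes A: "rmod R A" and S: "S \<subseteq> cr A"
 shows "submodule (mspan R A S) R A"
proof -
 have ne: "cr A : {N. submodule N R A & S \<subseteq> N}" using submodule_carrier[OF A] S by simp
 show ?thesis unfolding mspan_def
by (rule submoduleI'[OF A])
 (use ne in "auto intro: submodule_zero[OF A] submodule_add submodule_smult")
qed

lemma mspan_superset: "S \<subseteq> mspan R A S"
by (auto simp: mspan_def)

lemma mspan_least: "submodule N R A ==> S \<subseteq> N ==> mspan R A S \<subseteq> N"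
by (auto simp: mspan_def)

definition mproj :: "('r, 'a) module => 'a set => 'a => 'a set" where
 "mproj A N x = N +>\<^bsub>A\<^esub> x"

context
 fixes R :: "'r ring" and A :: "('r, 'a) module" and N :: "'a set"
 assumes A: "rmod R A" and N: "submodule N R A"
begin

interpretation A: Module.module R A by (rule A)

lemma abelian_subgroup_submodule: "abelian_subgroup N A"
proof -
 have "subgroup N (add_monoid A)" using submodule.axioms(1)[OF N] .
 thus ?thesis
by (intro abelian_subgroupI3 additive_subgroup.intro) (auto simp: A.abelian_group_axioms)
qed

interpretation N: abelian_subgroup N A by (rule abelian_subgroup_submodule)

abbreviation proj :: "'a => 'a set" where "proj == mproj A N"

lemma proj_eq_iff:
 assumes "x : cr A" "y : cr A"
 shows "proj x = proj y \<longleftrightarrow> x \<ominus>\<^bsub>A\<^esub> y : N"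
proof
 assume "proj x = proj y"
 hence "x : N +>\<^bsub>A\<^esub> y" using N.a_rcos_self[OF assms(1)] by (simp add: mproj_def)
 then obtain n where "n : N" "x = n \<oplus>\<^bsub>A\<^esub> y" unfolding a_r_coset_def' by blast
 thus "x \<ominus>\<^bsub>A\<^esub> y : N" using assms submodule_subset[OF N]
by (auto simp: a_minus_def A.add.m_assoc A.r_neg subset_iff)
next
 assume n: "x \<ominus>\<^bsub>A\<^esub> y : N"
 have "x = (x \<ominus>\<^bsub>A\<^esub> y) \<oplus>\<^bsub>A\<^esub> y" using assms by (simp add: a_minus_def A.add.m_assoc A.l_neg)
 hence "x : N +>\<^bsub>A\<^esub> y" using n by (auto simp: a_r_coset_def')
 thus "proj x = proj y" using assms N.a_repr_independence'[of x y] by (simp add: mproj_def)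
qed

lemma carrier_mquot: "cr (mquot A N) = proj ` cr A"
by (auto simp: mquot_def A_RCOSETS_def' mproj_def)

lemma zero_mquot: "\<zero>\<^bsub>mquot A N\<^esub> = proj \<zero>\<^bsub>A\<^esub>"
using submodule_subset[OF N] by (simp add: mquot_def mproj_def A.a_coset_add_zero)

lemma add_mquot: "x : cr A ==> y : cr A ==> proj x \<oplus>\<^bsub>mquot A N\<^esub> proj y = proj (x \<oplus>\<^bsub>A\<^esub> y)"
by (simp add: mquot_def mproj_def N.a_rcos_sum)

text \<open>\<open>mquot\<close> scales a coset by a union over all its members. Scaled
  representatives differ by an element of the submodule, so all of them contribute the same coset
  and the union collapses.\<close>

lemma smult_mquot:
 assumes "a : cr R" "x : cr A"
 shows "a \<odot>\<^bsub>mquot A N\<^esub> proj x = proj (a \<odot>\<^bsub>A\<^esub> x)"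
proof -
 have "proj (a \<odot>\<^bsub>A\<^esub> u) = proj (a \<odot>\<^bsub>A\<^esub> x)" if ux: "u : proj x" for u
 proof -
 obtain n where n: "n : N" "u = n \<oplus>\<^bsub>A\<^esub> x" using ux unfolding mproj_def a_r_coset_def' by blast
 hence nc: "n : cr A" using submodule_subset[OF N] by auto
 have c: "a \<odot>\<^bsub>A\<^esub> n : cr A" "a \<odot>\<^bsub>A\<^esub> x : cr A" using assms nc by auto
 have u: "a \<odot>\<^bsub>A\<^esub> u = a \<odot>\<^bsub>A\<^esub> n \<oplus>\<^bsub>A\<^esub> a \<odot>\<^bsub>A\<^esub> x"
unfolding n(2) by (rule A.smult_r_distr[OF assms(1) nc assms(2)])
 have "a \<odot>\<^bsub>A\<^esub> u \<ominus>\<^bsub>A\<^esub> a \<odot>\<^bsub>A\<^esub> x : N"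
unfolding u minus_simps(4)[OF A c] by (rule submodule_smult[OF N assms(1) n(1)])
 moreover have "a \<odot>\<^bsub>A\<^esub> u : cr A" unfolding u using c by (rule A.a_closed)
 ultimately show ?thesis using c(2) by (simp add: proj_eq_iff)
 qed
 moreover have "x : proj x" using N.a_rcos_self[OF assms(2)] by (simp add: mproj_def)
 ultimately have "(\<Union>u\<in>proj x. proj (a \<odot>\<^bsub>A\<^esub> u)) = proj (a \<odot>\<^bsub>A\<^esub> x)" by blast
 thus ?thesis by (simp add: mquot_def mproj_def)
qed

lemma module_mquot: "rmod R (mquot A N)"
proof -
 have eq: "mquot A N = mk_module (cr (mquot A N)) (add (mquot A N)) \<zero>\<^bsub>mquot A N\<^esub> (smult (mquot A N))"
by (simp add: mquot_def mk_module_def)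
 show ?thesis
by (subst eq, rule module_mk_module[OF module_axiomsD(1)[OF A]])
 (auto simp: carrier_mquot zero_mquot add_mquot smult_mquot A.add.m_assoc A.smult_l_distr
 A.smult_r_distr A.smult_assoc1 A.smult_l_null, (simp add: A.add.m_comm)+)
qed

lemma mlinear_proj: "mlinear R A (mquot A N) proj"
by (rule mlinearI) (auto simp: carrier_mquot add_mquot smult_mquot)

lemma proj_eq_zero_iff: "x : cr A ==> proj x = \<zero>\<^bsub>mquot A N\<^esub> \<longleftrightarrow> x : N"
by (simp add: zero_mquot proj_eq_iff minus_simps(1)[OF A])

lemma mquot_lift:
 assumes B: "rmod R B" and f: "mlinear R A B f" and ker: "!!x. x : N ==> f x = \<zero>\<^bsub>B\<^esub>"
 obtains h where "mlinear R (mquot A N) B h" "!!x. x : cr A ==> h (proj x) = f x"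
proof -
 interpret B: Module.module R B by fact
 \<comment> \<open>The value on a coset is read off from an arbitrary representative;
   \<open>ker\<close> makes the choice irrelevant.\<close>
 define h where "h K = f (SOME x. x : cr A & proj x = K)" for K
 have hp: "h (proj x) = f x" if "x : cr A" for x
 proof -
 define y where "y = (SOME y. y : cr A & proj y = proj x)"
 have y: "y : cr A & proj y = proj x" unfolding y_def by (rule someI[of _ x]) (simp add: that)
 hence "y \<ominus>\<^bsub>A\<^esub> x : N" using that proj_eq_iff by blast
 hence "f y \<ominus>\<^bsub>B\<^esub> f x = \<zero>\<^bsub>B\<^esub>" using ker mlinear_minus[OF A B f] y that by metis
 hence "f y = f x" using lin_in[OF f] y that
by (simp add: minus_simps(2)[OF B])
 thus ?thesis by (simp add: h_def y_def)
 qed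
 have "mlinear R (mquot A N) B h"
by (rule mlinearI) (auto simp: carrier_mquot add_mquot smult_mquot hp
 lin_in[OF f] lin_add[OF f] lin_smult[OF f])
 with hp show thesis by (rule that[rotated])
qed

lemma spans_mquot: "spans R A S ==> spans R (mquot A N) (proj ` S)"
proof -
 assume S: "spans R A S"
 have "proj x : V" if V: "submodule V R (mquot A N)" "proj ` S \<subseteq> V" and x: "x : cr A" for V x
using spansD[OF S submodule_preimage[OF A module_mquot mlinear_proj V(1)] _ x] V(2) spans_subset[OF S]
by auto
 thus ?thesis using spans_subset[OF S] by (auto simp: spans_def carrier_mquot)
qed

end

text \<open>\<open>mquot_map\<close> is again a union over representatives; it collapses because
  \<open>f\<close> carries the difference of two representatives into \<open>V\<close>.\<close>

lemma mquot_map_proj: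
 assumes A: "rmod R A" and B: "rmod R B" and N: "submodule N R A" and V: "submodule V R B"
and f: "mlinear R A B f" and NV: "!!x. x : N ==> f x : V" and x: "x : cr A"
 shows "mquot_map B V f (mproj A N x) = mproj B V (f x)"
proof -
 interpret A: Module.module R A by fact
 interpret B: Module.module R B by fact
 have "mproj B V (f u) = mproj B V (f x)" if ux: "u : mproj A N x" for u
 proof -
 obtain n where n: "n : N" "u = n \<oplus>\<^bsub>A\<^esub> x" using ux unfolding mproj_def a_r_coset_def' by blast
 hence nc: "n : cr A" using submodule_subset[OF N] by auto
 have c: "f n : cr B" "f x : cr B" "f u : cr B"
using lin_in[OF f] nc x n(2) by auto
 have u: "f u = f n \<oplus>\<^bsub>B\<^esub> f x" unfolding n(2) by (rule lin_add[OF f nc x])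
 have "f u \<ominus>\<^bsub>B\<^esub> f x : V"
unfolding u minus_simps(4)[OF B c(1,2)] by (rule NV[OF n(1)])
 thus ?thesis using c by (simp add: proj_eq_iff[OF B V])
 qed
 moreover have "x : mproj A N x"
using abelian_subgroup.a_rcos_self[OF abelian_subgroup_submodule[OF A N] x] by (simp add: mproj_def)
 ultimately have "(\<Union>u\<in>mproj A N x. mproj B V (f u)) = mproj B V (f x)" by blast
 thus ?thesis by (simp add: mquot_map_def mproj_def)
qed

subsection \<open>Transport, free modules, tensor products and direct sums\<close>

lemma carrier_tag [simp]: "cr (tag_module t A) = t ` cr A"
and zero_tag [simp]: "\<zero>\<^bsub>tag_module t A\<^esub> = t \<zero>\<^bsub>A\<^esub>"
by (simp_all add: tag_module_def)

lemma add_tag [simp]: "inj t ==> x : cr A ==> y : cr A ==>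
 t x \<oplus>\<^bsub>tag_module t A\<^esub> t y = t (x \<oplus>\<^bsub>A\<^esub> y)"
and smult_tag [simp]: "inj t ==> x : cr A ==> a \<odot>\<^bsub>tag_module t A\<^esub> t x = t (a \<odot>\<^bsub>A\<^esub> x)"
by (simp_all add: tag_module_def inv_into_f_f inj_on_subset[of t UNIV])

lemma module_tag:
 fixes R :: "'r ring"
 assumes A: "rmod R A" and t: "inj t"
 shows "rmod R (tag_module t A)"
proof -
 interpret A: Module.module R A by fact
 have eq: "tag_module t A = mk_module (cr (tag_module t A)) (add (tag_module t A))
 \<zero>\<^bsub>tag_module t A\<^esub> (smult (tag_module t A))"
by (simp add: tag_module_def mk_module_def)
 show ?thesis
by (subst eq, rule module_mk_module[OF module_axiomsD(1)[OF A]])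
 (auto simp: t A.add.m_assoc A.smult_l_distr A.smult_r_distr A.smult_assoc1 A.smult_l_null intro!: arg_cong[of _ _ t] A.add.m_comm)
qed

lemma mlinear_tag: "inj t ==> mlinear R A (tag_module t A) t"
by (rule mlinearI) auto

lemma mlinear_from_tag:
 assumes "inj t"
 shows "mlinear R (tag_module t A) B f \<longleftrightarrow> mlinear R A B (%x. f (t x))"
using assms by (auto simp: mlinear_def Pi_iff)

lemma mlinear_untag:
 assumes t: "inj t" "!!x. u (t x) = x" shows "mlinear R (tag_module t A) A u"
unfolding mlinear_from_tag[OF t(1)] t(2) by (rule lin_id)

lemma mlinear_into_tag: "inj t ==> mlinear R A B f ==> mlinear R A (tag_module t B) (%x. t (f x))"
by (rule lin_comp[OF _ mlinear_tag])

text \<open>One bound serves sums and scalar multiples: the support of \<open>w\<close> lies in the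
  union of two finite supports, and scalar multiples take both to be the same.\<close>

lemma finite_support_add:
 fixes z :: "'i => 'b"
 assumes "finite {i : I. x i ~= z i}" "finite {i : I. y i ~= z i}"
and "!!i. i : I ==> x i = z i ==> y i = z i ==> w i = z i"
 shows "finite {i : I. w i ~= z i}"
by (rule finite_subset[OF _ finite_UnI[OF assms(1,2)]]) (use assms(3) in auto)

lemma module_free:
 assumes R: "cring R" shows "rmod R (free_module R G)"
proof -
 interpret R: cring R by fact
 have add: "finite {g. \<xi> g \<oplus>\<^bsub>R\<^esub> \<eta> g ~= \<zero>\<^bsub>R\<^esub>}"
 if "finite {g. \<xi> g ~= \<zero>\<^bsub>R\<^esub>}" "finite {g. \<eta> g ~= \<zero>\<^bsub>R\<^esub>}" for \<xi> \<eta> :: "'b => 'a"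
by (rule finite_subset[OF _ finite_UnI[OF that]]) auto
 have sm: "finite {g. a \<otimes>\<^bsub>R\<^esub> \<xi> g ~= \<zero>\<^bsub>R\<^esub>}"
 if "finite {g. \<xi> g ~= \<zero>\<^bsub>R\<^esub>}" "a : cr R" for a and \<xi> :: "'b => 'a"
by (rule finite_subset[OF _ that(1)]) (use that(2) in auto)
 show ?thesis unfolding free_module_def
by (rule module_mk_module[OF R]) (auto simp: add sm R.a_assoc R.l_distr R.r_distr R.m_assoc intro: R.a_comm)
qed

lemma basis_elem_in_free: "cring R ==> g : G ==> basis_elem R g : cr (free_module R G)"
proof -
 assume R: "cring R" and g: "g : G"
 interpret R: cring R by fact
 have "{h. basis_elem R g h ~= \<zero>\<^bsub>R\<^esub>} \<subseteq> {g}" by (auto simp: basis_elem_def)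
 thus ?thesis using g finite_subset[of _ "{g}"] by (auto simp: free_module_def basis_elem_def)
qed

lemma spans_free:
 assumes R: "cring R" shows "spans R (free_module R G) (basis_elem R ` G)"
unfolding spans_def
proof (intro conjI allI impI subsetI)
 interpret R: cring R by fact
 interpret F: Module.module R "free_module R G" by (rule module_free[OF R])
 show "x : cr (free_module R G)" if "x : basis_elem R ` G" for x
using that basis_elem_in_free[OF R] by auto
 fix N \<xi> assume N: "submodule N R (free_module R G)" and gen: "basis_elem R ` G \<subseteq> N"
and \<xi>: "\<xi> : cr (free_module R G)"
 have "finite {g. \<xi> g ~= \<zero>\<^bsub>R\<^esub>}" using \<xi> by (simp add: free_module_def)
 \<comment> \<open>Induction on a finite set containing the support, splitting off the coefficient
   at one point. The bounding set may stick out of \<open>G\<close>, where the coefficient vanishes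
   anyway.\<close>
 moreover have "\<xi> : N" if "finite S" "\<xi> : cr (free_module R G)" "{g. \<xi> g ~= \<zero>\<^bsub>R\<^esub>} \<subseteq> S" for S \<xi>
using that
 proof (induction S arbitrary: \<xi> rule: finite_induct)
 case empty
 hence "\<xi> = \<zero>\<^bsub>free_module R G\<^esub>" by (auto simp: free_module_def)
 thus ?case using submodule_zero[OF module_free[OF R] N] by simp
 next
 case (insert g S)
 show ?case
 proof (cases "g : G")
 case False
 hence "\<xi> g = \<zero>\<^bsub>R\<^esub>" using insert.prems by (auto simp: free_module_def)
 hence "{h. \<xi> h ~= \<zero>\<^bsub>R\<^esub>} \<subseteq> S" using insert.prems(2) by auto
 thus ?thesis using insert by auto
 next
 case True
 define \<eta> where "\<eta> = \<xi>(g := \<zero>\<^bsub>R\<^esub>)"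
 have "finite {h. \<eta> h ~= \<zero>\<^bsub>R\<^esub>}"
by (rule finite_subset[of _ "{h. \<xi> h ~= \<zero>\<^bsub>R\<^esub>}"]) (use insert.prems in "auto simp: \<eta>_def free_module_def")
 hence \<eta>: "\<eta> : cr (free_module R G)" using insert.prems(1) by (auto simp: free_module_def \<eta>_def)
 moreover have "{h. \<eta> h ~= \<zero>\<^bsub>R\<^esub>} \<subseteq> S" using insert.prems(2) by (auto simp: \<eta>_def)
 ultimately have "\<eta> : N" by (rule insert.IH)
 moreover have "\<xi> g : cr R" using insert.prems(1) by (auto simp: free_module_def)
 hence "\<xi> g \<odot>\<^bsub>free_module R G\<^esub> basis_elem R g : N" using True gen submodule_smult[OF N] by auto
 ultimately have "\<eta> \<oplus>\<^bsub>free_module R G\<^esub> (\<xi> g \<odot>\<^bsub>free_module R G\<^esub> basis_elem R g) : N"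
by (rule submodule_add[OF N])
 also have "\<eta> \<oplus>\<^bsub>free_module R G\<^esub> (\<xi> g \<odot>\<^bsub>free_module R G\<^esub> basis_elem R g) = \<xi>"
using insert.prems(1) by (auto simp: free_module_def \<eta>_def basis_elem_def)
 finally show ?thesis .
 qed
 qed
 ultimately show "\<xi> : N" using \<xi> by blast
qed

lemma free_lift:
 assumes B: "rmod R B" and v: "!!g. g : G ==> v g : cr B"
 obtains h where "mlinear R (free_module R G) B h" "!!g. g : G ==> h (basis_elem R g) = v g"
proof -
 interpret B: Module.module R B by fact
 define S where "S \<xi> = {g. \<xi> g ~= \<zero>\<^bsub>R\<^esub>}" for \<xi> :: "'c => 'a"
 define h where "h \<xi> = finsum B (%g. \<xi> g \<odot>\<^bsub>B\<^esub> v g) (S \<xi>)" for \<xi>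
 let ?F = "free_module R G"
 have c: "\<xi> g : cr R" "finite (S \<xi>)" "S \<xi> \<subseteq> G" if "\<xi> : cr ?F" for \<xi> g
using that by (auto simp: free_module_def S_def)
 \<comment> \<open>The sum may run over any finite set between the support and \<open>G\<close>;
   functions with different supports can then be added termwise.\<close>
 have ext: "h \<xi> = finsum B (%g. \<xi> g \<odot>\<^bsub>B\<^esub> v g) T"
 if "\<xi> : cr ?F" "finite T" "S \<xi> \<subseteq> T" "T \<subseteq> G" for \<xi> T
unfolding h_def
by (rule B.add.finprod_mono_neutral_cong_left)
 (use that c[OF that(1)] v in "auto simp: S_def B.smult_l_null")
 have lin: "mlinear R ?F B h"
 proof (rule mlinearI)
 fix \<xi> assume \<xi>: "\<xi> : cr ?F"
 show "h \<xi> : cr B" unfolding h_def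
by (rule B.finsum_closed) (use c[OF \<xi>] v in auto)
 {
 fix \<eta> assume \<eta>: "\<eta> : cr ?F"
 let ?T = "S \<xi> Un S \<eta>"
 have s: "\<xi> \<oplus>\<^bsub>?F\<^esub> \<eta> = (%g. \<xi> g \<oplus>\<^bsub>R\<^esub> \<eta> g)" by (simp add: free_module_def)
 interpret F: Module.module R ?F by (rule module_free[OF module_axiomsD(1)[OF B]])
 have "h (\<xi> \<oplus>\<^bsub>?F\<^esub> \<eta>) = finsum B (%g. (\<xi> \<oplus>\<^bsub>?F\<^esub> \<eta>) g \<odot>\<^bsub>B\<^esub> v g) ?T"
by (rule ext[OF F.a_closed[OF \<xi> \<eta>]]) (use c[OF \<xi>] c[OF \<eta>] in "auto simp: S_def s")
 also have "\<dots> = finsum B (%g. \<xi> g \<odot>\<^bsub>B\<^esub> v g \<oplus>\<^bsub>B\<^esub> \<eta> g \<odot>\<^bsub>B\<^esub> v g) ?T"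
unfolding s by (rule B.finsum_cong') (use c[OF \<xi>] c[OF \<eta>] v in "auto simp: B.smult_l_distr subset_iff")
 also have "\<dots> = h \<xi> \<oplus>\<^bsub>B\<^esub> h \<eta>"
 proof -
 have T: "finite ?T" "S \<xi> \<subseteq> ?T" "S \<eta> \<subseteq> ?T" "?T \<subseteq> G" using c[OF \<xi>] c[OF \<eta>] by auto
 show ?thesis
unfolding ext[OF \<xi> T(1,2,4)] ext[OF \<eta> T(1,3,4)]
by (rule B.finsum_addf) (use T c(1)[OF \<xi>] c(1)[OF \<eta>] v in "auto simp: Pi_iff subset_iff")
 qed
 finally show "h (\<xi> \<oplus>\<^bsub>?F\<^esub> \<eta>) = h \<xi> \<oplus>\<^bsub>B\<^esub> h \<eta>" .
 }
 fix a assume a: "a : cr R"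
 have s: "a \<odot>\<^bsub>?F\<^esub> \<xi> = (%g. a \<otimes>\<^bsub>R\<^esub> \<xi> g)" by (simp add: free_module_def)
 interpret F: Module.module R ?F by (rule module_free[OF module_axiomsD(1)[OF B]])
 have "h (a \<odot>\<^bsub>?F\<^esub> \<xi>) = finsum B (%g. (a \<odot>\<^bsub>?F\<^esub> \<xi>) g \<odot>\<^bsub>B\<^esub> v g) (S \<xi>)"
by (rule ext[OF F.smult_closed[OF a \<xi>]]) (use a c[OF \<xi>] in "auto simp: S_def s")
 also have "\<dots> = finsum B (%g. a \<odot>\<^bsub>B\<^esub> (\<xi> g \<odot>\<^bsub>B\<^esub> v g)) (S \<xi>)"
unfolding s by (rule B.finsum_cong') (use a c[OF \<xi>] v in "auto simp: B.smult_assoc1 subset_iff")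
 also have "\<dots> = a \<odot>\<^bsub>B\<^esub> h \<xi>" unfolding h_def
by (rule mlinear_finsum[OF B B mlinear_scale[OF B lin_id a], symmetric])
 (use c[OF \<xi>] v in auto)
 finally show "h (a \<odot>\<^bsub>?F\<^esub> \<xi>) = a \<odot>\<^bsub>B\<^esub> h \<xi>" .
 qed
 have "h (basis_elem R g) = v g" if g: "g : G" for g
 proof -
 have "h (basis_elem R g) = finsum B (%x. basis_elem R g x \<odot>\<^bsub>B\<^esub> v x) {g}"
by (rule ext) (use g basis_elem_in_free[OF module_axiomsD(1)[OF B]] in "auto simp: S_def basis_elem_def split: if_splits")
 also have "\<dots> = v g" using v[OF g] by (simp add: basis_elem_def)
 finally show ?thesis .
 qed
 with lin show thesis by (rule that)
qed

text \<open>Multilinear maps on a family of modules.\<close>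

definition multilin :: "'r ring => 'i set => ('i => ('r, 'a) module) => ('r, 'b) module => (('i => 'a) => 'b) => bool" where
 "multilin R I A B v \<longleftrightarrow> (ALL x : Pi\<^sub>E I (%i. cr (A i)). v x : cr B) \<and>
 (ALL x : Pi\<^sub>E I (%i. cr (A i)). ALL i:I. mlinear R (A i) B (%u. v (x(i := u))))"

lemma multilinD:
 assumes "multilin R I A B v" "x : Pi\<^sub>E I (%i. cr (A i))"
 shows "v x : cr B" "i : I ==> mlinear R (A i) B (%u. v (x(i := u)))"
using assms by (auto simp: multilin_def)

lemma multilin_comp: "multilin R I A B v ==> mlinear R B C f ==> multilin R I A C (%x. f (v x))"
using lin_in[of R B C f] lin_comp[of R _ B _ C f] by (auto simp: multilin_def) blast

text \<open>The hypothesis \<open>l\<close> says that changing one input coordinate changes a single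
  output coordinate, and linearly. Faces, degeneracies, the extra degeneracy, the action and the
  composition of fields all have this shape, so their multilinearity becomes a case distinction on
  positions.\<close>

lemma multilin_reindex:
 assumes v: "multilin R J B C v"
and m: "!!x. x : Pi\<^sub>E I (%i. cr (A i)) ==> m x : Pi\<^sub>E J (%j. cr (B j))"
and l: "!!x k. x : Pi\<^sub>E I (%i. cr (A i)) ==> k : I ==>
 EX j:J. EX l. mlinear R (A k) (B j) l & (ALL u:cr (A k). m (x(k := u)) = (m x)(j := l u))"
and A: "!!i. i : I ==> rmod R (A i)"
 shows "multilin R I A C (%x. v (m x))"
unfolding multilin_def
proof (intro conjI ballI)
 fix x assume x: "x : Pi\<^sub>E I (%i. cr (A i))"
 show "v (m x) : cr C" by (rule multilinD(1)[OF v m[OF x]])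
 fix k assume k: "k : I"
 obtain j l where j: "j : J" "mlinear R (A k) (B j) l"
 "ALL u:cr (A k). m (x(k := u)) = (m x)(j := l u)" using l[OF x k] by blast
 have "mlinear R (A k) C (%u. v ((m x)(j := l u)))"
by (rule lin_comp[OF j(2) multilinD(2)[OF v m[OF x] j(1)]])
 thus "mlinear R (A k) C (%u. v (m (x(k := u))))"
using mlinear_cong[OF A[OF k], of "%u. v (m (x(k := u)))" "%u. v ((m x)(j := l u))"] j(3) by simp
qed

context
 fixes R :: "'r ring" and I :: "'i set" and A :: "'i => ('r, 'a) module"
 assumes R: "cring R" and A: "!!i. i : I ==> rmod R (A i)"
begin

private abbreviation "F == free_module R (Pi\<^sub>E I (%i. cr (A i)))"
private abbreviation "N == mspan R F (multilinear_relations R I A)"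

private lemma F: "rmod R F" by (rule module_free[OF R])

private lemma fam_upd: "x : Pi\<^sub>E I (%i. cr (A i)) ==> i : I ==> u : cr (A i) ==>
 x(i := u) : Pi\<^sub>E I (%i. cr (A i))"
by (auto simp: PiE_iff extensional_def)

private lemma relations_subset: "multilinear_relations R I A \<subseteq> cr F"
proof -
 interpret F: Module.module R F by (rule F)
 have "add (A i) u v : cr (A i)" if "i : I" "u : cr (A i)" "v : cr (A i)" for i u v
 proof -
 interpret Module.module R "A i" using A that by blast
 show ?thesis using that by simp
 qed
 moreover have "a \<odot>\<^bsub>A i\<^esub> u : cr (A i)" if "i : I" "a : cr R" "u : cr (A i)" for i a u
 proof -
 interpret Module.module R "A i" using A that by blast
 show ?thesis using that by simp
 qed
 ultimately show ?thesis unfolding multilinear_relations_def Let_def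
by (auto intro!: F.minus_closed F.a_closed F.smult_closed basis_elem_in_free[OF R] fam_upd)
qed

private lemma N: "submodule N R F"
by (rule submodule_mspan[OF F relations_subset])

lemma module_tensor: "rmod R (tensor R I A)"
unfolding tensor_def Let_def by (rule module_mquot[OF F N])

lemma pure_tensor_mproj: "pure_tensor R I A x = mproj F N (basis_elem R x)"
by (simp add: pure_tensor_def mproj_def Let_def)

lemma tensor_mquot: "tensor R I A = mquot F N"
by (simp add: tensor_def Let_def)

lemma pure_tensor_closed: "x : Pi\<^sub>E I (%i. cr (A i)) ==> pure_tensor R I A x : cr (tensor R I A)"
unfolding pure_tensor_mproj tensor_mquot
by (rule lin_in[OF mlinear_proj[OF F N] basis_elem_in_free[OF R]])

lemma spans_tensor: "spans R (tensor R I A) (pure_tensor R I A ` Pi\<^sub>E I (%i. cr (A i)))"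
using spans_mquot[OF F N spans_free[OF R]]
unfolding tensor_mquot image_image pure_tensor_mproj .

lemma multilin_pure_tensor: "multilin R I A (tensor R I A) (pure_tensor R I A)"
unfolding multilin_def
proof (intro conjI ballI)
 interpret F: Module.module R F by (rule F)
 fix x assume x: "x : Pi\<^sub>E I (%i. cr (A i))"
 thus "pure_tensor R I A x : cr (tensor R I A)" by (rule pure_tensor_closed)
 fix i assume i: "i : I"
 interpret Ai: Module.module R "A i" by (rule A[OF i])
 note b = basis_elem_in_free[OF R fam_upd[OF x i]]
 note lin = mlinear_proj[OF F N]
 show "mlinear R (A i) (tensor R I A) (%u. pure_tensor R I A (x(i := u)))"
 proof (rule mlinearI)
 fix u assume u: "u : cr (A i)"
 thus "pure_tensor R I A (x(i := u)) : cr (tensor R I A)"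
by (rule pure_tensor_closed[OF fam_upd[OF x i]])
 {
 fix v assume v: "v : cr (A i)"
 have "basis_elem R (x(i := u \<oplus>\<^bsub>A i\<^esub> v)) \<ominus>\<^bsub>F\<^esub>
 (basis_elem R (x(i := u)) \<oplus>\<^bsub>F\<^esub> basis_elem R (x(i := v))) : N"
by (rule subsetD[OF mspan_superset]) (use x i u v in "auto simp: multilinear_relations_def Let_def")
 thus "pure_tensor R I A (x(i := u \<oplus>\<^bsub>A i\<^esub> v)) =
 pure_tensor R I A (x(i := u)) \<oplus>\<^bsub>tensor R I A\<^esub> pure_tensor R I A (x(i := v))"
using u v b unfolding pure_tensor_mproj tensor_mquot
by (simp add: lin_add[OF lin, symmetric] proj_eq_iff[OF F N])
 }
 fix a assume a: "a : cr R"
 have "basis_elem R (x(i := a \<odot>\<^bsub>A i\<^esub> u)) \<ominus>\<^bsub>F\<^esub> a \<odot>\<^bsub>F\<^esub> basis_elem R (x(i := u)) : N"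
by (rule subsetD[OF mspan_superset]) (use x i u a in "auto simp: multilinear_relations_def Let_def")
 thus "pure_tensor R I A (x(i := a \<odot>\<^bsub>A i\<^esub> u)) = a \<odot>\<^bsub>tensor R I A\<^esub> pure_tensor R I A (x(i := u))"
using u a b unfolding pure_tensor_mproj tensor_mquot
by (simp add: lin_smult[OF lin, symmetric] proj_eq_iff[OF F N])
 qed
qed

lemma tensor_lift:
 assumes B: "rmod R B" and v: "multilin R I A B v"
 obtains h where "mlinear R (tensor R I A) B h"
 "!!x. x : Pi\<^sub>E I (%i. cr (A i)) ==> h (pure_tensor R I A x) = v x"
proof -
 interpret B: Module.module R B by fact
 interpret F: Module.module R F by (rule F)
 obtain f where f: "mlinear R F B f" "!!x. x : Pi\<^sub>E I (%i. cr (A i)) ==> f (basis_elem R x) = v x"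
using free_lift[OF B, of "Pi\<^sub>E I (%i. cr (A i))" v] multilinD(1)[OF v] by blast
 have "multilinear_relations R I A \<subseteq> {x : cr F. f x = \<zero>\<^bsub>B\<^esub>}"
 proof
 fix r assume r: "r : multilinear_relations R I A"
 hence rF: "r : cr F" using relations_subset by blast
 from r consider
 (add) x i u w where "x : Pi\<^sub>E I (%i. cr (A i))" "i : I" "u : cr (A i)" "w : cr (A i)"
 "r = basis_elem R (x(i := u \<oplus>\<^bsub>A i\<^esub> w)) \<ominus>\<^bsub>F\<^esub> (basis_elem R (x(i := u)) \<oplus>\<^bsub>F\<^esub> basis_elem R (x(i := w)))"
 | (sm) x i a u where "x : Pi\<^sub>E I (%i. cr (A i))" "i : I" "a : cr R" "u : cr (A i)"
 "r = basis_elem R (x(i := a \<odot>\<^bsub>A i\<^esub> u)) \<ominus>\<^bsub>F\<^esub> a \<odot>\<^bsub>F\<^esub> basis_elem R (x(i := u))"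
unfolding multilinear_relations_def Let_def by blast
 hence "f r = \<zero>\<^bsub>B\<^esub>"
 proof cases
 case add
 interpret Ai: Module.module R "A i" by (rule A[OF add(2)])
 note b = basis_elem_in_free[OF R fam_upd[OF add(1,2)]] and fu = fam_upd[OF add(1,2)]
 have "v (x(i := u \<oplus>\<^bsub>A i\<^esub> w)) = v (x(i := u)) \<oplus>\<^bsub>B\<^esub> v (x(i := w))"
by (rule lin_add[OF multilinD(2)[OF v add(1,2)] add(3,4)])
 moreover have "v (x(i := u)) : cr B" "v (x(i := w)) : cr B"
using multilinD(1)[OF v fu] add by auto
 ultimately show ?thesis unfolding add(5)
using add(3,4) b by (simp add: mlinear_minus[OF F B f(1)] lin_add[OF f(1)] f(2) fu minus_simps(2)[OF B])
 next
 case sm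
 interpret Ai: Module.module R "A i" by (rule A[OF sm(2)])
 note b = basis_elem_in_free[OF R fam_upd[OF sm(1,2)]] and fu = fam_upd[OF sm(1,2)]
 have "v (x(i := a \<odot>\<^bsub>A i\<^esub> u)) = a \<odot>\<^bsub>B\<^esub> v (x(i := u))"
by (rule lin_smult[OF multilinD(2)[OF v sm(1,2)] sm(3,4)])
 moreover have "v (x(i := u)) : cr B"
using multilinD(1)[OF v fu] sm by auto
 ultimately show ?thesis unfolding sm(5)
using sm(3,4) b by (simp add: mlinear_minus[OF F B f(1)] lin_smult[OF f(1)] f(2) fu minus_simps(2)[OF B])
 qed
 with rF show "r : {x : cr F. f x = \<zero>\<^bsub>B\<^esub>}" by simp
 qed
 hence "N \<subseteq> {x : cr F. f x = \<zero>\<^bsub>B\<^esub>}" by (rule mspan_least[OF submodule_kernel[OF F B f(1)]])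
 then obtain h where h: "mlinear R (mquot F N) B h" "!!x. x : cr F ==> h (mproj F N x) = f x"
using mquot_lift[OF F N B f(1)] by blast
 show thesis
 proof (rule that[of h])
 show "mlinear R (tensor R I A) B h" using h(1) by (simp add: tensor_mquot)
 show "h (pure_tensor R I A x) = v x" if "x : Pi\<^sub>E I (%i. cr (A i))" for x
unfolding pure_tensor_mproj using h(2)[OF basis_elem_in_free[OF R that]] f(2)[OF that] by simp
 qed
qed

end

context
 fixes R :: "'r ring" and I :: "'i set" and A :: "'i => ('r, 'a) module"
 assumes R: "cring R" and A: "!!i. i : I ==> rmod R (A i)"
begin

private lemma A_facts:
 assumes "i : I"
 shows "x : cr (A i) ==> y : cr (A i) ==> x \<oplus>\<^bsub>A i\<^esub> y : cr (A i)"
 "\<zero>\<^bsub>A i\<^esub> : cr (A i)" "a : cr R ==> x : cr (A i) ==> a \<odot>\<^bsub>A i\<^esub> x : cr (A i)"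
 "\<zero>\<^bsub>A i\<^esub> \<oplus>\<^bsub>A i\<^esub> \<zero>\<^bsub>A i\<^esub> = \<zero>\<^bsub>A i\<^esub>" "a : cr R ==> a \<odot>\<^bsub>A i\<^esub> \<zero>\<^bsub>A i\<^esub> = \<zero>\<^bsub>A i\<^esub>"
proof -
 interpret Module.module R "A i" by (rule A[OF assms])
 show "x : cr (A i) ==> y : cr (A i) ==> x \<oplus>\<^bsub>A i\<^esub> y : cr (A i)"
 "\<zero>\<^bsub>A i\<^esub> : cr (A i)" "a : cr R ==> x : cr (A i) ==> a \<odot>\<^bsub>A i\<^esub> x : cr (A i)"
 "\<zero>\<^bsub>A i\<^esub> \<oplus>\<^bsub>A i\<^esub> \<zero>\<^bsub>A i\<^esub> = \<zero>\<^bsub>A i\<^esub>" "a : cr R ==> a \<odot>\<^bsub>A i\<^esub> \<zero>\<^bsub>A i\<^esub> = \<zero>\<^bsub>A i\<^esub>"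
by (auto simp: smult_r_null)
qed

private lemma A_eqs:
 assumes "i : I"
 shows "x : cr (A i) ==> y : cr (A i) ==> u : cr (A i) ==>
 (x \<oplus>\<^bsub>A i\<^esub> y) \<oplus>\<^bsub>A i\<^esub> u = x \<oplus>\<^bsub>A i\<^esub> (y \<oplus>\<^bsub>A i\<^esub> u)"
 "x : cr (A i) ==> y : cr (A i) ==> x \<oplus>\<^bsub>A i\<^esub> y = y \<oplus>\<^bsub>A i\<^esub> x"
 "x : cr (A i) ==> \<zero>\<^bsub>A i\<^esub> \<oplus>\<^bsub>A i\<^esub> x = x"
 "x : cr (A i) ==> x \<oplus>\<^bsub>A i\<^esub> \<zero>\<^bsub>A i\<^esub> = x"
 "a : cr R ==> b : cr R ==> x : cr (A i) ==> (a \<oplus>\<^bsub>R\<^esub> b) \<odot>\<^bsub>A i\<^esub> x = a \<odot>\<^bsub>A i\<^esub> x \<oplus>\<^bsub>A i\<^esub> b \<odot>\<^bsub>A i\<^esub> x"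
 "a : cr R ==> x : cr (A i) ==> y : cr (A i) ==> a \<odot>\<^bsub>A i\<^esub> (x \<oplus>\<^bsub>A i\<^esub> y) = a \<odot>\<^bsub>A i\<^esub> x \<oplus>\<^bsub>A i\<^esub> a \<odot>\<^bsub>A i\<^esub> y"
 "a : cr R ==> b : cr R ==> x : cr (A i) ==> (a \<otimes>\<^bsub>R\<^esub> b) \<odot>\<^bsub>A i\<^esub> x = a \<odot>\<^bsub>A i\<^esub> (b \<odot>\<^bsub>A i\<^esub> x)"
 "x : cr (A i) ==> \<one>\<^bsub>R\<^esub> \<odot>\<^bsub>A i\<^esub> x = x" "x : cr (A i) ==> \<zero>\<^bsub>R\<^esub> \<odot>\<^bsub>A i\<^esub> x = \<zero>\<^bsub>A i\<^esub>"
proof -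
 interpret Module.module R "A i" by (rule A[OF assms])
 show "x : cr (A i) ==> y : cr (A i) ==> u : cr (A i) ==>
 (x \<oplus>\<^bsub>A i\<^esub> y) \<oplus>\<^bsub>A i\<^esub> u = x \<oplus>\<^bsub>A i\<^esub> (y \<oplus>\<^bsub>A i\<^esub> u)"
 "x : cr (A i) ==> y : cr (A i) ==> x \<oplus>\<^bsub>A i\<^esub> y = y \<oplus>\<^bsub>A i\<^esub> x"
by (rule M.add.m_assoc M.add.m_comm; assumption)+
 show "x : cr (A i) ==> \<zero>\<^bsub>A i\<^esub> \<oplus>\<^bsub>A i\<^esub> x = x"
 "x : cr (A i) ==> x \<oplus>\<^bsub>A i\<^esub> \<zero>\<^bsub>A i\<^esub> = x"
 "a : cr R ==> b : cr R ==> x : cr (A i) ==> (a \<oplus>\<^bsub>R\<^esub> b) \<odot>\<^bsub>A i\<^esub> x = a \<odot>\<^bsub>A i\<^esub> x \<oplus>\<^bsub>A i\<^esub> b \<odot>\<^bsub>A i\<^esub> x"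
 "a : cr R ==> x : cr (A i) ==> y : cr (A i) ==> a \<odot>\<^bsub>A i\<^esub> (x \<oplus>\<^bsub>A i\<^esub> y) = a \<odot>\<^bsub>A i\<^esub> x \<oplus>\<^bsub>A i\<^esub> a \<odot>\<^bsub>A i\<^esub> y"
 "a : cr R ==> b : cr R ==> x : cr (A i) ==> (a \<otimes>\<^bsub>R\<^esub> b) \<odot>\<^bsub>A i\<^esub> x = a \<odot>\<^bsub>A i\<^esub> (b \<odot>\<^bsub>A i\<^esub> x)"
 "x : cr (A i) ==> \<one>\<^bsub>R\<^esub> \<odot>\<^bsub>A i\<^esub> x = x" "x : cr (A i) ==> \<zero>\<^bsub>R\<^esub> \<odot>\<^bsub>A i\<^esub> x = \<zero>\<^bsub>A i\<^esub>"
by (simp_all add: smult_l_distr smult_r_distr smult_assoc1 smult_l_null)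
qed

lemma carrier_direct_sum: "cr (direct_sum I A) =
 {x : Pi\<^sub>E I (%i. cr (A i)). finite {i : I. x i ~= \<zero>\<^bsub>A i\<^esub>}}"
by (simp add: direct_sum_def)

lemma module_direct_sum: "rmod R (direct_sum I A)"
unfolding direct_sum_def
proof (rule module_mk_module[OF R], goal_cases)
 case (1 x y)
 hence "finite {i : I. (\<lambda>i\<in>I. x i \<oplus>\<^bsub>A i\<^esub> y i) i ~= \<zero>\<^bsub>A i\<^esub>}"
by - (rule finite_support_add[of I x "%i. \<zero>\<^bsub>A i\<^esub>" y]; simp add: A_facts)
 with 1 show ?case by (simp only: mem_Collect_eq) (auto simp: A_facts PiE_iff)
next
 case 2
 have "{i : I. (\<lambda>i\<in>I. \<zero>\<^bsub>A i\<^esub>) i ~= \<zero>\<^bsub>A i\<^esub>} = {}" by auto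
 thus ?case by (simp only: mem_Collect_eq) (auto simp: A_facts)
next
 case (3 a x)
 hence "finite {i : I. (\<lambda>i\<in>I. a \<odot>\<^bsub>A i\<^esub> x i) i ~= \<zero>\<^bsub>A i\<^esub>}"
by - (rule finite_support_add[of I x "%i. \<zero>\<^bsub>A i\<^esub>" x]; simp add: A_facts)
 with 3 show ?case by (simp only: mem_Collect_eq) (auto simp: A_facts PiE_iff)
next
 case (4 x y u)
 thus ?case by (intro restrict_ext) (auto simp: A_eqs(1) PiE_iff)
next
 case (5 x y)
 thus ?case by (intro restrict_ext A_eqs(2)) (auto simp: PiE_iff)
next
 case (6 x)
 thus ?case by (intro extensionalityI[where A = I]) (auto simp: A_eqs(3) PiE_iff)
next
 case (7 a b x)
 thus ?case by (intro restrict_ext) (auto simp: A_eqs(5) PiE_iff)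
next
 case (8 a x y)
 thus ?case by (intro restrict_ext) (auto simp: A_eqs(6) PiE_iff)
next
 case (9 a b x)
 thus ?case by (intro restrict_ext) (auto simp: A_eqs(7) PiE_iff)
next
 case (10 x)
 thus ?case by (intro extensionalityI[where A = I]) (auto simp: A_eqs(8) PiE_iff)
next
 case (11 x)
 thus ?case by (intro restrict_ext) (auto simp: A_eqs(9) PiE_iff)
qed

lemma summand_incl_closed:
 assumes "j : I" "u : cr (A j)"
 shows "summand_incl I A j u : cr (direct_sum I A)"
proof -
 have "{i : I. summand_incl I A j u i ~= \<zero>\<^bsub>A i\<^esub>} \<subseteq> {j}" by (auto simp: summand_incl_def)
 hence "finite {i : I. summand_incl I A j u i ~= \<zero>\<^bsub>A i\<^esub>}" by (rule finite_subset) simp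
 thus ?thesis using assms by (auto simp: carrier_direct_sum summand_incl_def A_facts)
qed

lemma mlinear_summand_incl:
 assumes j: "j : I" shows "mlinear R (A j) (direct_sum I A) (summand_incl I A j)"
by (rule mlinearI, erule summand_incl_closed[OF j])
 (auto simp: direct_sum_def summand_incl_def fun_eq_iff restrict_def A_facts j)

lemma spans_direct_sum:
 assumes S: "!!i. i : I ==> spans R (A i) (S i)"
 shows "spans R (direct_sum I A) (\<Union>i\<in>I. summand_incl I A i ` S i)"
unfolding spans_def
proof (intro conjI allI impI)
 show "(\<Union>i\<in>I. summand_incl I A i ` S i) \<subseteq> cr (direct_sum I A)"
using summand_incl_closed spans_subset[OF S] by blast
 fix N assume N: "submodule N R (direct_sum I A)" and gen: "(\<Union>i\<in>I. summand_incl I A i ` S i) \<subseteq> N"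
 have incl: "summand_incl I A i u : N" if i: "i : I" "u : cr (A i)" for i u
using spansD[OF S[OF i(1)] submodule_preimage[OF A[OF i(1)] module_direct_sum mlinear_summand_incl[OF i(1)] N] _ i(2)]
 gen i spans_subset[OF S[OF i(1)]] by blast
 have "x : N" if "finite J" "x : cr (direct_sum I A)" "{i : I. x i ~= \<zero>\<^bsub>A i\<^esub>} \<subseteq> J" for J x
using that
 proof (induction J arbitrary: x rule: finite_induct)
 case empty
 hence "x = \<zero>\<^bsub>direct_sum I A\<^esub>" by (auto simp: direct_sum_def fun_eq_iff PiE_iff extensional_def)
 thus ?case using submodule_zero[OF module_direct_sum N] by simp
 next
 case (insert j J)
 show ?case
 proof (cases "j : I")
 case False
 hence "{i : I. x i ~= \<zero>\<^bsub>A i\<^esub>} \<subseteq> J" using insert.prems(2) by auto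
 thus ?thesis using insert by auto
 next
 case True
 define y where "y = x(j := \<zero>\<^bsub>A j\<^esub>)"
 have "finite {i : I. y i ~= \<zero>\<^bsub>A i\<^esub>}"
by (rule finite_subset[of _ "{i : I. x i ~= \<zero>\<^bsub>A i\<^esub>}"]) (use insert.prems in "auto simp: y_def carrier_direct_sum")
 hence y: "y : cr (direct_sum I A)" using insert.prems(1) True
by (auto simp: carrier_direct_sum y_def PiE_iff extensional_def A_facts)
 moreover have "{i : I. y i ~= \<zero>\<^bsub>A i\<^esub>} \<subseteq> J" using insert.prems(2) by (auto simp: y_def)
 ultimately have "y : N" by (rule insert.IH)
 moreover have xj: "x j : cr (A j)" using insert.prems(1) True by (auto simp: carrier_direct_sum)
 ultimately have "y \<oplus>\<^bsub>direct_sum I A\<^esub> summand_incl I A j (x j) : N"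
using submodule_add[OF N] incl[OF True] by blast
 also have "y \<oplus>\<^bsub>direct_sum I A\<^esub> summand_incl I A j (x j) = x"
using insert.prems(1) True xj
by (auto simp: direct_sum_def y_def summand_incl_def fun_eq_iff restrict_def PiE_iff extensional_def A_eqs)
 finally show ?thesis .
 qed
 qed
 thus "cr (direct_sum I A) \<subseteq> N" by (auto simp: carrier_direct_sum)
qed

lemma direct_sum_lift:
 assumes B: "rmod R B" and f: "!!i. i : I ==> mlinear R (A i) B (f i)"
 obtains h where "mlinear R (direct_sum I A) B h"
 "!!i u. i : I ==> u : cr (A i) ==> h (summand_incl I A i u) = f i u"
proof -
 interpret B: Module.module R B by fact
 let ?D = "direct_sum I A"
 define S where "S x = {i : I. x i ~= \<zero>\<^bsub>A i\<^esub>}" for x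
 define h where "h x = finsum B (%i. f i (x i)) (S x)" for x
 have f0: "f i \<zero>\<^bsub>A i\<^esub> = \<zero>\<^bsub>B\<^esub>" if "i : I" for i by (rule lin_zero[OF A[OF that] B f[OF that]])
 have c: "finite (S x)" "S x \<subseteq> I" if "x : cr ?D" for x
using that by (auto simp: carrier_direct_sum S_def)
 have xc: "i : I ==> x i : cr (A i)" if "x : cr ?D" for x i
using that by (auto simp: carrier_direct_sum)
 have fc: "i : I ==> f i (x i) : cr B" if "x : cr ?D" for x i
using lin_in[OF f] xc[OF that] by blast
 have ext: "h x = finsum B (%i. f i (x i)) T" if "x : cr ?D" "finite T" "S x \<subseteq> T" "T \<subseteq> I" for x T
unfolding h_def
by (rule B.add.finprod_mono_neutral_cong_left)
 (use that fc[OF that(1)] in "auto simp: S_def f0")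
 interpret D: Module.module R ?D by (rule module_direct_sum)
 have lin: "mlinear R ?D B h"
 proof (rule mlinearI)
 fix x assume x: "x : cr ?D"
 show "h x : cr B" unfolding h_def
by (rule B.finsum_closed) (use c[OF x] fc[OF x] in auto)
 {
 fix y assume y: "y : cr ?D"
 let ?T = "S x Un S y"
 have s: "x \<oplus>\<^bsub>?D\<^esub> y = (\<lambda>i\<in>I. x i \<oplus>\<^bsub>A i\<^esub> y i)" by (simp add: direct_sum_def)
 have T: "finite ?T" "S x \<subseteq> ?T" "S y \<subseteq> ?T" "?T \<subseteq> I" using c[OF x] c[OF y] by auto
 have "S (x \<oplus>\<^bsub>?D\<^esub> y) \<subseteq> ?T" by (auto simp: S_def s A_facts)
 hence "h (x \<oplus>\<^bsub>?D\<^esub> y) = finsum B (%i. f i ((x \<oplus>\<^bsub>?D\<^esub> y) i)) ?T"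
using ext[OF D.a_closed[OF x y] T(1) _ T(4)] by blast
 also have "\<dots> = finsum B (%i. f i (x i) \<oplus>\<^bsub>B\<^esub> f i (y i)) ?T"
 proof (rule B.finsum_cong')
 fix i assume "i : ?T"
 hence "i : I" using T by auto
 thus "f i ((x \<oplus>\<^bsub>?D\<^esub> y) i) = f i (x i) \<oplus>\<^bsub>B\<^esub> f i (y i)"
using xc[OF x] xc[OF y] by (simp add: s lin_add[OF f])
 qed (use T fc[OF x] fc[OF y] in "auto simp: Pi_iff subset_iff")
 also have "\<dots> = h x \<oplus>\<^bsub>B\<^esub> h y"
unfolding ext[OF x T(1,2,4)] ext[OF y T(1,3,4)]
by (rule B.finsum_addf) (use T fc[OF x] fc[OF y] in "auto simp: Pi_iff subset_iff")
 finally show "h (x \<oplus>\<^bsub>?D\<^esub> y) = h x \<oplus>\<^bsub>B\<^esub> h y" .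
 }
 fix a assume a: "a : cr R"
 have s: "a \<odot>\<^bsub>?D\<^esub> x = (\<lambda>i\<in>I. a \<odot>\<^bsub>A i\<^esub> x i)" by (simp add: direct_sum_def)
 have "S (a \<odot>\<^bsub>?D\<^esub> x) \<subseteq> S x" by (auto simp: S_def s A_facts a)
 hence "h (a \<odot>\<^bsub>?D\<^esub> x) = finsum B (%i. f i ((a \<odot>\<^bsub>?D\<^esub> x) i)) (S x)"
using ext[OF D.smult_closed[OF a x] c(1)[OF x] _ c(2)[OF x]] by blast
 also have "\<dots> = finsum B (%i. a \<odot>\<^bsub>B\<^esub> f i (x i)) (S x)"
 proof (rule B.finsum_cong')
 fix i assume "i : S x"
 hence "i : I" using c[OF x] by auto
 thus "f i ((a \<odot>\<^bsub>?D\<^esub> x) i) = a \<odot>\<^bsub>B\<^esub> f i (x i)"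
using xc[OF x] a by (simp add: s lin_smult[OF f])
 qed (use c[OF x] fc[OF x] a in "auto simp: Pi_iff subset_iff")
 also have "\<dots> = a \<odot>\<^bsub>B\<^esub> h x" unfolding h_def
by (rule mlinear_finsum[OF B B mlinear_scale[OF B lin_id a], symmetric])
 (use c[OF x] fc[OF x] in auto)
 finally show "h (a \<odot>\<^bsub>?D\<^esub> x) = a \<odot>\<^bsub>B\<^esub> h x" .
 qed
 have "h (summand_incl I A j u) = f j u" if j: "j : I" and u: "u : cr (A j)" for j u
 proof -
 have "h (summand_incl I A j u) = finsum B (%i. f i (summand_incl I A j u i)) {j}"
by (rule ext) (use j summand_incl_closed[OF j u] in "auto simp: S_def summand_incl_def")
 also have "\<dots> = f j u" using lin_in[OF f[OF j] u] j by (simp add: summand_incl_def)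
 finally show ?thesis .
 qed
 with lin show thesis by (rule that)
qed

end

subsection \<open>Extensions of maps given on generators\<close>

lemma restrict_mlinear:
 assumes "rmod R A" "mlinear R A B f"
 shows "mlinear R A B (restrict f (cr A))"
using mlinear_cong[OF assms(1), of "restrict f (cr A)" f] assms(2) by simp

text \<open>Spanning generators make the described map unique, and any linear \<open>f\<close> with
  the right values, cut off outside the carrier, shows that it exists. Generators may satisfy
  relations, so such an \<open>f\<close> has to be produced for each use.\<close>

lemma linear_ext:
 assumes A: "rmod R A" and B: "rmod R B" and sp: "spans R A (gen ` G)"
and f: "mlinear R A B f" "!!g. g : G ==> f (gen g) = v g"
 shows "mlinear R A B (linear_ext R A B G gen v)"
and "g : G ==> linear_ext R A B G gen v (gen g) = v g"
and "x : cr A ==> linear_ext R A B G gen v x = f x"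
proof -
 let ?f = "restrict f (cr A)"
 have lin: "mlinear R A B ?f" by (rule restrict_mlinear[OF A f(1)])
 have genc: "gen g : cr A" if "g : G" for g using spans_subset[OF sp] that by auto
 have "linear_ext R A B G gen v = ?f" unfolding linear_ext_def
 proof (rule the_equality)
 show "mlinear R A B ?f & ?f : extensional (cr A) & (ALL g:G. ?f (gen g) = v g)"
using lin f(2) genc by auto
 fix h assume h: "mlinear R A B h & h : extensional (cr A) & (ALL g:G. h (gen g) = v g)"
 show "h = ?f"
 proof (rule extensionalityI[where A = "cr A"])
 show "h x = ?f x" if "x : cr A" for x
using h genc f(2) by (intro spans_eqI[OF A B sp _ lin _ that]) auto
 qed (use h in auto)
 qed
 thus "mlinear R A B (linear_ext R A B G gen v)"
and "g : G ==> linear_ext R A B G gen v (gen g) = v g"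
and "x : cr A ==> linear_ext R A B G gen v x = f x"
using lin f(2) genc by auto
qed

lemma bilinD:
 assumes "mbilinear R A B C f"
 shows "x : cr A ==> mlinear R B C (f x)" "y : cr B ==> mlinear R A C (%x. f x y)"
using assms by (auto simp: mbilinear_def)

text \<open>Since generators may satisfy relations, prescribed values need not extend. It suffices
  that they extend linearly in each variable while the other one stays at a generator.\<close>

lemma bilinear_ext:
 assumes A: "rmod R A" and B: "rmod R B" and C: "rmod R C"
and spA: "spans R A (gen ` G)" and spB: "spans R B (gen' ` H)"
and l: "!!h. h : H ==> EX ph. mlinear R A C ph & (ALL g:G. ph (gen g) = v g h)"
and r: "!!g. g : G ==> EX ps. mlinear R B C ps & (ALL h:H. ps (gen' h) = v g h)"
 shows "mbilinear R A B C (bilinear_ext R A B C G gen H gen' v)"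
and "g : G ==> h : H ==> bilinear_ext R A B C G gen H gen' v (gen g) (gen' h) = v g h"
proof -
 interpret A: Module.module R A by fact
 interpret B: Module.module R B by fact
 interpret C: Module.module R C by fact
 have genA: "gen g : cr A" if "g : G" for g using spans_subset[OF spA] that by auto
 have genB: "gen' h : cr B" if "h : H" for h using spans_subset[OF spB] that by auto
 obtain ph where ph: "!!h. h : H ==> mlinear R A C (ph h)" "!!g h. g : G ==> h : H ==> ph h (gen g) = v g h"
using l by metis
 \<comment> \<open>Those \<open>a\<close> for which the values \<open>ph h a\<close> at the
   generators of \<open>B\<close> extend linearly over \<open>B\<close>. They form a submodule,
   which by \<open>r\<close> contains the generators of \<open>A\<close> and hence
   everything.\<close>
 define V where "V = {a : cr A. EX ps. mlinear R B C ps & (ALL h:H. ps (gen' h) = ph h a)}"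
 have subV: "submodule V R A"
 proof (rule submoduleI'[OF A])
 show "\<zero>\<^bsub>A\<^esub> : V" using mlinear_const_zero[OF C] ph(1) lin_zero[OF A C] by (force simp: V_def)
 fix x y assume xy: "x : V" "y : V"
 obtain p q where p: "mlinear R B C p" "ALL h:H. p (gen' h) = ph h x"
and q: "mlinear R B C q" "ALL h:H. q (gen' h) = ph h y" using xy by (auto simp: V_def)
 thus "x \<oplus>\<^bsub>A\<^esub> y : V" using xy mlinear_plus[OF C p(1) q(1)] lin_add[OF ph(1)]
by (auto simp: V_def intro!: exI[of _ "%u. p u \<oplus>\<^bsub>C\<^esub> q u"])
 next
 fix a x assume a: "a : cr R" and x: "x : V"
 obtain p where p: "mlinear R B C p" "ALL h:H. p (gen' h) = ph h x" using x by (auto simp: V_def)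
 thus "a \<odot>\<^bsub>A\<^esub> x : V" using x a mlinear_scale[OF C p(1) a] lin_smult[OF ph(1)]
by (auto simp: V_def intro!: exI[of _ "%u. a \<odot>\<^bsub>C\<^esub> p u"])
 qed (auto simp: V_def)
 have "EX ps. mlinear R B C ps & (ALL h:H. ps (gen' h) = ph h a)" if a: "a : cr A" for a
 proof -
 have "a : V" by (rule spansD[OF spA subV _ a]) (use r ph(2) genA in "auto simp: V_def")
 thus ?thesis by (simp add: V_def)
 qed
 then obtain F where F: "!!a. a : cr A ==> mlinear R B C (F a)"
 "!!a h. a : cr A ==> h : H ==> F a (gen' h) = ph h a" by metis
 have linA: "mlinear R A C (%a. F a y)" if y: "y : cr B" for y
 proof (rule mlinearI)
 fix a assume a: "a : cr A"
 show "F a y : cr C" by (rule lin_in[OF F(1)[OF a] y])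
 show "F (a \<oplus>\<^bsub>A\<^esub> b) y = F a y \<oplus>\<^bsub>C\<^esub> F b y" if b: "b : cr A" for b
by (rule spans_eqI[OF B C spB F(1) mlinear_plus[OF C F(1)[OF a] F(1)[OF b]] _ y])
 (use a b in "auto simp: F(2) lin_add[OF ph(1)]")
 show "F (r \<odot>\<^bsub>A\<^esub> a) y = r \<odot>\<^bsub>C\<^esub> F a y" if "r : cr R" for r
by (rule spans_eqI[OF B C spB F(1) mlinear_scale[OF C F(1)[OF a] that] _ y])
 (use a that in "auto simp: F(2) lin_smult[OF ph(1)]")
 qed
 define f where "f = (\<lambda>a\<in>cr A. restrict (F a) (cr B))"
 have fF: "f a y = F a y" if "a : cr A" "y : cr B" for a y using that by (simp add: f_def)
 have bil: "mbilinear R A B C f"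
unfolding mbilinear_def using F(1) linA
by (auto simp: f_def restrict_mlinear[OF B] mlinear_cong[OF A, of "%x. (if x : cr A then F x _ else _)" "%x. F x _"]
 intro!: iffD1[OF mlinear_cong[OF A] linA])
 have vals: "f (gen g) (gen' h) = v g h" if "g : G" "h : H" for g h
using that genA genB by (simp add: fF F(2) ph(2))
 have "bilinear_ext R A B C G gen H gen' v = f" unfolding bilinear_ext_def
 proof (rule the_equality)
 show "mbilinear R A B C f & f : extensional (cr A) \<and>
 (ALL x:cr A. f x : extensional (cr B)) & (ALL g:G. ALL h:H. f (gen g) (gen' h) = v g h)"
using bil vals by (auto simp: f_def)
 fix k assume k: "mbilinear R A B C k & k : extensional (cr A) \<and>
 (ALL x:cr A. k x : extensional (cr B)) & (ALL g:G. ALL h:H. k (gen g) (gen' h) = v g h)"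
 hence kb: "mbilinear R A B C k" by blast
 have 1: "k (gen g) y = f (gen g) y" if g: "g : G" and y: "y : cr B" for g y
by (rule spans_eqI[OF B C spB bilinD(1)[OF kb] bilinD(1)[OF bil] _ y])
 (use g genA k vals in auto)
 have 2: "k a y = f a y" if a: "a : cr A" and y: "y : cr B" for a y
by (rule spans_eqI[OF A C spA bilinD(2)[OF kb y] bilinD(2)[OF bil y] _ a]) (use 1 y in auto)
 show "k = f"
 proof (rule extensionalityI[where A = "cr A"])
 fix a assume a: "a : cr A"
 show "k a = f a"
by (rule extensionalityI[where A = "cr B"]) (use k a 2 in "auto simp: f_def")
 qed (use k in "auto simp: f_def")
 qed
 thus "mbilinear R A B C (bilinear_ext R A B C G gen H gen' v)"
and "g : G ==> h : H ==> bilinear_ext R A B C G gen H gen' v (gen g) (gen' h) = v g h"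
using bil vals by auto
qed

section \<open>Resolutions with an extra degeneracy\<close>

text \<open>The first isomorphism theorem at the end of a complex: the outgoing map is zero, so
  every element of \<open>B\<close> is a cycle. It yields \<open>H_0\<close> of the resolutions as
  well as the homology at the augmentation term.\<close>

lemma homology_at_cokernel:
 assumes "rmod R A" "rmod R B" "rmod R C" "mlinear R A B f" "mlinear R B C g"
and "f ` cr A = {x : cr B. g x = \<zero>\<^bsub>C\<^esub>}" "g ` cr B = cr C"
 shows "module_iso R (homology_at A f B (%_. ()) zero_module) C"
proof -
 let ?N = "f ` cr A"
 have N: "submodule ?N R B" by (rule submodule_image[OF assms(1,2,4) submodule_carrier[OF assms(1)]])
 obtain h where h: "mlinear R (mquot B ?N) C h" "!!x. x : cr B ==> h (mproj B ?N x) = g x"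
using mquot_lift[OF assms(2) N assms(3,5)] assms(6) by blast
 have "bij_betw h (cr (mquot B ?N)) (cr C)"
unfolding bij_betw_def
 proof
 show "inj_on h (cr (mquot B ?N))"
 proof (rule inj_onI)
 fix u v assume "u : cr (mquot B ?N)" "v : cr (mquot B ?N)" and e: "h u = h v"
 then obtain x y where x: "x : cr B" "u = mproj B ?N x" and y: "y : cr B" "v = mproj B ?N y"
by (auto simp: carrier_mquot[OF assms(2) N])
 hence "g (x \<ominus>\<^bsub>B\<^esub> y) = \<zero>\<^bsub>C\<^esub>"
using e lin_in[OF assms(5)] h(2)
by (simp add: mlinear_minus[OF assms(2,3,5)] minus_simps(2)[OF assms(3)])
 hence "x \<ominus>\<^bsub>B\<^esub> y : ?N" using assms(6) x y minus_simps(6)[OF assms(2)] by simp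
 thus "u = v" using x y proj_eq_iff[OF assms(2) N] by simp
 qed
 have "h ` cr (mquot B ?N) = g ` cr B"
unfolding carrier_mquot[OF assms(2) N] image_image using h(2) by (intro image_cong) auto
 thus "h ` cr (mquot B ?N) = cr C" using assms(7) by simp
 qed
 thus ?thesis using h(1) by (auto simp: module_iso_def homology_at_def zero_module_def)
qed

lemma pmodule_homD:
 assumes "pmodule_hom M R P N K f"
 shows "L : MObj M ==> mlinear R (MVal N L) (MVal K L) (f L)"
and "al : MArr M ==> x : cr (MVal N (MFib M al)) ==> p : cr (Val P (Tgt M al)) ==>
 f (Src M al) (Act N al x p) = Act K al (f (MFib M al) x) p"
using assms by (auto simp: pmodule_hom_def)

lemma (in unital_pmodule) act_arr:
 "al : MArr M ==> mbilinear R (MVal N (MFib M al)) (Val P (Tgt M al)) (MVal N (Src M al)) (Act N al)"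
by (rule act) (simp add: hom_opmod_def)

text \<open>A single application of the action is enough, because by the module axiom an iterated
  action is the action of a composite.\<close>

definition act_span ::
 "('l, 'a, 'o, 'm) opmod => ('o, 'm, 'r, 'v) operad => ('l, 'a, 'r, 'v, 'w) pmodule =>
 ('l => 'w set) => 'l => 'w set" where
 "act_span M P F S L = {Act F al e p | al e p. al : MArr M & Src M al = L & e : S (MFib M al) \<and>
 p : cr (Val P (Tgt M al))}"

text \<open>Freeness on the image of \<open>j\<close>: the test maps are given on the source of \<open>j\<close> and have to vanish
 on its kernel.\<close>

definition free_along ::
 "'k itself => ('o, 'm) opcat => ('l, 'a, 'o, 'm) opmod => 'r ring => ('o, 'm, 'r, 'v) operad =>
 ('l, 'a, 'r, 'v, 'w) pmodule => ('l => ('r, 'y) module) => ('l => 'y => 'w) => bool" where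
 "free_along _ Op M R P F Y j \<longleftrightarrow>
 (ALL (K :: ('l, 'a, 'r, 'v, 'k) pmodule) ps. unital_pmodule Op M R P K -->
 (ALL L:MObj M. mlinear R (Y L) (MVal K L) (ps L)) -->
 (ALL L:MObj M. ALL y:cr (Y L). j L y = \<zero>\<^bsub>MVal F L\<^esub> --> ps L y = \<zero>\<^bsub>MVal K L\<^esub>) -->
 (EX f. pmodule_hom M R P F K f & (ALL L:MObj M. ALL y:cr (Y L). f L (j L y) = ps L y)))"

text \<open>The uniqueness half of freeness: homomorphisms commute with the action, so agreement on
  \<open>S\<close> spreads to \<open>act_span\<close>.\<close>

lemma pmodule_hom_eqI:
 assumes F: "unital_pmodule Op M R P F" and K: "unital_pmodule Op M R P K"
and S: "!!L. L : MObj M ==> S L \<subseteq> cr (MVal F L)"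
and gen: "!!L. L : MObj M ==> spans R (MVal F L) (act_span M P F S L)"
and fg: "pmodule_hom M R P F K f" "pmodule_hom M R P F K g"
and eq: "!!L e. L : MObj M ==> e : S L ==> f L e = g L e"
and L: "L : MObj M" and x: "x : cr (MVal F L)"
 shows "f L x = g L x"
proof (rule spans_eqI[OF _ _ gen[OF L] pmodule_homD(1)[OF fg(1) L] pmodule_homD(1)[OF fg(2) L] _ x])
 interpret F: unital_pmodule Op M R P F by fact
 interpret K: unital_pmodule Op M R P K by fact
 show "rmod R (MVal F L)" "rmod R (MVal K L)" by (rule F.mval[OF L] K.mval[OF L])+
 fix y assume "y : act_span M P F S L"
 then obtain al e p where a: "al : MArr M" "Src M al = L" "e : S (MFib M al)" "p : cr (Val P (Tgt M al))"
 "y = Act F al e p" by (auto simp: act_span_def)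
 have "e : cr (MVal F (MFib M al))" using S[OF F.mfib[OF a(1)]] a(3) by blast
 thus "f L y = g L y"
using pmodule_homD(2)[OF fg(1) a(1) _ a(4)] pmodule_homD(2)[OF fg(2) a(1) _ a(4)] a eq[OF F.mfib[OF a(1)] a(3)]
by metis
qed

text \<open>The free collection is taken to be the image of \<open>j\<close>, with the inclusion as
  unit of the adjunction. This stays within the carrier type of \<open>F\<close>, as
  \<open>free_unital_pmodule\<close> demands, and works for a \<open>j\<close> with kernel: test
  maps on the image are pulled back along \<open>j\<close>.\<close>

lemma free_unital_pmoduleI:
 fixes Y :: "'l => ('r, 'y) module" and F :: "('l, 'a, 'r, 'v, 'w) pmodule"
 assumes F: "unital_pmodule Op M R P F"
and Y: "!!L. L : MObj M ==> rmod R (Y L)"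
and j: "!!L. L : MObj M ==> mlinear R (Y L) (MVal F L) (j L)"
and gen: "!!L. L : MObj M ==> spans R (MVal F L) (act_span M P F (%L. j L ` cr (Y L)) L)"
and free: "free_along TYPE('k) Op M R P F Y j"
 shows "free_unital_pmodule TYPE('k) Op M R P F"
proof -
 interpret F: unital_pmodule Op M R P F by fact
 define S where "S L = j L ` cr (Y L)" for L
 define E where "E L = (MVal F L)\<lparr>carrier := S L\<rparr>" for L
 have sub: "submodule (S L) R (MVal F L)" if "L : MObj M" for L
unfolding S_def
by (rule submodule_image[OF Y[OF that] F.mval[OF that] j[OF that] submodule_carrier[OF Y[OF that]]])
 note Ssub = submodule_subset[OF sub]
 have ex: "EX f. pmodule_hom M R P F K f & (ALL L:MObj M. ALL e:cr (E L). f L e = ph L e)"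
 if K: "unital_pmodule Op M R P K" and ph: "ALL L:MObj M. mlinear R (E L) (MVal K L) (ph L)"
 for K :: "('l, 'a, 'r, 'v, 'k) pmodule" and ph
 proof -
 interpret K: unital_pmodule Op M R P K by fact
 have jE: "mlinear R (Y L) (E L) (j L)" if "L : MObj M" for L
unfolding E_def using j[OF that] mlinear_carrier_update[OF Ssub[OF that]] by (auto simp: S_def)
 have lin: "ALL L:MObj M. mlinear R (Y L) (MVal K L) (%y. ph L (j L y))"
using lin_comp[OF jE] ph by blast
 have "ph L (j L y) = \<zero>\<^bsub>MVal K L\<^esub>" if "L : MObj M" "j L y = \<zero>\<^bsub>MVal F L\<^esub>" for L y
using lin_zero[OF submodule_module[OF F.mval[OF that(1)] sub[OF that(1)]] K.mval[OF that(1)]] ph that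
unfolding E_def by auto
 then obtain f where f: "pmodule_hom M R P F K f" "ALL L:MObj M. ALL y:cr (Y L). f L (j L y) = ph L (j L y)"
using free[unfolded free_along_def, rule_format, of K "%L y. ph L (j L y)"] K lin by blast
 thus ?thesis by (auto simp: E_def S_def)
 qed
 have un: "f L x = g L x" if K: "unital_pmodule Op M R P K" and fg: "pmodule_hom M R P F K f" "pmodule_hom M R P F K g"
and eq: "ALL L:MObj M. ALL e:cr (E L). f L e = ph L e & g L e = ph L e" and L: "L : MObj M" and x: "x : cr (MVal F L)"
 for K :: "('l, 'a, 'r, 'v, 'k) pmodule" and ph f g L x
by (rule pmodule_hom_eqI[OF F K, where S = S]) (use Ssub gen fg eq L x in "auto simp: S_def[abs_def] E_def")
 have "free_unital_pmodule_on TYPE('k) Op M R P F E (%L x. x)"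
unfolding free_unital_pmodule_on_def
 proof (intro conjI ballI allI impI)
 show "rmod R (E L)" if "L : MObj M" for L
unfolding E_def by (rule submodule_module[OF F.mval[OF that] sub[OF that]])
 show "mlinear R (E L) (MVal F L) (%x. x)" if "L : MObj M" for L
unfolding E_def by (rule mlinear_sub_source[OF lin_id Ssub[OF that]])
 qed (use F in blast, use ex in blast, use un in blast)
 thus ?thesis unfolding free_unital_pmodule_def by blast
qed

text \<open>An augmented complex of modules over the operad with contraction \<open>h0\<close>,
  \<open>h\<close>. The contraction is only linear, whereas \<open>d\<close> and \<open>e\<close>
  commute with the action. That \<open>d\<close> squares to zero is not assumed; it is derived from
  the contraction identities by checking on images of \<open>h\<close>, which generate.\<close>

locale bar_resolution = N: unital_pmodule Op M R P N
 for Op :: "('o, 'm) opcat" and M :: "('l, 'a, 'o, 'm) opmod" and R :: "'r ring"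
and P :: "('o, 'm, 'r, 'v) operad" and N :: "('l, 'a, 'r, 'v, 'w) pmodule" +
 fixes kk :: "'k itself" and K :: "nat => 'l => ('r, 'x) module" and ac :: "nat => 'a => 'x => 'v => 'x"
and h0 :: "'l => 'w => 'x" and h :: "nat => 'l => 'x => 'x"
and d :: "nat => 'l => 'x => 'x" and e :: "'l => 'x => 'w"
 assumes F: "unital_pmodule Op M R P \<lparr>MVal = K n, Act = ac n\<rparr>"
and d_hom: "pmodule_hom M R P \<lparr>MVal = K (Suc n), Act = ac (Suc n)\<rparr> \<lparr>MVal = K n, Act = ac n\<rparr> (d (Suc n))"
and e_hom: "pmodule_hom M R P \<lparr>MVal = K 0, Act = ac 0\<rparr> N e"
and h0_lin: "L : MObj M ==> mlinear R (MVal N L) (K 0 L) (h0 L)"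
and h_lin: "L : MObj M ==> mlinear R (K n L) (K (Suc n) L) (h n L)"
and e_h0: "L : MObj M ==> y : cr (MVal N L) ==> e L (h0 L y) = y"
and d_h0: "L : MObj M ==> x : cr (K 0 L) ==>
 d (Suc 0) L (h 0 L x) = x \<ominus>\<^bsub>K 0 L\<^esub> h0 L (e L x)"
and d_h: "L : MObj M ==> x : cr (K (Suc n) L) ==>
 d (Suc (Suc n)) L (h (Suc n) L x) = x \<ominus>\<^bsub>K (Suc n) L\<^esub> h n L (d (Suc n) L x)"
and gen0: "L : MObj M ==> spans R (K 0 L)
 (act_span M P \<lparr>MVal = K 0, Act = ac 0\<rparr> (%L. h0 L ` cr (MVal N L)) L)"
and gen: "L : MObj M ==> spans R (K (Suc n) L)
 (act_span M P \<lparr>MVal = K (Suc n), Act = ac (Suc n)\<rparr> (%L. h n L ` cr (K n L)) L)"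
and free0: "free_along kk Op M R P \<lparr>MVal = K 0, Act = ac 0\<rparr> (MVal N) h0"
and free: "free_along kk Op M R P \<lparr>MVal = K (Suc n), Act = ac (Suc n)\<rparr> (K n) (h n)"
begin

lemma K_mod: "L : MObj M ==> rmod R (K n L)"
using unital_pmodule.mval[OF F[of n]] by simp

lemma ac_bil: "al : MArr M ==> mbilinear R (K n (MFib M al)) (Val P (Tgt M al)) (K n (Src M al)) (ac n al)"
using unital_pmodule.act_arr[OF F[of n]] by simp

lemma d_lin: "L : MObj M ==> mlinear R (K (Suc n) L) (K n L) (d (Suc n) L)"
using pmodule_homD(1)[OF d_hom] by simp

lemma d_ac: "al : MArr M ==> x : cr (K (Suc n) (MFib M al)) ==> p : cr (Val P (Tgt M al)) ==>
 d (Suc n) (Src M al) (ac (Suc n) al x p) = ac n al (d (Suc n) (MFib M al) x) p"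
using pmodule_homD(2)[OF d_hom] by simp

lemma e_lin: "L : MObj M ==> mlinear R (K 0 L) (MVal N L) (e L)"
using pmodule_homD(1)[OF e_hom] by simp

lemma e_ac: "al : MArr M ==> x : cr (K 0 (MFib M al)) ==> p : cr (Val P (Tgt M al)) ==>
 e (Src M al) (ac 0 al x p) = Act N al (e (MFib M al) x) p"
using pmodule_homD(2)[OF e_hom] by simp

text \<open>All identities between linear maps that commute with the action are checked on \<open>h y\<close>.\<close>

lemma K_induct:
 assumes L: "L : MObj M" and N: "!!L. L : MObj M ==> submodule (V L) R (K (Suc n) L)"
and V: "!!al x p. al : MArr M ==> x : V (MFib M al) ==> p : cr (Val P (Tgt M al)) ==>
 ac (Suc n) al x p : V (Src M al)"
and h: "!!L y. L : MObj M ==> y : cr (K n L) ==> h n L y : V L"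
and x: "x : cr (K (Suc n) L)"
 shows "x : V L"
by (rule spansD[OF gen[OF L] N[OF L] _ x]) (use V h N.mfib in "force simp: act_span_def")

lemma K_induct0:
 assumes L: "L : MObj M" and N: "!!L. L : MObj M ==> submodule (V L) R (K 0 L)"
and V: "!!al x p. al : MArr M ==> x : V (MFib M al) ==> p : cr (Val P (Tgt M al)) ==>
 ac 0 al x p : V (Src M al)"
and h: "!!L y. L : MObj M ==> y : cr (MVal N L) ==> h0 L y : V L"
and x: "x : cr (K 0 L)"
 shows "x : V L"
by (rule spansD[OF gen0[OF L] N[OF L] _ x]) (use V h N.mfib in "force simp: act_span_def")

lemma ac_zero: "al : MArr M ==> p : cr (Val P (Tgt M al)) ==>
 ac n al \<zero>\<^bsub>K n (MFib M al)\<^esub> p = \<zero>\<^bsub>K n (Src M al)\<^esub>"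
using lin_zero[OF K_mod[OF N.mfib] K_mod[OF N.src] bilinD(2)[OF ac_bil]] by blast

lemma Act_zero: "al : MArr M ==> p : cr (Val P (Tgt M al)) ==>
 Act N al \<zero>\<^bsub>MVal N (MFib M al)\<^esub> p = \<zero>\<^bsub>MVal N (Src M al)\<^esub>"
using lin_zero[OF N.mval[OF N.mfib] N.mval[OF N.src] bilinD(2)[OF N.act_arr]] by blast

text \<open>On a generator, \<open>e (d (h y)) = e y - e (h0 (e y)) = 0\<close>.\<close>

lemma e_d: "L : MObj M ==> x : cr (K (Suc 0) L) ==> e L (d (Suc 0) L x) = \<zero>\<^bsub>MVal N L\<^esub>"
proof -
 let ?V = "%L. {x : cr (K (Suc 0) L). e L (d (Suc 0) L x) = \<zero>\<^bsub>MVal N L\<^esub>}"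
 assume L: "L : MObj M" and x: "x : cr (K (Suc 0) L)"
 have "x : ?V L"
 proof (rule K_induct[OF L _ _ _ x])
 show "submodule (?V L) R (K (Suc 0) L)" if "L : MObj M" for L
by (rule submodule_kernel[OF K_mod N.mval lin_comp[OF d_lin e_lin]]) (fact that)+
 show "ac (Suc 0) al x p : ?V (Src M al)"
 if "al : MArr M" "x : ?V (MFib M al)" "p : cr (Val P (Tgt M al))" for al x p
using that lin_in[OF d_lin[OF N.mfib]] lin_in[OF bilinD(2)[OF ac_bil]]
by (simp add: d_ac e_ac Act_zero)
 show "h 0 L y : ?V L" if L: "L : MObj M" and y: "y : cr (K 0 L)" for L y
 proof -
 have ey: "e L y : cr (MVal N L)" using lin_in[OF e_lin[OF L] y] .
 thus ?thesis
using lin_in[OF h_lin[OF L] y] lin_in[OF h0_lin[OF L] ey] y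
by (simp add: d_h0[OF L y] mlinear_minus[OF K_mod[OF L] N.mval[OF L] e_lin[OF L]] e_h0[OF L]
 minus_simps(2)[OF N.mval[OF L]])
 qed
 qed
 thus ?thesis by simp
qed

text \<open>On a generator, \<open>d (d (h y)) = d y - d (h (d y)) = h (d (d y))\<close>, which
  vanishes by induction on the degree. At the bottom \<open>h0 (e (d y))\<close> takes its place and
  \<open>e_d\<close> applies.\<close>

lemma d_d: "L : MObj M ==> x : cr (K (Suc (Suc n)) L) ==>
 d (Suc n) L (d (Suc (Suc n)) L x) = \<zero>\<^bsub>K n L\<^esub>"
proof (induction n arbitrary: L x)
 case (0 L x)
 let ?V = "%L. {x : cr (K (Suc (Suc 0)) L). d (Suc 0) L (d (Suc (Suc 0)) L x) = \<zero>\<^bsub>K 0 L\<^esub>}"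
 have "x : ?V L"
 proof (rule K_induct[OF 0(1) _ _ _ 0(2)])
 show "submodule (?V L) R (K (Suc (Suc 0)) L)" if "L : MObj M" for L
by (rule submodule_kernel[OF K_mod K_mod lin_comp[OF d_lin d_lin]]) (fact that)+
 show "ac (Suc (Suc 0)) al x p : ?V (Src M al)"
 if "al : MArr M" "x : ?V (MFib M al)" "p : cr (Val P (Tgt M al))" for al x p
using that lin_in[OF d_lin[OF N.mfib]] lin_in[OF bilinD(2)[OF ac_bil]]
by (simp add: d_ac ac_zero)
 show "h (Suc 0) L y : ?V L" if L: "L : MObj M" and y: "y : cr (K (Suc 0) L)" for L y
 proof -
 have dy: "d (Suc 0) L y : cr (K 0 L)" using lin_in[OF d_lin[OF L] y] .
 have "h0 L (e L (d (Suc 0) L y)) = \<zero>\<^bsub>K 0 L\<^esub>"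
using lin_zero[OF N.mval[OF L] K_mod[OF L] h0_lin[OF L]] by (simp add: e_d[OF L y])
 hence "d (Suc 0) L (h 0 L (d (Suc 0) L y)) = d (Suc 0) L y"
using dy by (simp add: d_h0[OF L dy] minus_simps(1)[OF K_mod[OF L]])
 thus ?thesis
using lin_in[OF h_lin[OF L] y] lin_in[OF h_lin[OF L] dy] y dy
by (simp add: d_h[OF L y] mlinear_minus[OF K_mod[OF L] K_mod[OF L] d_lin[OF L]]
 minus_simps(2)[OF K_mod[OF L]])
 qed
 qed
 thus ?case by simp
next
 case (Suc n L x)
 let ?V = "%L. {x : cr (K (Suc (Suc (Suc n))) L).
 d (Suc (Suc n)) L (d (Suc (Suc (Suc n))) L x) = \<zero>\<^bsub>K (Suc n) L\<^esub>}"
 have "x : ?V L"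
 proof (rule K_induct[OF Suc(2) _ _ _ Suc(3)])
 show "submodule (?V L) R (K (Suc (Suc (Suc n))) L)" if "L : MObj M" for L
by (rule submodule_kernel[OF K_mod K_mod lin_comp[OF d_lin d_lin]]) (fact that)+
 show "ac (Suc (Suc (Suc n))) al x p : ?V (Src M al)"
 if "al : MArr M" "x : ?V (MFib M al)" "p : cr (Val P (Tgt M al))" for al x p
using that lin_in[OF d_lin[OF N.mfib]] lin_in[OF bilinD(2)[OF ac_bil]]
by (simp add: d_ac ac_zero)
 show "h (Suc (Suc n)) L y : ?V L" if L: "L : MObj M" and y: "y : cr (K (Suc (Suc n)) L)" for L y
 proof -
 have dy: "d (Suc (Suc n)) L y : cr (K (Suc n) L)" using lin_in[OF d_lin[OF L] y] .
 have "h n L (d (Suc n) L (d (Suc (Suc n)) L y)) = \<zero>\<^bsub>K (Suc n) L\<^esub>"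
using lin_zero[OF K_mod[OF L] K_mod[OF L] h_lin[OF L]] by (simp add: Suc.IH[OF L y])
 hence "d (Suc (Suc n)) L (h (Suc n) L (d (Suc (Suc n)) L y)) = d (Suc (Suc n)) L y"
using dy by (simp add: d_h[OF L dy] minus_simps(1)[OF K_mod[OF L]])
 thus ?thesis
using lin_in[OF h_lin[OF L] y] lin_in[OF h_lin[OF L] dy] y dy
by (simp add: d_h[OF L y] mlinear_minus[OF K_mod[OF L] K_mod[OF L] d_lin[OF L]]
 minus_simps(2)[OF K_mod[OF L]])
 qed
 qed
 thus ?case by simp
qed

lemma exact_N: "L : MObj M ==> e L ` cr (K 0 L) = cr (MVal N L)"
using e_h0 lin_in[OF e_lin] lin_in[OF h0_lin] by (force simp: image_iff)

text \<open>On a cycle the contraction identity reads \<open>d (h x) = x\<close>.\<close>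

lemma exact_0:
 assumes L: "L : MObj M"
 shows "d (Suc 0) L ` cr (K (Suc 0) L) = {x : cr (K 0 L). e L x = \<zero>\<^bsub>MVal N L\<^esub>}"
proof (intro subset_antisym subsetI)
 show "x : {x : cr (K 0 L). e L x = \<zero>\<^bsub>MVal N L\<^esub>}" if "x : d (Suc 0) L ` cr (K (Suc 0) L)" for x
using that e_d[OF L] lin_in[OF d_lin[OF L]] by auto
 fix x assume x: "x : {x : cr (K 0 L). e L x = \<zero>\<^bsub>MVal N L\<^esub>}"
 hence "d (Suc 0) L (h 0 L x) = x"
by (simp add: d_h0[OF L] lin_zero[OF N.mval[OF L] K_mod[OF L] h0_lin[OF L]] minus_simps(1)[OF K_mod[OF L]])
 moreover have "h 0 L x : cr (K (Suc 0) L)" using x lin_in[OF h_lin[OF L]] by simp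
 ultimately show "x : d (Suc 0) L ` cr (K (Suc 0) L)" by (metis image_eqI)
qed

lemma exact_Suc:
 assumes L: "L : MObj M"
 shows "d (Suc (Suc n)) L ` cr (K (Suc (Suc n)) L) = {x : cr (K (Suc n) L). d (Suc n) L x = \<zero>\<^bsub>K n L\<^esub>}"
proof (intro subset_antisym subsetI)
 show "x : {x : cr (K (Suc n) L). d (Suc n) L x = \<zero>\<^bsub>K n L\<^esub>}"
 if "x : d (Suc (Suc n)) L ` cr (K (Suc (Suc n)) L)" for x
using that d_d[OF L] lin_in[OF d_lin[OF L]] by auto
 fix x assume x: "x : {x : cr (K (Suc n) L). d (Suc n) L x = \<zero>\<^bsub>K n L\<^esub>}"
 hence "d (Suc (Suc n)) L (h (Suc n) L x) = x"
by (simp add: d_h[OF L] lin_zero[OF K_mod[OF L] K_mod[OF L] h_lin[OF L]] minus_simps(1)[OF K_mod[OF L]])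
 moreover have "h (Suc n) L x : cr (K (Suc (Suc n)) L)" using x lin_in[OF h_lin[OF L]] by simp
 ultimately show "x : d (Suc (Suc n)) L ` cr (K (Suc (Suc n)) L)" by (metis image_eqI)
qed

lemma free_K: "free_unital_pmodule (kk :: 'k itself) Op M R P \<lparr>MVal = K n, Act = ac n\<rparr>"
proof -
 have "free_unital_pmodule TYPE('k) Op M R P \<lparr>MVal = K n, Act = ac n\<rparr>"
 proof (cases n)
 case 0
 show ?thesis unfolding 0
by (rule free_unital_pmoduleI[OF F, where Y = "MVal N" and j = h0])
 (use N.mval h0_lin gen0 free0 in "auto simp: free_along_def")
 next
 case (Suc m)
 show ?thesis unfolding Suc
by (rule free_unital_pmoduleI[OF F, where Y = "K m" and j = "h m"])
 (use K_mod h_lin gen free in "auto simp: free_along_def")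
 qed
 thus ?thesis by (simp add: free_unital_pmodule_def free_unital_pmodule_on_def)
qed

theorem free_acyclic: "free_acyclic_resolution (kk :: 'k itself) Op M R P N K d e"
unfolding free_acyclic_resolution_def
proof (intro conjI exI[of _ ac] ballI allI)
 show "let F = %n. \<lparr>MVal = K n, Act = ac n\<rparr> in
 (ALL n. free_unital_pmodule kk Op M R P (F n)) \<and>
 (ALL n. pmodule_hom M R P (F (Suc n)) (F n) (d (Suc n))) & pmodule_hom M R P (F 0) N e"
using free_K d_hom e_hom by (simp add: Let_def)
 fix L assume L: "L : MObj M"
 show "exact_at (K 0 L) (e L) (MVal N L) (%_. ()) (zero_module :: ('r, unit) module)"
using exact_N[OF L] by (simp add: exact_at_def zero_module_def)
 show "exact_at (K 1 L) (d 1 L) (K 0 L) (e L) (MVal N L)"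
using exact_0[OF L] by (simp add: exact_at_def)
 show "exact_at (K (n + 2) L) (d (n + 2) L) (K (n + 1) L) (d (n + 1) L) (K n L)" for n
using exact_Suc[OF L, of n] by (simp add: exact_at_def numeral_2_eq_2)
qed (rule N.unital_pmodule_axioms)

theorem H0: "L : MObj M ==>
 module_iso R (homology_at (K 1 L) (d 1 L) (K 0 L) (%_. ()) zero_module) (MVal N L)"
using exact_0 exact_N d_lin[of _ 0]
by (intro homology_at_cokernel[OF K_mod K_mod N.mval, where g = "e L"]) (auto simp: e_lin)

end

section \<open>Passage to the quotient by degenerate elements\<close>

lemma mquot_map_lin:
 assumes A: "rmod R A" and B: "rmod R B" and N: "submodule N R A" and V: "submodule V R B"
and f: "mlinear R A B f" and NV: "!!x. x : N ==> f x : V"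
 shows "mlinear R (mquot A N) (mquot B V) (mquot_map B V f)"
proof -
 interpret A: Module.module R A by fact
 note [simp] = mquot_map_proj[OF A B N V f NV] carrier_mquot[OF A N] carrier_mquot[OF B V]
 add_mquot[OF A N] add_mquot[OF B V] smult_mquot[OF A N] smult_mquot[OF B V] lin_in[OF f]
 show ?thesis by (rule mlinearI) (auto simp: lin_add[OF f] lin_smult[OF f])
qed

lemma mproj_zero_submodule:
 assumes A: "rmod R A" and x: "x : cr A"
 shows "mproj A {\<zero>\<^bsub>A\<^esub>} x = {x}"
proof -
 interpret A: Module.module R A by fact
 show ?thesis using x by (simp add: mproj_def a_r_coset_def')
qed

text \<open>Since \<open>h\<close> is a degeneracy in front of \<open>s_0\<close>, these are the
  degeneracy relations \<open>s_{j+1} h = h s_j\<close> and \<open>s_0 h = h h\<close>, plus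
  compatibility with the action. No relation between \<open>d\<close> and \<open>s\<close> is
  assumed: on generators it follows from the contraction identities.\<close>

locale normalized_bar_resolution = bar_resolution Op M R P N kk K ac h0 h d e
 for Op :: "('o, 'm) opcat" and M :: "('l, 'a, 'o, 'm) opmod" and R :: "'r ring"
and P :: "('o, 'm, 'r, 'v) operad" and N :: "('l, 'a, 'r, 'v, 'w) pmodule"
and kk :: "'k itself" and K :: "nat => 'l => ('r, 'x) module" and ac :: "nat => 'a => 'x => 'v => 'x"
and h0 :: "'l => 'w => 'x" and h :: "nat => 'l => 'x => 'x"
and d :: "nat => 'l => 'x => 'x" and e :: "'l => 'x => 'w" +
 fixes s :: "nat => 'l => nat => 'x => 'x"
 assumes s_lin: "L : MObj M ==> j \<le> n ==> mlinear R (K n L) (K (Suc n) L) (s n L j)"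
and s_ac: "al : MArr M ==> x : cr (K n (MFib M al)) ==> p : cr (Val P (Tgt M al)) ==> j \<le> n ==>
 s n (Src M al) j (ac n al x p) = ac (Suc n) al (s n (MFib M al) j x) p"
and s_h: "L : MObj M ==> x : cr (K n L) ==> j \<le> n ==>
 s (Suc n) L (Suc j) (h n L x) = h (Suc n) L (s n L j x)"
and s0_h: "L : MObj M ==> x : cr (K n L) ==> s (Suc n) L 0 (h n L x) = h (Suc n) L (h n L x)"
and s0_h0: "L : MObj M ==> y : cr (MVal N L) ==> s 0 L 0 (h0 L y) = h 0 L (h0 L y)"
begin

definition D :: "nat => 'l => 'x set" where
 "D n L = mspan R (K n L) (\<Union>j<n. s (n - 1) L j ` cr (K (n - 1) L))"

definition Q :: "nat => 'l => ('r, 'x set) module" where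
 "Q n L = mquot (K n L) (D n L)"

abbreviation \<pi> :: "nat => 'l => 'x => 'x set" where
 "\<pi> n L == mproj (K n L) (D n L)"

definition qac :: "nat => 'a => 'x set => 'v => 'x set" where
 "qac n al X p = mquot_map (K n (Src M al)) (D n (Src M al)) (%x. ac n al x p) X"

definition qd :: "nat => 'l => 'x set => 'x set" where
 "qd n L = mquot_map (K (n - 1) L) (D (n - 1) L) (d n L)"

definition qh :: "nat => 'l => 'x set => 'x set" where
 "qh n L = mquot_map (K (Suc n) L) (D (Suc n) L) (h n L)"

definition qh0 :: "'l => 'w => 'x set" where
 "qh0 L y = \<pi> 0 L (h0 L y)"

definition qe :: "'l => 'x set => 'w" where
 "qe L X = the_elem (e L ` X)"

lemma D_gens: "L : MObj M ==> (\<Union>j<n. s (n - 1) L j ` cr (K (n - 1) L)) \<subseteq> cr (K n L)"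
using lin_in[OF s_lin[of L _ "n - 1"]] by (cases n) fastforce+

lemma D_sub: "L : MObj M ==> submodule (D n L) R (K n L)"
unfolding D_def by (rule submodule_mspan[OF K_mod D_gens])

lemma D_carrier: "L : MObj M ==> x : D n L ==> x : cr (K n L)"
using submodule_subset[OF D_sub] by blast

lemma s_in_D: "j \<le> n ==> x : cr (K n L) ==> s n L j x : D (Suc n) L"
unfolding D_def by (rule subsetD[OF mspan_superset]) auto

lemma D_0: "L : MObj M ==> D 0 L = {\<zero>\<^bsub>K 0 L\<^esub>}"
using mspan_least[OF submodule_singleton_zero[OF K_mod[of L 0]], of "{}"] submodule_zero[OF K_mod D_sub, of L 0]
by (auto simp: D_def)

text \<open>A linear map sends \<open>D (Suc n)\<close> into a submodule \<open>V\<close> if it does so with the degeneracies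
 of generators \<open>ac z p\<close>, where \<open>z\<close> is in the image of the extra degeneracy.\<close>

lemma D_Suc_into:
 assumes L: "L : MObj M" and B: "rmod R B" and f: "mlinear R (K (Suc n) L) B f" and V: "submodule V R B"
and fs: "!!j x. j \<le> n ==> x : cr (K n L) ==> f (s n L j x) : V"
and x: "x : D (Suc n) L"
 shows "f x : V"
proof -
 have "D (Suc n) L \<subseteq> {x : cr (K (Suc n) L). f x : V}"
unfolding D_def
by (rule mspan_least[OF submodule_preimage[OF K_mod[OF L] B f V]])
 (use fs lin_in[OF s_lin[OF L]] in "auto simp: less_Suc_eq_le")
 thus ?thesis using x by blast
qed

lemma D_ac:
 assumes a: "al : MArr M" and x: "x : D n (MFib M al)" and p: "p : cr (Val P (Tgt M al))"
 shows "ac n al x p : D n (Src M al)"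
proof (cases n)
 case 0
 thus ?thesis using x a p by (simp add: D_0 N.mfib N.src ac_zero)
next
 case (Suc m)
 show ?thesis unfolding Suc
by (rule D_Suc_into[OF N.mfib[OF a] K_mod[OF N.src[OF a]] bilinD(2)[OF ac_bil[OF a] p] D_sub[OF N.src[OF a]]])
 (use x a p Suc s_in_D lin_in[OF bilinD(2)[OF ac_bil[OF a] p]] in "auto simp: s_ac[symmetric]")
qed

lemma D_h:
 assumes L: "L : MObj M" and x: "x : D n L"
 shows "h n L x : D (Suc n) L"
proof (cases n)
 case 0
 thus ?thesis
using x by (simp add: D_0[OF L] lin_zero[OF K_mod[OF L] K_mod[OF L] h_lin[OF L]] submodule_zero[OF K_mod[OF L] D_sub[OF L]])
next
 case (Suc m)
 show ?thesis unfolding Suc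
by (rule D_Suc_into[OF L K_mod[OF L] h_lin[OF L] D_sub[OF L]])
 (use x Suc L s_in_D lin_in[OF h_lin[OF L]] in "auto simp: s_h[symmetric]")
qed

text \<open>\<open>h h\<close> equals \<open>s_0 h\<close>, so on the quotient the contraction
  squares to zero.\<close>

lemma hh_in_D: "L : MObj M ==> y : cr (K n L) ==> h (Suc n) L (h n L y) : D (Suc (Suc n)) L"
using s_in_D[of 0 "Suc n" "h n L y" L] lin_in[OF h_lin] by (simp add: s0_h)

lemma hh0_in_D: "L : MObj M ==> y : cr (MVal N L) ==> h 0 L (h0 L y) : D (Suc 0) L"
using s_in_D[of 0 0 "h0 L y" L] lin_in[OF h0_lin] by (simp add: s0_h0)

text \<open>Induction on the degree, checked on generators \<open>h y\<close>. For
  \<open>j = i + 1\<close>, \<open>d (s_j (h y)) = d (h (s_i y)) = s_i y - h (d (s_i y))\<close>,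
  where the second term is degenerate by induction and \<open>D_h\<close>. For \<open>j = 0\<close>,
  \<open>d (h (h y)) = h y - h (y - h (d y)) = h (h (d y))\<close>, which is degenerate by
  \<open>hh_in_D\<close>; in degree zero \<open>h0 (e y)\<close> replaces
  \<open>h (d y)\<close>.\<close>

lemma d_s:
 assumes L: "L : MObj M" and x: "x : cr (K n L)" and j: "j \<le> n"
 shows "d (Suc n) L (s n L j x) : D n L"
using assms
proof (induction n arbitrary: L x j)
 case (0 L x j)
 let ?V = "%L. {x : cr (K 0 L). d (Suc 0) L (s 0 L 0 x) : D 0 L}"
 have "x : ?V L"
 proof (rule K_induct0[OF 0(1) _ _ _ 0(2)])
 show "submodule (?V L) R (K 0 L)" if "L : MObj M" for L
by (rule submodule_preimage[OF K_mod K_mod lin_comp[OF s_lin d_lin] D_sub]) (use that in auto)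
 show "ac 0 al x p : ?V (Src M al)"
 if "al : MArr M" "x : ?V (MFib M al)" "p : cr (Val P (Tgt M al))" for al x p
using that lin_in[OF s_lin[OF N.mfib]] lin_in[OF bilinD(2)[OF ac_bil]]
by (simp add: s_ac d_ac D_ac)
 show "h0 L y : ?V L" if L: "L : MObj M" and y: "y : cr (MVal N L)" for L y
using lin_in[OF h0_lin[OF L] y]
by (simp add: s0_h0[OF L y] d_h0[OF L] e_h0[OF L y] D_0[OF L] minus_simps(2)[OF K_mod[OF L]])
 qed
 thus ?case using 0(3) by simp
next
 case (Suc n L x j)
 let ?V = "%L. {x : cr (K (Suc n) L). d (Suc (Suc n)) L (s (Suc n) L j x) : D (Suc n) L}"
 have "x : ?V L"
 proof (rule K_induct[OF Suc.prems(1) _ _ _ Suc.prems(2)])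
 show "submodule (?V L) R (K (Suc n) L)" if "L : MObj M" for L
by (rule submodule_preimage[OF K_mod K_mod lin_comp[OF s_lin d_lin] D_sub]) (use that Suc.prems(3) in auto)
 show "ac (Suc n) al x p : ?V (Src M al)"
 if "al : MArr M" "x : ?V (MFib M al)" "p : cr (Val P (Tgt M al))" for al x p
using that Suc.prems(3) lin_in[OF s_lin[OF N.mfib]] lin_in[OF bilinD(2)[OF ac_bil]]
by (simp add: s_ac d_ac D_ac)
 fix L y assume L: "L : MObj M" and y: "y : cr (K n L)"
 note hy = lin_in[OF h_lin[OF L] y]
 have "d (Suc (Suc n)) L (s (Suc n) L j (h n L y)) : D (Suc n) L"
 proof (cases j)
 case (Suc i)
 hence i: "i \<le> n" using Suc.prems(3) by simp
 note sy = s_in_D[OF i y]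
 show ?thesis unfolding Suc s_h[OF L y i] d_h[OF L D_carrier[OF L sy]]
by (rule submodule_minus[OF K_mod[OF L] D_sub[OF L] sy D_h[OF L Suc.IH[OF L y i]]])
 next
 case 0
 have "d (Suc (Suc n)) L (s (Suc n) L j (h n L y)) = h n L y \<ominus>\<^bsub>K (Suc n) L\<^esub> h n L (d (Suc n) L (h n L y))"
unfolding 0 s0_h[OF L y] by (rule d_h[OF L hy])
 also have "\<dots> : D (Suc n) L"
 proof (cases n)
 case 0
 have y': "y : cr (K 0 L)" using y 0 by simp
 have ey: "h0 L (e L y) : cr (K 0 L)"
using lin_in[OF h0_lin[OF L]] lin_in[OF e_lin[OF L] y'] by blast
 have "h 0 L (h0 L (e L y)) : D (Suc 0) L"
by (rule hh0_in_D[OF L lin_in[OF e_lin[OF L] y']])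
 thus ?thesis unfolding 0
using y' ey hy 0 lin_in[OF h_lin[OF L] ey]
by (simp add: d_h0[OF L y'] mlinear_minus[OF K_mod[OF L] K_mod[OF L] h_lin[OF L] y' ey]
 minus_simps(5)[OF K_mod[OF L]])
 next
 case (Suc k)
 have y': "y : cr (K (Suc k) L)" using y Suc by simp
 have dy: "d (Suc k) L y : cr (K k L)" using lin_in[OF d_lin[OF L] y'] .
 have hdy: "h k L (d (Suc k) L y) : cr (K (Suc k) L)" using lin_in[OF h_lin[OF L] dy] .
 have "h (Suc k) L (h k L (d (Suc k) L y)) : D (Suc (Suc k)) L" by (rule hh_in_D[OF L dy])
 thus ?thesis unfolding Suc
using y' hdy hy Suc lin_in[OF h_lin[OF L] hdy]
by (simp add: d_h[OF L y'] mlinear_minus[OF K_mod[OF L] K_mod[OF L] h_lin[OF L] y' hdy]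
 minus_simps(5)[OF K_mod[OF L]])
 qed
 finally show ?thesis .
 qed
 thus "h n L y : ?V L" using hy by simp
 qed
 thus ?case by simp
qed

lemma D_d: "L : MObj M ==> x : D (Suc n) L ==> d (Suc n) L x : D n L"
by (rule D_Suc_into[OF _ K_mod d_lin D_sub]) (auto intro: d_s)

lemma Q_mod: "L : MObj M ==> rmod R (Q n L)"
unfolding Q_def by (rule module_mquot[OF K_mod D_sub])

lemma \<pi>_lin: "L : MObj M ==> mlinear R (K n L) (Q n L) (\<pi> n L)"
unfolding Q_def by (rule mlinear_proj[OF K_mod D_sub])

lemma Q_carrier: "L : MObj M ==> cr (Q n L) = \<pi> n L ` cr (K n L)"
unfolding Q_def by (rule carrier_mquot[OF K_mod D_sub])

lemma Q_lift:
 assumes "L : MObj M" "rmod R B" "mlinear R (K n L) B f" "!!x. x : D n L ==> f x = \<zero>\<^bsub>B\<^esub>"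
 obtains g where "mlinear R (Q n L) B g" "!!x. x : cr (K n L) ==> g (\<pi> n L x) = f x"
unfolding Q_def by (rule mquot_lift[OF K_mod[OF assms(1)] D_sub[OF assms(1)] assms(2-4)]) auto

lemma \<pi>_zero: "L : MObj M ==> x : D n L ==> \<pi> n L x = \<zero>\<^bsub>Q n L\<^esub>"
unfolding Q_def using proj_eq_zero_iff[OF K_mod D_sub] D_carrier by blast

lemma qac_\<pi>: "al : MArr M ==> x : cr (K n (MFib M al)) ==> p : cr (Val P (Tgt M al)) ==>
 qac n al (\<pi> n (MFib M al) x) p = \<pi> n (Src M al) (ac n al x p)"
unfolding qac_def
by (rule mquot_map_proj[OF K_mod K_mod D_sub D_sub bilinD(2)[OF ac_bil] D_ac]) (auto simp: N.mfib N.src)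

lemma qd_\<pi>: "L : MObj M ==> x : cr (K (Suc n) L) ==> qd (Suc n) L (\<pi> (Suc n) L x) = \<pi> n L (d (Suc n) L x)"
unfolding qd_def diff_Suc_1
by (rule mquot_map_proj[OF K_mod K_mod D_sub D_sub d_lin D_d]) auto

lemma qh_\<pi>: "L : MObj M ==> x : cr (K n L) ==> qh n L (\<pi> n L x) = \<pi> (Suc n) L (h n L x)"
unfolding qh_def
by (rule mquot_map_proj[OF K_mod K_mod D_sub D_sub h_lin D_h]) auto

lemma qe_\<pi>: "L : MObj M ==> x : cr (K 0 L) ==> qe L (\<pi> 0 L x) = e L x"
using mproj_zero_submodule[OF K_mod, of L x 0] by (simp add: qe_def D_0)

lemma qac_bil:
 assumes a: "al : MArr M"
 shows "mbilinear R (Q n (MFib M al)) (Val P (Tgt M al)) (Q n (Src M al)) (qac n al)"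
unfolding mbilinear_def
proof (intro conjI ballI)
 fix X assume "X : cr (Q n (MFib M al))"
 then obtain x where x: "x : cr (K n (MFib M al))" "X = \<pi> n (MFib M al) x"
by (auto simp: Q_carrier N.mfib[OF a])
 have "mlinear R (Val P (Tgt M al)) (Q n (Src M al)) (%p. \<pi> n (Src M al) (ac n al x p))"
by (rule lin_comp[OF bilinD(1)[OF ac_bil[OF a] x(1)] \<pi>_lin[OF N.src[OF a]]])
 thus "mlinear R (Val P (Tgt M al)) (Q n (Src M al)) (qac n al X)"
using mlinear_cong[OF N.val[OF N.tgt[OF a]], of "qac n al X"] x by (simp add: qac_\<pi>[OF a])
next
 fix p assume p: "p : cr (Val P (Tgt M al))"
 show "mlinear R (Q n (MFib M al)) (Q n (Src M al)) (%X. qac n al X p)"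
unfolding qac_def Q_def
by (rule mquot_map_lin[OF K_mod K_mod D_sub D_sub bilinD(2)[OF ac_bil]])
 (use a p D_ac in "auto simp: N.mfib N.src")
qed

lemma Q_pmodule: "unital_pmodule Op M R P \<lparr>MVal = Q n, Act = qac n\<rparr>"
proof (intro unital_pmodule.intro unital_pmodule_axioms.intro N.unital_operad_axioms N.left_operadic_module_axioms)
 interpret F: unital_pmodule Op M R P "\<lparr>MVal = K n, Act = ac n\<rparr>" by (rule F)
 show "rmod R (MVal \<lparr>MVal = Q n, Act = qac n\<rparr> L)" if "L : MObj M" for L
using Q_mod[OF that] by simp
 show "mbilinear R (MVal \<lparr>MVal = Q n, Act = qac n\<rparr> (MFib M al)) (Val P S)
 (MVal \<lparr>MVal = Q n, Act = qac n\<rparr> L) (Act \<lparr>MVal = Q n, Act = qac n\<rparr> al)" if "al : hom_opmod M L S" for al L S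
using that qac_bil[of al n] by (auto simp: hom_opmod_def)
 show "Act \<lparr>MVal = Q n, Act = qac n\<rparr> al x (Gam P g y z) =
 Act \<lparr>MVal = Q n, Act = qac n\<rparr> (Post M g al) (Act \<lparr>MVal = Q n, Act = qac n\<rparr> (MInd M g al) x y) z"
 if a: "al : hom_opmod M L B" and g: "g : hom_opcat Op B C"
and xyz: "x : cr (MVal \<lparr>MVal = Q n, Act = qac n\<rparr> (MFib M al))"
 "y : cr (Val P (Fib Op g))" "z : cr (Val P C)" for al L B g C x y z
 proof -
 have aa: "al : MArr M" "Src M al = L" "Tgt M al = B" using a by (auto simp: hom_opmod_def)
 have ii: "MInd M g al : MArr M" "Src M (MInd M g al) = MFib M (Post M g al)" "Tgt M (MInd M g al) = Fib Op g"
 "MFib M (MInd M g al) = MFib M al" using N.mind[OF a g] N.mfib_mind[OF a g] by (auto simp: hom_opmod_def)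
 have pp: "Post M g al : MArr M" "Src M (Post M g al) = L" "Tgt M (Post M g al) = C"
using N.post[OF a g] by (auto simp: hom_opmod_def)
 obtain u where u: "u : cr (K n (MFib M al))" "x = \<pi> n (MFib M al) u"
using xyz(1) by (auto simp: Q_carrier N.mfib[OF aa(1)])
 have "Gam P g y z : cr (Val P B)"
using lin_in[OF bilinD(1)[OF N.gam[OF g] xyz(2)] xyz(3)] .
 moreover have "ac n (MInd M g al) u y : cr (K n (MFib M (Post M g al)))"
using lin_in[OF bilinD(1)[OF ac_bil[OF ii(1)]], of u n y] u xyz(2) ii by simp
 ultimately show ?thesis
using u xyz F.act_gam[OF a g, of u y z] qac_\<pi>[OF aa(1) u(1)] qac_\<pi>[OF ii(1), of u n y] qac_\<pi>[OF pp(1)] aa ii pp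
by simp
 qed
 show "Act \<lparr>MVal = Q n, Act = qac n\<rparr> (MInd M (Idn Op T) al) x (Unt P T) = x"
 if a: "al : hom_opmod M L T" and x: "x : cr (MVal \<lparr>MVal = Q n, Act = qac n\<rparr> (MFib M al))" for al L T x
 proof -
 have aa: "al : MArr M" "Tgt M al = T" using a by (auto simp: hom_opmod_def)
 have T: "T : Obj Op" using N.tgt[OF aa(1)] aa(2) by simp
 note g = N.idn[OF T]
 have ii: "MInd M (Idn Op T) al : MArr M" "Src M (MInd M (Idn Op T) al) = MFib M al"
 "Tgt M (MInd M (Idn Op T) al) = Fib Op (Idn Op T)" "MFib M (MInd M (Idn Op T) al) = MFib M al"
using N.mind[OF a g] N.mfib_mind[OF a g] N.post_idn[OF a] by (auto simp: hom_opmod_def)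
 obtain u where u: "u : cr (K n (MFib M al))" "x = \<pi> n (MFib M al) u"
using x by (auto simp: Q_carrier N.mfib[OF aa(1)])
 show ?thesis using F.act_unt[OF a] u qac_\<pi>[OF ii(1), of u n "Unt P T"] N.unt[OF T] ii by simp
 qed
qed

lemma Q_gen:
 assumes L: "L : MObj M" and j: "!!L. L : MObj M ==> S L \<subseteq> cr (K n L)"
and sp: "spans R (K n L) (act_span M P \<lparr>MVal = K n, Act = ac n\<rparr> S L)"
 shows "spans R (Q n L) (act_span M P \<lparr>MVal = Q n, Act = qac n\<rparr> (%L. \<pi> n L ` S L) L)"
proof -
 have "act_span M P \<lparr>MVal = Q n, Act = qac n\<rparr> (%L. \<pi> n L ` S L) L =
 \<pi> n L ` act_span M P \<lparr>MVal = K n, Act = ac n\<rparr> S L"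
 proof (intro subset_antisym subsetI)
 fix X assume "X : act_span M P \<lparr>MVal = Q n, Act = qac n\<rparr> (%L. \<pi> n L ` S L) L"
 then obtain al x p where "al : MArr M" "Src M al = L" "x : S (MFib M al)" "p : cr (Val P (Tgt M al))"
 "X = qac n al (\<pi> n (MFib M al) x) p" by (auto simp: act_span_def)
 moreover from this have "X = \<pi> n L (ac n al x p)" using qac_\<pi> j[OF N.mfib] by blast
 ultimately show "X : \<pi> n L ` act_span M P \<lparr>MVal = K n, Act = ac n\<rparr> S L" by (auto simp: act_span_def)
 next
 fix X assume "X : \<pi> n L ` act_span M P \<lparr>MVal = K n, Act = ac n\<rparr> S L"
 then obtain al x p where "al : MArr M" "Src M al = L" "x : S (MFib M al)" "p : cr (Val P (Tgt M al))"
 "X = \<pi> n L (ac n al x p)" by (auto simp: act_span_def)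
 moreover from this have "X = qac n al (\<pi> n (MFib M al) x) p" using qac_\<pi> j[OF N.mfib] by blast
 ultimately show "X : act_span M P \<lparr>MVal = Q n, Act = qac n\<rparr> (%L. \<pi> n L ` S L) L" by (auto simp: act_span_def)
 qed
 thus ?thesis using spans_mquot[OF K_mod[OF L] D_sub[OF L] sp] by (simp add: Q_def)
qed

lemma Q_hom_lift:
 assumes K': "unital_pmodule Op M R P K'" and f: "pmodule_hom M R P \<lparr>MVal = K n, Act = ac n\<rparr> K' f"
and D: "!!L x. L : MObj M ==> x : D n L ==> f L x = \<zero>\<^bsub>MVal K' L\<^esub>"
 obtains g where "pmodule_hom M R P \<lparr>MVal = Q n, Act = qac n\<rparr> K' g"
 "!!L x. L : MObj M ==> x : cr (K n L) ==> g L (\<pi> n L x) = f L x"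
proof -
 interpret K': unital_pmodule Op M R P K' by fact
 have "EX g. mlinear R (Q n L) (MVal K' L) g & (ALL x:cr (K n L). g (\<pi> n L x) = f L x)"
 if L: "L : MObj M" for L
 proof -
 have "mlinear R (K n L) (MVal K' L) (f L)" using pmodule_homD(1)[OF f L] by simp
 then obtain g where "mlinear R (Q n L) (MVal K' L) g" "!!x. x : cr (K n L) ==> g (\<pi> n L x) = f L x"
using Q_lift[OF L K'.mval[OF L], of n "f L"] D[OF L] by blast
 thus ?thesis by blast
 qed
 then obtain g where g: "!!L. L : MObj M ==> mlinear R (Q n L) (MVal K' L) (g L)"
 "!!L x. L : MObj M ==> x : cr (K n L) ==> g L (\<pi> n L x) = f L x" by metis
 have "pmodule_hom M R P \<lparr>MVal = Q n, Act = qac n\<rparr> K' g"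
unfolding pmodule_hom_def
 proof (intro conjI ballI)
 fix al X p assume a: "al : MArr M" and X: "X : cr (MVal \<lparr>MVal = Q n, Act = qac n\<rparr> (MFib M al))"
and p: "p : cr (Val P (Tgt M al))"
 obtain x where x: "x : cr (K n (MFib M al))" "X = \<pi> n (MFib M al) x"
using X by (auto simp: Q_carrier N.mfib[OF a])
 show "g (Src M al) (Act \<lparr>MVal = Q n, Act = qac n\<rparr> al X p) = Act K' al (g (MFib M al) X) p"
using pmodule_homD(2)[OF f a, of x p] x p lin_in[OF bilinD(2)[OF ac_bil[OF a] p] x(1)]
by (simp add: qac_\<pi>[OF a] g(2) N.src[OF a] N.mfib[OF a])
 qed (use g(1) in simp)
 with g(2) show thesis by (rule that[rotated])
qed

text \<open>Degenerate elements are spanned by degeneracies of elements \<open>h y\<close> acted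
  upon, and \<open>s_j (h y)\<close> is \<open>h (h y)\<close> or \<open>h (s_i y)\<close>. A
  homomorphism is thus controlled on \<open>D\<close> by its values on these few kinds of
  elements.\<close>

lemma D_induct:
 assumes hom: "pmodule_hom M R P \<lparr>MVal = K (Suc n), Act = ac (Suc n)\<rparr> K' f"
and K': "unital_pmodule Op M R P K'"
and z: "!!L y. L : MObj M ==> n = 0 ==> y : cr (MVal N L) ==> f L (h 0 L (h0 L y)) = \<zero>\<^bsub>MVal K' L\<^esub>"
 "!!L m y. L : MObj M ==> n = Suc m ==> y : cr (K m L) ==> f L (h n L (h m L y)) = \<zero>\<^bsub>MVal K' L\<^esub>"
 "!!L j m y. L : MObj M ==> n = Suc m ==> j \<le> m ==> y : cr (K m L) ==> f L (h n L (s m L j y)) = \<zero>\<^bsub>MVal K' L\<^esub>"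
and L: "L : MObj M" and x: "x : D (Suc n) L"
 shows "f L x = \<zero>\<^bsub>MVal K' L\<^esub>"
proof -
 interpret K': unital_pmodule Op M R P K' by fact
 have f_lin: "mlinear R (K (Suc n) L) (MVal K' L) (f L)" if "L : MObj M" for L using pmodule_homD(1)[OF hom that] by simp
 have fs: "f L (s n L j x) = \<zero>\<^bsub>MVal K' L\<^esub>" if j: "j \<le> n" and L: "L : MObj M" and x: "x : cr (K n L)" for L j x
 proof -
 let ?V = "%L. {x : cr (K n L). f L (s n L j x) = \<zero>\<^bsub>MVal K' L\<^esub>}"
 have sub: "submodule (?V L) R (K n L)" if "L : MObj M" for L
by (rule submodule_kernel[OF K_mod K'.mval lin_comp[OF s_lin f_lin]]) (use that j in auto)
 have act: "ac n al x p : ?V (Src M al)"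
 if a: "al : MArr M" and x: "x : ?V (MFib M al)" and p: "p : cr (Val P (Tgt M al))" for al x p
 proof -
 have "Act K' al \<zero>\<^bsub>MVal K' (MFib M al)\<^esub> p = \<zero>\<^bsub>MVal K' (Src M al)\<^esub>"
using lin_zero[OF K'.mval[OF N.mfib[OF a]] K'.mval[OF N.src[OF a]] bilinD(2)[OF K'.act_arr[OF a] p]] .
 thus ?thesis
using x pmodule_homD(2)[OF hom a, of "s n (MFib M al) j x" p] p lin_in[OF s_lin[OF N.mfib[OF a] j]]
 lin_in[OF bilinD(2)[OF ac_bil[OF a] p]]
by (simp add: s_ac[OF a _ p j])
 qed
 have "x : ?V L"
 proof (cases n)
 case 0
 show ?thesis
by (rule K_induct0[OF L, where V = ?V])
 (use x sub act z(1) j 0 s0_h0 lin_in[OF h0_lin] in simp_all)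
 next
 case (Suc m)
 show ?thesis unfolding Suc
 proof (rule K_induct[OF L, where V = "%L. {x : cr (K (Suc m) L). f L (s (Suc m) L j x) = \<zero>\<^bsub>MVal K' L\<^esub>}"])
 fix L y assume L: "L : MObj M" and y: "y : cr (K m L)"
 have "f L (s (Suc m) L j (h m L y)) = \<zero>\<^bsub>MVal K' L\<^esub>"
 proof (cases j)
 case 0 thus ?thesis using z(2)[OF L Suc y] Suc by (simp add: s0_h[OF L y])
 next
 case (Suc i)
 hence "i \<le> m" using j \<open>n = Suc m\<close> by simp
 thus ?thesis using z(3)[OF L \<open>n = Suc m\<close> _ y] \<open>n = Suc m\<close> Suc by (simp add: s_h[OF L y])
 qed
 thus "h m L y : {x : cr (K (Suc m) L). f L (s (Suc m) L j x) = \<zero>\<^bsub>MVal K' L\<^esub>}"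
using lin_in[OF h_lin[OF L] y] by simp
 qed (use x sub act Suc in simp_all)
 qed
 thus ?thesis by simp
 qed
 have "f L x : {\<zero>\<^bsub>MVal K' L\<^esub>}"
by (rule D_Suc_into[OF L K'.mval[OF L] f_lin[OF L] submodule_singleton_zero[OF K'.mval[OF L]] _ x])
 (use fs L in auto)
 thus ?thesis by simp
qed

lemma Q_free0: "free_along kk Op M R P \<lparr>MVal = Q 0, Act = qac 0\<rparr> (MVal N) qh0"
unfolding free_along_def
proof (intro allI impI)
 fix K' :: "('l, 'a, 'r, 'v, 'k) pmodule" and ps
 assume K': "unital_pmodule Op M R P K'" and ps: "ALL L:MObj M. mlinear R (MVal N L) (MVal K' L) (ps L)"
and ker: "ALL L:MObj M. ALL y:cr (MVal N L). qh0 L y = \<zero>\<^bsub>MVal \<lparr>MVal = Q 0, Act = qac 0\<rparr> L\<^esub> --> ps L y = \<zero>\<^bsub>MVal K' L\<^esub>"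
 interpret K': unital_pmodule Op M R P K' by fact
 have "ps L y = \<zero>\<^bsub>MVal K' L\<^esub>" if "L : MObj M" "y : cr (MVal N L)" "h0 L y = \<zero>\<^bsub>K 0 L\<^esub>" for L y
using that ker lin_zero[OF K_mod Q_mod \<pi>_lin, OF that(1) that(1) that(1), of 0] by (simp add: qh0_def)
 then obtain f where f: "pmodule_hom M R P \<lparr>MVal = K 0, Act = ac 0\<rparr> K' f"
 "ALL L:MObj M. ALL y:cr (MVal N L). f L (h0 L y) = ps L y"
using free0[unfolded free_along_def, rule_format, OF K', of ps] ps by auto
 have "f L x = \<zero>\<^bsub>MVal K' L\<^esub>" if "L : MObj M" "x : D 0 L" for L x
using that lin_zero[OF K_mod K'.mval, OF that(1) that(1), of 0 "f L"] pmodule_homD(1)[OF f(1) that(1)] by (simp add: D_0)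
 then obtain g where g: "pmodule_hom M R P \<lparr>MVal = Q 0, Act = qac 0\<rparr> K' g"
 "!!L x. L : MObj M ==> x : cr (K 0 L) ==> g L (\<pi> 0 L x) = f L x" using Q_hom_lift[OF K' f(1)] by blast
 have "ALL L:MObj M. ALL y:cr (MVal N L). g L (qh0 L y) = ps L y"
using f(2) g(2) lin_in[OF h0_lin] by (simp add: qh0_def)
 with g(1) show "EX g. pmodule_hom M R P \<lparr>MVal = Q 0, Act = qac 0\<rparr> K' g \<and>
 (ALL L:MObj M. ALL y:cr (MVal N L). g L (qh0 L y) = ps L y)" by blast
qed

text \<open>A test map on \<open>Q n\<close> is pulled back to \<open>K n\<close> and extended over
  \<open>K (Suc n)\<close> by freeness there. By hypothesis the pulled back map kills every
  \<open>z\<close> with \<open>h z\<close> degenerate. The elements \<open>h0 y\<close>,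
  \<open>h y\<close> and \<open>s_j y\<close> are of this kind, so by \<open>D_induct\<close> the
  extension vanishes on \<open>D\<close> and descends.\<close>

lemma Q_free: "free_along kk Op M R P \<lparr>MVal = Q (Suc n), Act = qac (Suc n)\<rparr> (Q n) (qh n)"
unfolding free_along_def
proof (intro allI impI)
 fix K' :: "('l, 'a, 'r, 'v, 'k) pmodule" and ps
 assume K': "unital_pmodule Op M R P K'" and ps: "ALL L:MObj M. mlinear R (Q n L) (MVal K' L) (ps L)"
and ker: "ALL L:MObj M. ALL y:cr (Q n L). qh n L y = \<zero>\<^bsub>MVal \<lparr>MVal = Q (Suc n), Act = qac (Suc n)\<rparr> L\<^esub> --> ps L y = \<zero>\<^bsub>MVal K' L\<^esub>"
 interpret K': unital_pmodule Op M R P K' by fact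
 define ph where "ph L x = ps L (\<pi> n L x)" for L x
 have ph: "ALL L:MObj M. mlinear R (K n L) (MVal K' L) (ph L)"
unfolding ph_def using lin_comp[OF \<pi>_lin] ps by blast
 have ph0: "ph L x = \<zero>\<^bsub>MVal K' L\<^esub>" if "L : MObj M" "x : cr (K n L)" "h n L x : D (Suc n) L" for L x
using that ker by (auto simp: ph_def Q_carrier qh_\<pi> \<pi>_zero)
 have "ph L y = \<zero>\<^bsub>MVal K' L\<^esub>" if "L : MObj M" "y : cr (K n L)" "h n L y = \<zero>\<^bsub>K (Suc n) L\<^esub>" for L y
using ph0[OF that(1,2)] that(3) submodule_zero[OF K_mod D_sub, OF that(1) that(1)] by simp
 then obtain f where f: "pmodule_hom M R P \<lparr>MVal = K (Suc n), Act = ac (Suc n)\<rparr> K' f"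
 "ALL L:MObj M. ALL y:cr (K n L). f L (h n L y) = ph L y"
using free[of n, unfolded free_along_def, rule_format, OF K', of ph] ph by auto
 have "f L x = \<zero>\<^bsub>MVal K' L\<^esub>" if "L : MObj M" "x : D (Suc n) L" for L x
 proof (rule D_induct[OF f(1) K' _ _ _ that])
 show "f L (h 0 L (h0 L y)) = \<zero>\<^bsub>MVal K' L\<^esub>" if "L : MObj M" "n = 0" "y : cr (MVal N L)" for L y
using f(2) that lin_in[OF h0_lin] ph0 hh0_in_D by simp
 show "f L (h n L (h m L y)) = \<zero>\<^bsub>MVal K' L\<^esub>" if "L : MObj M" "n = Suc m" "y : cr (K m L)" for L m y
using f(2) that lin_in[OF h_lin] ph0 hh_in_D by simp
 show "f L (h n L (s m L j y)) = \<zero>\<^bsub>MVal K' L\<^esub>" if "L : MObj M" "n = Suc m" "j \<le> m" "y : cr (K m L)" for L j m y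
using f(2) that D_carrier ph0 D_h s_in_D by simp
 qed
 then obtain g where g: "pmodule_hom M R P \<lparr>MVal = Q (Suc n), Act = qac (Suc n)\<rparr> K' g"
 "!!L x. L : MObj M ==> x : cr (K (Suc n) L) ==> g L (\<pi> (Suc n) L x) = f L x" using Q_hom_lift[OF K' f(1)] by blast
 have "ALL L:MObj M. ALL y:cr (Q n L). g L (qh n L y) = ps L y"
using f(2) g(2) lin_in[OF h_lin] by (auto simp: Q_carrier qh_\<pi> ph_def)
 with g(1) show "EX g. pmodule_hom M R P \<lparr>MVal = Q (Suc n), Act = qac (Suc n)\<rparr> K' g \<and>
 (ALL L:MObj M. ALL y:cr (Q n L). g L (qh n L y) = ps L y)" by blast
qed

text \<open>All identities are inherited through the surjections \<open>\<pi>\<close>; only freeness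
  used the finer argument of \<open>D_induct\<close>.\<close>

sublocale Q: bar_resolution Op M R P N kk Q qac qh0 qh qd qe
proof (rule bar_resolution.intro, rule N.unital_pmodule_axioms, rule bar_resolution_axioms.intro)
 show "unital_pmodule Op M R P \<lparr>MVal = Q n, Act = qac n\<rparr>" for n by (rule Q_pmodule)
 show "pmodule_hom M R P \<lparr>MVal = Q (Suc n), Act = qac (Suc n)\<rparr> \<lparr>MVal = Q n, Act = qac n\<rparr> (qd (Suc n))" for n
unfolding pmodule_hom_def pmodule.select_convs
 proof (intro conjI ballI)
 show "mlinear R (Q (Suc n) L) (Q n L) (qd (Suc n) L)" if "L : MObj M" for L
unfolding qd_def Q_def diff_Suc_1
by (rule mquot_map_lin[OF K_mod K_mod D_sub D_sub d_lin D_d]) (use that in auto)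
 fix al X p assume a: "al : MArr M" and X: "X : cr (Q (Suc n) (MFib M al))" and p: "p : cr (Val P (Tgt M al))"
 obtain x where x: "x : cr (K (Suc n) (MFib M al))" "X = \<pi> (Suc n) (MFib M al) x"
using X by (auto simp: Q_carrier N.mfib[OF a])
 show "qd (Suc n) (Src M al) (qac (Suc n) al X p) = qac n al (qd (Suc n) (MFib M al) X) p"
using x p lin_in[OF bilinD(2)[OF ac_bil[OF a] p] x(1)] lin_in[OF d_lin[OF N.mfib[OF a]]]
by (simp add: qac_\<pi>[OF a] qd_\<pi> N.src[OF a] N.mfib[OF a] d_ac[OF a])
 qed
 show "pmodule_hom M R P \<lparr>MVal = Q 0, Act = qac 0\<rparr> N qe"
unfolding pmodule_hom_def pmodule.select_convs
 proof (intro conjI ballI)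
 fix L assume L: "L : MObj M"
 have "!!x. x : D 0 L ==> e L x = \<zero>\<^bsub>MVal N L\<^esub>" using lin_zero[OF K_mod[OF L] N.mval[OF L] e_lin[OF L]] by (simp add: D_0[OF L])
 then obtain g where g: "mlinear R (Q 0 L) (MVal N L) g" "!!x. x : cr (K 0 L) ==> g (\<pi> 0 L x) = e L x"
using Q_lift[OF L N.mval[OF L] e_lin[OF L]] by blast
 hence "qe L X = g X" if "X : cr (Q 0 L)" for X
using that by (auto simp: Q_carrier[OF L] qe_\<pi>[OF L])
 thus "mlinear R (Q 0 L) (MVal N L) (qe L)"
using mlinear_cong[OF Q_mod[OF L], of 0 "qe L" g] g(1) by blast
 next
 fix al X p assume a: "al : MArr M" and X: "X : cr (Q 0 (MFib M al))" and p: "p : cr (Val P (Tgt M al))"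
 obtain x where x: "x : cr (K 0 (MFib M al))" "X = \<pi> 0 (MFib M al) x"
using X by (auto simp: Q_carrier N.mfib[OF a])
 show "qe (Src M al) (qac 0 al X p) = Act N al (qe (MFib M al) X) p"
using x p lin_in[OF bilinD(2)[OF ac_bil[OF a] p] x(1)]
by (simp add: qac_\<pi>[OF a] qe_\<pi> N.src[OF a] N.mfib[OF a] e_ac[OF a])
 qed
 fix L assume L: "L : MObj M"
 show "mlinear R (MVal N L) (Q 0 L) (qh0 L)"
unfolding qh0_def by (rule lin_comp[OF h0_lin[OF L] \<pi>_lin[OF L]])
 show "mlinear R (Q n L) (Q (Suc n) L) (qh n L)" for n
unfolding qh_def Q_def
by (rule mquot_map_lin[OF K_mod K_mod D_sub D_sub h_lin D_h]) (use L in auto)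
 show "qe L (qh0 L y) = y" if "y : cr (MVal N L)" for y
using that lin_in[OF h0_lin[OF L]] by (simp add: qh0_def qe_\<pi>[OF L] e_h0[OF L])
 show "qd (Suc 0) L (qh 0 L X) = X \<ominus>\<^bsub>Q 0 L\<^esub> qh0 L (qe L X)" if X: "X : cr (Q 0 L)" for X
 proof -
 obtain x where x: "x : cr (K 0 L)" "X = \<pi> 0 L x" using X by (auto simp: Q_carrier[OF L])
 thus ?thesis
using lin_in[OF h_lin[OF L] x(1)] lin_in[OF h0_lin[OF L] lin_in[OF e_lin[OF L] x(1)]]
by (simp add: qh_\<pi>[OF L] qd_\<pi>[OF L] qe_\<pi>[OF L] qh0_def d_h0[OF L] mlinear_minus[OF K_mod[OF L] Q_mod[OF L] \<pi>_lin[OF L]])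
 qed
 show "qd (Suc (Suc n)) L (qh (Suc n) L X) = X \<ominus>\<^bsub>Q (Suc n) L\<^esub> qh n L (qd (Suc n) L X)"
 if X: "X : cr (Q (Suc n) L)" for n X
 proof -
 obtain x where x: "x : cr (K (Suc n) L)" "X = \<pi> (Suc n) L x" using X by (auto simp: Q_carrier[OF L])
 have dx: "d (Suc n) L x : cr (K n L)" by (rule lin_in[OF d_lin[OF L] x(1)])
 show ?thesis
using x dx lin_in[OF h_lin[OF L] x(1)] lin_in[OF h_lin[OF L] dx]
by (simp add: qh_\<pi>[OF L] qd_\<pi>[OF L] d_h[OF L] mlinear_minus[OF K_mod[OF L] Q_mod[OF L] \<pi>_lin[OF L]])
 qed
 have sub0: "h0 L ` cr (MVal N L) \<subseteq> cr (K 0 L)" if "L : MObj M" for L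
using lin_in[OF h0_lin[OF that]] by auto
 show "spans R (Q 0 L) (act_span M P \<lparr>MVal = Q 0, Act = qac 0\<rparr> (%L. qh0 L ` cr (MVal N L)) L)"
using Q_gen[OF L sub0 gen0[OF L]] by (simp add: image_image qh0_def)
 have sub: "h n L ` cr (K n L) \<subseteq> cr (K (Suc n) L)" if "L : MObj M" for L n
using lin_in[OF h_lin[OF that]] by auto
 \<comment> \<open>The two families of sets are known to agree only at objects of \<open>M\<close>;
   this is enough, because \<open>act_span\<close> evaluates them at fibers.\<close>
 have "act_span M P \<lparr>MVal = Q (Suc n), Act = qac (Suc n)\<rparr> (%L. qh n L ` cr (Q n L)) L =
 act_span M P \<lparr>MVal = Q (Suc n), Act = qac (Suc n)\<rparr> (%L. \<pi> (Suc n) L ` (h n L ` cr (K n L))) L" for n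
 proof -
 have "qh n L ` cr (Q n L) = \<pi> (Suc n) L ` (h n L ` cr (K n L))" if "L : MObj M" for L
using that by (simp add: Q_carrier image_image qh_\<pi> cong: image_cong_simp)
 thus ?thesis unfolding act_span_def using N.mfib by (metis (no_types, lifting))
 qed
 thus "spans R (Q (Suc n) L) (act_span M P \<lparr>MVal = Q (Suc n), Act = qac (Suc n)\<rparr> (%L. qh n L ` cr (Q n L)) L)" for n
using Q_gen[OF L sub gen[OF L]] by simp
qed (rule Q_free0 Q_free)+

end

section \<open>The bar construction over a preorder\<close>

text \<open>The categories of blobs depend on configurations only through the containment relation.
  Keeping the relation abstract separates the bar construction from topology and fields.\<close>

definition pre_cat :: "('c => 'c => bool) => ('c \<times> 'c, 'c \<times> 'c \<times> 'c) opcat" where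
 "pre_cat rel = \<lparr>
 Obj = {(X', X). rel X' X},
 Arr = {(X', X'', X). rel X' X'' & rel X'' X},
 Dom = (%(X', X'', X). (X', X)),
 Cod = (%(X', X'', X). (X'', X)),
 Idn = (%(X', X). (X', X', X)),
 Cmp = (%(X'', Y, X) (X', _, _). (X', Y, X)),
 Fib = (%(X', X'', X). (X', X'')),
 Ind = (%(X'', Y, X) (X', _, _). (X', X'', Y))\<rparr>"

definition pre_mod :: "('c => 'c => bool) => ('c => bool) => ('c, 'c \<times> 'c, 'c \<times> 'c, 'c \<times> 'c \<times> 'c) opmod" where
 "pre_mod rel tp = \<lparr>
 MObj = {X. tp X},
 MArr = {(X', X). tp X' & rel X' X & tp X},
 Src = (%(X', X). X),
 Tgt = (%(X', X). (X', X)),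
 Post = (%(X', X'', X) _. (X'', X)),
 MFib = (%(X', X). X'),
 MInd = (%(X', X'', X) _. (X', X''))\<rparr>"

lemma pre_cat_sel [simp]:
 "(X', X) : Obj (pre_cat rel) \<longleftrightarrow> rel X' X"
 "(X', X'', X) : Arr (pre_cat rel) \<longleftrightarrow> rel X' X'' & rel X'' X"
 "Dom (pre_cat rel) (X', X'', X) = (X', X)" "Cod (pre_cat rel) (X', X'', X) = (X'', X)"
 "Idn (pre_cat rel) (X', X) = (X', X', X)" "Cmp (pre_cat rel) (X'', Y, X) (X', Z, W) = (X', Y, X)"
 "Fib (pre_cat rel) (X', X'', X) = (X', X'')" "Ind (pre_cat rel) (X'', Y, X) (X', Z, W) = (X', X'', Y)"
by (auto simp: pre_cat_def)

lemma pre_mod_sel [simp]: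
 "X : MObj (pre_mod rel tp) \<longleftrightarrow> tp X"
 "(X', X) : MArr (pre_mod rel tp) \<longleftrightarrow> tp X' & rel X' X & tp X"
 "Src (pre_mod rel tp) (X', X) = X" "Tgt (pre_mod rel tp) (X', X) = (X', X)"
 "Post (pre_mod rel tp) (X', X'', X) a = (X'', X)" "MFib (pre_mod rel tp) (X', X) = X'"
 "MInd (pre_mod rel tp) (X', X'', X) a = (X', X'')"
by (auto simp: pre_mod_def)

lemma hom_pre_cat [simp]:
 "f : hom_opcat (pre_cat rel) A B \<longleftrightarrow>
 (EX X' X'' X. f = (X', X'', X) & A = (X', X) & B = (X'', X) & rel X' X'' & rel X'' X)"
by (cases f) (auto simp: hom_opcat_def)

lemma hom_pre_mod [simp]:
 "a : hom_opmod (pre_mod rel tp) L S \<longleftrightarrow> (EX X'. a = (X', L) & S = (X', L) & tp X' & rel X' L & tp L)"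
by (cases a) (auto simp: hom_opmod_def)

lemma left_operadic_module_pre:
 assumes "!!X Y Z. rel X Y ==> rel Y Z ==> rel X Z" "!!X Y. rel X Y ==> rel X X" "!!X Y. rel X Y ==> rel Y Y"
and "!!X. tp X ==> rel X X" "!!X Y. tp X ==> rel X Y ==> tp Y"
 shows "left_operadic_module (pre_cat rel) (pre_mod rel tp)"
by (intro left_operadic_module.intro unary_operadic_category.intro left_operadic_module_axioms.intro;
 clarsimp?; (blast intro: assms)?)

text \<open>Reflexivity is demanded only for elements that occur in a relation or satisfy
  \<open>tp\<close>; for configurations these are the validly decorated ones.\<close>

locale pre_bar = unital_pmodule "pre_cat rel" "pre_mod rel tp" R P N
 for rel :: "'c => 'c => bool" and tp :: "'c => bool" and R :: "'r ring"
and P :: "('c \<times> 'c, 'c \<times> 'c \<times> 'c, 'r, 'v) operad" and N :: "('c, 'c \<times> 'c, 'r, 'v, 'w) pmodule" +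
 assumes R: "cring R" and rel_trans: "rel X Y ==> rel Y Z ==> rel X Z"
and rel_left: "rel X Y ==> rel X X" and rel_right: "rel X Y ==> rel Y Y"
and tp_refl: "tp X ==> rel X X" and tp_down: "tp X ==> rel X Y ==> tp Y"
begin

abbreviation "Cat == pre_cat rel"
abbreviation "Mdu == pre_mod rel tp"
abbreviation "Bar n X == bar Cat Mdu R P N n X"
abbreviation "Bface == bar_face Cat Mdu R P N"
abbreviation "Bdegen == bar_degen Cat Mdu R P N"
abbreviation "Baug == bar_aug Cat Mdu R P N"
abbreviation "Bdiff == bar_diff Cat Mdu R P N"
abbreviation "Bsum == bar_summand Cat Mdu R P N"
abbreviation "NBdiff == nbar_diff Cat Mdu R P N"
abbreviation "NBar == nbar Cat Mdu R P N"

definition un :: "'c => 'v" where "un X = Unt P (X, X)"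

lemma Val_mod: "rel X Y ==> rmod R (Val P (X, Y))"
using val[of "(X, Y)"] by simp

lemma N_mod: "tp X ==> rmod R (MVal N X)"
using mval[of X] by simp

lemma Gam_bil: "rel X Y ==> rel Y Z ==>
 mbilinear R (Val P (X, Y)) (Val P (Y, Z)) (Val P (X, Z)) (Gam P (X, Y, Z))"
using gam[of "(X, Y, Z)" "(X, Z)" "(Y, Z)"] by simp

lemma Act_bil: "tp X ==> rel X Y ==> mbilinear R (MVal N X) (Val P (X, Y)) (MVal N Y) (Act N (X, Y))"
using act[of "(X, Y)" Y "(X, Y)"] tp_down[of X Y] by simp

lemma Gam_closed: "rel X Y ==> rel Y Z ==> x : cr (Val P (X, Y)) ==> y : cr (Val P (Y, Z)) ==>
 Gam P (X, Y, Z) x y : cr (Val P (X, Z))"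
using lin_in[OF bilinD(1)[OF Gam_bil]] by blast

lemma Act_closed: "tp X ==> rel X Y ==> x : cr (MVal N X) ==> y : cr (Val P (X, Y)) ==>
 Act N (X, Y) x y : cr (MVal N Y)"
using lin_in[OF bilinD(1)[OF Act_bil]] by blast

lemma Gam_assoc: "rel W X ==> rel X Y ==> rel Y Z ==> x : cr (Val P (W, X)) ==> y : cr (Val P (X, Y)) ==>
 z : cr (Val P (Y, Z)) ==> Gam P (W, X, Z) x (Gam P (X, Y, Z) y z) = Gam P (W, Y, Z) (Gam P (W, X, Y) x y) z"
using gam_assoc[of "(W, X, Z)" "(W, Z)" "(X, Z)" "(X, Y, Z)" "(Y, Z)" x y z] rel_trans[of W X Y] rel_trans[of W X Z] rel_trans[of X Y Z] by simp

lemma Unt_closed: "rel X Y ==> Unt P (X, Y) : cr (Val P (X, X))"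
using unt[of "(X, Y)"] by simp

text \<open>The unit attached to \<open>(X, Y)\<close> already lives in \<open>P (X, X)\<close>. In
  the product of the units of \<open>(X, X)\<close> and \<open>(X, Y)\<close> the left unit law
  returns the second and the right unit law the first, so they coincide.\<close>

lemma Unt_eq: "rel X Y ==> Unt P (X, Y) = un X"
proof -
 assume r: "rel X Y"
 have "Gam P (X, X, X) (Unt P (X, X)) (Unt P (X, Y)) = Unt P (X, Y)"
using unt_gam[of "(X, X)" "Unt P (X, Y)"] rel_left[OF r] Unt_closed[OF r] by simp
 moreover have "Gam P (X, X, X) (Unt P (X, X)) (Unt P (X, Y)) = Unt P (X, X)"
using gam_unt[of "(X, X, Y)" "(X, Y)" "(X, Y)" "Unt P (X, X)"] r rel_left[OF r] Unt_closed[OF rel_left[OF r]] by simp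
 ultimately show ?thesis by (simp add: un_def)
qed

lemma un_closed: "rel X X ==> un X : cr (Val P (X, X))"
unfolding un_def by (rule Unt_closed)

lemma Gam_un_left: "rel X Y ==> x : cr (Val P (X, Y)) ==> Gam P (X, X, Y) (un X) x = x"
using unt_gam[of "(X, Y)" x] by (simp add: Unt_eq)

lemma Gam_un_right: "rel X Y ==> x : cr (Val P (X, Y)) ==> Gam P (X, Y, Y) x (un Y) = x"
using gam_unt[of "(X, Y, Y)" "(X, Y)" "(Y, Y)" x] rel_right by (simp add: un_def)

lemma Act_Gam: "tp X ==> rel X Y ==> rel Y Z ==> x : cr (MVal N X) ==> y : cr (Val P (X, Y)) ==>
 z : cr (Val P (Y, Z)) ==> Act N (X, Z) x (Gam P (X, Y, Z) y z) = Act N (Y, Z) (Act N (X, Y) x y) z"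
using act_gam[of "(X, Z)" Z "(X, Z)" "(X, Y, Z)" "(Y, Z)" x y z] rel_trans[of X Y Z] tp_down[of X Z] by simp

lemma Act_un: "tp X ==> x : cr (MVal N X) ==> Act N (X, X) x (un X) = x"
using act_unt[of "(X, X)" X "(X, X)" x] tp_refl by (simp add: un_def)

text \<open>A tower over \<open>X\<close> amounts to the list of the configurations \<open>X\<^sub>0, \<dots>, X\<^sub>n\<close> in \<open>T\<^sub>i = (X\<^sub>i, X)\<close>.\<close>

definition tow :: "'c => 'c list => ('c \<times> 'c \<times> 'c, 'c \<times> 'c) tower" where
 "tow X Xs = (map (%i. (Xs ! Suc i, Xs ! i, X)) [0..<length Xs - 1], (last Xs, X))"

definition untow :: "('c \<times> 'c \<times> 'c, 'c \<times> 'c) tower => 'c list" where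
 "untow t = map (%i. fst (level Cat Mdu t i)) [0..<Suc (length (fst t))]"

text \<open>The base \<open>X\<close> serves as predecessor of the first entry, so that all
  relations have one form. \<open>tp\<close> is asked of the outermost entry only and passes down
  the chain.\<close>

definition chs :: "nat => 'c => 'c list set" where
 "chs n X = {Xs. length Xs = Suc n & tp (last Xs) & (ALL i<=n. rel (Xs ! i) ((X # Xs) ! i))}"

text \<open>With \<open>X\<close> put in front, the value at \<open>T_0\<close> and the values at
  the fibers of all \<open>f_i\<close> become one formula, \<open>P (X_i, X_{i-1})\<close> with
  \<open>X_{-1} = X\<close>. For the empty list only the module at \<open>X\<close> remains; this is
  the tail of a chain with one entry.\<close>

definition fac :: "'c => 'c list => nat => ('r, 'v + 'w) module" where
 "fac X Xs i = (if i < length Xs then tag_module Inl (Val P (Xs ! i, (X # Xs) ! i))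
 else tag_module Inr (MVal N (last (X # Xs))))"

definition fam :: "'c => 'c list => (nat => 'v + 'w) set" where
 "fam X Xs = (\<Pi>\<^sub>E i\<in>{..length Xs}. cr (fac X Xs i))"

definition bg :: "'c => 'c list => (nat => 'v + 'w) => ('c \<times> 'c \<times> 'c, 'c \<times> 'c, 'r, 'v, 'w) bar_elem" where
 "bg X Xs x = bar_gen Cat Mdu R P N (length Xs - 1) X (tow X Xs, x)"

lemma chsD:
 assumes "Xs : chs n X"
 shows "length Xs = Suc n" "Xs ~= []" "tp (last Xs)" "i \<le> n ==> rel (Xs ! i) ((X # Xs) ! i)" "last Xs = Xs ! n"
proof -
 show "length Xs = Suc n" "tp (last Xs)" "i \<le> n ==> rel (Xs ! i) ((X # Xs) ! i)"
using assms by (auto simp: chs_def)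
 thus "Xs ~= []" by auto
 thus "last Xs = Xs ! n" using \<open>length Xs = Suc n\<close> by (simp add: last_conv_nth)
qed

lemma chs_base: "Xs : chs n X ==> i \<le> n ==> rel (Xs ! i) X"
proof (induction i)
 case 0 thus ?case using chsD(4)[of Xs n X 0] by simp
next
 case (Suc i) thus ?case using chsD(4)[of Xs n X "Suc i"] rel_trans by simp
qed

lemma chs_tp: "Xs : chs n X ==> i \<le> n ==> tp (Xs ! i)"
proof (induction "n - i" arbitrary: i)
 case 0
 hence "i = n" by simp
 thus ?case using chsD(3,5)[OF 0(2)] by simp
next
 case (Suc k)
 hence i: "k = n - Suc i" "Suc i \<le> n" by simp_all
 show ?case using Suc(1)[OF i(1) Suc.prems(1) i(2)] chsD(4)[OF Suc.prems(1) i(2)] tp_down by simp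
qed

lemma level_tow: "Xs ~= [] ==> i < length Xs ==> level Cat Mdu (tow X Xs) i = (Xs ! i, X)"
proof -
 assume Xs: "Xs ~= []" and i: "i < length Xs"
 show ?thesis
 proof (cases "i < length Xs - 1")
 case False
 hence "i = length Xs - 1" using i by simp
 thus ?thesis using Xs by (simp add: level_def tow_def last_conv_nth)
 qed (simp add: level_def tow_def)
qed

lemma untow_tow: "Xs ~= [] ==> untow (tow X Xs) = Xs"
proof -
 assume Xs: "Xs ~= []"
 hence l: "Suc (length (fst (tow X Xs))) = length Xs" by (simp add: tow_def)
 show ?thesis unfolding untow_def l
by (rule nth_equalityI) (use Xs in "auto simp: level_tow simp del: upt_Suc")
qed

text \<open>The second components of all levels coincide: each morphism of a tower keeps it, and at
  the last level it is the source of the arrow. Only the first components carry information.\<close>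

lemma towers_eq:
 assumes X: "tp X" shows "towers Cat Mdu n X = tow X ` chs n X"
proof (intro subset_antisym subsetI)
 fix t assume t: "t : towers Cat Mdu n X"
 obtain fs al where ft: "t = (fs, al)" by (cases t)
 obtain A B where ab: "al = (A, B)" by (cases al)
 have B: "B = X" and A: "tp A" "rel A X" and l: "length fs = n" and fs: "set fs \<subseteq> Arr Cat"
and dom: "!!i. i < n ==> Dom Cat (fs ! i) = level Cat Mdu t (Suc i)"
using t by (auto simp: towers_def ft ab)
 define Xs where "Xs = map (%i. fst (level Cat Mdu t i)) [0..<Suc n]"
 have Xs_nth: "Xs ! i = fst (level Cat Mdu t i)" if "i \<le> n" for i
using that unfolding Xs_def by (simp del: upt_Suc)
 have lX: "length Xs = Suc n" by (simp add: Xs_def)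
 have lev_n: "level Cat Mdu t n = (A, X)" by (simp add: level_def ft l ab B)
 have fsi: "EX a b c. fs ! i = (a, b, c) & rel a b & rel b c" if "i < n" for i
 proof -
 have "fs ! i : Arr Cat" using fs that l by auto
 thus ?thesis by (cases "fs ! i") auto
 qed
 have snd: "snd (level Cat Mdu t i) = X" if "i \<le> n" for i
using that
 proof (induction "n - i" arbitrary: i)
 case 0 thus ?case using lev_n by simp
 next
 case (Suc k)
 hence i: "i < n" by simp
 obtain a b c where f: "fs ! i = (a, b, c)" using fsi[OF i] by blast
 have "snd (level Cat Mdu t (Suc i)) = X" using Suc i by simp
 hence "c = X" using dom[OF i] by (simp add: f) (metis snd_conv)
 thus ?case using i by (simp add: f level_def ft l)
 qed
 have lev: "level Cat Mdu t i = (Xs ! i, X)" if "i \<le> n" for i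
using snd[OF that] Xs_nth[OF that] by (metis prod.collapse)
 have f: "fs ! i = (Xs ! Suc i, Xs ! i, X)" if i: "i < n" for i
 proof -
 obtain a b c where f: "fs ! i = (a, b, c)" using fsi[OF i] by blast
 have "level Cat Mdu t i = (b, c)" using that by (simp add: level_def ft l f)
 moreover have "(a, c) = level Cat Mdu t (Suc i)" using dom[OF that] f by simp
 ultimately show ?thesis using lev[of i] lev[of "Suc i"] that f by simp
 qed
 have last: "last Xs = A" using lev[of n] lev_n lX by (cases Xs rule: rev_cases) (auto simp: nth_append)
 have "t = tow X Xs"
unfolding tow_def ft ab B last lX by (auto simp: l f intro: nth_equalityI)
 moreover have "Xs : chs n X"
unfolding chs_def
 proof (intro CollectI conjI allI impI lX)
 show "tp (last Xs)" using last A by simp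
 fix i assume i: "i \<le> n"
 show "rel (Xs ! i) ((X # Xs) ! i)"
 proof (cases i)
 case 0
 show ?thesis
 proof (cases "n = 0")
 case True thus ?thesis using lev_n lev[of 0] A 0 by simp
 next
 case False thus ?thesis using fsi[of 0] f[of 0] 0 by simp
 qed
 next
 case (Suc k)
 thus ?thesis using fsi[of k] f[of k] i by simp
 qed
 qed
 ultimately show "t : tow X ` chs n X" by blast
next
 fix t assume "t : tow X ` chs n X"
 then obtain Xs where Xs: "Xs : chs n X" "t = tow X Xs" by blast
 note c = chsD[OF Xs(1)]
 have "rel (last Xs) X" using chs_base[OF Xs(1), of n] c(5) by simp
 moreover have "set (fst t) \<subseteq> Arr Cat"
using c(1) c(4)[of "Suc _"] chs_base[OF Xs(1)] by (auto simp: Xs(2) tow_def)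
 moreover have "Dom Cat (fst t ! i) = level Cat Mdu t (i + 1)" if "i < n" for i
using that c(1) level_tow[OF c(2), of "Suc i" X] by (simp add: Xs(2)) (simp add: tow_def)
 ultimately show "t : towers Cat Mdu n X"
using c X by (auto simp: towers_def Xs(2)) (auto simp: tow_def)
qed

lemma bar_factor_tow: "Xs ~= [] ==> bar_factor Cat Mdu P N (tow X Xs) = fac X Xs"
proof
 fix i assume Xs: "Xs ~= []"
 have l: "length (fst (tow X Xs)) = length Xs - 1" by (simp add: tow_def)
 consider "i = 0" | "0 < i" "i < length Xs" | "length Xs \<le> i" by linarith
 thus "bar_factor Cat Mdu P N (tow X Xs) i = fac X Xs i"
 proof cases
 case 1
 thus ?thesis using Xs by (simp add: bar_factor_def fac_def level_tow)
 next
 case 2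
 then obtain k where k: "i = Suc k" by (cases i) auto
 have "i \<le> length (fst (tow X Xs))" using 2 l by simp
 moreover have "fst (tow X Xs) ! k = (Xs ! Suc k, Xs ! k, X)" using 2 k by (simp add: tow_def)
 ultimately show ?thesis using 2 k by (simp add: bar_factor_def fac_def)
 next
 case 3
 hence "i ~= 0" "~ i \<le> length (fst (tow X Xs))" using Xs l by (cases Xs; simp)+
 thus ?thesis using 3 Xs by (simp add: bar_factor_def fac_def) (simp add: tow_def)
 qed
qed

lemma bar_summand_tow: "Xs : chs n X ==> Bsum (tow X Xs) = tensor R {..Suc n} (fac X Xs)"
using chsD(1,2)[of Xs n X] by (simp add: bar_summand_def bar_factor_tow) (simp add: tow_def)

lemma fac_mod: "Xs : chs n X ==> i \<le> Suc n ==> rmod R (fac X Xs i)"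
using chsD[of Xs n X] by (auto simp: fac_def intro!: module_tag Val_mod N_mod)

lemma fam_chs: "Xs : chs n X ==> fam X Xs = Pi\<^sub>E {..Suc n} (%i. cr (fac X Xs i))"
by (simp add: fam_def chsD(1))

lemma summand_mod: "Xs : chs n X ==> rmod R (tensor R {..Suc n} (fac X Xs))"
by (rule module_tensor[OF R]) (auto intro: fac_mod)

lemma summand_mod': "tp X ==> t : towers Cat Mdu n X ==> rmod R (Bsum t)"
using summand_mod by (auto simp: towers_eq bar_summand_tow)

lemma Bar_mod: "tp X ==> rmod R (Bar n X)"
unfolding bar_def by (rule module_direct_sum[OF R]) (rule summand_mod')

lemma bar_gens_eq: "tp X ==> bar_gens Cat Mdu P N n X = (%(Xs, x). (tow X Xs, x)) ` Sigma (chs n X) (fam X)"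
using chsD(1,2) by (fastforce simp: bar_gens_def towers_eq bar_factor_tow fam_def)

lemma bg_eq: "Xs : chs n X ==> bg X Xs x = summand_incl (towers Cat Mdu n X) (Bsum) (tow X Xs)
 (pure_tensor R {..Suc n} (fac X Xs) x)"
using chsD(1,2)[of Xs n X] by (simp add: bg_def bar_gen_def bar_factor_tow)

lemma bg_multilin:
 assumes X: "tp X" and Xs: "Xs : chs n X"
 shows "multilin R {..Suc n} (fac X Xs) (Bar n X) (bg X Xs)"
proof -
 have "mlinear R (tensor R {..Suc n} (fac X Xs)) (Bar n X)
 (summand_incl (towers Cat Mdu n X) (Bsum) (tow X Xs))"
unfolding bar_def bar_summand_tow[OF Xs, symmetric]
by (rule mlinear_summand_incl[OF R summand_mod'[OF X]]) (use X Xs in "auto simp: towers_eq")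
 from multilin_comp[OF multilin_pure_tensor[OF R] this]
 show ?thesis using fac_mod[OF Xs] by (simp add: bg_eq[OF Xs, abs_def])
qed

lemma bg_closed: "tp X ==> Xs : chs n X ==> x : fam X Xs ==> bg X Xs x : cr (Bar n X)"
using multilinD(1)[OF bg_multilin] by (simp add: fam_chs)

lemma Bar_spans:
 assumes X: "tp X" shows "spans R (Bar n X) ((%(Xs, x). bg X Xs x) ` Sigma (chs n X) (fam X))"
proof -
 \<comment> \<open>The chain is recovered from the tower by \<open>untow\<close>, so that the union
   can be indexed by the summands of the direct sum.\<close>
 have "spans R (Bar n X) (\<Union>t\<in>towers Cat Mdu n X. summand_incl (towers Cat Mdu n X) (Bsum) t `
 (pure_tensor R {..Suc n} (fac X (untow t)) ` fam X (untow t)))"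
unfolding bar_def
 proof (rule spans_direct_sum[OF R summand_mod'[OF X]])
 fix t assume "t : towers Cat Mdu n X"
 then obtain Xs where Xs: "Xs : chs n X" "t = tow X Xs" by (auto simp: towers_eq[OF X])
 show "spans R (Bsum t) (pure_tensor R {..Suc n} (fac X (untow t)) ` fam X (untow t))"
unfolding Xs(2) untow_tow[OF chsD(2)[OF Xs(1)]] bar_summand_tow[OF Xs(1)] fam_chs[OF Xs(1)]
by (rule spans_tensor[OF R]) (auto intro: fac_mod[OF Xs(1)])
 qed
 also have "(\<Union>t\<in>towers Cat Mdu n X. summand_incl (towers Cat Mdu n X) (Bsum) t `
 (pure_tensor R {..Suc n} (fac X (untow t)) ` fam X (untow t))) = (%(Xs, x). bg X Xs x) ` Sigma (chs n X) (fam X)"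
by (auto simp: towers_eq[OF X] untow_tow[OF chsD(2)] bg_eq image_iff) (metis bg_eq untow_tow chsD(2))+
 finally show ?thesis .
qed

lemma Bar_lift:
 assumes X: "tp X" and B: "rmod R B"
and v: "!!Xs. Xs : chs n X ==> multilin R {..Suc n} (fac X Xs) B (v Xs)"
 obtains f where "mlinear R (Bar n X) B f" "!!Xs x. Xs : chs n X ==> x : fam X Xs ==> f (bg X Xs x) = v Xs x"
proof -
 have "EX g. mlinear R (Bsum t) B g \<and>
 (ALL x:fam X (untow t). g (pure_tensor R {..Suc n} (fac X (untow t)) x) = v (untow t) x)"
 if t: "t : towers Cat Mdu n X" for t
 proof -
 obtain Xs where Xs: "Xs : chs n X" "t = tow X Xs" using t by (auto simp: towers_eq[OF X])
 obtain g where "mlinear R (tensor R {..Suc n} (fac X Xs)) B g"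
 "!!x. x : Pi\<^sub>E {..Suc n} (%i. cr (fac X Xs i)) ==> g (pure_tensor R {..Suc n} (fac X Xs) x) = v Xs x"
using tensor_lift[OF R _ B v[OF Xs(1)]] fac_mod[OF Xs(1)] by auto
 thus ?thesis
unfolding Xs(2) untow_tow[OF chsD(2)[OF Xs(1)]] bar_summand_tow[OF Xs(1)] fam_chs[OF Xs(1)] by blast
 qed
 then obtain g where g: "!!t. t : towers Cat Mdu n X ==> mlinear R (Bsum t) B (g t)"
 "!!t x. t : towers Cat Mdu n X ==> x : fam X (untow t) ==>
 g t (pure_tensor R {..Suc n} (fac X (untow t)) x) = v (untow t) x" by metis
 obtain f where f: "mlinear R (Bar n X) B f"
 "!!t u. t : towers Cat Mdu n X ==> u : cr (Bsum t) ==>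
 f (summand_incl (towers Cat Mdu n X) (Bsum) t u) = g t u"
by (rule direct_sum_lift[where I = "towers Cat Mdu n X" and A = "Bsum" and f = g,
 OF R summand_mod'[OF X] B g(1), folded bar_def], assumption, assumption, rule that)
 have "f (bg X Xs x) = v Xs x" if Xs: "Xs : chs n X" and x: "x : fam X Xs" for Xs x
 proof -
 have t: "tow X Xs : towers Cat Mdu n X" using Xs by (simp add: towers_eq[OF X])
 have "pure_tensor R {..Suc n} (fac X Xs) x : cr (Bsum (tow X Xs))"
unfolding bar_summand_tow[OF Xs]
by (rule pure_tensor_closed[OF R]) (use x fac_mod[OF Xs] in "auto simp: fam_chs[OF Xs]")
 thus ?thesis
using f(2)[OF t] g(2)[OF t] x by (simp add: bg_eq[OF Xs] untow_tow[OF chsD(2)[OF Xs]])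
 qed
 with f(1) show thesis by (rule that)
qed

lemma Bar_eqI:
 assumes "tp X" "rmod R B" "mlinear R (Bar n X) B f" "mlinear R (Bar n X) B g"
and "!!Xs x. Xs : chs n X ==> x : fam X Xs ==> f (bg X Xs x) = g (bg X Xs x)" "y : cr (Bar n X)"
 shows "f y = g y"
by (rule spans_eqI[OF Bar_mod[OF assms(1)] assms(2) Bar_spans[OF assms(1)] assms(3,4) _ assms(6)])
 (use assms(5) in auto)

text \<open>Faces, degeneracies and augmentation are all described by \<open>linear_ext\<close> on
  \<open>bar_gen\<close>; this turns a multilinear formula on chains into linearity and explicit
  values.\<close>

lemma Bar_linear_ext:
 assumes X: "tp X" and B: "rmod R B"
and v: "!!Xs. Xs : chs n X ==> multilin R {..Suc n} (fac X Xs) B (v Xs)"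
and w: "!!Xs x. Xs : chs n X ==> x : fam X Xs ==> w (tow X Xs, x) = v Xs x"
 shows "mlinear R (Bar n X) B (linear_ext R (Bar n X) B (bar_gens Cat Mdu P N n X) (bar_gen Cat Mdu R P N n X) w)"
and "Xs : chs n X ==> x : fam X Xs ==>
 linear_ext R (Bar n X) B (bar_gens Cat Mdu P N n X) (bar_gen Cat Mdu R P N n X) w (bg X Xs x) = v Xs x"
proof -
 obtain f where f: "mlinear R (Bar n X) B f" "!!Xs x. Xs : chs n X ==> x : fam X Xs ==> f (bg X Xs x) = v Xs x"
using Bar_lift[OF X B v] by blast
 have bgn: "bar_gen Cat Mdu R P N n X (tow X Xs, x) = bg X Xs x" if "Xs : chs n X" for Xs x
using chsD(1)[OF that] by (simp add: bg_def)
 have "bar_gen Cat Mdu R P N n X ` bar_gens Cat Mdu P N n X = (%(Xs, x). bg X Xs x) ` Sigma (chs n X) (fam X)"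
unfolding bar_gens_eq[OF X] image_image by (rule image_cong) (auto simp: bgn)
 hence sp: "spans R (Bar n X) (bar_gen Cat Mdu R P N n X ` bar_gens Cat Mdu P N n X)"
using Bar_spans[OF X] by simp
 have vals: "f (bar_gen Cat Mdu R P N n X g) = w g" if "g : bar_gens Cat Mdu P N n X" for g
using that f(2) w by (auto simp: bar_gens_eq[OF X] bgn)
 note le = linear_ext[where gen = "bar_gen Cat Mdu R P N n X" and G = "bar_gens Cat Mdu P N n X" and v = w,
 OF Bar_mod[OF X] B sp f(1) vals]
 show "mlinear R (Bar n X) B (linear_ext R (Bar n X) B (bar_gens Cat Mdu P N n X) (bar_gen Cat Mdu R P N n X) w)"
by (rule le(1))
 show "linear_ext R (Bar n X) B (bar_gens Cat Mdu P N n X) (bar_gen Cat Mdu R P N n X) w (bg X Xs x) = v Xs x"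
 if "Xs : chs n X" "x : fam X Xs"
using le(3)[OF _ bg_closed[OF X that]] f(2)[OF that] by simp
qed

end

lemma mlinear_projl: "mlinear R A B f ==> mlinear R (tag_module Inl A) B (%u. f (projl u))"
and mlinear_projr: "mlinear R A B f ==> mlinear R (tag_module Inr A) B (%u. f (projr u))"
by (simp_all add: mlinear_from_tag)

section \<open>Faces and degeneracies in terms of chains\<close>

context pre_bar
begin

text \<open>Deleting \<open>X_i\<close> describes every face, the first and the last included; the
  case distinction of \<open>face_tower\<close> disappears.\<close>

definition del :: "nat => 'c list => 'c list" where
 "del i Xs = take i Xs @ drop (Suc i) Xs"

definition dup :: "nat => 'c list => 'c list" where
 "dup j Xs = take (Suc j) Xs @ drop j Xs"

text \<open>The base in front absorbs the case \<open>i = 0\<close>, so only the last face, which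
  uses the action, remains special.\<close>

definition mm :: "'c => 'c list => nat => (nat => 'v + 'w) => 'v + 'w" where
 "mm X Xs i x = (if Suc i < length Xs then Inl (Gam P (Xs ! Suc i, Xs ! i, (X # Xs) ! i) (projl (x (Suc i))) (projl (x i)))
 else Inr (Act N (last Xs, (X # Xs) ! i) (projr (x (Suc i))) (projl (x i))))"

definition mrg :: "'c => 'c list => nat => (nat => 'v + 'w) => nat => 'v + 'w" where
 "mrg X Xs i x = (\<lambda>j\<in>{..length Xs - 1}. if j < i then x j else if j = i then mm X Xs i x else x (Suc j))"

definition dg :: "'c list => nat => (nat => 'v + 'w) => nat => 'v + 'w" where
 "dg Xs j x = (\<lambda>k\<in>{..Suc (length Xs)}. if k \<le> j then x k else if k = Suc j then Inl (un (Xs ! j)) else x (k - 1))"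

text \<open>Families over \<open>X' # Xs\<close> are exactly the \<open>con a y\<close> with
  \<open>y\<close> a family over \<open>Xs\<close> based at \<open>X'\<close>. This recursion
  replaces index shifts in the identities for \<open>h\<close> and the action.\<close>

definition con :: "'v => (nat => 'v + 'w) => nat => 'v + 'w" where
 "con a x = case_nat (Inl a) x"

lemma con_simps [simp]: "con a x 0 = Inl a" "con a x (Suc i) = x i"
by (simp_all add: con_def)

lemma length_del [simp]: "i < length Xs ==> length (del i Xs) = length Xs - 1"
by (simp add: del_def)

lemma nth_del: "i < length Xs ==> j < length Xs - 1 ==> del i Xs ! j = (if j < i then Xs ! j else Xs ! Suc j)"
by (simp add: del_def nth_append)

lemma nth_Cons_del: "i < length Xs ==> j < length Xs ==>
 (X # del i Xs) ! j = (if j \<le> i then (X # Xs) ! j else (X # Xs) ! Suc j)"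
by (cases j) (auto simp: nth_del)

lemma last_Cons_nth: "last (X # Xs) = (X # Xs) ! length Xs"
by (simp add: last_conv_nth)

lemma last_Cons_del:
 assumes i: "i < length Xs"
 shows "last (X # del i Xs) = (if Suc i < length Xs then last (X # Xs) else (X # Xs) ! i)"
proof -
 have l: "length (del i Xs) = length Xs - 1" using i by simp
 have "length Xs = Suc (length Xs - 1)" using i by simp
 moreover have "length Xs - 1 = i" if "~ Suc i < length Xs" using i that by simp
 ultimately show ?thesis
unfolding last_Cons_nth l using i nth_Cons_del[OF i, of "length Xs - 1" X]
by (metis One_nat_def Suc_lessI diff_Suc_less le_neq_implies_less lessI less_Suc_eq_le not_less)
qed

lemma length_dup [simp]: "j < length Xs ==> length (dup j Xs) = Suc (length Xs)"
by (simp add: dup_def)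

lemma nth_dup: "j < length Xs ==> i < Suc (length Xs) ==> dup j Xs ! i = (if i \<le> j then Xs ! i else Xs ! (i - 1))"
by (auto simp: dup_def nth_append)

lemma nth_Cons_dup: "j < length Xs ==> i < Suc (Suc (length Xs)) ==>
 (X # dup j Xs) ! i = (if i \<le> Suc j then (X # Xs) ! i else (X # Xs) ! (i - 1))"
by (cases i) (auto simp: nth_dup nth_Cons')

lemma last_Cons_dup: "j < length Xs ==> last (X # dup j Xs) = last (X # Xs)"
unfolding last_Cons_nth by (subst nth_Cons_dup) auto

lemma fac_del:
 assumes i: "i < length Xs"
 shows "j < i ==> fac X (del i Xs) j = fac X Xs j"
and "i < j ==> j < length Xs ==> fac X (del i Xs) j = fac X Xs (Suc j)"
and "fac X (del i Xs) i = (if Suc i < length Xs then tag_module Inl (Val P (Xs ! Suc i, (X # Xs) ! i))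
 else tag_module Inr (MVal N ((X # Xs) ! i)))"
using i by (auto simp: fac_def nth_del nth_Cons_del last_Cons_del simp del: last.simps nth_Cons_Suc)

lemma fac_dup:
 assumes j: "j < length Xs"
 shows "i \<le> j ==> fac X (dup j Xs) i = fac X Xs i"
and "fac X (dup j Xs) (Suc j) = tag_module Inl (Val P (Xs ! j, Xs ! j))"
and "Suc j < i ==> i \<le> Suc (length Xs) ==> fac X (dup j Xs) i = fac X Xs (i - 1)"
using j by (auto simp: fac_def nth_dup nth_Cons_dup last_Cons_dup nth_Cons' simp del: last.simps)

lemma fac_Cons [simp]: "fac X (X' # Xs) 0 = tag_module Inl (Val P (X', X))" "fac X (X' # Xs) (Suc i) = fac X' Xs i"
by (simp_all add: fac_def)

lemma fac_base: "Xs ~= [] ==> 0 < i ==> fac X Xs i = fac X' Xs i"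
by (cases i) (auto simp: fac_def)

lemma chs_del:
 assumes Xs: "Xs : chs (Suc n) X" and i: "i \<le> Suc n" shows "del i Xs : chs n X"
proof -
 note c = chsD[OF Xs]
 have i': "i < length Xs" using i c(1) by simp
 have "rel (del i Xs ! j) ((X # del i Xs) ! j)" if j: "j \<le> n" for j
 proof -
 consider "j < i" | "j = i" | "i < j" by linarith
 thus ?thesis
 proof cases
 case 1 thus ?thesis using c(1,4) i' j by (simp add: nth_del nth_Cons_del)
 next
 case 2
 have "rel (Xs ! Suc i) (Xs ! i)" "rel (Xs ! i) ((X # Xs) ! i)"
using c(4)[of i] c(4)[of "Suc i"] i j 2 by simp_all
 from rel_trans[OF this] show ?thesis using c(1) i' j 2
by (simp add: nth_del nth_Cons_del del: nth_Cons_Suc)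
 next
 case 3
 then obtain m where "j = Suc m" by (cases j) auto
 thus ?thesis using 3 c(1) c(4)[of "Suc j"] i' j by (simp add: nth_del)
 qed
 qed
 moreover have "tp (last (del i Xs))"
 proof -
 have ne: "del i Xs ~= []" using c(1) i' by (metis length_del diff_Suc_1 length_0_conv nat.distinct(1))
 have "last (del i Xs) = (if Suc i < length Xs then last Xs else (X # Xs) ! i)"
using last_Cons_del[OF i', of X] ne c(2) by simp
 moreover have "(X # Xs) ! i = Xs ! n" if "~ Suc i < length Xs"
 proof -
 have "i = Suc n" using that i' c(1) by simp
 thus ?thesis by simp
 qed
 ultimately show ?thesis using c(3) chs_tp[OF Xs, of n] by (simp split: if_splits)
 qed
 ultimately show ?thesis using c(1) i' by (simp add: chs_def)
qed

lemma chs_dup: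
 assumes Xs: "Xs : chs n X" and j: "j \<le> n" shows "dup j Xs : chs (Suc n) X"
proof -
 note c = chsD[OF Xs]
 have j': "j < length Xs" using j c(1) by simp
 have "rel (dup j Xs ! i) ((X # dup j Xs) ! i)" if i: "i \<le> Suc n" for i
 proof -
 consider "i \<le> j" | "i = Suc j" | "Suc j < i" by linarith
 thus ?thesis
 proof cases
 case 1 thus ?thesis using c(1,4) j' i by (simp add: nth_dup nth_Cons_dup)
 next
 case 2
 have "rel (Xs ! j) (Xs ! j)" by (rule tp_refl[OF chs_tp[OF Xs j]])
 thus ?thesis using c(1) j' i 2 by (simp add: nth_dup)
 next
 case 3
 define k where "k = i - 2"
 have "i = Suc (Suc k)" using 3 by (simp add: k_def)
 thus ?thesis using c(1) c(4)[of "Suc k"] j' i 3 by (simp add: nth_dup)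
 qed
 qed
 moreover have "last (dup j Xs) = last Xs"
using last_Cons_dup[OF j', of X] j' by (simp split: if_splits) (metis length_dup[OF j'] list.size(3) nat.distinct(1))
 ultimately show ?thesis using c j' by (simp add: chs_def)
qed

lemma fam_l: "x : fam X Xs ==> i < length Xs ==> projl (x i) : cr (Val P (Xs ! i, (X # Xs) ! i)) & x i = Inl (projl (x i))"
proof -
 assume x: "x : fam X Xs" and i: "i < length Xs"
 have "x i : cr (fac X Xs i)" using x i by (auto simp: fam_def)
 thus ?thesis using i by (auto simp: fac_def)
qed

lemma fam_r: "x : fam X Xs ==> projr (x (length Xs)) : cr (MVal N (last (X # Xs))) & x (length Xs) = Inr (projr (x (length Xs)))"
proof -
 assume x: "x : fam X Xs"
 have "x (length Xs) : cr (fac X Xs (length Xs))" using x by (auto simp: fam_def)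
 thus ?thesis by (auto simp: fac_def simp del: last.simps)
qed

lemma fam_upd: "x : fam X Xs ==> k \<le> length Xs ==> u : cr (fac X Xs k) ==> x(k := u) : fam X Xs"
by (auto simp: fam_def PiE_iff extensional_def)

lemma mm_closed:
 assumes Xs: "Xs : chs n X" and x: "x : fam X Xs" and i: "i \<le> n"
 shows "mm X Xs i x : cr (fac X (del i Xs) i)"
proof -
 note c = chsD[OF Xs]
 have i': "i < length Xs" using i c(1) by simp
 show ?thesis
 proof (cases "Suc i < length Xs")
 case True
 hence "rel (Xs ! Suc i) (Xs ! i)" using c(1) c(4)[of "Suc i"] by simp
 moreover have "rel (Xs ! i) ((X # Xs) ! i)" using c(4) i by blast
 ultimately show ?thesis using Gam_closed fam_l[OF x True] fam_l[OF x i'] True by (simp add: fac_del(3)[OF i'] mm_def)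
 next
 case False
 hence "i = n" using i c(1) by simp
 hence e: "Suc i = length Xs" "last Xs = Xs ! i" using c by simp_all
 have "rel (Xs ! i) ((X # Xs) ! i)" using c(4) i by blast
 thus ?thesis using Act_closed[of "Xs ! i"] chs_tp[OF Xs i] fam_r[OF x] fam_l[OF x i'] False e c(2)
by (simp add: fac_del(3)[OF i'] mm_def)
 qed
qed

lemma mm_lin:
 assumes Xs: "Xs : chs n X" and x: "x : fam X Xs" and i: "i \<le> n" and k: "k = i \<or> k = Suc i"
 shows "mlinear R (fac X Xs k) (fac X (del i Xs) i) (%u. mm X Xs i (x(k := u)))"
proof -
 note c = chsD[OF Xs]
 have i': "i < length Xs" using i c(1) by simp
 have r: "rel (Xs ! i) ((X # Xs) ! i)" using c(4) i by blast
 show ?thesis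
 proof (cases "Suc i < length Xs")
 case True
 hence r': "rel (Xs ! Suc i) (Xs ! i)" using c(1) c(4)[of "Suc i"] by simp
 note b = Gam_bil[OF r' r]
 from k show ?thesis
 proof
 assume k: "k = i"
 show ?thesis unfolding fac_del(3)[OF i']
using mlinear_projl[OF mlinear_into_tag[OF inj_Inl bilinD(1)[OF b conjunct1[OF fam_l[OF x True, simplified]]]]] True
by (simp add: k mm_def fac_def)
 next
 assume k: "k = Suc i"
 show ?thesis unfolding fac_del(3)[OF i']
using mlinear_projl[OF mlinear_into_tag[OF inj_Inl bilinD(2)[OF b conjunct1[OF fam_l[OF x i']]]]] True
by (simp add: k mm_def fac_def)
 qed
 next
 case False
 hence "i = n" using i c(1) by simp
 hence e: "Suc i = length Xs" "last Xs = Xs ! i" using c by simp_all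
 note b = Act_bil[OF chs_tp[OF Xs i] r]
 have xr: "projr (x (Suc i)) : cr (MVal N (Xs ! i))" using fam_r[OF x] e c(2) by simp
 from k show ?thesis
 proof
 assume k: "k = i"
 show ?thesis unfolding fac_del(3)[OF i']
using mlinear_projl[OF mlinear_into_tag[OF inj_Inr bilinD(1)[OF b xr]]] False i' e(2)
by (simp add: k mm_def fac_def)
 next
 assume k: "k = Suc i"
 show ?thesis unfolding fac_del(3)[OF i']
using mlinear_projr[OF mlinear_into_tag[OF inj_Inr bilinD(2)[OF b conjunct1[OF fam_l[OF x i']]]]] False e c(2)
by (simp add: k mm_def fac_def)
 qed
 qed
qed

lemma mrg_fam:
 assumes Xs: "Xs : chs (Suc n) X" and x: "x : fam X Xs" and i: "i \<le> Suc n"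
 shows "mrg X Xs i x : fam X (del i Xs)"
proof -
 have i': "i < length Xs" and l: "length Xs = Suc (Suc n)" using i chsD(1)[OF Xs] by simp_all
 have "(if j < i then x j else if j = i then mm X Xs i x else x (Suc j)) : cr (fac X (del i Xs) j)"
 if j: "j \<le> Suc n" for j
 proof -
 consider "j < i" | "j = i" | "i < j" by linarith
 thus ?thesis
 proof cases
 case 1 thus ?thesis using x l j by (auto simp: fam_def fac_del(1)[OF i'])
 next
 case 2 thus ?thesis using mm_closed[OF Xs x i] by simp
 next
 case 3 thus ?thesis using x l j by (auto simp: fam_def fac_del(2)[OF i'])
 qed
 qed
 thus ?thesis using l i' by (auto simp: mrg_def fam_def)
qed

lemma mrg_multilin:
 assumes Xs: "Xs : chs (Suc n) X" and i: "i \<le> Suc n" and v: "multilin R {..Suc n} (fac X (del i Xs)) B v"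
 shows "multilin R {..Suc (Suc n)} (fac X Xs) B (%x. v (mrg X Xs i x))"
proof (rule multilin_reindex[OF v])
 note fc = fam_chs[OF Xs] and fd = fam_chs[OF chs_del[OF Xs i]]
 have i': "i < length Xs" and l: "length Xs = Suc (Suc n)" using i chsD(1)[OF Xs] by simp_all
 fix x assume "x : Pi\<^sub>E {..Suc (Suc n)} (%i. cr (fac X Xs i))"
 hence x: "x : fam X Xs" by (simp add: fc)
 thus "mrg X Xs i x : Pi\<^sub>E {..Suc n} (%j. cr (fac X (del i Xs) j))"
using mrg_fam[OF Xs _ i] by (simp add: fd)
 fix k assume k: "k : {..Suc (Suc n)}"
 consider "k < i" | "k = i \<or> k = Suc i" | "Suc i < k" by linarith
 thus "EX j:{..Suc n}. EX l. mlinear R (fac X Xs k) (fac X (del i Xs) j) l \<and>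
 (ALL u:cr (fac X Xs k). mrg X Xs i (x(k := u)) = (mrg X Xs i x)(j := l u))"
 proof cases
 case 1
 show ?thesis
by (rule bexI[of _ k], rule exI[of _ "%u. u"])
 (use 1 i l in "auto simp: fac_del(1)[OF i'] lin_id mrg_def mm_def fun_eq_iff")
 next
 case 2
 show ?thesis
by (rule bexI[of _ i], rule exI[of _ "%u. mm X Xs i (x(k := u))"], rule conjI, rule mm_lin[OF Xs x i 2])
 (use 2 i l in "auto simp: mrg_def fun_eq_iff")
 next
 case 3
 then obtain m where m: "k = Suc m" by (cases k) auto
 show ?thesis
by (rule bexI[of _ m], rule exI[of _ "%u. u"])
 (use 3 k i l m in "auto simp: fac_del(2)[OF i'] lin_id mrg_def mm_def fun_eq_iff")
 qed
qed (use fac_mod[OF Xs] in auto)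

lemma length_tow [simp]: "length (fst (tow X Xs)) = length Xs - 1"
by (simp add: tow_def)

lemma nth_tow: "i < length Xs - 1 ==> fst (tow X Xs) ! i = (Xs ! Suc i, Xs ! i, X)"
by (simp add: tow_def)

text \<open>Composition in a preorder forgets the middle object, so composing neighbours of a tower
  amounts to a deletion in the chain.\<close>

lemma face_tower_tow:
 assumes l: "length Xs = Suc (Suc n)" and i: "i \<le> Suc n"
 shows "face_tower Cat Mdu i (tow X Xs) = tow X (del i Xs)"
proof (rule prod_eqI)
 have i': "i < length Xs" using l i by simp
 have ld: "length (del i Xs) = Suc n" using l i' by simp
 consider "i = 0" | "0 < i" "i < Suc n" | "i = Suc n" using i by linarith
 note cs = this
 show "fst (face_tower Cat Mdu i (tow X Xs)) = fst (tow X (del i Xs))"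
using cs
 proof cases
 case 1
 have nd: "del 0 Xs ! j = Xs ! Suc j" if "j < length Xs - 1" for j using nth_del[OF i' that] 1 by simp
 show ?thesis unfolding 1
by (intro nth_equalityI) (use l ld 1 in "auto simp: face_tower_def Let_def nth_tl nth_tow nd")
 next
 case 2
 have c: "Cmp Cat (fst (tow X Xs) ! (i - 1)) (fst (tow X Xs) ! i) = (Xs ! Suc i, Xs ! (i - 1), X)"
using 2 l by (simp add: nth_tow)
 have len: "length (fst (face_tower Cat Mdu i (tow X Xs))) = n"
using 2 l by (simp add: face_tower_def Let_def)
 have "fst (face_tower Cat Mdu i (tow X Xs)) ! j = fst (tow X (del i Xs)) ! j" if j: "j < n" for j
 proof -
 consider "j < i - 1" | "j = i - 1" | "i - 1 < j" by linarith
 thus ?thesis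
 proof cases
 case 1
 hence "Suc j < i" "j < i" by simp_all
 thus ?thesis using 1 2 l j ld c
by (simp add: face_tower_def Let_def nth_append nth_tow nth_del)
 next
 case 2
 hence "i = Suc j" using \<open>0 < i\<close> by simp
 thus ?thesis using \<open>i < Suc n\<close> l j ld c
by (simp add: face_tower_def Let_def nth_append nth_tow nth_del)
 next
 case 3
 obtain m where m: "i = Suc m" using \<open>0 < i\<close> by (cases i) auto
 hence "Suc (Suc m) + (j - Suc m) = Suc j" "m < j" using 3 by simp_all
 thus ?thesis using \<open>i < Suc n\<close> l j ld
by (simp add: m face_tower_def Let_def nth_append nth_tow nth_del)
 qed
 qed
 thus ?thesis using len ld by (intro nth_equalityI) simp_all
 next
 case 3
 thus ?thesis
by (intro nth_equalityI) (use l ld in "auto simp: face_tower_def Let_def nth_butlast nth_tow nth_del")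
 qed
 have ne: "del i Xs ~= []" "Xs ~= []" using ld l by auto
 have "last (del i Xs) = (if Suc i < length Xs then last Xs else (X # Xs) ! i)"
using last_Cons_del[OF i', of X] ne by simp
 moreover have "snd (tow X Xs) = (last Xs, X)" "snd (tow X (del i Xs)) = (last (del i Xs), X)"
by (simp_all add: tow_def)
 ultimately show "snd (face_tower Cat Mdu i (tow X Xs)) = snd (tow X (del i Xs))"
using l i by (cases "i = Suc n") (simp_all add: face_tower_def Let_def nth_tow)
qed

lemma face_merge_tow:
 assumes l: "length Xs = Suc (Suc n)" and i: "i \<le> Suc n"
 shows "face_merge Cat Mdu P N i (tow X Xs) x = mm X Xs i x"
proof -
 have ne: "Xs ~= []" using l by auto
 consider "i = 0" | "0 < i" "i < Suc n" | "i = Suc n" using i by linarith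
 thus ?thesis
by cases (use l ne in "auto simp: face_merge_def Let_def nth_tow mm_def last_conv_nth nth_Cons'")
qed

lemma bar_face_lin:
 assumes X: "tp X" and i: "i \<le> Suc n"
 shows "mlinear R (Bar (Suc n) X) (Bar n X) (Bface (Suc n) X i)"
and "Xs : chs (Suc n) X ==> x : fam X Xs ==>
 Bface (Suc n) X i (bg X Xs x) = bg X (del i Xs) (mrg X Xs i x)"
proof -
 let ?w = "%(t, x). bar_gen Cat Mdu R P N n X (face_tower Cat Mdu i t, \<lambda>j\<in>{..Suc n}. if j < i then x j
 else if j = i then face_merge Cat Mdu P N i t x else x (j + 1))"
 have w: "?w (tow X Xs, x) = bg X (del i Xs) (mrg X Xs i x)" if Xs: "Xs : chs (Suc n) X" for Xs x
 proof -
 have l: "length Xs = Suc (Suc n)" using chsD(1)[OF Xs] .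
 show ?thesis unfolding prod.case face_tower_tow[OF l i] face_merge_tow[OF l i]
using l i by (simp add: bg_def mrg_def cong: if_cong)
 qed
 note le = Bar_linear_ext[OF X Bar_mod[OF X] mrg_multilin[OF _ i bg_multilin[OF X chs_del[OF _ i]]] w]
 have eq: "Bface (Suc n) X i = linear_ext R (Bar (Suc n) X) (Bar n X)
 (bar_gens Cat Mdu P N (Suc n) X) (bar_gen Cat Mdu R P N (Suc n) X) ?w"
by (simp add: bar_face_def)
 show "mlinear R (Bar (Suc n) X) (Bar n X) (Bface (Suc n) X i)"
and "Xs : chs (Suc n) X ==> x : fam X Xs ==>
 Bface (Suc n) X i (bg X Xs x) = bg X (del i Xs) (mrg X Xs i x)"
unfolding eq by (rule le; assumption)+
qed

lemma bar_aug_lin: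
 assumes X: "tp X"
 shows "mlinear R (Bar 0 X) (MVal N X) (Baug X)"
and "Xs : chs 0 X ==> x : fam X Xs ==>
 Baug X (bg X Xs x) = Act N (last Xs, X) (projr (x 1)) (projl (x 0))"
proof -
 let ?w = "%(t, x). Act N (snd t) (projr (x 1)) (projl (x 0))"
 have v: "multilin R {..Suc 0} (fac X Xs) (MVal N X) (%x. Act N (last Xs, X) (projr (x 1)) (projl (x 0)))"
 if Xs: "Xs : chs 0 X" for Xs
 proof -
 have l: "length Xs = 1" using chsD(1)[OF Xs] by simp
 \<comment> \<open>In degree zero the augmentation is the merge at position \<open>0\<close> with
   its tag removed, whose linearity is already known.\<close>
 have mm0: "Act N (last Xs, X) (projr (x 1)) (projl (x 0)) = projr (mm X Xs 0 x)" for x :: "nat => 'v + 'w"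
using l by (simp add: mm_def)
 have f0: "fac X (del 0 Xs) 0 = tag_module Inr (MVal N X)" using fac_del(3)[of 0 Xs X] l by simp
 have pr: "mlinear R (fac X (del 0 Xs) 0) (MVal N X) projr" unfolding f0 by (rule mlinear_untag) auto
 show ?thesis unfolding multilin_def mm0
 proof (intro conjI ballI)
 fix x assume "x : Pi\<^sub>E {..Suc 0} (%i. cr (fac X Xs i))"
 hence x: "x : fam X Xs" by (simp add: fam_chs[OF Xs])
 show "projr (mm X Xs 0 x) : cr (MVal N X)" by (rule lin_in[OF pr mm_closed[OF Xs x]]) simp
 fix k :: nat assume "k : {..Suc 0}"
 hence "k = 0 \<or> k = Suc 0" by auto
 thus "mlinear R (fac X Xs k) (MVal N X) (%u. projr (mm X Xs 0 (x(k := u))))"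
by (intro lin_comp[OF mm_lin[OF Xs x] pr]) auto
 qed
 qed
 note le = Bar_linear_ext[OF X N_mod[OF X] v, where w = ?w]
 have w: "?w (tow X Xs, x) = Act N (last Xs, X) (projr (x 1)) (projl (x 0))" for Xs and x :: "nat => 'v + 'w"
by (simp add: tow_def)
 show "mlinear R (Bar 0 X) (MVal N X) (Baug X)"
and "Xs : chs 0 X ==> x : fam X Xs ==>
 Baug X (bg X Xs x) = Act N (last Xs, X) (projr (x 1)) (projl (x 0))"
unfolding bar_aug_def by (rule le; (assumption | rule w))+
qed

lemma dg_fam:
 assumes Xs: "Xs : chs n X" and x: "x : fam X Xs" and j: "j \<le> n"
 shows "dg Xs j x : fam X (dup j Xs)"
proof -
 have j': "j < length Xs" and l: "length Xs = Suc n" using j chsD(1)[OF Xs] by simp_all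
 have u: "un (Xs ! j) : cr (Val P (Xs ! j, Xs ! j))" by (rule un_closed[OF tp_refl[OF chs_tp[OF Xs j]]])
 have "(if k \<le> j then x k else if k = Suc j then Inl (un (Xs ! j)) else x (k - 1)) : cr (fac X (dup j Xs) k)"
 if k: "k \<le> Suc (length Xs)" for k
 proof -
 consider "k \<le> j" | "k = Suc j" | "Suc j < k" by linarith
 thus ?thesis
 proof cases
 case 1 thus ?thesis using x j' by (auto simp: fam_def fac_dup(1)[OF j'])
 next
 case 2 thus ?thesis using u by (simp add: fac_dup(2)[OF j'])
 next
 case 3
 hence "k - 1 \<le> length Xs" using k by simp
 thus ?thesis using x k 3 by (auto simp: fam_def fac_dup(3)[OF j'])
 qed
 qed
 thus ?thesis using l j' by (auto simp: dg_def fam_def)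
qed

lemma bar_degen_lin:
 assumes X: "tp X" and j: "j \<le> n"
 shows "mlinear R (Bar n X) (Bar (Suc n) X) (Bdegen n X j)"
and "Xs : chs n X ==> x : fam X Xs ==>
 Bdegen n X j (bg X Xs x) = bg X (dup j Xs) (dg Xs j x)"
proof -
 let ?w = "%(t, x). bar_gen Cat Mdu R P N (Suc n) X
 ((take j (fst t) @ [Idn Cat (level Cat Mdu t j)] @ drop j (fst t), snd t),
 \<lambda>k\<in>{..Suc (Suc n)}. if k \<le> j then x k
 else if k = j + 1 then Inl (Unt P (level Cat Mdu t j)) else x (k - 1))"
 have v: "multilin R {..Suc n} (fac X Xs) (Bar (Suc n) X) (%x. bg X (dup j Xs) (dg Xs j x))" if Xs: "Xs : chs n X" for Xs
 proof (rule multilin_reindex[OF bg_multilin[OF X chs_dup[OF Xs j]]])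
 have j': "j < length Xs" and l: "length Xs = Suc n" using j chsD(1)[OF Xs] by simp_all
 fix x assume "x : Pi\<^sub>E {..Suc n} (%i. cr (fac X Xs i))"
 hence x: "x : fam X Xs" by (simp add: fam_chs[OF Xs])
 thus "dg Xs j x : Pi\<^sub>E {..Suc (Suc n)} (%i. cr (fac X (dup j Xs) i))"
using dg_fam[OF Xs x j] by (simp add: fam_chs[OF chs_dup[OF Xs j]])
 fix k assume k: "k : {..Suc n}"
 show "EX i:{..Suc (Suc n)}. EX l. mlinear R (fac X Xs k) (fac X (dup j Xs) i) l \<and>
 (ALL u:cr (fac X Xs k). dg Xs j (x(k := u)) = (dg Xs j x)(i := l u))"
 proof (cases "k \<le> j")
 case True
 show ?thesis
by (rule bexI[of _ k], rule exI[of _ "%u. u"])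
 (use True k l in "auto simp: fac_dup(1)[OF j'] lin_id dg_def fun_eq_iff")
 next
 case False
 show ?thesis
by (rule bexI[of _ "Suc k"], rule exI[of _ "%u. u"])
 (use False k l in "auto simp: fac_dup(3)[OF j'] lin_id dg_def fun_eq_iff")
 qed
 qed (use fac_mod[OF Xs] in auto)
 have tw: "(take j (fst (tow X Xs)) @ [Idn Cat (level Cat Mdu (tow X Xs) j)] @ drop j (fst (tow X Xs)), snd (tow X Xs)) = tow X (dup j Xs)"
 if Xs: "Xs : chs n X" for Xs
 proof (rule prod_eqI)
 have j': "j < length Xs" and l: "length Xs = Suc n" using j chsD(1)[OF Xs] by simp_all
 have ld: "length (dup j Xs) = Suc (Suc n)" using j' l by simp
 have lv: "level Cat Mdu (tow X Xs) j = (Xs ! j, X)" by (rule level_tow[OF chsD(2)[OF Xs] j'])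
 have "(take j (fst (tow X Xs)) @ [Idn Cat (level Cat Mdu (tow X Xs) j)] @ drop j (fst (tow X Xs))) ! i = fst (tow X (dup j Xs)) ! i"
 if i: "i < Suc n" for i
 proof -
 consider "i < j" | "i = j" | "j < i" by linarith
 thus ?thesis
 proof cases
 case 3
 hence "j + (i - Suc j) = i - 1" by simp
 thus ?thesis using 3 l ld i j lv by (simp add: nth_append nth_tow nth_dup[OF j'])
 qed (use l ld i j lv in "simp_all add: nth_append nth_tow nth_dup[OF j']")
 qed
 thus "fst (take j (fst (tow X Xs)) @ [Idn Cat (level Cat Mdu (tow X Xs) j)] @ drop j (fst (tow X Xs)), snd (tow X Xs)) = fst (tow X (dup j Xs))"
using l ld j by (intro nth_equalityI) simp_all
 have "dup j Xs ~= []" using ld by auto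
 hence "last (dup j Xs) = last Xs" using last_Cons_dup[OF j', of X] chsD(2)[OF Xs] by simp
 thus "snd (take j (fst (tow X Xs)) @ [Idn Cat (level Cat Mdu (tow X Xs) j)] @ drop j (fst (tow X Xs)), snd (tow X Xs)) = snd (tow X (dup j Xs))"
by (simp add: tow_def)
 qed
 have w: "?w (tow X Xs, x) = bg X (dup j Xs) (dg Xs j x)" if Xs: "Xs : chs n X" for Xs x
 proof -
 have j': "j < length Xs" and l: "length Xs = Suc n" using j chsD(1)[OF Xs] by simp_all
 \<comment> \<open>\<open>bar_degen\<close> inserts the unit at the level \<open>(X_j, X)\<close>;
   by \<open>Unt_eq\<close> it depends on \<open>X_j\<close> alone.\<close>
 have "rel (Xs ! j) X" by (rule chs_base[OF Xs j])
 hence u: "Unt P (level Cat Mdu (tow X Xs) j) = un (Xs ! j)"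
by (simp add: level_tow[OF chsD(2)[OF Xs] j'] Unt_eq)
 show ?thesis unfolding prod.case tw[OF Xs] u using l j' by (simp add: bg_def dg_def cong: if_cong)
 qed
 note le = Bar_linear_ext[OF X Bar_mod[OF X] v w]
 have eq: "Bdegen n X j = linear_ext R (Bar n X) (Bar (Suc n) X)
 (bar_gens Cat Mdu P N n X) (bar_gen Cat Mdu R P N n X) ?w"
by (simp add: bar_degen_def numeral_2_eq_2)
 show "mlinear R (Bar n X) (Bar (Suc n) X) (Bdegen n X j)"
and "Xs : chs n X ==> x : fam X Xs ==>
 Bdegen n X j (bg X Xs x) = bg X (dup j Xs) (dg Xs j x)"
unfolding eq by (rule le; assumption)+
qed

end

section \<open>The action, the extra degeneracy and the contraction\<close>

context pre_bar
begin

text \<open>What may follow \<open>X'\<close> as the first entry of a chain with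
  \<open>n + 1\<close> entries.\<close>

definition tails :: "nat => 'c => 'c list set" where
 "tails n X = (case n of 0 => {[]} | Suc m => chs m X)"

lemma chs_Cons: "X' # Xs : chs n X \<longleftrightarrow> rel X' X & tp X' & Xs : tails n X'"
proof
 assume c: "X' # Xs : chs n X"
 have "Xs : tails n X'"
 proof (cases n)
 case 0 thus ?thesis using chsD(1)[OF c] by (simp add: tails_def)
 next
 case (Suc m)
 have "rel (Xs ! i) ((X' # Xs) ! i)" if "i \<le> m" for i using chsD(4)[OF c, of "Suc i"] that Suc by simp
 moreover have "length Xs = Suc m" using chsD(1)[OF c] Suc by simp
 moreover from this have "Xs ~= []" by auto
 ultimately show ?thesis using chsD(3)[OF c] Suc by (simp add: tails_def chs_def)
 qed
 thus "rel X' X & tp X' & Xs : tails n X'" using chsD(4)[OF c, of 0] chs_tp[OF c, of 0] by simp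
next
 assume a: "rel X' X & tp X' & Xs : tails n X'"
 show "X' # Xs : chs n X"
 proof (cases n)
 case 0 thus ?thesis using a by (simp add: tails_def chs_def)
 next
 case (Suc m)
 hence Xs: "Xs : chs m X'" using a by (simp add: tails_def)
 have "rel ((X' # Xs) ! i) ((X # X' # Xs) ! i)" if "i \<le> n" for i
using a chsD(4)[OF Xs] that Suc by (cases i) auto
 thus ?thesis using chsD(1-3)[OF Xs] Suc by (simp add: chs_def)
 qed
qed

lemma tails_length: "Xs : tails n X ==> length Xs = n"
by (cases n) (auto simp: tails_def chsD(1))

lemma tails_Suc [simp]: "tails (Suc n) X = chs n X" and tails_0 [simp]: "tails 0 X = {[]}"
by (simp_all add: tails_def)

lemma con_fam: "a : cr (Val P (X', X)) ==> x : fam X' Xs ==> con a x : fam X (X' # Xs)"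
proof -
 assume a: "a : cr (Val P (X', X))" and x: "x : fam X' Xs"
 have "con a x i : cr (fac X (X' # Xs) i)" if "i \<le> Suc (length Xs)" for i
using that a x by (cases i) (auto simp: fam_def)
 moreover have "con a x i = undefined" if "~ i \<le> Suc (length Xs)" for i
using that x by (cases i) (auto simp: fam_def PiE_iff extensional_def)
 ultimately show ?thesis by (auto simp: fam_def PiE_iff extensional_def)
qed

lemma gen_cases:
 assumes "Ys : chs n X" "x : fam X Ys"
 obtains X' Xs a y where "Ys = X' # Xs" "x = con a y" "rel X' X" "tp X'" "Xs : tails n X'"
 "a : cr (Val P (X', X))" "y : fam X' Xs"
proof -
 obtain X' Xs where Ys: "Ys = X' # Xs" using chsD(2)[OF assms(1)] by (cases Ys) auto
 have a: "projl (x 0) : cr (Val P (X', X))" "x 0 = Inl (projl (x 0))" using fam_l[OF assms(2), of 0] Ys by auto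
 have x: "x = con (projl (x 0)) (%i. x (Suc i))"
 proof
 fix i show "x i = con (projl (x 0)) (%i. x (Suc i)) i" using a(2) by (cases i) simp_all
 qed
 have "x (Suc i) : cr (fac X' Xs i)" if "i \<le> length Xs" for i
using assms(2) that by (auto simp: fam_def Ys PiE_iff dest!: bspec[of _ _ "Suc i"])
 moreover have "x (Suc i) = undefined" if "~ i \<le> length Xs" for i
using assms(2) that by (auto simp: fam_def Ys PiE_iff extensional_def)
 ultimately have "(%i. x (Suc i)) : fam X' Xs" by (auto simp: fam_def PiE_iff extensional_def)
 thus thesis using that[OF Ys x] assms(1) a(1) by (simp add: Ys chs_Cons)
qed

lemma bg_con_lin:
 assumes X: "tp X" and Xs: "X' # Xs : chs n X" and y: "y : fam X' Xs"
 shows "mlinear R (Val P (X', X)) (Bar n X) (%a. bg X (X' # Xs) (con a y))"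
proof -
 have r: "rel X' X" using Xs by (simp add: chs_Cons)
 interpret V: Module.module R "Val P (X', X)" by (rule Val_mod[OF r])
 have "con \<zero>\<^bsub>Val P (X', X)\<^esub> y : fam X (X' # Xs)" by (rule con_fam[OF _ y]) simp
 hence "mlinear R (fac X (X' # Xs) 0) (Bar n X) (%u. bg X (X' # Xs) ((con \<zero>\<^bsub>Val P (X', X)\<^esub> y)(0 := u)))"
using multilinD(2)[OF bg_multilin[OF X Xs], of _ 0] by (simp add: fam_chs[OF Xs])
 moreover have "(con z y)(0 := Inl a) = con a y" for z a
 proof
 fix i show "((con z y)(0 := Inl a)) i = con a y i" by (cases i) simp_all
 qed
 ultimately show ?thesis by (simp add: mlinear_from_tag)
qed

definition h0 :: "'c => 'w => ('c \<times> 'c \<times> 'c, 'c \<times> 'c, 'r, 'v, 'w) bar_elem" where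
 "h0 X w = bg X [X] (con (un X) (\<lambda>i\<in>{..0}. Inr w))"

text \<open>Only linearity and the values on generators are ever used, so a choice suffices;
  \<open>Bar_lift\<close> shows that such a map exists. The inserted entry is the base, which the
  action changes, so \<open>h\<close> is not a homomorphism of modules over the operad.\<close>

definition h :: "nat => 'c => ('c \<times> 'c \<times> 'c, 'c \<times> 'c, 'r, 'v, 'w) bar_elem => ('c \<times> 'c \<times> 'c, 'c \<times> 'c, 'r, 'v, 'w) bar_elem" where
 "h n X = (SOME f. mlinear R (Bar n X) (Bar (Suc n) X) f \<and>
 (ALL Xs:chs n X. ALL x:fam X Xs. f (bg X Xs x) = bg X (X # Xs) (con (un X) x)))"

text \<open>An arrow \<open>(X', X)\<close> moves the base of a chain from \<open>X'\<close> to
  \<open>X\<close>. The list stays the same, and \<open>p\<close> is composed into the first factor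
  only.\<close>

definition ac :: "nat => 'c \<times> 'c => ('c \<times> 'c \<times> 'c, 'c \<times> 'c, 'r, 'v, 'w) bar_elem => 'v =>
 ('c \<times> 'c \<times> 'c, 'c \<times> 'c, 'r, 'v, 'w) bar_elem" where
 "ac n al y p = (SOME f. mlinear R (Bar n (fst al)) (Bar n (snd al)) f \<and>
 (ALL Xs:chs n (fst al). ALL x:fam (fst al) Xs.
 f (bg (fst al) Xs x) = bg (snd al) Xs (x(0 := Inl (Gam P (hd Xs, fst al, snd al) (projl (x 0)) p))))) y"

lemma Inr_fam: "w : cr (MVal N X) ==> (\<lambda>i\<in>{..0}. Inr w) : fam X []"
by (simp add: fam_def fac_def)

lemma single_chs: "tp X ==> [X] : chs 0 X"
by (simp add: chs_Cons tp_refl)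

lemma h0_lin:
 assumes X: "tp X" shows "mlinear R (MVal N X) (Bar 0 X) (h0 X)"
proof -
 interpret N: Module.module R "MVal N X" by (rule N_mod[OF X])
 let ?z = "con (un X) (\<lambda>i\<in>{..0}. Inr \<zero>\<^bsub>MVal N X\<^esub>)"
 have "?z : fam X [X]" by (rule con_fam[OF un_closed[OF tp_refl[OF X]] Inr_fam]) simp
 hence "mlinear R (fac X [X] (Suc 0)) (Bar 0 X) (%u. bg X [X] (?z(Suc 0 := u)))"
using multilinD(2)[OF bg_multilin[OF X single_chs[OF X]], of _ "Suc 0"] by (simp add: fam_chs[OF single_chs[OF X]])
 moreover have "?z(Suc 0 := Inr w) = con (un X) (\<lambda>i\<in>{..0}. Inr w)" for w
 proof
 fix i show "(?z(Suc 0 := Inr w)) i = con (un X) (\<lambda>i\<in>{..0}. Inr w) i" by (cases i) auto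
 qed
 moreover have "fac X [X] (Suc 0) = tag_module Inr (MVal N X)" by (simp add: fac_def)
 ultimately show ?thesis by (simp add: mlinear_from_tag h0_def[abs_def])
qed

lemma cons_chs: "tp X ==> Xs : chs n X ==> X # Xs : chs (Suc n) X"
by (simp add: chs_Cons tp_refl)

lemma
 assumes X: "tp X"
 shows h_lin: "mlinear R (Bar n X) (Bar (Suc n) X) (h n X)"
and h_bg: "Xs : chs n X ==> x : fam X Xs ==> h n X (bg X Xs x) = bg X (X # Xs) (con (un X) x)"
proof -
 have v: "multilin R {..Suc n} (fac X Xs) (Bar (Suc n) X) (%x. bg X (X # Xs) (con (un X) x))" if Xs: "Xs : chs n X" for Xs
 proof (rule multilin_reindex[OF bg_multilin[OF X cons_chs[OF X Xs]]])
 fix x assume "x : Pi\<^sub>E {..Suc n} (%i. cr (fac X Xs i))"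
 hence x: "x : fam X Xs" by (simp add: fam_chs[OF Xs])
 show "con (un X) x : Pi\<^sub>E {..Suc (Suc n)} (%i. cr (fac X (X # Xs) i))"
using con_fam[OF un_closed[OF tp_refl[OF X]] x] by (simp add: fam_chs[OF cons_chs[OF X Xs]])
 fix k assume k: "k : {..Suc n}"
 have "con (un X) (x(k := u)) = (con (un X) x)(Suc k := u)" for u
 proof
 fix i show "con (un X) (x(k := u)) i = ((con (un X) x)(Suc k := u)) i" by (cases i) simp_all
 qed
 thus "EX j:{..Suc (Suc n)}. EX l. mlinear R (fac X Xs k) (fac X (X # Xs) j) l \<and>
 (ALL u:cr (fac X Xs k). con (un X) (x(k := u)) = (con (un X) x)(j := l u))"
using k by (intro bexI[of _ "Suc k"] exI[of _ "%u. u"]) (auto simp: lin_id)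
 qed (use fac_mod[OF Xs] in auto)
 have "EX f. mlinear R (Bar n X) (Bar (Suc n) X) f \<and>
 (ALL Xs:chs n X. ALL x:fam X Xs. f (bg X Xs x) = bg X (X # Xs) (con (un X) x))"
using Bar_lift[OF X Bar_mod[OF X] v] by metis
 from someI_ex[OF this, folded h_def]
 show "mlinear R (Bar n X) (Bar (Suc n) X) (h n X)"
and "Xs : chs n X ==> x : fam X Xs ==> h n X (bg X Xs x) = bg X (X # Xs) (con (un X) x)" by blast+
qed

lemma chs_rebase:
 assumes "Xs : chs n X'" "rel X' X" shows "Xs : chs n X"
proof -
 obtain X0 Ys where Xs: "Xs = X0 # Ys" using chsD(2)[OF assms(1)] by (cases Xs) auto
 show ?thesis using assms rel_trans unfolding Xs chs_Cons by blast
qed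

lemma
 assumes X': "tp X'" and r: "rel X' X" and p: "p : cr (Val P (X', X))"
 shows ac_lin: "mlinear R (Bar n X') (Bar n X) (%y. ac n (X', X) y p)"
and ac_bg: "Xs : chs n X' ==> x : fam X' Xs ==>
 ac n (X', X) (bg X' Xs x) p = bg X Xs (x(0 := Inl (Gam P (hd Xs, X', X) (projl (x 0)) p)))"
proof -
 note X = tp_down[OF X' r]
 let ?m = "%Xs x. x(0 := Inl (Gam P (hd Xs, X', X) (projl (x 0)) p))"
 have v: "multilin R {..Suc n} (fac X' Xs) (Bar n X) (%x. bg X Xs (?m Xs x))" if Xs: "Xs : chs n X'" for Xs
 proof (rule multilin_reindex[OF bg_multilin[OF X chs_rebase[OF Xs r]]])
 obtain X0 Ys where Y: "Xs = X0 # Ys" using chsD(2)[OF Xs] by (cases Xs) auto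
 have r0: "rel X0 X'" using Xs by (simp add: Y chs_Cons)
 fix x assume "x : Pi\<^sub>E {..Suc n} (%i. cr (fac X' Xs i))"
 hence x: "x : fam X' Xs" by (simp add: fam_chs[OF Xs])
 obtain a y where xy: "x = con a y" "a : cr (Val P (X0, X'))" "y : fam X0 Ys"
using gen_cases[OF Xs x] unfolding Y by blast
 have m: "?m Xs (con b z) = con (Gam P (X0, X', X) b p) z" for b z
 proof
 fix i show "?m Xs (con b z) i = con (Gam P (X0, X', X) b p) z i" by (cases i) (simp_all add: Y)
 qed
 show "?m Xs x : Pi\<^sub>E {..Suc n} (%j. cr (fac X Xs j))"
unfolding xy(1) m fam_chs[OF chs_rebase[OF Xs r], symmetric] unfolding Y
by (rule con_fam[OF Gam_closed[OF r0 r xy(2) p] xy(3)])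
 fix k assume k: "k : {..Suc n}"
 show "EX j:{..Suc n}. EX l. mlinear R (fac X' Xs k) (fac X Xs j) l \<and>
 (ALL u:cr (fac X' Xs k). ?m Xs (x(k := u)) = (?m Xs x)(j := l u))"
 proof (cases k)
 case 0
 have "mlinear R (fac X' Xs 0) (fac X Xs 0) (%u. Inl (Gam P (X0, X', X) (projl u) p))"
unfolding Y fac_Cons by (rule mlinear_projl[OF mlinear_into_tag[OF inj_Inl bilinD(2)[OF Gam_bil[OF r0 r] p]]])
 thus ?thesis unfolding 0 by (intro bexI[of _ 0] exI conjI) (auto simp: Y fun_eq_iff)
 next
 case (Suc m)
 have "fac X' Xs k = fac X Xs k" unfolding Suc Y by simp
 thus ?thesis using k Suc by (intro bexI[of _ k] exI[of _ "%u. u"]) (auto simp: lin_id fun_eq_iff)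
 qed
 qed (use fac_mod[OF Xs] in auto)
 have "EX f. mlinear R (Bar n X') (Bar n X) f & (ALL Xs:chs n X'. ALL x:fam X' Xs. f (bg X' Xs x) = bg X Xs (?m Xs x))"
using Bar_lift[OF X' Bar_mod[OF X] v] by metis
 from someI_ex[OF this]
 have "mlinear R (Bar n X') (Bar n X) (%y. ac n (X', X) y p) \<and>
 (ALL Xs:chs n X'. ALL x:fam X' Xs. ac n (X', X) (bg X' Xs x) p = bg X Xs (?m Xs x))"
by (simp add: ac_def)
 thus "mlinear R (Bar n X') (Bar n X) (%y. ac n (X', X) y p)"
and "Xs : chs n X' ==> x : fam X' Xs ==> ac n (X', X) (bg X' Xs x) p = bg X Xs (?m Xs x)" by blast+
qed

lemma ac_con:
 assumes "tp X'" "rel X' X" "p : cr (Val P (X', X))" "X0 # Xs : chs n X'"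
 "a : cr (Val P (X0, X'))" "y : fam X0 Xs"
 shows "ac n (X', X) (bg X' (X0 # Xs) (con a y)) p = bg X (X0 # Xs) (con (Gam P (X0, X', X) a p) y)"
proof -
 have "(con a y)(0 := Inl b) = con b y" for b
 proof
 fix i show "((con a y)(0 := Inl b)) i = con b y i" by (cases i) simp_all
 qed
 thus ?thesis using ac_bg[OF assms(1-3,4) con_fam[OF assms(5,6)]] by simp
qed

lemma Bar_eqI':
 assumes "tp X" "rmod R B" "mlinear R (Bar n X) B f" "mlinear R (Bar n X) B g"
and "!!X' Xs a y. X' # Xs : chs n X ==> rel X' X ==> tp X' ==> Xs : tails n X' ==> a : cr (Val P (X', X)) ==>
 y : fam X' Xs ==> f (bg X (X' # Xs) (con a y)) = g (bg X (X' # Xs) (con a y))"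
and "z : cr (Bar n X)"
 shows "f z = g z"
proof (rule Bar_eqI[OF assms(1-4) _ assms(6)])
 fix Xs x assume Xs: "Xs : chs n X" and x: "x : fam X Xs"
 show "f (bg X Xs x) = g (bg X Xs x)"
using Xs x by (rule gen_cases) (use assms(5) Xs in auto)
qed

text \<open>The maps for different \<open>p\<close> were chosen separately, so linearity in
  \<open>p\<close> is compared on generators, where it is linearity of \<open>Gam\<close> in its
  second argument.\<close>

lemma ac_bil:
 assumes X': "tp X'" and r: "rel X' X"
 shows "mbilinear R (Bar n X') (Val P (X', X)) (Bar n X) (ac n (X', X))"
unfolding mbilinear_def
proof (intro conjI ballI)
 note X = tp_down[OF X' r]
 interpret V: Module.module R "Val P (X', X)" by (rule Val_mod[OF r])
 fix y assume y: "y : cr (Bar n X')"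
 have lin: "mlinear R (Val P (X', X)) (Bar n X) (%p. bg X (X0 # Xs) (con (Gam P (X0, X', X) a p) z))"
 if "X0 # Xs : chs n X'" "a : cr (Val P (X0, X'))" "z : fam X0 Xs" for X0 Xs a z
by (rule lin_comp[OF bilinD(1)[OF Gam_bil[OF _ r] that(2)] bg_con_lin[OF X chs_rebase[OF that(1) r] that(3)]])
 (use that in "simp add: chs_Cons")
 note acl = ac_lin[OF X' r]
 show "mlinear R (Val P (X', X)) (Bar n X) (ac n (X', X) y)"
 proof (rule mlinearI)
 fix p assume p: "p : cr (Val P (X', X))"
 show "ac n (X', X) y p : cr (Bar n X)" by (rule lin_in[OF acl[OF p] y])
 show "ac n (X', X) y (p \<oplus>\<^bsub>Val P (X', X)\<^esub> q) = ac n (X', X) y p \<oplus>\<^bsub>Bar n X\<^esub> ac n (X', X) y q"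
 if q: "q : cr (Val P (X', X))" for q
by (rule Bar_eqI'[OF X' Bar_mod[OF X] acl mlinear_plus[OF Bar_mod[OF X] acl[OF p] acl[OF q]] _ y])
 (use p q lin_add[OF lin p q] in "auto simp: ac_con[OF X' r]")
 show "ac n (X', X) y (c \<odot>\<^bsub>Val P (X', X)\<^esub> p) = c \<odot>\<^bsub>Bar n X\<^esub> ac n (X', X) y p" if c: "c : cr R" for c
by (rule Bar_eqI'[OF X' Bar_mod[OF X] acl mlinear_scale[OF Bar_mod[OF X] acl[OF p] c] _ y])
 (use p c lin_smult[OF lin c p] in "auto simp: ac_con[OF X' r]")
 qed
qed (rule ac_lin[OF X' r])

lemma ac_closed: "tp X' ==> rel X' X ==> y : cr (Bar n X') ==> p : cr (Val P (X', X)) ==>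
 ac n (X', X) y p : cr (Bar n X)"
using lin_in[OF ac_lin] by blast

lemma Bar_pmodule: "unital_pmodule Cat Mdu R P \<lparr>MVal = Bar n, Act = ac n\<rparr>"
proof (intro unital_pmodule.intro unital_pmodule_axioms.intro unital_operad_axioms left_operadic_module_axioms)
 show "rmod R (MVal \<lparr>MVal = Bar n, Act = ac n\<rparr> L)" if "L : MObj Mdu" for L
using that by (simp add: Bar_mod)
 show "mbilinear R (MVal \<lparr>MVal = Bar n, Act = ac n\<rparr> (MFib Mdu al)) (Val P S) (MVal \<lparr>MVal = Bar n, Act = ac n\<rparr> L)
 (Act \<lparr>MVal = Bar n, Act = ac n\<rparr> al)" if "al : hom_opmod Mdu L S" for al L S
using that by (auto simp: ac_bil)
 show "Act \<lparr>MVal = Bar n, Act = ac n\<rparr> al x (Gam P g y z) =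
 Act \<lparr>MVal = Bar n, Act = ac n\<rparr> (Post Mdu g al) (Act \<lparr>MVal = Bar n, Act = ac n\<rparr> (MInd Mdu g al) x y) z"
 if a: "al : hom_opmod Mdu L B" and g: "g : hom_opcat Cat B C"
and xyz: "x : cr (MVal \<lparr>MVal = Bar n, Act = ac n\<rparr> (MFib Mdu al))"
 "y : cr (Val P (Fib Cat g))" "z : cr (Val P C)" for al L B g C x y z
 proof -
 obtain X' where X': "al = (X', L)" "B = (X', L)" "tp X'" "rel X' L" "tp L" using a by auto
 obtain X'' where X'': "g = (X', X'', L)" "C = (X'', L)" "rel X' X''" "rel X'' L" using g X' by auto
 note t'' = tp_down[OF X'(3) X''(3)]
 have y: "y : cr (Val P (X', X''))" and z: "z : cr (Val P (X'', L))" using xyz X'' by auto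
 have "ac n (X', L) x (Gam P (X', X'', L) y z) = ac n (X'', L) (ac n (X', X'') x y) z"
by (rule Bar_eqI'[OF X'(3) Bar_mod[OF X'(5)] ac_lin[OF X'(3,4) Gam_closed[OF X''(3,4) y z]]
 lin_comp[OF ac_lin[OF X'(3) X''(3) y] ac_lin[OF t'' X''(4) z]]])
 (use xyz X' X'' t'' y z in "auto simp: ac_con Gam_closed Gam_assoc chs_rebase[OF _ X''(3)]")
 thus ?thesis by (simp add: X' X'')
 qed
 show "Act \<lparr>MVal = Bar n, Act = ac n\<rparr> (MInd Mdu (Idn Cat T) al) x (Unt P T) = x"
 if a: "al : hom_opmod Mdu L T" and x: "x : cr (MVal \<lparr>MVal = Bar n, Act = ac n\<rparr> (MFib Mdu al))" for al L T x
 proof -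
 obtain X' where X': "al = (X', L)" "T = (X', L)" "tp X'" "rel X' L" using a by auto
 note r = tp_refl[OF X'(3)]
 have "ac n (X', X') x (un X') = x"
by (rule Bar_eqI'[OF X'(3) Bar_mod[OF X'(3)] ac_lin[OF X'(3) r un_closed[OF r]] lin_id])
 (use x X' r in "auto simp: ac_con un_closed Gam_un_right")
 thus ?thesis using X' by (simp add: Unt_eq)
 qed
qed

lemma mrg_0:
 assumes "Xs ~= []" "y : fam X' Xs"
 shows "mrg X (X' # Xs) 0 (con a y) = y(0 := Inl (Gam P (Xs ! 0, X', X) (projl (y 0)) a))"
proof
 fix j show "mrg X (X' # Xs) 0 (con a y) j = (y(0 := Inl (Gam P (Xs ! 0, X', X) (projl (y 0)) a))) j"
using assms by (cases j) (auto simp: mrg_def mm_def fam_def PiE_iff extensional_def)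
qed

lemma mrg_Suc:
 assumes "Xs ~= []" shows "mrg X (X' # Xs) (Suc i) (con a y) = con a (mrg X' Xs i y)"
proof
 have mm: "mm X (X' # Xs) (Suc i) (con a y) = mm X' Xs i y" using assms by (simp add: mm_def)
 have l: "Suc j \<le> length Xs \<longleftrightarrow> j \<le> length Xs - 1" for j using assms by (cases Xs) auto
 fix j show "mrg X (X' # Xs) (Suc i) (con a y) j = con a (mrg X' Xs i y) j"
by (cases j) (auto simp: mrg_def mm l)
qed

lemma del_Cons: "del 0 (X # Xs) = Xs" "del (Suc i) (X # Xs) = X # del i Xs"
by (simp_all add: del_def)

lemma dup_Cons: "dup 0 (X # Xs) = X # X # Xs" "dup (Suc j) (X # Xs) = X # dup j Xs"
by (simp_all add: dup_def)

lemma dg_Suc: "dg (X # Xs) (Suc j) (con a y) = con a (dg Xs j y)"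
proof
 fix k show "dg (X # Xs) (Suc j) (con a y) k = con a (dg Xs j y) k"
 proof (cases k)
 case (Suc m)
 thus ?thesis by (cases m) (auto simp: dg_def)
 qed (simp add: dg_def)
qed

lemma dg_0: "y : fam X' Xs ==> dg (X # Xs) 0 (con a y) = con a (con (un X) y)"
proof
 fix k assume y: "y : fam X' Xs"
 show "dg (X # Xs) 0 (con a y) k = con a (con (un X) y) k"
 proof (cases k)
 case (Suc m)
 thus ?thesis using y by (cases m) (auto simp: dg_def fam_def PiE_iff extensional_def)
 qed (simp add: dg_def)
qed

lemma face_con_0:
 assumes X: "tp X" and Xs: "X' # Xs : chs (Suc n) X" and a: "a : cr (Val P (X', X))" and y: "y : fam X' Xs"
 shows "Bface (Suc n) X 0 (bg X (X' # Xs) (con a y)) =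
 bg X Xs (y(0 := Inl (Gam P (Xs ! 0, X', X) (projl (y 0)) a)))"
proof -
 have "Xs ~= []" using chsD(1)[OF Xs] by auto
 thus ?thesis
using bar_face_lin(2)[OF X _ Xs con_fam[OF a y], of 0] mrg_0[OF _ y] by (simp add: del_Cons)
qed

lemma face_con_Suc:
 assumes X: "tp X" and Xs: "X' # Xs : chs (Suc n) X" and a: "a : cr (Val P (X', X))" and y: "y : fam X' Xs"
and i: "i \<le> n"
 shows "Bface (Suc n) X (Suc i) (bg X (X' # Xs) (con a y)) = bg X (X' # del i Xs) (con a (mrg X' Xs i y))"
proof -
 have "Xs ~= []" using chsD(1)[OF Xs] by auto
 thus ?thesis
using bar_face_lin(2)[OF X _ Xs con_fam[OF a y], of "Suc i"] i mrg_Suc by (simp add: del_Cons)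
qed

lemma aug_con:
 assumes X: "tp X" and X': "[X'] : chs 0 X" and a: "a : cr (Val P (X', X))" and y: "y : fam X' []"
 shows "Baug X (bg X [X'] (con a y)) = Act N (X', X) (projr (y 0)) a"
using bar_aug_lin(2)[OF X X' con_fam[OF a y]] by simp

lemma fam_Nil: "y : fam X [] ==> projr (y 0) : cr (MVal N X) & y = (\<lambda>i\<in>{..0}. Inr (projr (y 0)))"
using fam_r[of y X "[]"] by (auto simp: fam_def PiE_iff extensional_def fun_eq_iff)

text \<open>This face merges the inserted unit with the factor next to it, which the right unit law
  undoes.\<close>

lemma face_0_h:
 assumes X: "tp X" and z: "z : cr (Bar n X)"
 shows "Bface (Suc n) X 0 (h n X z) = z"
proof (rule Bar_eqI[OF X Bar_mod[OF X] lin_comp[OF h_lin[OF X] bar_face_lin(1)[OF X]] lin_id _ z])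
 fix Xs x assume Xs: "Xs : chs n X" and x: "x : fam X Xs"
 have l: "0 < length Xs" using chsD(2)[OF Xs] by simp
 have "Gam P (Xs ! 0, X, X) (projl (x 0)) (un X) = projl (x 0)"
by (rule Gam_un_right) (use fam_l[OF x l] chs_base[OF Xs, of 0] in auto)
 moreover have "x(0 := Inl (projl (x 0))) = x" using fam_l[OF x l] by auto
 ultimately show "Bface (Suc n) X 0 (h n X (bg X Xs x)) = bg X Xs x"
using face_con_0[OF X cons_chs[OF X Xs] un_closed[OF tp_refl[OF X]] x] by (simp add: h_bg[OF X Xs x])
qed simp

text \<open>The inserted unit sits in front of everything these faces touch, so they are merely
  shifted by one position.\<close>

lemma face_Suc_h:
 assumes X: "tp X" and z: "z : cr (Bar (Suc n) X)" and i: "i \<le> Suc n"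
 shows "Bface (Suc (Suc n)) X (Suc i) (h (Suc n) X z) = h n X (Bface (Suc n) X i z)"
proof (rule Bar_eqI[OF X Bar_mod[OF X] lin_comp[OF h_lin[OF X] bar_face_lin(1)[OF X]]
 lin_comp[OF bar_face_lin(1)[OF X i] h_lin[OF X]] _ z])
 fix Xs x assume Xs: "Xs : chs (Suc n) X" and x: "x : fam X Xs"
 show "Bface (Suc (Suc n)) X (Suc i) (h (Suc n) X (bg X Xs x)) =
 h n X (Bface (Suc n) X i (bg X Xs x))"
using face_con_Suc[OF X cons_chs[OF X Xs] un_closed[OF tp_refl[OF X]] x i]
by (simp add: h_bg[OF X Xs x] bar_face_lin(2)[OF X i Xs x] h_bg[OF X chs_del[OF Xs i] mrg_fam[OF Xs x i]])
qed (use i in simp)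

text \<open>Here the shifted face is the last one: the operad factor acts on the module factor,
  which is the augmentation, and only the inserted unit is left in front.\<close>

lemma face_1_h:
 assumes X: "tp X" and z: "z : cr (Bar 0 X)"
 shows "Bface (Suc 0) X (Suc 0) (h 0 X z) = h0 X (Baug X z)"
proof (rule Bar_eqI'[OF X Bar_mod[OF X] lin_comp[OF h_lin[OF X] bar_face_lin(1)[OF X]]
 lin_comp[OF bar_aug_lin(1)[OF X] h0_lin[OF X]] _ z])
 fix X' Xs a y assume c: "X' # Xs : chs 0 X" and t: "Xs : tails 0 X'" and a: "a : cr (Val P (X', X))" and y: "y : fam X' Xs"
 have Xs: "Xs = []" using t by simp
 have "mrg X [X'] 0 (con a y) = (\<lambda>i\<in>{..0}. Inr (Act N (X', X) (projr (y 0)) a))"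
by (auto simp: mrg_def mm_def fun_eq_iff)
 thus "Bface (Suc 0) X (Suc 0) (h 0 X (bg X (X' # Xs) (con a y))) =
 h0 X (Baug X (bg X (X' # Xs) (con a y)))"
using face_con_Suc[OF X cons_chs[OF X c] un_closed[OF tp_refl[OF X]] con_fam[OF a y], of 0]
 aug_con[OF X _ a, of y] c y h_bg[OF X c con_fam[OF a y]] by (simp add: Xs h0_def del_def)
qed simp

text \<open>Only the first face meets the factor changed by \<open>p\<close>; there the claim is
  associativity of \<open>Gam\<close>.\<close>

lemma face_ac:
 assumes X': "tp X'" and r: "rel X' X" and p: "p : cr (Val P (X', X))" and i: "i \<le> Suc n"
and z: "z : cr (Bar (Suc n) X')"
 shows "Bface (Suc n) X i (ac (Suc n) (X', X) z p) =
 ac n (X', X) (Bface (Suc n) X' i z) p"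
proof (rule Bar_eqI'[OF X' Bar_mod lin_comp[OF ac_lin[OF X' r p] bar_face_lin(1)[OF _ i]]
 lin_comp[OF bar_face_lin(1)[OF X' i] ac_lin[OF X' r p]] _ z])
 note X = tp_down[OF X' r]
 show "tp X" "tp X" by fact+
 fix X0 Xs a y assume c: "X0 # Xs : chs (Suc n) X'" and r0: "rel X0 X'" and Xs: "Xs : tails (Suc n) X0"
and a: "a : cr (Val P (X0, X'))" and y: "y : fam X0 Xs"
 have Xs': "Xs : chs n X0" using Xs by simp
 hence ne: "Xs ~= []" by (rule chsD(2))
 note cX = chs_rebase[OF c r] and b = Gam_closed[OF r0 r a p]
 show "Bface (Suc n) X i (ac (Suc n) (X', X) (bg X' (X0 # Xs) (con a y)) p) =
 ac n (X', X) (Bface (Suc n) X' i (bg X' (X0 # Xs) (con a y))) p"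
 proof (cases i)
 case 0
 obtain X1 Ys a' y' where Y: "Xs = X1 # Ys" "y = con a' y'" "rel X1 X0" "a' : cr (Val P (X1, X0))" "y' : fam X1 Ys"
using gen_cases[OF Xs' y] by metis
 have u: "(con a' y')(0 := Inl q) = con q y'" for q
 proof
 fix i show "((con a' y')(0 := Inl q)) i = con q y' i" by (cases i) simp_all
 qed
 have c': "X1 # Ys : chs n X'" using chs_rebase[OF Xs' r0] Y(1) by simp
 show ?thesis
unfolding 0 ac_con[OF X' r p c a y] face_con_0[OF X cX b y] face_con_0[OF X' c a y]
unfolding Y(1,2) u
using ac_con[OF X' r p c' Gam_closed[OF Y(3) r0 Y(4) a] Y(5)] Gam_assoc[OF Y(3) r0 r Y(4) a p]
by (simp add: u)
 next
 case (Suc k)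
 hence k: "k \<le> n" using i by simp
 have "X0 # del k Xs : chs n X'" using chs_del[OF c, of "Suc k"] k by (simp add: del_Cons)
 \<comment> \<open>\<open>mrg_fam\<close> concerns chains with at least two entries. For
   \<open>n = 0\<close> the tail has one entry and merging leaves a single module factor.\<close>
 moreover have "mrg X0 Xs k y : fam X0 (del k Xs)"
 proof (cases n)
 case 0
 obtain X1 where X1: "Xs = [X1]" using chsD(1)[OF Xs'] 0 by (auto simp: length_Suc_conv)
 have "mm X0 Xs k y : cr (fac X0 (del k Xs) k)" by (rule mm_closed[OF Xs' y k])
 thus ?thesis using k 0 X1 by (auto simp: mrg_def fam_def del_Cons)
 next
 case (Suc m)
 thus ?thesis using mrg_fam[of Xs m X0 y k] Xs' y k by simp
 qed
 ultimately show ?thesis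
unfolding Suc ac_con[OF X' r p c a y] face_con_Suc[OF X cX b y k] face_con_Suc[OF X' c a y k]
by (simp add: ac_con[OF X' r p _ a])
 qed
qed

lemma aug_ac:
 assumes X': "tp X'" and r: "rel X' X" and p: "p : cr (Val P (X', X))" and z: "z : cr (Bar 0 X')"
 shows "Baug X (ac 0 (X', X) z p) = Act N (X', X) (Baug X' z) p"
proof (rule Bar_eqI'[OF X' N_mod lin_comp[OF ac_lin[OF X' r p] bar_aug_lin(1)]
 lin_comp[OF bar_aug_lin(1)[OF X'] bilinD(2)[OF Act_bil[OF X' r] p]] _ z])
 note X = tp_down[OF X' r]
 show "tp X" "tp X" by fact+
 fix X0 Xs a y assume c: "X0 # Xs : chs 0 X'" and r0: "rel X0 X'" and t: "tp X0" and Xs: "Xs : tails 0 X0"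
and a: "a : cr (Val P (X0, X'))" and y: "y : fam X0 Xs"
 have Xs': "Xs = []" using Xs by simp
 have y': "y : fam X0 []" and c': "[X0] : chs 0 X'" using y c Xs' by simp_all
 show "Baug X (ac 0 (X', X) (bg X' (X0 # Xs) (con a y)) p) =
 Act N (X', X) (Baug X' (bg X' (X0 # Xs) (con a y))) p"
unfolding Xs' ac_con[OF X' r p c' a y'] aug_con[OF X chs_rebase[OF c' r] Gam_closed[OF r0 r a p] y'] aug_con[OF X' c' a y']
using Act_Gam[OF t r0 r _ a p] fam_Nil[OF y'] by blast
qed

lemma bar_diff_lin:
 assumes X: "tp X" shows "mlinear R (Bar (Suc n) X) (Bar n X) (Bdiff (Suc n) X)"
proof -
 have eq: "Bdiff (Suc n) X = (%x. finsum (Bar n X) (%i. if even i then Bface (Suc n) X i x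
 else \<ominus>\<^bsub>Bar n X\<^esub> Bface (Suc n) X i x) {..Suc n})"
by (simp add: bar_diff_def fun_eq_iff Let_def)
 show ?thesis unfolding eq
 proof (rule mlinear_finsum_fun[OF Bar_mod[OF X]])
 fix i assume "i : {..Suc n}"
 hence "mlinear R (Bar (Suc n) X) (Bar n X) (Bface (Suc n) X i)" by (intro bar_face_lin(1)[OF X]) simp
 thus "mlinear R (Bar (Suc n) X) (Bar n X) (%x. if even i then Bface (Suc n) X i x
 else \<ominus>\<^bsub>Bar n X\<^esub> Bface (Suc n) X i x)"
using mlinear_uminus[OF Bar_mod[OF X]] by (cases "even i") auto
 qed
qed

lemma diff_ac:
 assumes X': "tp X'" and r: "rel X' X" and p: "p : cr (Val P (X', X))" and z: "z : cr (Bar (Suc n) X')"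
 shows "Bdiff (Suc n) X (ac (Suc n) (X', X) z p) = ac n (X', X) (Bdiff (Suc n) X' z) p"
proof -
 note X = tp_down[OF X' r] and l = ac_lin[OF X' r p]
 interpret B: Module.module R "Bar n X" by (rule Bar_mod[OF X])
 interpret B': Module.module R "Bar n X'" by (rule Bar_mod[OF X'])
 let ?g = "%i. if even i then Bface (Suc n) X' i z else \<ominus>\<^bsub>Bar n X'\<^esub> Bface (Suc n) X' i z"
 have fc: "Bface (Suc n) X' i z : cr (Bar n X')" if "i \<le> Suc n" for i
by (rule lin_in[OF bar_face_lin(1)[OF X' that] z])
 have "ac n (X', X) (Bdiff (Suc n) X' z) p = finsum (Bar n X) (%i. ac n (X', X) (?g i) p) {..Suc n}"
unfolding bar_diff_def Let_def diff_Suc_1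
by (rule mlinear_finsum[OF Bar_mod[OF X'] Bar_mod[OF X] l]) (use fc in auto)
 also have "\<dots> = Bdiff (Suc n) X (ac (Suc n) (X', X) z p)"
unfolding bar_diff_def Let_def diff_Suc_1
by (rule B.finsum_cong')
 (use fc lin_in[OF l] in "auto simp: face_ac[OF X' r p _ z] mlinear_neg[OF Bar_mod[OF X'] Bar_mod[OF X] l]")
 finally show ?thesis ..
qed

lemma diff_h0:
 assumes X: "tp X" and z: "z : cr (Bar 0 X)"
 shows "Bdiff (Suc 0) X (h 0 X z) = z \<ominus>\<^bsub>Bar 0 X\<^esub> h0 X (Baug X z)"
proof -
 interpret B: Module.module R "Bar 0 X" by (rule Bar_mod[OF X])
 have "h0 X (Baug X z) : cr (Bar 0 X)"
using lin_in[OF h0_lin[OF X]] lin_in[OF bar_aug_lin(1)[OF X] z] by blast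
 thus ?thesis using z
by (simp add: bar_diff_def Let_def face_0_h[OF X z] face_1_h[OF X z] B.minus_eq B.add.m_comm atMost_Suc)
qed

text \<open>From \<open>d_0 h = id\<close> and \<open>d_{i+1} h = h d_i\<close>; the index shift
  reverses every sign, whence \<open>id - h d\<close>.\<close>

lemma diff_h:
 assumes X: "tp X" and z: "z : cr (Bar (Suc n) X)"
 shows "Bdiff (Suc (Suc n)) X (h (Suc n) X z) =
 z \<ominus>\<^bsub>Bar (Suc n) X\<^esub> h n X (Bdiff (Suc n) X z)"
proof -
 interpret B: Module.module R "Bar (Suc n) X" by (rule Bar_mod[OF X])
 note l = h_lin[OF X, of n]
 let ?f = "%i. Bface (Suc n) X i z"
 let ?g = "%i. if even i then ?f i else \<ominus>\<^bsub>Bar n X\<^esub> ?f i"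
 have fc: "?f i : cr (Bar n X)" if "i \<le> Suc n" for i
by (rule lin_in[OF bar_face_lin(1)[OF X that] z])
 interpret B': Module.module R "Bar n X" by (rule Bar_mod[OF X])
 have gc: "?g i : cr (Bar n X)" if "i \<le> Suc n" for i using fc[OF that] by simp
 let ?u = "%i. if even i then Bface (Suc (Suc n)) X i (h (Suc n) X z)
 else \<ominus>\<^bsub>Bar (Suc n) X\<^esub> Bface (Suc (Suc n)) X i (h (Suc n) X z)"
 have u0: "?u 0 = z" by (simp add: face_0_h[OF X z])
 have uS: "?u (Suc i) = \<ominus>\<^bsub>Bar (Suc n) X\<^esub> h n X (?g i)" if "i \<le> Suc n" for i
using lin_in[OF l fc[OF that]] fc[OF that]
by (simp add: face_Suc_h[OF X z that] mlinear_neg[OF Bar_mod[OF X] Bar_mod[OF X] l])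
 have hg: "h n X (?g i) : cr (Bar (Suc n) X)" if "i \<le> Suc n" for i
by (rule lin_in[OF l gc[OF that]])
 have "Bdiff (Suc (Suc n)) X (h (Suc n) X z) = finsum (Bar (Suc n) X) ?u {..Suc (Suc n)}"
by (simp add: bar_diff_def Let_def)
 also have "\<dots> = finsum (Bar (Suc n) X) (%i. ?u (Suc i)) {..Suc n} \<oplus>\<^bsub>Bar (Suc n) X\<^esub> ?u 0"
 proof (rule B.finsum_Suc2)
 have "?u i : cr (Bar (Suc n) X)" if "i \<le> Suc (Suc n)" for i
 proof (cases i)
 case 0 show ?thesis unfolding 0 u0 by (rule z)
 next
 case (Suc m)
 show ?thesis unfolding Suc using uS[of m] hg[of m] that Suc by simp
 qed
 thus "?u : {..Suc (Suc n)} \<rightarrow> cr (Bar (Suc n) X)" by blast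
 qed
 also have "finsum (Bar (Suc n) X) (%i. ?u (Suc i)) {..Suc n} = finsum (Bar (Suc n) X) (%i. \<ominus>\<^bsub>Bar (Suc n) X\<^esub> h n X (?g i)) {..Suc n}"
by (rule B.finsum_cong') (use uS hg in auto)
 also have "\<dots> = \<ominus>\<^bsub>Bar (Suc n) X\<^esub> h n X (Bdiff (Suc n) X z)"
unfolding bar_diff_def Let_def diff_Suc_1
by (rule mlinear_finsum[OF Bar_mod[OF X] Bar_mod[OF X] mlinear_uminus[OF Bar_mod[OF X] l], symmetric]) (use gc in auto)
 finally show ?thesis unfolding u0
using z lin_in[OF l lin_in[OF bar_diff_lin[OF X] z]] by (simp add: B.minus_eq B.add.m_comm)
qed

lemma degen_ac:
 assumes X': "tp X'" and r: "rel X' X" and p: "p : cr (Val P (X', X))" and j: "j \<le> n" and z: "z : cr (Bar n X')"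
 shows "Bdegen n X j (ac n (X', X) z p) = ac (Suc n) (X', X) (Bdegen n X' j z) p"
proof (rule Bar_eqI[OF X' Bar_mod lin_comp[OF ac_lin[OF X' r p] bar_degen_lin(1)[OF _ j]]
 lin_comp[OF bar_degen_lin(1)[OF X' j] ac_lin[OF X' r p]] _ z])
 note X = tp_down[OF X' r]
 show "tp X" "tp X" by fact+
 fix Xs x assume Xs: "Xs : chs n X'" and x: "x : fam X' Xs"
 have ne: "Xs ~= []" by (rule chsD(2)[OF Xs])
 let ?q = "Inl (Gam P (hd Xs, X', X) (projl (x 0)) p)"
 have "x(0 := ?q) : fam X Xs"
using Xs x
 proof (rule gen_cases)
 fix X0 Ys a y assume g: "Xs = X0 # Ys" "x = con a y" "rel X0 X'" "a : cr (Val P (X0, X'))" "y : fam X0 Ys"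
 have "x(0 := ?q) = con (Gam P (X0, X', X) a p) y"
 proof
 fix i show "(x(0 := ?q)) i = con (Gam P (X0, X', X) a p) y i" by (cases i) (simp_all add: g)
 qed
 thus ?thesis using con_fam[OF Gam_closed[OF g(3) r g(4) p] g(5)] g(1) by simp
 qed
 moreover have "dg Xs j (x(0 := ?q)) = (dg Xs j x)(0 := ?q)" by (auto simp: dg_def fun_eq_iff)
 moreover have "hd (dup j Xs) = hd Xs" "dg Xs j x 0 = x 0" using ne by (cases Xs; auto simp: dup_def dg_def)+
 ultimately show "Bdegen n X j (ac n (X', X) (bg X' Xs x) p) =
 ac (Suc n) (X', X) (Bdegen n X' j (bg X' Xs x)) p"
using bar_degen_lin(2)[OF X j chs_rebase[OF Xs r]] ac_bg[OF X' r p chs_dup[OF Xs j] dg_fam[OF Xs x j]]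
by (simp add: ac_bg[OF X' r p Xs x] bar_degen_lin(2)[OF X' j Xs x])
qed

lemma degen_h:
 assumes X: "tp X" and j: "j \<le> n" and z: "z : cr (Bar n X)"
 shows "Bdegen (Suc n) X (Suc j) (h n X z) = h (Suc n) X (Bdegen n X j z)"
proof (rule Bar_eqI[OF X Bar_mod[OF X] lin_comp[OF h_lin[OF X] bar_degen_lin(1)[OF X]]
 lin_comp[OF bar_degen_lin(1)[OF X j] h_lin[OF X]] _ z])
 fix Xs x assume Xs: "Xs : chs n X" and x: "x : fam X Xs"
 show "Bdegen (Suc n) X (Suc j) (h n X (bg X Xs x)) = h (Suc n) X (Bdegen n X j (bg X Xs x))"
using bar_degen_lin(2)[OF X _ cons_chs[OF X Xs] con_fam[OF un_closed[OF tp_refl[OF X]] x], of "Suc j"] j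
 h_bg[OF X chs_dup[OF Xs j] dg_fam[OF Xs x j]]
by (simp add: h_bg[OF X Xs x] bar_degen_lin(2)[OF X j Xs x] dup_Cons dg_Suc)
qed (use j in simp)

text \<open>After \<open>X\<close> has been inserted in front, repeating the first entry and
  inserting \<open>X\<close> once more are the same operation, units included.\<close>

lemma degen_0_h:
 assumes X: "tp X" and z: "z : cr (Bar n X)"
 shows "Bdegen (Suc n) X 0 (h n X z) = h (Suc n) X (h n X z)"
proof (rule Bar_eqI[OF X Bar_mod[OF X] lin_comp[OF h_lin[OF X] bar_degen_lin(1)[OF X]]
 lin_comp[OF h_lin[OF X] h_lin[OF X]] _ z])
 fix Xs x assume Xs: "Xs : chs n X" and x: "x : fam X Xs"
 note ux = con_fam[OF un_closed[OF tp_refl[OF X]] x]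
 show "Bdegen (Suc n) X 0 (h n X (bg X Xs x)) = h (Suc n) X (h n X (bg X Xs x))"
using bar_degen_lin(2)[OF X _ cons_chs[OF X Xs] ux, of 0] h_bg[OF X cons_chs[OF X Xs] ux]
by (simp add: h_bg[OF X Xs x] dup_Cons dg_0[OF x])
qed simp

lemma degen_0_h0:
 assumes X: "tp X" and w: "w : cr (MVal N X)"
 shows "Bdegen 0 X 0 (h0 X w) = h 0 X (h0 X w)"
proof -
 note y = Inr_fam[OF w]
 note ux = con_fam[OF un_closed[OF tp_refl[OF X]] y]
 show ?thesis
using bar_degen_lin(2)[OF X _ single_chs[OF X] ux, of 0] h_bg[OF X single_chs[OF X] ux]
by (simp add: h0_def dup_Cons dg_0[OF y] del: atMost_0)
qed

text \<open>A generator with first factor \<open>a\<close> and remaining factors \<open>y\<close> is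
  \<open>a\<close> acting on \<open>h y\<close>, by the left unit law. Thus \<open>act_span\<close>
  already contains all generators.\<close>

lemma Bar_gen_Suc: "tp X ==> spans R (Bar (Suc n) X)
 (act_span Mdu P \<lparr>MVal = Bar (Suc n), Act = ac (Suc n)\<rparr> (%X. h n X ` cr (Bar n X)) X)"
proof (rule spans_mono[OF Bar_spans])
 assume X: "tp X"
 show "(%(Xs, x). bg X Xs x) ` Sigma (chs (Suc n) X) (fam X) \<subseteq>
 act_span Mdu P \<lparr>MVal = Bar (Suc n), Act = ac (Suc n)\<rparr> (%X. h n X ` cr (Bar n X)) X"
 proof clarsimp
 fix Ys x assume "Ys : chs (Suc n) X" "x : fam X Ys"
 thus "bg X Ys x : act_span Mdu P \<lparr>MVal = Bar (Suc n), Act = ac (Suc n)\<rparr> (%X. h n X ` cr (Bar n X)) X"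
 proof (rule gen_cases)
 fix X' Xs a y assume g: "Ys = X' # Xs" "x = con a y" "rel X' X" "tp X'" "Xs : tails (Suc n) X'"
 "a : cr (Val P (X', X))" "y : fam X' Xs"
 have Xs: "Xs : chs n X'" using g(5) by simp
 have "bg X Ys x = ac (Suc n) (X', X) (h n X' (bg X' Xs y)) a"
using ac_con[OF g(4,3,6) cons_chs[OF g(4) Xs] un_closed[OF tp_refl[OF g(4)]] g(7)]
by (simp add: g h_bg[OF g(4) Xs g(7)] Gam_un_left)
 thus ?thesis using g X bg_closed[OF g(4) Xs g(7)]
unfolding act_span_def by (auto intro!: exI[of _ "(X', X)"] exI[of _ "h n X' (bg X' Xs y)"] exI[of _ a])
 qed
 qed
 show "act_span Mdu P \<lparr>MVal = Bar (Suc n), Act = ac (Suc n)\<rparr> (%X. h n X ` cr (Bar n X)) X \<subseteq> cr (Bar (Suc n) X)"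
by (auto simp: act_span_def intro!: ac_closed lin_in[OF h_lin])
qed

lemma Bar_gen_0: "tp X ==> spans R (Bar 0 X)
 (act_span Mdu P \<lparr>MVal = Bar 0, Act = ac 0\<rparr> (%X. h0 X ` cr (MVal N X)) X)"
proof (rule spans_mono[OF Bar_spans])
 assume X: "tp X"
 show "(%(Xs, x). bg X Xs x) ` Sigma (chs 0 X) (fam X) \<subseteq>
 act_span Mdu P \<lparr>MVal = Bar 0, Act = ac 0\<rparr> (%X. h0 X ` cr (MVal N X)) X"
 proof clarsimp
 fix Ys x assume "Ys : chs 0 X" "x : fam X Ys"
 thus "bg X Ys x : act_span Mdu P \<lparr>MVal = Bar 0, Act = ac 0\<rparr> (%X. h0 X ` cr (MVal N X)) X"
 proof (rule gen_cases)
 fix X' Xs a y assume g: "Ys = X' # Xs" "x = con a y" "rel X' X" "tp X'" "Xs : tails 0 X'"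
 "a : cr (Val P (X', X))" "y : fam X' Xs"
 have Xs: "Xs = []" using g(5) by simp
 have y: "y : fam X' []" using g(7) Xs by simp
 obtain w where w: "w : cr (MVal N X')" "y = (\<lambda>i\<in>{..0}. Inr w)" using fam_Nil[OF y] by blast
 have "bg X Ys x = ac 0 (X', X) (h0 X' w) a"
using ac_con[OF g(4,3,6) single_chs[OF g(4)] un_closed[OF tp_refl[OF g(4)]] y] Gam_un_left[OF g(3,6)]
by (simp add: g(1,2) Xs h0_def w(2))
 thus ?thesis using g X w(1)
unfolding act_span_def by (auto intro!: exI[of _ "(X', X)"] exI[of _ "h0 X' w"] exI[of _ a])
 qed
 qed
 show "act_span Mdu P \<lparr>MVal = Bar 0, Act = ac 0\<rparr> (%X. h0 X ` cr (MVal N X)) X \<subseteq> cr (Bar 0 X)"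
by (auto simp: act_span_def intro!: ac_closed lin_in[OF h0_lin])
qed

text \<open>The formula is forced, since a generator is \<open>a\<close> acting on the extra
  degeneracy of its tail. \<open>T\<close> stands for that tail: the generator one degree lower, or
  the bare module element in degree zero. Multilinearity makes it well defined on tensors, and the
  module axiom of \<open>K\<close> makes it a homomorphism.\<close>

lemma Bar_hom_ext:
 assumes K: "unital_pmodule Cat Mdu R P K"
and Y: "!!X Xs. tp X ==> Xs : tails n X ==> multilin R {..n} (fac X Xs) (Y X) (T X Xs)"
and ps: "!!X. tp X ==> mlinear R (Y X) (MVal K X) (ps X)"
 shows "EX f. pmodule_hom Mdu R P \<lparr>MVal = Bar n, Act = ac n\<rparr> K f \<and>
 (ALL X. tp X --> (ALL X' Xs a y. X' # Xs : chs n X --> a : cr (Val P (X', X)) --> y : fam X' Xs -->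
 f X (bg X (X' # Xs) (con a y)) = Act K (X', X) (ps X' (T X' Xs y)) a))"
proof -
 interpret K: unital_pmodule Cat Mdu R P K by fact
 have Kmod: "rmod R (MVal K X)" if "tp X" for X using K.mval[of X] that by simp
 have Kbil: "mbilinear R (MVal K X') (Val P (X', X)) (MVal K X) (Act K (X', X))" if "tp X'" "rel X' X" for X' X
using K.act_arr[of "(X', X)"] that tp_down by simp
 let ?v = "%X Ys x. Act K (hd Ys, X) (ps (hd Ys) (T (hd Ys) (tl Ys) (%i. x (Suc i)))) (projl (x 0))"
 have v: "multilin R {..Suc n} (fac X Ys) (MVal K X) (?v X Ys)" if X: "tp X" and Ys: "Ys : chs n X" for X Ys
unfolding multilin_def
 proof (intro conjI ballI)
 fix x assume "x : Pi\<^sub>E {..Suc n} (%i. cr (fac X Ys i))"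
 hence x: "x : fam X Ys" by (simp add: fam_chs[OF Ys])
 obtain X' Xs a y where g: "Ys = X' # Xs" "x = con a y" "rel X' X" "tp X'" "Xs : tails n X'"
 "a : cr (Val P (X', X))" "y : fam X' Xs" using gen_cases[OF Ys x] by metis
 have l: "length Xs = n" using tails_length[OF g(5)] .
 have y: "y : Pi\<^sub>E {..n} (%i. cr (fac X' Xs i))" using g(7) l by (simp add: fam_def)
 note b = Kbil[OF g(4,3)]
 have c: "ps X' (T X' Xs y) : cr (MVal K X')"
by (rule lin_in[OF ps[OF g(4)] multilinD(1)[OF Y[OF g(4,5)] y]])
 show "?v X Ys x : cr (MVal K X)"
using lin_in[OF bilinD(1)[OF b c] g(6)] by (simp add: g(1,2))
 fix k assume k: "k : {..Suc n}"
 show "mlinear R (fac X Ys k) (MVal K X) (%u. ?v X Ys (x(k := u)))"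
 proof (cases k)
 case 0
 show ?thesis using mlinear_projl[OF bilinD(1)[OF b c]] by (simp add: 0 g(1,2))
 next
 case (Suc m)
 have e: "(%i. ((con a y)(Suc m := u)) (Suc i)) = y(m := u)" for u by (auto simp: fun_eq_iff)
 have "mlinear R (fac X' Xs m) (MVal K X) (%u. Act K (X', X) (ps X' (T X' Xs (y(m := u)))) a)"
by (rule lin_comp[OF lin_comp[OF multilinD(2)[OF Y[OF g(4,5)] y] ps[OF g(4)]] bilinD(2)[OF b g(6)]])
 (use k Suc in simp)
 moreover have "projl (((con a y)(Suc m := u)) 0) = a" for u by simp
 ultimately show ?thesis unfolding Suc g(1,2) list.sel e by simp
 qed
 qed
 have "EX f. mlinear R (Bar n X) (MVal K X) f & (ALL Ys:chs n X. ALL x:fam X Ys. f (bg X Ys x) = ?v X Ys x)" if X: "tp X" for X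
using Bar_lift[OF X Kmod[OF X] v[OF X]] by metis
 then obtain f where f: "!!X. tp X ==> mlinear R (Bar n X) (MVal K X) (f X)"
 "!!X Ys x. tp X ==> Ys : chs n X ==> x : fam X Ys ==> f X (bg X Ys x) = ?v X Ys x" by metis
 have fc: "f X (bg X (X' # Xs) (con a y)) = Act K (X', X) (ps X' (T X' Xs y)) a"
 if "tp X" "X' # Xs : chs n X" "a : cr (Val P (X', X))" "y : fam X' Xs" for X X' Xs a y
using f(2)[OF that(1,2) con_fam[OF that(3,4)]] by simp
 have hom: "f X (ac n (X', X) z p) = Act K (X', X) (f X' z) p"
 if X': "tp X'" and r: "rel X' X" and z: "z : cr (Bar n X')" and p: "p : cr (Val P (X', X))" for X' X z p
 proof (rule Bar_eqI'[OF X' Kmod lin_comp[OF ac_lin[OF X' r p] f(1)] lin_comp[OF f(1)[OF X'] bilinD(2)[OF Kbil[OF X' r] p]] _ z])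
 note X = tp_down[OF X' r]
 show "tp X" "tp X" by fact+
 fix X0 Xs a y assume c: "X0 # Xs : chs n X'" and r0: "rel X0 X'" and t: "tp X0" and Xs: "Xs : tails n X0"
and a: "a : cr (Val P (X0, X'))" and y: "y : fam X0 Xs"
 have y': "y : Pi\<^sub>E {..n} (%i. cr (fac X0 Xs i))" using y tails_length[OF Xs] by (simp add: fam_def)
 have "ps X0 (T X0 Xs y) : cr (MVal K X0)"
by (rule lin_in[OF ps[OF t] multilinD(1)[OF Y[OF t Xs] y']])
 thus "f X (ac n (X', X) (bg X' (X0 # Xs) (con a y)) p) = Act K (X', X) (f X' (bg X' (X0 # Xs) (con a y))) p"
using K.act_gam[of "(X0, X)" X "(X0, X)" "(X0, X', X)" "(X', X)" "ps X0 (T X0 Xs y)" a p] r0 r t X a p rel_trans[OF r0 r]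
by (simp add: ac_con[OF X' r p c a y] fc[OF X chs_rebase[OF c r] Gam_closed[OF r0 r a p] y] fc[OF X' c a y])
 qed
 have "pmodule_hom Mdu R P \<lparr>MVal = Bar n, Act = ac n\<rparr> K f"
using f(1) hom by (auto simp: pmodule_hom_def)
 thus ?thesis using fc by blast
qed

lemma Bar_free: "free_along TYPE('k) Cat Mdu R P \<lparr>MVal = Bar (Suc n), Act = ac (Suc n)\<rparr> (Bar n) (h n)"
unfolding free_along_def
proof (intro allI impI)
 fix K :: "('c, 'c \<times> 'c, 'r, 'v, 'k) pmodule" and ps
 assume K: "unital_pmodule Cat Mdu R P K" and ps: "ALL L:MObj Mdu. mlinear R (Bar n L) (MVal K L) (ps L)"
 interpret K: unital_pmodule Cat Mdu R P K by fact
 have ps': "!!X. tp X ==> mlinear R (Bar n X) (MVal K X) (ps X)" using ps by simp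
 have "!!X Xs. tp X ==> Xs : tails (Suc n) X ==> multilin R {..Suc n} (fac X Xs) (Bar n X) (bg X Xs)"
using bg_multilin by simp
 from Bar_hom_ext[OF K this ps'] obtain f where f: "pmodule_hom Mdu R P \<lparr>MVal = Bar (Suc n), Act = ac (Suc n)\<rparr> K f"
 "!!X X' Xs a y. tp X ==> X' # Xs : chs (Suc n) X ==> a : cr (Val P (X', X)) ==> y : fam X' Xs ==>
 f X (bg X (X' # Xs) (con a y)) = Act K (X', X) (ps X' (bg X' Xs y)) a" by blast
 have "f X (h n X z) = ps X z" if X: "tp X" and z: "z : cr (Bar n X)" for X z
 proof (rule Bar_eqI[OF X _ lin_comp[OF h_lin[OF X]] ps'[OF X] _ z])
 show "rmod R (MVal K X)" using K.mval[of X] X by simp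
 show "mlinear R (Bar (Suc n) X) (MVal K X) (f X)" using pmodule_homD(1)[OF f(1), of X] X by simp
 fix Xs x assume Xs: "Xs : chs n X" and x: "x : fam X Xs"
 have "ps X (bg X Xs x) : cr (MVal K X)" by (rule lin_in[OF ps'[OF X] bg_closed[OF X Xs x]])
 thus "f X (h n X (bg X Xs x)) = ps X (bg X Xs x)"
using f(2)[OF X cons_chs[OF X Xs] un_closed[OF tp_refl[OF X]] x] K.act_unt[of "(X, X)" X "(X, X)" "ps X (bg X Xs x)"] X
by (simp add: h_bg[OF X Xs x] tp_refl un_def)
 qed
 with f(1) show "EX f. pmodule_hom Mdu R P \<lparr>MVal = Bar (Suc n), Act = ac (Suc n)\<rparr> K f \<and>
 (ALL L:MObj Mdu. ALL y:cr (Bar n L). f L (h n L y) = ps L y)" by auto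
qed

lemma Bar_free0: "free_along TYPE('k) Cat Mdu R P \<lparr>MVal = Bar 0, Act = ac 0\<rparr> (MVal N) h0"
unfolding free_along_def
proof (intro allI impI)
 fix K :: "('c, 'c \<times> 'c, 'r, 'v, 'k) pmodule" and ps
 assume K: "unital_pmodule Cat Mdu R P K" and ps: "ALL L:MObj Mdu. mlinear R (MVal N L) (MVal K L) (ps L)"
 interpret K: unital_pmodule Cat Mdu R P K by fact
 have ps': "!!X. tp X ==> mlinear R (MVal N X) (MVal K X) (ps X)" using ps by simp
 have m: "multilin R {..0} (fac X Xs) (MVal N X) (%y. projr (y 0))" if "tp X" "Xs : tails 0 X" for X Xs
 proof -
 have "fac X Xs 0 = tag_module Inr (MVal N X)" using that by (simp add: fac_def)
 moreover have "mlinear R (tag_module Inr (MVal N X)) (MVal N X) projr" by (rule mlinear_untag) auto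
 ultimately show ?thesis using that(2)
by (auto simp: multilin_def PiE_iff dest: lin_in)
 qed
 from Bar_hom_ext[OF K m ps'] obtain f where f: "pmodule_hom Mdu R P \<lparr>MVal = Bar 0, Act = ac 0\<rparr> K f"
 "!!X X' Xs a y. tp X ==> X' # Xs : chs 0 X ==> a : cr (Val P (X', X)) ==> y : fam X' Xs ==>
 f X (bg X (X' # Xs) (con a y)) = Act K (X', X) (ps X' (projr (y 0))) a" by blast
 have "f X (h0 X w) = ps X w" if X: "tp X" and w: "w : cr (MVal N X)" for X w
 proof -
 have "ps X w : cr (MVal K X)" by (rule lin_in[OF ps'[OF X] w])
 thus ?thesis
using f(2)[OF X single_chs[OF X] un_closed[OF tp_refl[OF X]] Inr_fam[OF w]] K.act_unt[of "(X, X)" X "(X, X)" "ps X w"] X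
by (simp add: h0_def tp_refl un_def)
 qed
 with f(1) show "EX f. pmodule_hom Mdu R P \<lparr>MVal = Bar 0, Act = ac 0\<rparr> K f \<and>
 (ALL L:MObj Mdu. ALL y:cr (MVal N L). f L (h0 L y) = ps L y)" by auto
qed

lemma aug_h0:
 assumes X: "tp X" and w: "w : cr (MVal N X)"
 shows "Baug X (h0 X w) = w"
using aug_con[OF X single_chs[OF X] un_closed[OF tp_refl[OF X]] Inr_fam[OF w]] Act_un[OF X w] by (simp add: h0_def)

sublocale B: normalized_bar_resolution Cat Mdu R P N "TYPE('k)" "bar Cat Mdu R P N" ac h0 h
 "Bdiff" "Baug" "Bdegen"
proof (intro normalized_bar_resolution.intro bar_resolution.intro unital_pmodule_axioms
 bar_resolution_axioms.intro normalized_bar_resolution_axioms.intro)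
 show "pmodule_hom Mdu R P \<lparr>MVal = Bar (Suc n), Act = ac (Suc n)\<rparr> \<lparr>MVal = Bar n, Act = ac n\<rparr> (Bdiff (Suc n))" for n
by (auto simp: pmodule_hom_def bar_diff_lin diff_ac)
 show "pmodule_hom Mdu R P \<lparr>MVal = Bar 0, Act = ac 0\<rparr> N (Baug)"
by (auto simp: pmodule_hom_def bar_aug_lin aug_ac)
qed (auto simp: Bar_pmodule h0_lin h_lin aug_h0 diff_h0 diff_h Bar_gen_0 Bar_gen_Suc Bar_free Bar_free0
 bar_degen_lin(1) degen_ac degen_h degen_0_h degen_0_h0)

lemma nbar_eq: "B.Q = NBar" "B.qd = NBdiff" "B.qe = nbar_aug Cat Mdu R P N"
proof -
 have D: "B.D = degenerate_part Cat Mdu R P N"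
by (intro ext) (simp add: B.D_def degenerate_part_def)
 show "B.Q = NBar" by (intro ext) (simp add: B.Q_def nbar_def D)
 show "B.qd = NBdiff" by (intro ext) (simp add: B.qd_def nbar_diff_def D)
 show "B.qe = nbar_aug Cat Mdu R P N" by (intro ext) (simp add: B.qe_def nbar_aug_def)
qed

theorem bar_resolutions:
 "free_acyclic_resolution TYPE('k) Cat Mdu R P N (bar Cat Mdu R P N) (Bdiff) (Baug)"
 "free_acyclic_resolution TYPE('k) Cat Mdu R P N (NBar) (NBdiff) (nbar_aug Cat Mdu R P N)"
using B.free_acyclic B.Q.free_acyclic by (simp_all add: nbar_eq)

theorem bar_H0:
 assumes X: "tp X"
 shows "module_iso R (homology_at (bar Cat Mdu R P N 1 X) (Bdiff 1 X) (bar Cat Mdu R P N 0 X)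
 (%_. ()) zero_module) (MVal N X)"
and "module_iso R (homology_at (NBar 1 X) (NBdiff 1 X) (NBar 0 X)
 (%_. ()) zero_module) (MVal N X)"
using B.H0[of X] B.Q.H0[of X] X by (simp_all add: nbar_eq)

end

section \<open>Charts of topological manifolds\<close>

text \<open>\<open>chart_at\<close> with its homeomorphism made explicit, so that charts can be
  restricted and composed.\<close>

definition is_chart :: "(nat => real) topology => 'p topology => 'p set => (nat => real) set => ('p => nat => real) => bool" where
 "is_chart E X U V f \<longleftrightarrow> openin X U & openin E V & homeomorphic_map (subt X U) (subt E V) f"

lemma chart_at_iff: "chart_at E X p \<longleftrightarrow> (EX U V f. is_chart E X U V f & p : U)"
by (auto simp: chart_at_def is_chart_def homeomorphic_space)

lemma is_chartD:
 assumes "is_chart E X U V f"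
 shows "openin X U" "openin E V" "homeomorphic_map (subt X U) (subt E V) f"
 "U \<subseteq> topspace X" "V \<subseteq> topspace E" "f ` U = V" "inj_on f U"
proof -
 show 1: "openin X U" "openin E V" and 2: "homeomorphic_map (subt X U) (subt E V) f"
using assms by (auto simp: is_chart_def)
 show 3: "U \<subseteq> topspace X" "V \<subseteq> topspace E" using 1 openin_subset by auto
 thus "f ` U = V" "inj_on f U"
using homeomorphic_imp_surjective_map[OF 2] homeomorphic_imp_injective_map[OF 2] by (simp_all add: inf.absorb2)
qed

lemma is_chart_restrict:
 assumes c: "is_chart E X U V f" and W: "openin X W" "W \<subseteq> U"
 shows "is_chart E X W (f ` W) f"
proof -
 note d = is_chartD[OF c]
 have "openin (subt X U) W" using W d(1) by (simp add: openin_open_subtopology)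
 hence "openin (subt E V) (f ` W)"
using homeomorphic_imp_open_map[OF d(3)] by (simp add: open_map_def)
 hence o: "openin E (f ` W)" "f ` W \<subseteq> V" using d(2) by (simp_all add: openin_open_subtopology)
 have "homeomorphic_map (subt (subt X U) W) (subt (subt E V) (f ` W)) f"
by (rule homeomorphic_map_subtopologies[OF d(3)]) (use W o d in auto)
 thus ?thesis using W o by (simp add: is_chart_def subtopology_subtopology inf.absorb2)
qed

lemma is_chart_open: "openin X W ==> is_chart E (subt X W) U V f \<longleftrightarrow> is_chart E X U V f & U \<subseteq> W"
by (auto simp: is_chart_def openin_open_subtopology subtopology_subtopology inf.absorb2)

lemma chart_at_open: "openin X W ==> p : W ==> chart_at E (subt X W) p \<longleftrightarrow> chart_at E X p"
proof
 assume W: "openin X W" "p : W" and "chart_at E X p"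
 then obtain U V f where c: "is_chart E X U V f" "p : U" by (auto simp: chart_at_iff)
 hence o: "openin X (U Int W)" using W is_chartD(1) by blast
 have "is_chart E (subt X W) (U Int W) (f ` (U Int W)) f"
using is_chart_restrict[OF c(1) o] is_chart_open[OF W(1)] by blast
 thus "chart_at E (subt X W) p" using c W unfolding chart_at_iff by blast
qed (auto simp: chart_at_iff is_chart_open)

lemma chart_at_topspace: "chart_at E X p ==> p : topspace X"
using is_chartD(4) by (fastforce simp: chart_at_iff)

text \<open>Both sets have the same open part in \<open>W\<close>, and charts may be shrunk to open
  parts. The later statements about boundaries of complements are all comparisons of this
  kind.\<close>

lemma chart_at_local:
 assumes W: "openin M W" "p : W" and eq: "A Int W = B Int W"
 shows "chart_at E (subt M A) p \<longleftrightarrow> chart_at E (subt M B) p"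
proof -
 have *: "chart_at E (subt M S) p \<longleftrightarrow> p : S & chart_at E (subt M (S Int W)) p" for S
 proof -
 have "openin (subt M S) (S Int W)" using W(1) by (simp add: openin_subtopology_Int2)
 thus ?thesis
using chart_at_open[of "subt M S" "S Int W" p E] chart_at_topspace[of E "subt M S" p] W(2)
by (auto simp: subtopology_subtopology)
 qed
 have "p : A \<longleftrightarrow> p : B" using eq W(2) by blast
 thus ?thesis by (subst (1 2) *) (simp add: eq)
qed

lemma openin_chart_points: "openin X {p : topspace X. chart_at E X p}"
proof (subst openin_subopen, clarify)
 fix p assume "chart_at E X p"
 then obtain U V f where c: "is_chart E X U V f" "p : U" by (auto simp: chart_at_iff)
 have "U \<subseteq> {p : topspace X. chart_at E X p}" using c(1) is_chartD(4)[OF c(1)] by (auto simp: chart_at_iff)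
 thus "EX T. openin X T & p : T & T \<subseteq> {p : topspace X. chart_at E X p}" using c is_chartD(1)[OF c(1)] by blast
qed

lemma closedin_mboundary: "closedin X (mboundary k X)"
proof -
 have "mboundary k X = topspace X - {p : topspace X. chart_at (Euclidean_space k) X p}" by (auto simp: mboundary_def)
 thus ?thesis using openin_chart_points by (metis closedin_def openin_closedin_eq)
qed

lemma mboundary_subset: "mboundary k (subt M S) \<subseteq> S"
by (auto simp: mboundary_def)

lemma Euclidean_top: "Euclidean_space k = top_of_set {x. ALL i>=k. x i = 0}"
by (simp add: Euclidean_space_def euclidean_product_topology)

lemma half_space_top: "half_space k = top_of_set {x. (ALL i>=k. x i = 0) & 0 \<le> x 0}"
unfolding half_space_def Euclidean_top subtopology_subtopology by (rule arg_cong[of _ _ top_of_set]) auto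

lemma cont_coord: "continuous_on S (%x::nat => real. x i)"
by (rule continuous_on_subset[OF continuous_on_product_coordinates]) simp

lemma cont_if: "continuous_on S f ==> continuous_on S g ==> continuous_on S (%x. if P then f x else g x)"
by (cases P) auto

lemma open_half_in_Euclidean:
 assumes "openin (Euclidean_space k) T" "T \<subseteq> {x. 0 \<le> x 0}"
 shows "openin (half_space k) T"
proof -
 have "T = T Int {x. 0 \<le> x 0}" using assms(2) by auto
 thus ?thesis unfolding half_space_def using assms(1) by (metis openin_subtopology_Int)
qed

text \<open>Invariance of domain. Near \<open>p\<close> the set \<open>A\<close> is the homeomorphic
  image of an open set of Euclidean space. Followed by a half-space chart \<open>f\<close> of
  \<open>X\<close> this is an injective continuous map into Euclidean space of the same dimension,
  so its image is open. Pulling back along \<open>f\<close> shows that \<open>A\<close> is a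
  neighbourhood of \<open>p\<close> in \<open>X\<close>.\<close>

lemma interior_chart_open:
 assumes p: "chart_at (half_space k) X p" and A: "A \<subseteq> topspace X" and e: "chart_at (Euclidean_space k) (subt X A) p"
 obtains W where "openin X W" "p : W" "W \<subseteq> A"
proof -
 obtain U V f where c: "is_chart (half_space k) X U V f" "p : U" using p by (auto simp: chart_at_iff)
 obtain W0 V0 g where c0: "is_chart (Euclidean_space k) (subt X A) W0 V0 g" "p : W0" using e by (auto simp: chart_at_iff)
 note d = is_chartD[OF c(1)] and d0 = is_chartD[OF c0(1)]
 define W where "W = W0 Int U"
 have Wo: "openin (subt X A) W" unfolding W_def
 proof -
 have "W0 \<subseteq> A" using d0(4) by auto
 hence "W0 Int U = W0 Int (U Int A)" by auto
 thus "openin (subt X A) (W0 Int U)" using d0(1) d(1) openin_subtopology_Int by (metis openin_Int)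
 qed
 hence WA: "W \<subseteq> A" "W \<subseteq> U" "W \<subseteq> topspace X" using openin_subset[OF Wo] d(4) by (auto simp: W_def)
 note c1 = is_chart_restrict[OF c0(1) Wo]
 have c1: "is_chart (Euclidean_space k) (subt X A) W (g ` W) g"
by (rule is_chart_restrict[OF c0(1) Wo]) (simp add: W_def)
 note d1 = is_chartD[OF c1]
 obtain g' where g': "homeomorphic_maps (subt X W) (subt (Euclidean_space k) (g ` W)) g g'"
using d1(3) WA by (auto simp: homeomorphic_map_maps subtopology_subtopology inf.absorb2)
 have cg: "continuous_map (subt (Euclidean_space k) (g ` W)) (subt X W) g'"
and gi: "!!x. x : W ==> g' (g x) = x" using g' WA by (auto simp: homeomorphic_maps_def)
 have "continuous_map (subt X U) (subt (half_space k) V) f"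
using d(3) homeomorphic_imp_continuous_map by blast
 hence "continuous_map (subt X U) (Euclidean_space k) f"
by (auto simp: continuous_map_in_subtopology half_space_def)
 hence "continuous_map (subt X W) (Euclidean_space k) f"
using WA(2) by (rule continuous_map_from_subtopology_mono)
 hence "continuous_map (subt (Euclidean_space k) (g ` W)) (Euclidean_space k) (f \<circ> g')"
by (rule continuous_map_compose[OF cg])
 moreover have "inj_on (f \<circ> g') (g ` W)"
 proof (rule inj_onI)
 fix x y assume "x : g ` W" "y : g ` W" and e: "(f \<circ> g') x = (f \<circ> g') y"
 then obtain u v where "u : W" "v : W" "x = g u" "y = g v" by blast
 thus "x = y" using e gi inj_onD[OF d(7), of u v] WA(2) by auto
 qed
 ultimately have "openin (Euclidean_space k) ((f \<circ> g') ` (g ` W))"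
by (rule invariance_of_domain_Euclidean_space[OF d1(2)])
 moreover have "(f \<circ> g') ` (g ` W) = f ` W" using gi by (force simp: image_iff)
 ultimately have "openin (Euclidean_space k) (f ` W)" by simp
 moreover have fWV: "f ` W \<subseteq> V" using WA(2) d(6) by auto
 ultimately have "openin (half_space k) (f ` W)"
using d(5) by (intro open_half_in_Euclidean) (auto simp: half_space_def)
 hence "openin (subt (half_space k) V) (f ` W)" using fWV d(2) by (simp add: openin_open_subtopology)
 hence "openin (subt X U) {x : topspace (subt X U). f x : f ` W}"
using openin_continuous_map_preimage homeomorphic_imp_continuous_map[OF d(3)] by blast
 moreover have inW: "x : W" if "x : U" "f x : f ` W" for x
using inj_on_image_mem_iff[OF d(7) that(1) WA(2)] that(2) by simp
 moreover have "{x : topspace (subt X U). f x : f ` W} = W"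
using d(4) WA inW by (intro subset_antisym subsetI) (simp_all add: subset_iff)
 ultimately have "openin X W" using d(1) by (simp add: openin_open_subtopology)
 moreover have "p : W" using c(2) c0(2) by (simp add: W_def)
 ultimately show thesis using WA(1) by (rule that)
qed

lemma openin_half_pos:
 assumes V: "openin (half_space k) V"
 shows "openin (Euclidean_space k) (V Int {x. 0 < x 0})"
proof -
 obtain T where T: "openin (Euclidean_space k) T" "V = T Int {x. 0 \<le> x 0}" using V by (auto simp: half_space_def openin_subtopology)
 have "open {x::nat => real. 0 < x 0}" by (rule open_Collect_less) (auto intro: cont_coord)
 hence "openin (Euclidean_space k) (topspace (Euclidean_space k) Int {x. 0 < x 0})"
by (auto simp: Euclidean_top openin_open)
 from openin_Int[OF T(1) this] have "openin (Euclidean_space k) (T Int (topspace (Euclidean_space k) Int {x. 0 < x 0}))" .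
 also have "T Int (topspace (Euclidean_space k) Int {x. 0 < x 0}) = V Int {x. 0 < x 0}"
using openin_subset[OF T(1)] T(2) by auto
 finally show ?thesis .
qed

text \<open>Moving slightly in the negative direction of coordinate \<open>0\<close> stays in
  \<open>T\<close>. Hence an open set inside the closed half-space never touches its wall.\<close>

lemma Euclidean_open_lower:
 assumes T: "openin (Euclidean_space (Suc j)) T" and a: "a : T"
 shows "EX b:T. b 0 < a 0"
proof -
 define c where "c t = a(0 := a 0 - t)" for t :: real
 have "continuous_on UNIV c" unfolding c_def
by (rule continuous_on_coordinatewise_then_product) (auto intro!: continuous_intros cont_if)
 moreover obtain T' where T': "open T'" "T = {x. ALL i>=Suc j. x i = 0} Int T'" using T by (auto simp: Euclidean_top openin_open)
 ultimately have o: "open (c -` T')" by (simp add: open_vimage)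
 have "0 : c -` T'" using a T' by (simp add: c_def)
 then obtain e where e: "e > 0" "ball 0 e \<subseteq> c -` T'" using o open_contains_ball by blast
 have "e / 2 : ball 0 e" using e(1) by (simp add: dist_norm)
 hence "c (e / 2) : T'" using e(2) by blast
 moreover have "c (e / 2) : {x. ALL i>=Suc j. x i = 0}" using a T'(2) by (auto simp: c_def)
 ultimately have "c (e / 2) : T" using T'(2) by blast
 moreover have "c (e / 2) 0 < a 0" using e(1) by (simp add: c_def)
 ultimately show ?thesis by blast
qed

text \<open>Any half-space chart detects the boundary. Where coordinate \<open>0\<close> is positive
  the chart shrinks to a Euclidean one. Where it vanishes, a Euclidean chart would by invariance of
  domain produce an open subset of Euclidean space inside the half-space that touches the wall,
  against \<open>Euclidean_open_lower\<close>.\<close>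

lemma mboundary_chart:
 assumes c: "is_chart (half_space (Suc j)) X U V f" and q: "q : U"
 shows "q : mboundary (Suc j) X \<longleftrightarrow> f q 0 = 0"
proof
 note d = is_chartD[OF c]
 assume b: "q : mboundary (Suc j) X"
 show "f q 0 = 0"
 proof (rule ccontr)
 assume "f q 0 ~= 0"
 moreover have "f q : V" using d(6) q by auto
 ultimately have pos: "f q : V Int {x. 0 < x 0}" using d(5) by (auto simp: half_space_def)
 let ?V = "V Int {x. 0 < x 0}"
 have oE: "openin (Euclidean_space (Suc j)) ?V" by (rule openin_half_pos[OF d(2)])
 hence oH: "openin (half_space (Suc j)) ?V" by (rule open_half_in_Euclidean) auto
 hence "openin (subt (half_space (Suc j)) V) ?V" using d(2) by (simp add: openin_open_subtopology)
 hence "openin (subt X U) {x : topspace (subt X U). f x : ?V}"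
using openin_continuous_map_preimage homeomorphic_imp_continuous_map[OF d(3)] by blast
 hence oU: "openin X {x : U. f x : ?V}" using d(1,4) by (simp add: openin_open_subtopology inf.absorb2)
 have im: "f ` {x : U. f x : ?V} = ?V" using d(6) by auto
 have "is_chart (half_space (Suc j)) X {x : U. f x : ?V} ?V f" using is_chart_restrict[OF c oU] im by auto
 moreover have "subt (half_space (Suc j)) ?V = subt (Euclidean_space (Suc j)) ?V"
unfolding half_space_def subtopology_subtopology by (rule arg_cong[of _ _ "subt _"]) auto
 ultimately have "is_chart (Euclidean_space (Suc j)) X {x : U. f x : ?V} ?V f" using oE by (simp add: is_chart_def)
 hence "chart_at (Euclidean_space (Suc j)) X q" using q pos unfolding chart_at_iff by blast
 thus False using b by (simp add: mboundary_def)
 qed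
next
 note d = is_chartD[OF c]
 assume 0: "f q 0 = 0"
 have "q : topspace X" using d(4) q by auto
 moreover have "~ chart_at (Euclidean_space (Suc j)) X q"
 proof
 assume "chart_at (Euclidean_space (Suc j)) X q"
 hence e: "chart_at (Euclidean_space (Suc j)) (subt X U) q" using chart_at_open[OF d(1) q] by simp
 then obtain W V0 g where c1: "is_chart (Euclidean_space (Suc j)) (subt X U) W V0 g" "q : W" by (auto simp: chart_at_iff)
 note d1 = is_chartD[OF c1(1)]
 have WU: "W \<subseteq> U" using d1(4) by auto
 obtain g' where g': "homeomorphic_maps (subt X W) (subt (Euclidean_space (Suc j)) V0) g g'"
using d1(3) WU by (auto simp: homeomorphic_map_maps subtopology_subtopology inf.absorb2)
 have cg: "continuous_map (subt (Euclidean_space (Suc j)) V0) (subt X W) g'"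
and gi: "!!x. x : W ==> g' (g x) = x" using g' WU d(4) by (auto simp: homeomorphic_maps_def)
 have "continuous_map (subt X U) (subt (half_space (Suc j)) V) f"
using d(3) homeomorphic_imp_continuous_map by blast
 hence "continuous_map (subt X U) (Euclidean_space (Suc j)) f"
by (auto simp: continuous_map_in_subtopology half_space_def)
 hence "continuous_map (subt X W) (Euclidean_space (Suc j)) f"
using WU by (rule continuous_map_from_subtopology_mono)
 hence "continuous_map (subt (Euclidean_space (Suc j)) V0) (Euclidean_space (Suc j)) (f \<circ> g')"
by (rule continuous_map_compose[OF cg])
 moreover have "inj_on (f \<circ> g') V0"
 proof (rule inj_onI)
 fix x y assume "x : V0" "y : V0" and e: "(f \<circ> g') x = (f \<circ> g') y"
 then obtain u v where "u : W" "v : W" "x = g u" "y = g v" using d1(6) by blast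
 thus "x = y" using e gi inj_onD[OF d(7), of u v] WU by auto
 qed
 ultimately have "openin (Euclidean_space (Suc j)) ((f \<circ> g') ` V0)"
by (rule invariance_of_domain_Euclidean_space[OF d1(2)])
 moreover have "(f \<circ> g') ` V0 = f ` W" using gi d1(6) by (force simp: image_iff)
 ultimately have "openin (Euclidean_space (Suc j)) (f ` W)" by simp
 from Euclidean_open_lower[OF this imageI[OF c1(2)]] obtain w where "w : W" "f w 0 < f q 0" by blast
 thus False using 0 WU d(5,6) by (force simp: half_space_def)
 qed
 ultimately show "q : mboundary (Suc j) X" by (simp add: mboundary_def)
qed

lemma chart_transport:
 assumes c: "chart_at E X p" and h: "homeomorphic_map E (subt E' Z) h" and Z: "openin E' Z"
 shows "chart_at E' X p"
proof -
 obtain U V f where c: "is_chart E X U V f" "p : U" using c by (auto simp: chart_at_iff)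
 note d = is_chartD[OF c(1)]
 have "openin (subt E' Z) (h ` V)" using homeomorphic_imp_open_map[OF h] d(2) by (simp add: open_map_def)
 hence o: "openin E' (h ` V)" "h ` V \<subseteq> Z" using Z by (simp_all add: openin_open_subtopology)
 have "homeomorphic_map (subt E V) (subt (subt E' Z) (h ` V)) h"
by (rule homeomorphic_map_subtopologies[OF h])
 (use d(5) o openin_subset[OF Z] in "auto")
 hence "homeomorphic_map (subt E V) (subt E' (h ` V)) h"
using o by (simp add: subtopology_subtopology inf.absorb2)
 from homeomorphic_map_compose[OF d(3) this] have "is_chart E' X U (h ` V) (h \<circ> f)" using d(1) o by (simp add: is_chart_def)
 thus ?thesis using c(2) unfolding chart_at_iff by blast
qed

lemma homeo_top_of_set:
 fixes f g :: "(nat => real) => nat => real"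
 assumes "!!i. continuous_on S (%x. f x i)" "!!i. continuous_on T (%y. g y i)"
 "!!x. x : S ==> f x : T" "!!y. y : T ==> g y : S"
 "!!x. x : S ==> g (f x) = x" "!!y. y : T ==> f (g y) = y"
 shows "homeomorphic_maps (top_of_set S) (top_of_set T) f g"
using assms continuous_on_coordinatewise_then_product[of S f] continuous_on_coordinatewise_then_product[of T g]
by (auto simp: homeomorphic_maps_def Pi_iff)

text \<open>The exponential in coordinate \<open>0\<close> identifies Euclidean space with the open
  half-space. In dimension zero both models are the same point.\<close>

lemma chart_Euclidean_half:
 assumes "chart_at (Euclidean_space k) X p" shows "chart_at (half_space k) X p"
proof (cases k)
 case 0
 hence "half_space k = Euclidean_space k" by (simp add: half_space_top Euclidean_top) (metis order_refl)
 thus ?thesis using assms by simp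
next
 case (Suc j)
 let ?Z = "{x. (ALL i>=k. x i = 0) & 0 < x 0} :: (nat => real) set"
 have "homeomorphic_maps (top_of_set {x. ALL i>=k. x i = 0}) (top_of_set ?Z)
 (%x. x(0 := exp (x 0))) (%y. y(0 := ln (y 0)))"
by (rule homeo_top_of_set) (use Suc in "auto intro!: continuous_intros cont_coord cont_if simp: fun_eq_iff")
 moreover have "subt (half_space k) ?Z = top_of_set ?Z"
unfolding half_space_top subtopology_subtopology by (rule arg_cong[of _ _ top_of_set]) auto
 ultimately have "homeomorphic_map (Euclidean_space k) (subt (half_space k) ?Z) (%x. x(0 := exp (x 0)))"
unfolding Euclidean_top homeomorphic_map_maps by auto
 moreover have "openin (half_space k) ?Z"
 proof -
 have "?Z = {x. (ALL i>=k. x i = 0) & 0 \<le> x 0} Int {x. 0 < x 0}" by auto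
 moreover have "open {x::nat => real. 0 < x 0}" by (rule open_Collect_less) (auto intro: cont_coord)
 ultimately show ?thesis unfolding half_space_top openin_open by blast
 qed
 ultimately show ?thesis by (rule chart_transport[OF assms])
qed

lemma manifold_Euclidean_chartsI:
 assumes "Hausdorff_space X" "second_countable X" "!!p. p : topspace X ==> chart_at (Euclidean_space k) X p"
 shows "manifold k X"
unfolding manifold_def using assms(1,2) chart_Euclidean_half[OF assms(3)] by blast

lemma manifold_subI:
 assumes "manifold k' M" "!!p. p : topspace M Int S ==> chart_at (half_space k) (subt M S) p"
 shows "manifold k (subt M S)"
using assms by (auto simp: manifold_def Hausdorff_space_subtopology second_countable_subtopology)

lemma manifold_open: "manifold k X ==> openin X W ==> manifold k (subt X W)"
by (rule manifold_subI) (auto simp: chart_at_open manifold_def)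

text \<open>A half-space chart carries the boundary to the wall \<open>x 0 = 0\<close>, and dropping
  that coordinate is a homeomorphism onto Euclidean space of one dimension less. So the boundary
  even has Euclidean charts everywhere.\<close>

theorem manifold_bdry:
 assumes X: "manifold (Suc j) X" shows "manifold j (bdry (Suc j) X)"
proof -
 let ?B = "mboundary (Suc j) X"
 let ?Z = "{x. (ALL i>=Suc j. x i = 0) & x 0 = 0} :: (nat => real) set"
 have shift: "homeomorphic_maps (top_of_set ?Z) (top_of_set {x. ALL i>=j. x i = 0}) (%x i. x (Suc i)) (%y. case_nat 0 y)"
 proof (rule homeo_top_of_set)
 show "continuous_on {x. ALL i>=j. x i = 0} (%y::nat => real. case_nat 0 y i)" for i
by (cases i) (auto intro: cont_coord)
 show "case_nat 0 (%i. x (Suc i)) = x" if "x : ?Z" for x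
using that by (auto simp: fun_eq_iff split: nat.split)
 show "case_nat 0 y : ?Z" if "y : {x. ALL i>=j. x i = 0}" for y :: "nat => real"
using that by (auto split: nat.split)
 qed (auto intro: cont_coord)
 let ?\<sigma> = "%x i. x (Suc i) :: real"
 have \<sigma>: "homeomorphic_map (top_of_set ?Z) (Euclidean_space j) ?\<sigma>"
using shift unfolding Euclidean_top homeomorphic_map_maps by blast
 have "chart_at (Euclidean_space j) (subt X ?B) p" if p: "p : ?B" for p
 proof -
 have "p : topspace X" using p by (simp add: mboundary_def)
 then obtain U V f where c: "is_chart (half_space (Suc j)) X U V f" "p : U"
using X by (auto simp: manifold_def chart_at_iff)
 note d = is_chartD[OF c(1)]
 have im: "f ` (U Int ?B) = V Int ?Z"
 proof -
 have "V \<subseteq> {x. ALL i>=Suc j. x i = 0}" using d(5) by (auto simp: half_space_top)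
 thus ?thesis using mboundary_chart[OF c(1)] d(6) by (auto simp: image_iff)
 qed
 have "homeomorphic_map (subt (subt X U) (U Int ?B)) (subt (subt (half_space (Suc j)) V) (V Int ?Z)) f"
 proof (rule homeomorphic_map_subtopologies[OF d(3)])
 have "topspace (subt X U) Int (U Int ?B) = U Int ?B" "topspace (subt (half_space (Suc j)) V) Int (V Int ?Z) = V Int ?Z"
using d(4,5) by auto
 thus "f ` (topspace (subt X U) Int (U Int ?B)) = topspace (subt (half_space (Suc j)) V) Int (V Int ?Z)"
using im by simp
 qed
 hence f: "homeomorphic_map (subt (subt X ?B) (U Int ?B)) (subt (top_of_set ?Z) (V Int ?Z)) f"
 proof -
 have 1: "subt (subt X U) (U Int ?B) = subt (subt X ?B) (U Int ?B)"
unfolding subtopology_subtopology by (rule arg_cong[of _ _ "subt X"]) auto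
 have 2: "subt (subt (half_space (Suc j)) V) (V Int ?Z) = subt (top_of_set ?Z) (V Int ?Z)"
unfolding half_space_top subtopology_subtopology by (rule arg_cong[of _ _ top_of_set]) auto
 show ?thesis using \<open>homeomorphic_map (subt (subt X U) (U Int ?B)) _ f\<close> unfolding 1 2 .
 qed
 have oVZ: "openin (top_of_set ?Z) (V Int ?Z)"
 proof -
 obtain T where T: "open T" "V = {x. (ALL i>=Suc j. x i = 0) & 0 \<le> x 0} Int T" using d(2) by (auto simp: half_space_top openin_open)
 hence "V Int ?Z = ?Z Int T" by auto
 thus ?thesis using T(1) by (auto simp: openin_open)
 qed
 hence o: "openin (Euclidean_space j) (?\<sigma> ` (V Int ?Z))" using homeomorphic_imp_open_map[OF \<sigma>] by (simp add: open_map_def)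
 have "homeomorphic_map (subt (top_of_set ?Z) (V Int ?Z)) (subt (Euclidean_space j) (?\<sigma> ` (V Int ?Z))) ?\<sigma>"
by (rule homeomorphic_map_subtopologies[OF \<sigma>]) (use openin_subset[OF o] openin_subset[OF oVZ] in "auto simp: inf.absorb2")
 from homeomorphic_map_compose[OF f this]
 have "is_chart (Euclidean_space j) (subt X ?B) (U Int ?B) (?\<sigma> ` (V Int ?Z)) (?\<sigma> \<circ> f)"
using o d(1) by (auto simp: is_chart_def openin_subtopology)
 thus ?thesis using c(2) p unfolding chart_at_iff by blast
 qed
 thus ?thesis unfolding bdry_def
by (intro manifold_Euclidean_chartsI)
 (use X in "auto simp: manifold_def Hausdorff_space_subtopology second_countable_subtopology mboundary_def")
qed

lemma manifold_homeomorphic: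
 assumes XY: "X homeomorphic_space Y" and Y: "manifold k Y" shows "manifold k X"
proof -
 have "chart_at (half_space k) X p" if p: "p : topspace X" for p
 proof -
 obtain h where h: "homeomorphic_map X Y h" using XY by (auto simp: homeomorphic_space)
 have "h p : topspace Y" using h p homeomorphic_imp_surjective_map by blast
 then obtain U V f where c: "is_chart (half_space k) Y U V f" "h p : U" using Y by (auto simp: manifold_def chart_at_iff)
 note d = is_chartD[OF c(1)]
 let ?U = "{x : topspace X. h x : U}"
 have oU: "openin X ?U" using openin_continuous_map_preimage[OF homeomorphic_imp_continuous_map[OF h] d(1)] .
 have "h ` ?U = U" using homeomorphic_imp_surjective_map[OF h] d(4) by auto
 hence "homeomorphic_map (subt X ?U) (subt Y U) h"
by (intro homeomorphic_map_subtopologies[OF h]) (use d(4) in "auto simp: Int_absorb1 Int_def")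
 from homeomorphic_map_compose[OF this d(3)] have "is_chart (half_space k) X ?U V (f \<circ> h)"
using oU d(2) by (simp add: is_chart_def)
 thus ?thesis using p c(2) unfolding chart_at_iff by blast
 qed
 thus ?thesis
using Y homeomorphic_Hausdorff_space[OF XY] homeomorphic_space_second_countability[OF XY] by (simp add: manifold_def)
qed

section \<open>Balls, blobs and their complements\<close>

lemma unit_ball_top: "unit_ball k = top_of_set {x. (ALL i>=k. x i = 0) & (\<Sum>i<k. (x i)\<^sup>2) \<le> 1}"
unfolding unit_ball_def Euclidean_top subtopology_subtopology by (rule arg_cong[of _ _ top_of_set]) auto

lemma second_countable_top_of_set: "second_countable (top_of_set (S :: (nat => real) set))"
proof (rule second_countable_subtopology)
 obtain B :: "(nat => real) set set" where B: "countable B" "topological_basis B"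
using ex_countable_basis by blast
 show "second_countable (euclidean :: (nat => real) topology)"
unfolding second_countable_def
 proof (intro exI[of _ B] conjI allI impI ballI)
 show "openin euclidean V" if "V : B" for V using topological_basis_open[OF B(2) that] by (simp only: open_openin)
 show "EX V:B. x : V & V \<subseteq> U" if "openin euclidean U & x : U" for U x
 proof -
 have "open U" "x : U" using that by (simp_all only: open_openin)
 thus ?thesis using topological_basisE[OF B(2)] by metis
 qed
 qed (rule B(1))
qed

lemma Hausdorff_top_of_set: "Hausdorff_space (top_of_set (S :: (nat => real) set))"
by (rule Hausdorff_space_subtopology) simp

text \<open>The squared norm with coordinate \<open>i\<close> singled out and its slot taken over by
  \<open>x 0\<close>, as in the coordinate exchange of the charts of the ball.\<close>

lemma sum_remove_pole:
 fixes x :: "nat => real"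
 assumes "i < k"
 shows "(\<Sum>j<k. (x j)\<^sup>2) = (x i)\<^sup>2 + (\<Sum>m\<in>{1..<k}. (if m = i then x 0 else x m)\<^sup>2)"
proof -
 have "(\<Sum>j<k. (x j)\<^sup>2) = (x i)\<^sup>2 + (\<Sum>j\<in>{..<k} - {i}. (x j)\<^sup>2)"
using assms by (subst sum.remove[of _ i]) auto
 also have "(\<Sum>j\<in>{..<k} - {i}. (x j)\<^sup>2) = (\<Sum>m\<in>{1..<k}. (if m = i then x 0 else x m)\<^sup>2)"
by (rule sum.reindex_bij_witness[where i = "%m. if m = i then 0 else m" and j = "%j. if j = 0 then i else j"])
 (use assms in "auto split: if_splits")
 finally show ?thesis .
qed

theorem manifold_unit_ball: "manifold (Suc d) (unit_ball (Suc d))"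
unfolding manifold_def
proof (intro conjI ballI)
 let ?k = "Suc d"
 let ?B = "{x. (ALL i>=?k. x i = 0) & (\<Sum>i<?k. (x i)\<^sup>2) \<le> 1} :: (nat => real) set"
 show "Hausdorff_space (unit_ball ?k)" "second_countable (unit_ball ?k)"
unfolding unit_ball_top by (rule Hausdorff_top_of_set second_countable_top_of_set)+
 fix p assume "p : topspace (unit_ball ?k)"
 hence p: "p : ?B" by (simp add: unit_ball_top)
 have cs: "continuous_on UNIV (%x::nat => real. \<Sum>i<?k. (x i)\<^sup>2)" by (intro continuous_intros cont_coord)
 show "chart_at (half_space ?k) (unit_ball ?k) p"
 proof (cases "(\<Sum>i<?k. (p i)\<^sup>2) < 1")
 case True
 let ?V = "{x. (ALL i>=?k. x i = 0) & (\<Sum>i<?k. (x i)\<^sup>2) < 1} :: (nat => real) set"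
 have o: "open {x::nat => real. (\<Sum>i<?k. (x i)\<^sup>2) < 1}" by (rule open_Collect_less[OF cs]) simp
 have "?V = {x. ALL i>=?k. x i = 0} Int {x. (\<Sum>i<?k. (x i)\<^sup>2) < 1}" "?V = ?B Int {x. (\<Sum>i<?k. (x i)\<^sup>2) < 1}" by auto
 hence "openin (Euclidean_space ?k) ?V" "openin (unit_ball ?k) ?V"
unfolding Euclidean_top unit_ball_top openin_open using o by blast+
 moreover have "subt (unit_ball ?k) ?V = subt (Euclidean_space ?k) ?V"
unfolding Euclidean_top unit_ball_top subtopology_subtopology by (rule arg_cong[of _ _ top_of_set]) auto
 ultimately have "chart_at (Euclidean_space ?k) (unit_ball ?k) p"
unfolding chart_at_def using True p homeomorphic_space_refl by (intro exI[of _ ?V]) auto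
 thus ?thesis by (rule chart_Euclidean_half)
 next
 case False
 hence s1: "(\<Sum>i<?k. (p i)\<^sup>2) = 1" using p by auto
 obtain i where i: "i < ?k" "p i ~= 0"
 proof -
 have "EX i<?k. p i ~= 0"
 proof (rule ccontr)
 assume "~ ?thesis"
 hence "(\<Sum>i<?k. (p i)\<^sup>2) = 0" by (intro sum.neutral) auto
 thus False using s1 by simp
 qed
 thus ?thesis using that by blast
 qed
 \<comment> \<open>On the sphere some coordinate is nonzero; its sign selects the hemisphere on
   which that coordinate is recovered by a square root.\<close>
 define \<sigma> where "\<sigma> = sgn (p i)"
 have \<sigma>: "\<sigma> * p i > 0" "\<sigma> * \<sigma> = 1" "\<sigma> = 1 \<or> \<sigma> = -1" using i(2) by (auto simp: \<sigma>_def sgn_if)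
 define q where "q y = (\<Sum>m\<in>{1..<?k}. (y m)\<^sup>2)" for y :: "nat => real"
 \<comment> \<open>Coordinate \<open>0\<close> becomes the depth \<open>1 - |x|^2\<close> below the
   sphere, and the old \<open>x 0\<close> moves to slot \<open>i\<close>. The inverse
   \<open>ps\<close> solves \<open>(x i)^2 = 1 - y 0 - q y\<close>. The order of the tests makes
   both formulas correct for \<open>i = 0\<close> as well.\<close>
 define ph where "ph x j = (if j = 0 then 1 - (\<Sum>i<?k. (x i)\<^sup>2) else if j = i then x 0 else x j)" for x :: "nat => real" and j
 define ps where "ps y j = (if j = i then \<sigma> * sqrt (1 - y 0 - q y) else if j = 0 then y i else y j)" for y :: "nat => real" and j
 let ?U = "?B Int {x. 0 < \<sigma> * x i}"
 let ?V = "{y. (ALL i>=?k. y i = 0) & 0 \<le> y 0} Int {y. 0 < 1 - y 0 - q y}"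
 have cq: "continuous_on UNIV q" unfolding q_def by (intro continuous_intros cont_coord)
 have qph: "(\<Sum>i<?k. (x i)\<^sup>2) = (x i)\<^sup>2 + q (ph x)" for x
unfolding sum_remove_pole[OF i(1), of x] q_def by (rule arg_cong2[of _ _ _ _ "(+)"]) (auto simp: ph_def intro!: sum.cong)
 have qps: "(\<Sum>i<?k. (ps y i)\<^sup>2) = 1 - y 0" if "0 < 1 - y 0 - q y" for y
 proof -
 have "(\<Sum>m\<in>{1..<?k}. (if m = i then ps y 0 else ps y m)\<^sup>2) = q y"
unfolding q_def by (rule sum.cong) (auto simp: ps_def)
 moreover have "(ps y i)\<^sup>2 = 1 - y 0 - q y"
using that \<sigma>(2) by (simp add: ps_def power_mult_distrib power2_eq_square[of \<sigma>])
 ultimately show ?thesis using sum_remove_pole[OF i(1), of "ps y"] by simp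
 qed
 have "homeomorphic_maps (top_of_set ?U) (top_of_set ?V) ph ps"
 proof (rule homeo_top_of_set)
 show "continuous_on ?U (%x. ph x j)" for j
unfolding ph_def by (intro cont_if continuous_intros cont_coord)
 show "continuous_on ?V (%y. ps y j)" for j
unfolding ps_def by (intro cont_if continuous_intros cont_coord continuous_on_subset[OF cq]) auto
 show "ph x : ?V" if "x : ?U" for x
 proof -
 have "1 - ph x 0 - q (ph x) = (x i)\<^sup>2" using qph[of x] by (simp add: ph_def)
 moreover have "0 < (x i)\<^sup>2" using that by auto
 ultimately have "0 < 1 - ph x 0 - q (ph x)" by linarith
 moreover have "0 \<le> ph x 0" "ALL m>=?k. ph x m = 0" using that i(1) unfolding ph_def by (simp_all del: sum.lessThan_Suc)
 ultimately show ?thesis by blast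
 qed
 show "ps y : ?U" if "y : ?V" for y
 proof -
 have "\<sigma> * ps y i = sqrt (1 - y 0 - q y)" using \<sigma>(2) by (simp add: ps_def mult.assoc[symmetric])
 hence "0 < \<sigma> * ps y i" using that by simp
 thus ?thesis using that i(1) qps[of y] by (auto simp: ps_def)
 qed
 show "ps (ph x) = x" if "x : ?U" for x
 proof
 fix j
 have "1 - ph x 0 - q (ph x) = (x i)\<^sup>2" using qph[of x] by (simp add: ph_def)
 moreover have "\<sigma> * \<bar>x i\<bar> = x i" using that \<sigma>(3) by (auto simp: abs_if)
 ultimately have "\<sigma> * sqrt (1 - ph x 0 - q (ph x)) = x i" by simp
 thus "ps (ph x) j = x j" by (auto simp: ps_def) (auto simp: ph_def)
 qed
 show "ph (ps y) = y" if "y : ?V" for y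
 proof
 fix j show "ph (ps y) j = y j" using that qps[of y] by (auto simp: ph_def) (auto simp: ps_def)
 qed
 qed
 moreover have "subt (unit_ball ?k) ?U = top_of_set ?U" "subt (half_space ?k) ?V = top_of_set ?V"
unfolding unit_ball_top half_space_top subtopology_subtopology by (rule arg_cong[of _ _ top_of_set]; auto)+
 ultimately have "subt (unit_ball ?k) ?U homeomorphic_space subt (half_space ?k) ?V"
by (auto simp: homeomorphic_space_def)
 moreover have "openin (unit_ball ?k) ?U"
unfolding unit_ball_top openin_open
by (intro exI[of _ "{x. 0 < \<sigma> * x i}"] conjI open_Collect_less continuous_intros cont_coord) auto
 moreover have "openin (half_space ?k) ?V"
unfolding half_space_top openin_open
by (intro exI[of _ "{y. 0 < 1 - y 0 - q y}"] conjI open_Collect_less continuous_intros cont_coord cq) auto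
 ultimately show ?thesis unfolding chart_at_def using p \<sigma>(1) by (intro exI[of _ ?U] exI[of _ ?V]) auto
 qed
qed

text \<open>Points are functions on all natural numbers, so compactness comes from a product of
  compact intervals and single points, in which the ball is closed.\<close>

lemma compact_unit_ball: "compact_space (unit_ball k)"
proof -
 let ?B = "{x. (ALL i>=k. x i = 0) & (\<Sum>i<k. (x i)\<^sup>2) \<le> 1} :: (nat => real) set"
 let ?P = "Pi\<^sub>E UNIV (%i. if i < k then {-1..1} else {0}) :: (nat => real) set"
 have "compactin (powertop_real UNIV) ?P" unfolding compactin_PiE by (auto simp: compactin_euclidean_iff)
 hence P: "compact ?P" by (simp add: euclidean_product_topology)
 have "closed {x::nat => real. (\<Sum>i<k. (x i)\<^sup>2) \<le> 1}"
by (intro closed_Collect_le continuous_intros cont_coord)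
 moreover have "?B = ?P Int {x. (\<Sum>i<k. (x i)\<^sup>2) \<le> 1}"
 proof -
 have "x i : {-1..1}" if "(\<Sum>i<k. (x i)\<^sup>2) \<le> 1" "i < k" for x :: "nat => real" and i
 proof -
 have "(x i)\<^sup>2 \<le> (\<Sum>i<k. (x i)\<^sup>2)" using that(2) by (intro member_le_sum) auto
 hence "(x i)\<^sup>2 \<le> 1" using that(1) by linarith
 hence "\<bar>x i\<bar> \<le> 1" using abs_square_le_1[of "x i"] by blast
 thus ?thesis by auto
 qed
 thus ?thesis by (auto simp: PiE_iff split: if_splits)
 qed
 ultimately have "compact ?B" using compact_Int_closed[OF P] by simp
 thus ?thesis unfolding unit_ball_top by (simp add: compact_space_subtopology compactin_euclidean_iff)
qed

text \<open>The ball is star-shaped about the origin.\<close>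

lemma connected_unit_ball: "connected_space (unit_ball k)"
proof -
 let ?B = "{x. (ALL i>=k. x i = 0) & (\<Sum>i<k. (x i)\<^sup>2) \<le> 1} :: (nat => real) set"
 have cc: "connected_component ?B (%_. 0) x" if x: "x : ?B" for x
unfolding connected_component_def
 proof (intro exI[of _ "(%t i. t * x i) ` {0..1}"] conjI)
 show "connected ((%t i. t * x i) ` {0..1::real})"
by (intro connected_continuous_image continuous_on_coordinatewise_then_product continuous_intros) auto
 show "(%t i. t * x i) ` {0..1} \<subseteq> ?B"
 proof clarify
 fix t :: real assume t: "t : {0..1}"
 have "(\<Sum>i<k. (t * x i)\<^sup>2) = t\<^sup>2 * (\<Sum>i<k. (x i)\<^sup>2)" by (simp add: power_mult_distrib sum_distrib_left)
 also have "\<dots> \<le> 1 * 1" using t x by (intro mult_mono) (auto simp: power_le_one intro: sum_nonneg)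
 finally show "(ALL i>=k. t * x i = 0) & (\<Sum>i<k. (t * x i)\<^sup>2) \<le> 1" using x by auto
 qed
 show "(%_. 0) : (%t i. t * x i) ` {0..1}" by (rule image_eqI[of _ _ 0]) auto
 show "x : (%t i. t * x i) ` {0..1}" by (rule image_eqI[of _ _ 1]) auto
 qed
 hence "connected ?B" unfolding connected_iff_connected_component
by (meson connected_component_sym connected_component_trans)
 thus ?thesis unfolding unit_ball_top by (simp add: connected_space_subtopology connectedin_iff_connected)
qed

lemma unit_ball_nonempty: "topspace (unit_ball k) ~= {}"
unfolding unit_ball_top by (auto intro!: exI[of _ "%_. 0"])

section \<open>Codimension-zero submanifolds, proper blobs and regions\<close>

locale mfd =
 fixes d :: nat and M :: "'p topology"
 assumes manifold_M: "manifold (Suc d) M"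
begin

abbreviation "bnd == bd d M"

lemma bnd_def: "bnd S = mboundary (Suc d) (subt M S)"
by (simp add: bd_def)

lemma bdry_bnd: "bdry (Suc d) (subt M S) = subt M (bnd S)"
proof -
 have "S Int bnd S = bnd S" using mboundary_subset[of "Suc d" M S] by (auto simp: bnd_def)
 thus ?thesis by (simp add: bdry_def bnd_def[symmetric] subtopology_subtopology)
qed

lemma bnd_subset: "bnd S \<subseteq> S" "bnd S \<subseteq> topspace M"
by (auto simp: bnd_def mboundary_def)

definition ball :: "'p set => bool" where
 "ball D \<longleftrightarrow> D \<subseteq> topspace M & subt M D homeomorphic_space unit_ball (Suc d)"

definition good :: "'p set => bool" where
 "good S \<longleftrightarrow> closedin M S & manifold (Suc d) (subt M S)"

text \<open>The first alternative in the definition of a blob, with closedness of the complement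
  built into \<open>good\<close>. The other alternative is the degenerate one and is treated
  separately throughout.\<close>

definition pblob :: "'p set => 'p set => bool" where
 "pblob S D \<longleftrightarrow> ball D & D ~= S & D \<subseteq> S - bnd S & good (cut d M S {D}) & bnd (cut d M S {D}) = bnd S Un bnd D"

definition region :: "'p set => 'p set set => bool" where
 "region S DD \<longleftrightarrow> good S & finite DD & (ALL D:DD. pblob S D) & pairwise disjnt DD"

lemma Hausdorff_M: "Hausdorff_space M"
using manifold_M by (simp add: manifold_def)

lemma ballD:
 assumes "ball D"
 shows "D \<subseteq> topspace M" "compactin M D" "closedin M D" "connectedin M D" "D ~= {}" "good D"
proof -
 show s: "D \<subseteq> topspace M" using assms by (simp add: ball_def)
 have h: "subt M D homeomorphic_space unit_ball (Suc d)" using assms by (simp add: ball_def)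
 show c: "compactin M D" using homeomorphic_compact_space[OF h] compact_unit_ball s by (simp add: compactin_subspace)
 thus cl: "closedin M D" by (rule compactin_imp_closedin[OF Hausdorff_M])
 show "connectedin M D" using homeomorphic_connected_space[OF h] connected_unit_ball s by (simp add: connectedin_def)
 show "D ~= {}"
using homeomorphic_empty_space[OF h] unit_ball_nonempty s by (metis inf.absorb2 topspace_subtopology null_topspace_iff_trivial)
 show "good D" using cl manifold_homeomorphic[OF h manifold_unit_ball] by (simp add: good_def)
qed

lemma chart_M: "p : topspace M ==> chart_at (half_space (Suc d)) M p"
using manifold_M by (simp add: manifold_def)

text \<open>By \<open>interior_chart_open\<close> the intrinsic interior of \<open>A\<close> is open
  in \<open>M\<close>, even at boundary points of \<open>M\<close>. Removing interiors of blobs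
  therefore leaves closed sets.\<close>

lemma openin_int:
 assumes A: "A \<subseteq> topspace M" shows "openin M (A - bnd A)"
proof (subst openin_subopen, clarify)
 fix p assume p: "p : A" "p ~: bnd A"
 let ?C = "{p : topspace (subt M A). chart_at (Euclidean_space (Suc d)) (subt M A) p}"
 have C: "?C = A - bnd A" using A by (auto simp: bnd_def mboundary_def)
 hence "chart_at (Euclidean_space (Suc d)) (subt M A) p" using p by blast
 then obtain W where W: "openin M W" "p : W" "W \<subseteq> A" using interior_chart_open[OF chart_M A] p A by blast
 have "openin (subt M A) (A - bnd A)" using openin_chart_points[of "subt M A"] C by metis
 hence "openin (subt M A) ((A - bnd A) Int W)"
using W openin_subtopology_Int2 by (metis inf.absorb2 openin_Int openin_subtopology_Int)
 then obtain T where "openin M T" "(A - bnd A) Int W = T Int A" by (auto simp: openin_subtopology)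
 hence "openin M (T Int W)" "T Int W = (A - bnd A) Int W" using W by auto
 thus "EX T. openin M T & p : T & T \<subseteq> A - bnd A" using p W by (intro exI[of _ "T Int W"]) auto
qed

lemma local_bnd:
 assumes "openin M W" "p : W" "A Int W = B Int W" shows "p : bnd A \<longleftrightarrow> p : bnd B"
using chart_at_local[OF assms, of "Euclidean_space (Suc d)"] assms(2,3) openin_subset[OF assms(1)]
by (auto simp: bnd_def mboundary_def)

lemma local_half:
 assumes "openin M W" "p : W" "A Int W = B Int W" "p : A" "manifold (Suc d) (subt M B)"
 shows "chart_at (half_space (Suc d)) (subt M A) p"
proof -
 have "p : topspace (subt M B)" using assms openin_subset by fastforce
 thus ?thesis using chart_at_local[OF assms(1-3)] assms(5) by (simp add: manifold_def)
qed

lemma good_top: "good (topspace M)"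
using manifold_M by (simp add: good_def)

lemma good_subset: "good S ==> S \<subseteq> topspace M"
by (simp add: good_def closedin_subset)

lemma good_codim0: "good S \<longleftrightarrow> codim0 (Suc d) M S"
by (simp add: good_def codim0_def)

lemma closedin_bnd: "good S ==> closedin M (bnd S)"
using closedin_mboundary[of "subt M S" "Suc d"] closedin_closed_subtopology by (auto simp: good_def bnd_def)

lemma manifold_bnd: "good S ==> manifold d (subt M (bnd S))"
using manifold_bdry[of d "subt M S"] by (simp add: bdry_bnd good_def)

lemma cut_Union: "cut d M S DD = S - (\<Union>D\<in>DD. D - bnd D)"
by (simp add: cut_def)

lemma closedin_cut: "closedin M S ==> (!!D. D : DD ==> D \<subseteq> topspace M) ==> closedin M (cut d M S DD)"
unfolding cut_Union by (rule closedin_diff) (auto intro!: openin_int)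

lemma goodI:
 assumes "closedin M S" "!!p. p : S ==> chart_at (half_space (Suc d)) (subt M S) p"
 shows "good S"
unfolding good_def using assms by (auto intro!: manifold_subI[OF manifold_M])

lemma pblob_ball: "pblob S D ==> ball D" and pblob_subset: "pblob S D ==> D \<subseteq> S - bnd S" and pblob_neq: "pblob S D ==> D ~= S"
by (simp_all add: pblob_def)

text \<open>Boundaries are determined pointwise: near each point \<open>X\<close> is traded for a
  set \<open>Y\<close> whose boundary is already understood there.\<close>

lemma bnd_eq_localI:
 assumes "!!p. p : X ==> EX W Y. openin M W & p : W & X Int W = Y Int W & (p : bnd Y \<longleftrightarrow> p : B)" "B \<subseteq> X"
 shows "bnd X = B"
proof (intro subset_antisym subsetI)
 fix p assume "p : bnd X"
 moreover from this have "p : X" using bnd_subset(1) by blast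
 ultimately show "p : B" using assms(1)[of p] local_bnd by metis
next
 fix p assume p: "p : B"
 hence "p : X" using assms(2) by blast
 thus "p : bnd X" using assms(1)[of p] local_bnd p by metis
qed

lemma openin_compl: "closedin M S ==> openin M (topspace M - S)"
by (simp add: openin_diff)

text \<open>Off \<open>D\<close> the complement looks like \<open>S\<close>. In the open interior of
  \<open>E\<close>, which contains \<open>D\<close>, it looks like the complement of
  \<open>D\<close> in \<open>E\<close>. Charts and boundaries are local, so both descriptions
  transfer.\<close>

lemma pblob_trans:
 assumes S: "good S" and E: "pblob S E" and D: "pblob E D"
 shows "pblob S D"
proof -
 note bE = ballD[OF pblob_ball[OF E]] and bD = ballD[OF pblob_ball[OF D]]
 have DE: "D \<subseteq> E - bnd E" and ES: "E \<subseteq> S - bnd S" using pblob_subset[OF D] pblob_subset[OF E] by auto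
 have SM: "S \<subseteq> topspace M" by (rule good_subset[OF S])
 have gE: "good (cut d M E {D})" and bE': "bnd (cut d M E {D}) = bnd E Un bnd D" using D by (auto simp: pblob_def)
 have cover: "EX W Y. openin M W & p : W & cut d M S {D} Int W = Y Int W & good Y & (p : bnd Y \<longleftrightarrow> p : bnd S Un bnd D)"
 if p: "p : cut d M S {D}" for p
 proof (cases "p : D")
 case False
 show ?thesis
 proof (intro exI conjI)
 show "openin M (topspace M - D)" by (rule openin_compl[OF bD(3)])
 show "cut d M S {D} Int (topspace M - D) = S Int (topspace M - D)" by (auto simp: cut_Union)
 show "p : topspace M - D" using False p SM by (auto simp: cut_Union)
 show "p : bnd S \<longleftrightarrow> p : bnd S Un bnd D" using False bnd_subset(1)[of D] by blast
 qed (rule S)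
 next
 case True
 show ?thesis
 proof (intro exI conjI)
 show "openin M (E - bnd E)" by (rule openin_int[OF bE(1)])
 show "cut d M S {D} Int (E - bnd E) = cut d M E {D} Int (E - bnd E)" using ES by (auto simp: cut_Union)
 show "p : E - bnd E" using True DE by blast
 have "p : bnd D" using True p by (auto simp: cut_Union)
 thus "p : bnd (cut d M E {D}) \<longleftrightarrow> p : bnd S Un bnd D" by (simp add: bE')
 qed (rule gE)
 qed
 have "good (cut d M S {D})"
 proof (rule goodI)
 show "closedin M (cut d M S {D})" by (rule closedin_cut) (use S bD in "auto simp: good_def")
 show "chart_at (half_space (Suc d)) (subt M (cut d M S {D})) p" if "p : cut d M S {D}" for p
using cover[OF that] local_half[OF _ _ _ that] unfolding good_def by metis
 qed
 moreover have "bnd (cut d M S {D}) = bnd S Un bnd D"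
 proof (rule bnd_eq_localI)
 show "bnd S Un bnd D \<subseteq> cut d M S {D}" using DE ES bnd_subset(1)[of S] bnd_subset(1)[of D] by (auto simp: cut_Union)
 qed (use cover in blast)
 moreover have "D ~= S" using DE ES pblob_neq[OF E] by blast
 ultimately show ?thesis using pblob_ball[OF D] DE ES by (auto simp: pblob_def)
qed

lemma regionD:
 assumes "region S DD"
 shows "good S" "finite DD" "!!D. D : DD ==> pblob S D" "pairwise disjnt DD" "S ~: DD" "S \<subseteq> topspace M"
 "!!D D'. D : DD ==> D' : DD ==> D ~= D' ==> D Int D' = {}"
proof -
 show "good S" "finite DD" "pairwise disjnt DD" and p: "!!D. D : DD ==> pblob S D"
using assms by (simp_all add: region_def)
 show "S \<subseteq> topspace M" by (rule good_subset[OF \<open>good S\<close>])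
 show "S ~: DD" using p[of S] pblob_neq[of S S] by blast
 show "!!D D'. D : DD ==> D' : DD ==> D ~= D' ==> D Int D' = {}"
using \<open>pairwise disjnt DD\<close> unfolding pairwise_def disjnt_def by blast
qed

text \<open>Near a point outside all blobs the complement looks like \<open>S\<close>. Near a point
  on the boundary of \<open>D\<close> it looks like the complement of \<open>D\<close> alone,
  because the other blobs form a closed set that misses the point.\<close>

lemma region_cut:
 assumes R: "region S DD"
 shows "good (cut d M S DD)" and "bnd (cut d M S DD) = bnd S Un bds d M DD"
proof -
 note r = regionD[OF R]
 have b: "ball D" "D \<subseteq> S - bnd S" "D \<subseteq> topspace M" "closedin M D" if "D : DD" for D
using pblob_ball[OF r(3)[OF that]] pblob_subset[OF r(3)[OF that]] ballD by auto
 have cover: "EX W Y. openin M W & p : W & cut d M S DD Int W = Y Int W & good Y & (p : bnd Y \<longleftrightarrow> p : bnd S Un bds d M DD)"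
 if p: "p : cut d M S DD" for p
 proof (cases "EX D:DD. p : D")
 case False
 show ?thesis
 proof (intro exI conjI)
 show "openin M (topspace M - \<Union>DD)" using r(2) b by (intro openin_compl closedin_Union) auto
 show "cut d M S DD Int (topspace M - \<Union>DD) = S Int (topspace M - \<Union>DD)" by (auto simp: cut_Union)
 show "p : topspace M - \<Union>DD" using False p r(6) by (auto simp: cut_Union)
 have "p ~: bds d M DD" using False bnd_subset(1) unfolding bds_def by blast
 thus "p : bnd S \<longleftrightarrow> p : bnd S Un bds d M DD" by blast
 qed (rule r(1))
 next
 case True
 then obtain D where D: "D : DD" "p : D" by blast
 have pD: "p : bnd D" using p D by (auto simp: cut_Union)
 have g: "good (cut d M S {D})" "bnd (cut d M S {D}) = bnd S Un bnd D" using r(3)[OF D(1)] by (auto simp: pblob_def)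
 show ?thesis
 proof (intro exI conjI)
 show "openin M (topspace M - \<Union>(DD - {D}))" using r(2) b by (intro openin_compl closedin_Union) auto
 show "cut d M S DD Int (topspace M - \<Union>(DD - {D})) = cut d M S {D} Int (topspace M - \<Union>(DD - {D}))"
using D by (auto simp: cut_Union)
 show "p : topspace M - \<Union>(DD - {D})" using D b(3)[OF D(1)] r(7)[OF D(1)] by blast
 have "p : bds d M DD" using D(1) pD by (auto simp: bds_def)
 thus "p : bnd (cut d M S {D}) \<longleftrightarrow> p : bnd S Un bds d M DD" using pD by (simp add: g(2))
 qed (rule g(1))
 qed
 show "good (cut d M S DD)"
 proof (rule goodI)
 show "closedin M (cut d M S DD)" by (rule closedin_cut) (use r(1) b in "auto simp: good_def")
 show "chart_at (half_space (Suc d)) (subt M (cut d M S DD)) p" if "p : cut d M S DD" for p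
using cover[OF that] local_half[OF _ _ _ that] unfolding good_def by metis
 qed
 show "bnd (cut d M S DD) = bnd S Un bds d M DD"
 proof (rule bnd_eq_localI)
 show "bnd S Un bds d M DD \<subseteq> cut d M S DD"
 proof (intro Un_least subsetI)
 show "p : cut d M S DD" if "p : bnd S" for p using that b bnd_subset(1)[of S] by (auto simp: cut_Union)
 fix p assume "p : bds d M DD"
 then obtain D where D: "D : DD" "p : bnd D" by (auto simp: bds_def)
 hence "p : D" using bnd_subset(1) by blast
 moreover have "p ~: D' - bnd D'" if "D' : DD" for D' using that D r(7)[of D D'] \<open>p : D\<close> by blast
 ultimately show "p : cut d M S DD" using b(2)[OF D(1)] by (auto simp: cut_Union)
 qed
 qed (use cover in blast)
qed

lemma region_empty: "good S ==> region S {}"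
by (simp add: region_def)

lemma cut_empty [simp]: "cut d M S {} = S"
by (simp add: cut_def)

text \<open>The geometry of one partial composition: the blob \<open>E\<close> is filled by its own
  complement of \<open>EE\<close>, and the two pieces meet exactly in a sphere.\<close>

lemma region_insert:
 assumes S: "region S DD" and E: "E : DD" and R: "region E EE"
 shows "region S (DD - {E} Un EE)"
and "cut d M S DD Un cut d M E EE = cut d M S (DD - {E} Un EE)"
and "cut d M S DD Int cut d M E EE = bnd E"
proof -
 note r = regionD[OF S] and r' = regionD[OF R]
 have sub: "F \<subseteq> E - bnd E" if "F : EE" for F using pblob_subset[OF r'(3)[OF that]] .
 have ES: "E \<subseteq> S - bnd S" using pblob_subset[OF r(3)[OF E]] .
 have "pairwise disjnt (DD - {E} Un EE)"
 proof (rule pairwiseI)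
 fix F G assume FG: "F : DD - {E} Un EE" "G : DD - {E} Un EE" "F ~= G"
 have "F Int G = {}" if "F : DD - {E}" "G : EE" for F G using that r(7)[of F E] E sub[of G] by blast
 thus "disjnt F G" using FG r(7)[of F G] r'(7)[of F G] by (auto simp: disjnt_def Int_commute)
 qed
 thus "region S (DD - {E} Un EE)"
using r r' pblob_trans[OF r(1) r(3)[OF E]] by (auto simp: region_def)
 show "cut d M S DD Int cut d M E EE = bnd E"
 proof (intro subset_antisym subsetI)
 fix p assume "p : cut d M S DD Int cut d M E EE"
 thus "p : bnd E" using E by (auto simp: cut_Union)
 next
 fix p assume p: "p : bnd E"
 hence pE: "p : E" using bnd_subset(1) by blast
 have "p ~: D - bnd D" if "D : DD" for D using r(7)[of D E] that E pE p by blast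
 moreover have "p ~: F - bnd F" if "F : EE" for F using sub[OF that] p by blast
 ultimately show "p : cut d M S DD Int cut d M E EE" using pE ES by (auto simp: cut_Union)
 qed
 show "cut d M S DD Un cut d M E EE = cut d M S (DD - {E} Un EE)"
 proof (intro subset_antisym subsetI)
 fix p assume "p : cut d M S DD Un cut d M E EE"
 thus "p : cut d M S (DD - {E} Un EE)"
 proof
 assume p: "p : cut d M S DD"
 have "p ~: F - bnd F" if "F : EE" for F using sub[OF that] p E by (auto simp: cut_Union)
 thus ?thesis using p by (auto simp: cut_Union)
 next
 assume p: "p : cut d M E EE"
 have "p ~: D - bnd D" if "D : DD - {E}" for D using r(7)[of D E] that E p by (auto simp: cut_Union)
 thus ?thesis using p ES by (auto simp: cut_Union)
 qed
 next
 fix p assume p: "p : cut d M S (DD - {E} Un EE)"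
 show "p : cut d M S DD Un cut d M E EE"
by (cases "p : E - bnd E") (use p in "auto simp: cut_Union")
 qed
qed

lemma bnd_disjoint: "region S DD ==> D : DD ==> bnd S Int D = {}"
using pblob_subset[OF regionD(3)] by blast

lemma clopen_family:
 assumes "finite \<Z>" "!!Z. Z : \<Z> ==> closedin M Z" "!!Z Z'. Z : \<Z> ==> Z' : \<Z> ==> Z ~= Z' ==> Z Int Z' = {}" "\<Y> \<subseteq> \<Z>"
 shows "closedin (subt M (\<Union>\<Z>)) (\<Union>\<Y>)" "openin (subt M (\<Union>\<Z>)) (\<Union>\<Y>)"
proof -
 have c: "closedin (subt M (\<Union>\<Z>)) (\<Union>\<X>)" if "\<X> \<subseteq> \<Z>" for \<X>
 proof (rule closedin_subset_topspace)
 show "closedin M (\<Union>\<X>)" using that assms(1,2) finite_subset by (intro closedin_Union) auto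
 qed (use that in auto)
 show "closedin (subt M (\<Union>\<Z>)) (\<Union>\<Y>)" by (rule c[OF assms(4)])
 have "\<Union>\<Z> \<subseteq> topspace M" using assms(2) closedin_subset by fastforce
 moreover have "\<Union>\<Y> = \<Union>\<Z> - \<Union>(\<Z> - \<Y>)" using assms(3,4) by auto
 ultimately show "openin (subt M (\<Union>\<Z>)) (\<Union>\<Y>)"
using c[of "\<Z> - \<Y>"] by (simp add: openin_closedin_eq inf.absorb2 Diff_Diff_Int) (simp add: inf.absorb2 Union_mono)
qed

lemma manifold_Union_family:
 assumes "finite \<Z>" "!!Z. Z : \<Z> ==> closedin M Z" "!!Z Z'. Z : \<Z> ==> Z' : \<Z> ==> Z ~= Z' ==> Z Int Z' = {}"
and m: "!!Z. Z : \<Z> ==> manifold k (subt M Z)"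
 shows "manifold k (subt M (\<Union>\<Z>))"
proof (rule manifold_subI[OF manifold_M])
 fix p assume "p : topspace M Int \<Union>\<Z>"
 then obtain Z where Z: "Z : \<Z>" "p : Z" "p : topspace M" by blast
 have "openin (subt M (\<Union>\<Z>)) (\<Union>{Z})" by (rule clopen_family(2)[OF assms(1-3)]) (use Z in auto)
 hence "chart_at (half_space k) (subt (subt M (\<Union>\<Z>)) Z) p \<longleftrightarrow> chart_at (half_space k) (subt M (\<Union>\<Z>)) p"
using chart_at_open[of _ Z p] Z by simp
 moreover have "\<Union>\<Z> Int Z = Z" using Z by blast
 ultimately show "chart_at (half_space k) (subt M (\<Union>\<Z>)) p"
using m[OF Z(1)] Z(2,3) by (simp add: manifold_def subtopology_subtopology)
qed

lemma region_bnds: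
 assumes R: "region S DD"
 shows "!!Z. Z : bnd ` insert S DD ==> closedin M Z & manifold d (subt M Z)"
and "!!Z Z'. Z : bnd ` insert S DD ==> Z' : bnd ` insert S DD ==> Z ~= Z' ==> Z Int Z' = {}"
and "\<Union>(bnd ` insert S DD) = bnd (cut d M S DD)"
proof -
 note r = regionD[OF R]
 have g: "good Z" if "Z : insert S DD" for Z using that r(1) ballD(6)[OF pblob_ball[OF r(3)]] by auto
 show "!!Z. Z : bnd ` insert S DD ==> closedin M Z & manifold d (subt M Z)"
using closedin_bnd[OF g] manifold_bnd[OF g] by blast
 have "bnd D Int bnd D' = {}" if "D : insert S DD" "D' : insert S DD" "D ~= D'" for D D'
using that r(7)[of D D'] bnd_disjoint[OF R, of D] bnd_disjoint[OF R, of D'] bnd_subset(1)[of D] bnd_subset(1)[of D'] by blast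
 thus "!!Z Z'. Z : bnd ` insert S DD ==> Z' : bnd ` insert S DD ==> Z ~= Z' ==> Z Int Z' = {}" by blast
 show "\<Union>(bnd ` insert S DD) = bnd (cut d M S DD)" using region_cut(2)[OF R] by (simp add: bds_def)
qed

text \<open>\<open>glues_to\<close> wants the common piece to be open in both boundaries. The
  boundary of a complement is a finite disjoint union of closed pieces, so each piece is open in
  it.\<close>

lemma region_glues:
 assumes S: "region S DD" and E: "E : DD" and R: "region E EE"
 shows "glues_to (Suc d) (subt M (cut d M S DD Un cut d M E EE)) (cut d M S DD) (cut d M E EE)"
and "glues_to (Suc d) (subt M (cut d M S DD Un cut d M E EE)) (cut d M E EE) (cut d M S DD)"
proof -
 let ?A = "cut d M S DD" and ?B = "cut d M E EE"
 note i = region_insert[OF S E R]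
 note gA = region_cut[OF S] and gB = region_cut[OF R] and gW = region_cut[OF i(1)]
 have W: "manifold (Suc d) (subt M (?A Un ?B))" using gW(1) by (simp add: i(2) good_def)
 have sub: "?A Un ?B \<subseteq> topspace M" using good_subset[OF gA(1)] good_subset[OF gB(1)] by blast
 have cod: "codim0 (Suc d) (subt M (?A Un ?B)) Y" if "good Y" "Y \<subseteq> ?A Un ?B" for Y
using that closedin_subset_topspace[of M Y "?A Un ?B"] by (simp add: codim0_def good_def subtopology_subtopology inf.absorb2)
 have bE: "ball E" by (rule pblob_ball[OF regionD(3)[OF S E]])
 \<comment> \<open>Compactness of the glued piece comes from \<open>E\<close> being a ball; neither
   \<open>M\<close> nor the complements have to be compact.\<close>
 have "compactin M (bnd E)" using closed_compactin[OF ballD(2)[OF bE] bnd_subset(1) closedin_bnd[OF ballD(6)[OF bE]]] .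
 hence comp: "compactin (subt M (?A Un ?B)) (bnd E)" using i(3) by (auto simp: compactin_subtopology)
 have opn: "openin (subt M (bnd (cut d M S' DD'))) (bnd E)" if "region S' DD'" "E : insert S' DD'" for S' DD'
 proof -
 have "bnd E : bnd ` insert S' DD'" using that(2) by (rule imageI)
 hence "openin (subt M (\<Union>(bnd ` insert S' DD'))) (\<Union>{bnd E})"
using region_bnds(1,2)[OF that(1)] regionD(2)[OF that(1)] by (intro clopen_family(2)) (blast | simp)+
 thus ?thesis by (simp only: region_bnds(3)[OF that(1)] cSup_singleton)
 qed
 have oA: "openin (bdry (Suc d) (subt M ?A)) (bnd E)" and oB: "openin (bdry (Suc d) (subt M ?B)) (bnd E)"
unfolding bdry_bnd using opn[OF S] opn[OF R] E by auto
 have ab: "(?A Un ?B) Int ?A = ?A" "(?A Un ?B) Int ?B = ?B" by auto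
 show "glues_to (Suc d) (subt M (?A Un ?B)) ?A ?B"
unfolding glues_to_def
using W sub cod[OF gA(1)] cod[OF gB(1)] comp oA oB by (simp add: i(3) subtopology_subtopology ab inf.absorb2)
 show "glues_to (Suc d) (subt M (?A Un ?B)) ?B ?A"
unfolding glues_to_def
using W sub cod[OF gA(1)] cod[OF gB(1)] comp oA oB
by (simp add: i(3) Int_commute[of ?B ?A] Un_commute[of ?B ?A] subtopology_subtopology ab inf.absorb2)
qed

lemma connected_pieces:
 assumes "finite \<X>" "!!E. E : \<X> ==> closedin M E" "!!E E'. E : \<X> ==> E' : \<X> ==> E ~= E' ==> E Int E' = {}"
and D: "connectedin M D" "D ~= {}" "D \<subseteq> \<Union>\<X>"
 obtains E where "E : \<X>" "D \<subseteq> E"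
proof -
 obtain p E where p: "p : D" "p : E" "E : \<X>" using D by blast
 have "connectedin (subt M (\<Union>\<X>)) D" using D by (simp add: connectedin_subtopology)
 moreover have "closedin (subt M (\<Union>\<X>)) E" "openin (subt M (\<Union>\<X>)) E"
using clopen_family[of \<X> "{E}"] assms(1-3) p(3) by auto
 ultimately have "D \<subseteq> E \<or> disjnt D E" by (rule connectedin_clopen_cases)
 thus thesis using p that by (auto simp: disjnt_def)
qed

text \<open>A ball is connected, so one inside a disjoint union of balls lies in a single member,
  and near that member the union looks like the member alone. The components of the union are its
  members, which accounts for the degenerate alternative.\<close>

lemma blob_Union_iff:
 assumes fin: "finite \<X>" and ball: "!!E. E : \<X> ==> ball E"
and disj: "!!E E'. E : \<X> ==> E' : \<X> ==> E ~= E' ==> E Int E' = {}"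
 shows "blob d M (\<Union>\<X>) D \<longleftrightarrow> (EX E:\<X>. pblob E D \<or> D = E)"
proof -
 have cl: "closedin M E" if "E : \<X>" for E using ballD(3)[OF ball[OF that]] .
 have XM: "\<Union>\<X> \<subseteq> topspace M" using ballD(1)[OF ball] by blast
 \<comment> \<open>The complement of the other members is a neighbourhood of \<open>E\<close> in
   which the union is just \<open>E\<close>; all comparisons are made there.\<close>
 have W: "openin M (topspace M - \<Union>(\<X> - {E}))" "E \<subseteq> topspace M - \<Union>(\<X> - {E})"
 "\<Union>\<X> Int (topspace M - \<Union>(\<X> - {E})) = E Int (topspace M - \<Union>(\<X> - {E}))" if E: "E : \<X>" for E
 proof -
 show "openin M (topspace M - \<Union>(\<X> - {E}))" by (rule openin_compl, rule closedin_Union) (use fin cl in auto)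
 show "E \<subseteq> topspace M - \<Union>(\<X> - {E})" using E disj ballD(1)[OF ball[OF E]] by blast
 show "\<Union>\<X> Int (topspace M - \<Union>(\<X> - {E})) = E Int (topspace M - \<Union>(\<X> - {E}))" using E by blast
 qed
 have comp: "E : connected_components_of (subt M (\<Union>\<X>))" if E: "E : \<X>" for E
 proof -
 have cE: "connectedin M E" "E ~= {}" using ballD(4,5)[OF ball[OF E]] by auto
 then obtain p where p: "p : E" by blast
 let ?C = "connected_component_of_set (subt M (\<Union>\<X>)) p"
 have cC: "connectedin (subt M (\<Union>\<X>)) ?C" by (simp add: connectedin_connected_component_of)
 have cE': "connectedin (subt M (\<Union>\<X>)) E" using cE E by (auto simp: connectedin_subtopology)
 have pt: "p : topspace (subt M (\<Union>\<X>))" using p E XM by auto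
 have "E \<subseteq> ?C" using connected_component_of_maximal[OF cE' p] .
 moreover have "?C \<subseteq> E"
 proof -
 have "connectedin M ?C" "?C \<subseteq> \<Union>\<X>" using cC by (auto simp: connectedin_subtopology)
 then obtain E' where "E' : \<X>" "?C \<subseteq> E'"
using connected_pieces[OF fin cl disj] \<open>E \<subseteq> ?C\<close> cE(2) by (metis subset_empty)
 thus ?thesis using \<open>E \<subseteq> ?C\<close> disj[OF E \<open>E' : \<X>\<close>] cE(2) by blast
 qed
 ultimately have "E = ?C" by blast
 thus ?thesis using pt unfolding connected_components_of_def by blast
 qed
 have bE: "bnd (\<Union>\<X>) Int E = bnd E" if E: "E : \<X>" for E
using local_bnd[OF W(1)[OF E] _ W(3)[OF E]] W(2)[OF E] bnd_subset(1)[of E] by blast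
 have cutW: "cut d M (\<Union>\<X>) {D} Int (topspace M - \<Union>(\<X> - {E})) = cut d M E {D} Int (topspace M - \<Union>(\<X> - {E}))"
 if E: "E : \<X>" for E D using W(3)[OF E] by (auto simp: cut_Union)
 show ?thesis
 proof
 assume b: "blob d M (\<Union>\<X>) D"
 hence bD: "ball D" using XM by (auto simp: blob_def ball_def)
 have DX: "D \<subseteq> \<Union>\<X>" using b by (simp add: blob_def)
 obtain E where E: "E : \<X>" "D \<subseteq> E" using connected_pieces[OF fin cl disj ballD(4,5)[OF bD] DX] .
 show "EX E:\<X>. pblob E D \<or> D = E"
 proof (cases "D : connected_components_of (subt M (\<Union>\<X>))")
 case True
 have "connectedin (subt M (\<Union>\<X>)) E" using ballD(4)[OF ball[OF E(1)]] E(1) by (auto simp: connectedin_subtopology)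
 hence "E \<subseteq> D"
using connected_components_of_maximal[OF True] E(2) ballD(5)[OF bD] by (auto simp: disjnt_def)
 thus ?thesis using E by blast
 next
 case False
 hence i: "D \<subseteq> \<Union>\<X> - bnd (\<Union>\<X>)" "manifold (Suc d) (subt M (cut d M (\<Union>\<X>) {D}))"
 "bnd (cut d M (\<Union>\<X>) {D}) = bnd (\<Union>\<X>) Un bnd D" using b by (auto simp: blob_def)
 have 1: "D \<subseteq> E - bnd E" using i(1) E bE[OF E(1)] by blast
 have 2: "good (cut d M E {D})"
 proof (rule goodI)
 show "closedin M (cut d M E {D})" by (rule closedin_cut) (use cl[OF E(1)] ballD(1)[OF bD] in auto)
 show "chart_at (half_space (Suc d)) (subt M (cut d M E {D})) p" if "p : cut d M E {D}" for p
by (rule local_half[OF W(1)[OF E(1)] _ cutW[OF E(1), symmetric] that i(2)])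
 (use that W(2)[OF E(1)] in "auto simp: cut_Union")
 qed
 have 3: "bnd (cut d M E {D}) = bnd E Un bnd D"
 proof (rule bnd_eq_localI)
 show "bnd E Un bnd D \<subseteq> cut d M E {D}" using 1 bnd_subset(1)[of E] bnd_subset(1)[of D] by (auto simp: cut_Union)
 fix p assume p: "p : cut d M E {D}"
 hence pE: "p : E" by (auto simp: cut_Union)
 hence 2: "p : bnd (cut d M (\<Union>\<X>) {D}) \<longleftrightarrow> p : bnd E Un bnd D" using bE[OF E(1)] unfolding i(3) by blast
 have "p : topspace M - \<Union>(\<X> - {E})" using W(2)[OF E(1)] pE by blast
 thus "EX V Y. openin M V & p : V & cut d M E {D} Int V = Y Int V & (p : bnd Y \<longleftrightarrow> p : bnd E Un bnd D)"
using W(1)[OF E(1)] cutW[OF E(1), of D, symmetric] 2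
by (intro exI[of _ "topspace M - \<Union>(\<X> - {E})"] exI[of _ "cut d M (\<Union>\<X>) {D}"] conjI)
 qed
 show ?thesis using E 1 2 3 bD by (auto simp: pblob_def)
 qed
 next
 assume "EX E:\<X>. pblob E D \<or> D = E"
 then obtain E where E: "E : \<X>" "pblob E D \<or> D = E" by blast
 from E(2) show "blob d M (\<Union>\<X>) D"
 proof
 assume "D = E"
 thus ?thesis using comp[OF E(1)] ball[OF E(1)] E(1) by (auto simp: blob_def ball_def)
 next
 assume p: "pblob E D"
 hence i: "ball D" "D \<subseteq> E - bnd E" "good (cut d M E {D})" "bnd (cut d M E {D}) = bnd E Un bnd D" by (auto simp: pblob_def)
 have 1: "D \<subseteq> \<Union>\<X> - bnd (\<Union>\<X>)" using i(2) E(1) bE[OF E(1)] by blast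
 have cases: "p : topspace M - E \<or> p : E" if "p : cut d M (\<Union>\<X>) {D}" for p using that XM by (auto simp: cut_Union)
 have cutE: "cut d M (\<Union>\<X>) {D} Int (topspace M - E) = \<Union>\<X> Int (topspace M - E)" using i(2) by (auto simp: cut_Union)
 have mX: "manifold (Suc d) (subt M (\<Union>\<X>))"
by (rule manifold_Union_family[OF fin cl disj]) (use ballD(6)[OF ball] in "auto simp: good_def")
 have "good (cut d M (\<Union>\<X>) {D})"
 proof (rule goodI)
 show "closedin M (cut d M (\<Union>\<X>) {D})" by (rule closedin_cut, rule closedin_Union) (use fin cl ballD(1)[OF i(1)] in auto)
 fix p assume p: "p : cut d M (\<Union>\<X>) {D}"
 show "chart_at (half_space (Suc d)) (subt M (cut d M (\<Union>\<X>) {D})) p"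
using cases[OF p]
 proof
 assume q: "p : topspace M - E"
 show ?thesis by (rule local_half[OF openin_compl[OF cl[OF E(1)]] q cutE p mX])
 next
 assume "p : E"
 thus ?thesis
by (intro local_half[OF W(1)[OF E(1)] _ cutW[OF E(1)] p]) (use W(2)[OF E(1)] i(3) in "auto simp: good_def")
 qed
 qed
 moreover have "bnd (cut d M (\<Union>\<X>) {D}) = bnd (\<Union>\<X>) Un bnd D"
 proof (rule bnd_eq_localI)
 show "bnd (\<Union>\<X>) Un bnd D \<subseteq> cut d M (\<Union>\<X>) {D}"
using 1 bnd_subset(1)[of "\<Union>\<X>"] bnd_subset(1)[of D] by (auto simp: cut_Union)
 fix p assume p: "p : cut d M (\<Union>\<X>) {D}"
 show "EX V Y. openin M V & p : V & cut d M (\<Union>\<X>) {D} Int V = Y Int V & (p : bnd Y \<longleftrightarrow> p : bnd (\<Union>\<X>) Un bnd D)"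
using cases[OF p]
 proof
 assume q: "p : topspace M - E"
 hence "p ~: bnd D" using i(2) bnd_subset(1)[of D] by blast
 hence "p : bnd (\<Union>\<X>) \<longleftrightarrow> p : bnd (\<Union>\<X>) Un bnd D" by blast
 thus ?thesis using openin_compl[OF cl[OF E(1)]] q cutE
by (intro exI[of _ "topspace M - E"] exI[of _ "\<Union>\<X>"] conjI)
 next
 assume q: "p : E"
 hence "p : bnd (\<Union>\<X>) \<longleftrightarrow> p : bnd E" using bE[OF E(1)] by blast
 hence 2: "p : bnd (cut d M E {D}) \<longleftrightarrow> p : bnd (\<Union>\<X>) Un bnd D" unfolding i(4) by blast
 have "p : topspace M - \<Union>(\<X> - {E})" using W(2)[OF E(1)] q by blast
 thus ?thesis using W(1)[OF E(1)] cutW[OF E(1), of D] 2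
by (intro exI[of _ "topspace M - \<Union>(\<X> - {E})"] exI[of _ "cut d M E {D}"] conjI)
 qed
 qed
 ultimately show ?thesis using 1 i(1) by (auto simp: blob_def ball_def good_def)
 qed
 qed
qed

text \<open>The only component is \<open>S\<close>, so the component alternative means
  \<open>D = S\<close>.\<close>

lemma blob_connected_iff:
 assumes S: "connectedin M S" "S ~= {}" "closedin M S"
 shows "blob d M S D \<longleftrightarrow> pblob S D \<or> D = S & ball S"
proof -
 have SM: "S \<subseteq> topspace M" using S(1) by (simp add: connectedin_def)
 have comps: "connected_components_of (subt M S) = {S}"
 proof -
 have c: "connected_space (subt M S)" "topspace (subt M S) = S" using S(1) SM by (auto simp: connectedin_def)
 have "connected_component_of_set (subt M S) p = S" if "p : S" for p
using c that by (simp add: connected_space_connected_component_set)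
 thus ?thesis using S(2) SM unfolding connected_components_of_def by (auto simp: image_iff inf.absorb2)
 qed
 show ?thesis
 proof
 assume b: "blob d M S D"
 have bD: "ball D" using b SM by (auto simp: blob_def ball_def)
 show "pblob S D \<or> D = S & ball S"
 proof (cases "D = S")
 case False
 hence "D \<subseteq> S - bnd S" "manifold (Suc d) (subt M (cut d M S {D}))" "bnd (cut d M S {D}) = bnd S Un bnd D"
using b comps by (auto simp: blob_def)
 moreover have "closedin M (cut d M S {D})" by (rule closedin_cut) (use S(3) ballD(1)[OF bD] in auto)
 ultimately show ?thesis using bD False by (simp add: pblob_def good_def)
 qed (use bD in simp)
 next
 assume "pblob S D \<or> D = S & ball S"
 thus "blob d M S D" using comps by (auto simp: pblob_def blob_def ball_def good_def)
 qed
qed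

end

section \<open>Fields on complements of blobs\<close>

lemma inj_Field [simp]: "inj Field" and inj_Degen [simp]: "inj (%a. Degen a c)"
by (auto intro: injI)

lemma module_ring:
 fixes R :: "'r ring"
 assumes R: "cring R"
 shows "rmod R (mk_module (cr R) (%x y. x \<oplus>\<^bsub>R\<^esub> y) \<zero>\<^bsub>R\<^esub> (%x y. x \<otimes>\<^bsub>R\<^esub> y))"
proof -
 interpret cring R by (rule R)
 show ?thesis by (rule module_mk_module[OF R]) (auto simp: a_ac m_assoc l_distr r_distr)
qed

lemma degen_simps:
 "cr (degen_module R e) = (%a. Degen a e) ` cr R"
 "a : cr R ==> a' : cr R ==> Degen a e \<oplus>\<^bsub>degen_module R e\<^esub> Degen a' e = Degen (a \<oplus>\<^bsub>R\<^esub> a') e"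
 "a' : cr R ==> a \<odot>\<^bsub>degen_module R e\<^esub> Degen a' e = Degen (a \<otimes>\<^bsub>R\<^esub> a') e"
proof -
 let ?A = "mk_module (cr R) (%x y. x \<oplus>\<^bsub>R\<^esub> y) \<zero>\<^bsub>R\<^esub> (%x y. x \<otimes>\<^bsub>R\<^esub> y)"
 show "cr (degen_module R e) = (%a. Degen a e) ` cr R" by (simp add: degen_module_def)
 show "Degen a e \<oplus>\<^bsub>degen_module R e\<^esub> Degen a' e = Degen (a \<oplus>\<^bsub>R\<^esub> a') e" if "a : cr R" "a' : cr R"
unfolding degen_module_def using add_tag[OF inj_Degen[of e], of a ?A a'] that by simp
 show "a \<odot>\<^bsub>degen_module R e\<^esub> Degen a' e = Degen (a \<otimes>\<^bsub>R\<^esub> a') e" if "a' : cr R"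
unfolding degen_module_def using smult_tag[OF inj_Degen[of e], of a' ?A a] that by simp
qed

locale field_theory = mfd d M + linearly_enriched d C R M
 for d :: nat and M :: "'p topology" and C :: "('p, 'f, 'r) fields" and R :: "'r ring" +
 assumes cring_R: "cring R"
begin

abbreviation "sub == subt M"
abbreviation "hole == cut d M"
abbreviation "bnds == bds d M"

section \<open>Fields on empty manifolds and on disjoint unions of spheres\<close>

lemma manifold_empty: "topspace (X :: 'p topology) = {} ==> manifold k X"
proof -
 assume "topspace X = {}"
 hence "X = sub {}" using null_topspace_iff_trivial[of X] null_topspace_iff_trivial[of "sub {}"] by simp
 thus ?thesis using manifold_subI[OF manifold_M, of "{}"] by simp
qed

text \<open>Over an empty intersection, agreement compares two fields on an empty manifold one
  dimension lower, so uniqueness there settles it.\<close>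

lemma agree_disjoint_aux:
 assumes uniq: "!!j x y X. k = Suc j ==> topspace X = {} ==> x : Fld C j X ==> y : Fld C j X ==> x = y"
and k: "k \<le> Suc d" and m: "manifold k (subt W A)" "manifold k (subt W B)" and AB: "A Int B = {}"
and x: "x : Fld C k (subt W A)" and y: "y : Fld C k (subt W B)"
 shows "agree C k W A B x y"
unfolding agree_def
proof (intro allI impI)
 fix j assume j: "k = Suc j"
 have 1: "Res C j (bdry k (subt W A)) {} (Bdr C j (subt W A) x) : Fld C j (subt (bdry k (subt W A)) {})"
 if m: "manifold k (subt W A)" and x: "x : Fld C k (subt W A)" for A x
 proof (rule Res)
 show "j \<le> d" using j k by simp
 show "manifold j (bdry k (subt W A))" using manifold_bdry m unfolding j by blast
 show "codim0 j (bdry k (subt W A)) {}" unfolding codim0_def using manifold_empty[of "subt (bdry k (subt W A)) {}"] by simp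
 show "Bdr C j (subt W A) x : Fld C j (bdry k (subt W A))" using Bdr m x k unfolding j by simp
 qed
 have "subt (bdry k (subt W A)) {} = subt (bdry k (subt W B)) {}"
by simp
 thus "Res C j (bdry k (subt W A)) (A Int B) (Bdr C j (subt W A) x) =
 Res C j (bdry k (subt W B)) (A Int B) (Bdr C j (subt W B) y)"
unfolding AB using uniq[OF j, of "subt (bdry k (subt W A)) {}"] 1[OF m(1) x] 1[OF m(2) y] by simp
qed

text \<open>Glue \<open>x\<close> and \<open>y\<close> along the decomposition of the empty manifold
  into two empty pieces. Restriction returns the first argument, and symmetry of glueing exchanges
  the two. The induction provides the agreement of \<open>x\<close> and \<open>y\<close>, a
  statement in one dimension less.\<close>

lemma Fld_empty_unique:
 assumes "k \<le> d" "topspace X = {}" "x : Fld C k X" "y : Fld C k X" shows "x = y"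
using assms
proof (induction k arbitrary: X x y)
 have *: "x = y" if k: "k \<le> d" and X: "topspace X = {}" and x: "x : Fld C k X" and y: "y : Fld C k X"
and ag: "!!x y. x : Fld C k X ==> y : Fld C k X ==> agree C k X {} {} x y" for k X x y
 proof -
 have XX: "subt X {} = X" by (metis X subtopology_topspace)
 have gl: "glues_to k X {} {}" using X XX manifold_empty[OF X] by (simp add: glues_to_def codim0_def)
 have G: "Glue C k X {} {} x y = x" if "x : Fld C k X" "y : Fld C k X" for x y
using Res_Glue[OF k gl, of x y] Res_id[OF k manifold_empty[OF X], of "Glue C k X {} {} x y"]
 Glue[OF _ gl, of x y] ag[OF that] that k XX X by simp
 show "x = y" using Glue_sym[OF _ gl, of x y] G[OF x y] G[OF y x] ag[OF x y] x y k XX by simp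
 qed
 { case 0 thus ?case by (intro *[of 0]) (auto simp: agree_def) }
 case (Suc k)
 show ?case
 proof (rule *[OF Suc.prems])
 fix x y assume xy: "x : Fld C (Suc k) X" "y : Fld C (Suc k) X"
 have XX: "subt X {} = X" by (metis Suc.prems(2) subtopology_topspace)
 show "agree C (Suc k) X {} {} x y"
by (rule agree_disjoint_aux) (use Suc.IH Suc.prems xy XX manifold_empty[OF Suc.prems(2)] in auto)
 qed
qed

lemma agree_disjoint:
 assumes "k \<le> Suc d" "manifold k (subt W A)" "manifold k (subt W B)" "A Int B = {}"
 "x : Fld C k (subt W A)" "y : Fld C k (subt W B)"
 shows "agree C k W A B x y"
by (rule agree_disjoint_aux[OF _ assms]) (use Fld_empty_unique assms(1) in auto)

text \<open>Spheres are indexed by the sets they bound. The members themselves may be nested, as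
  \<open>S\<close> and the blobs in it are; only their boundaries are disjoint.\<close>

definition bfam :: "'p set set => bool" where
 "bfam II \<longleftrightarrow> finite II & (ALL Z:II. good Z) & (ALL Z:II. ALL Z':II. Z ~= Z' --> bnd Z Int bnd Z' = {})"

lemma bfam_subset: "bfam II ==> JJ \<subseteq> II ==> bfam JJ"
unfolding bfam_def by (meson finite_subset subsetD)

lemma bnds_sing: "bnds {Z} = bnd Z" and bnds_insert: "bnds (insert Z II) = bnd Z Un bnds II"
and bnds_Un: "bnds (II Un JJ) = bnds II Un bnds JJ" and bnds_mono: "JJ \<subseteq> II ==> bnds JJ \<subseteq> bnds II"
by (auto simp: bds_def)

lemma bfam_manifold:
 assumes "bfam II" shows "closedin M (bnds II)" "manifold d (sub (bnds II))"
proof -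
 have g: "!!Z. Z : bnd ` II ==> closedin M Z" "!!Z. Z : bnd ` II ==> manifold d (sub Z)"
 "!!Z Z'. Z : bnd ` II ==> Z' : bnd ` II ==> Z ~= Z' ==> Z Int Z' = {}" "finite (bnd ` II)"
 proof -
 have g: "good Z" if "Z : II" for Z using assms that unfolding bfam_def by blast
 show "finite (bnd ` II)" using assms unfolding bfam_def by simp
 show "closedin M Z" "manifold d (sub Z)" if Z: "Z : bnd ` II" for Z using Z closedin_bnd[OF g] manifold_bnd[OF g] by auto
 show "Z Int Z' = {}" if "Z : bnd ` II" "Z' : bnd ` II" "Z ~= Z'" for Z Z'
using that assms unfolding bfam_def by force
 qed
 have e: "bnds II = \<Union>(bnd ` II)" by (simp add: bds_def)
 show "closedin M (bnds II)" unfolding e by (rule closedin_Union) (use g in auto)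
 show "manifold d (sub (bnds II))" unfolding e by (rule manifold_Union_family[OF g(4,1,3,2)])
qed

lemma bfam_codim0:
 assumes "bfam II" "JJ \<subseteq> II" shows "codim0 d (sub (bnds II)) (bnds JJ)"
proof -
 note m = bfam_manifold[OF bfam_subset[OF assms]] and s = bnds_mono[OF assms(2)]
 show ?thesis unfolding codim0_def
using m s by (simp add: closedin_subset_topspace subtopology_subtopology inf.absorb2)
qed

lemma bfam_glues:
 assumes "bfam (JJ Un \<K>)" "JJ Int \<K> = {}"
 shows "glues_to d (sub (bnds (JJ Un \<K>))) (bnds JJ) (bnds \<K>)" "bnds JJ Int bnds \<K> = {}"
proof -
 show d: "bnds JJ Int bnds \<K> = {}"
 proof (rule ccontr)
 assume "bnds JJ Int bnds \<K> ~= {}"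
 then obtain p Z Z' where *: "p : bnd Z" "p : bnd Z'" "Z : JJ" "Z' : \<K>" by (auto simp: bds_def)
 hence "Z ~= Z'" using assms(2) by blast
 hence "bnd Z Int bnd Z' = {}" using assms(1) *(3,4) unfolding bfam_def by simp
 thus False using *(1,2) by blast
 qed
 have "bnds (JJ Un \<K>) \<subseteq> topspace M" using bfam_manifold(1)[OF assms(1)] closedin_subset by blast
 thus "glues_to d (sub (bnds (JJ Un \<K>))) (bnds JJ) (bnds \<K>)"
using bfam_manifold(2)[OF assms(1)] bfam_codim0[OF assms(1), of JJ] bfam_codim0[OF assms(1), of \<K>] d
by (simp add: glues_to_def inf.absorb2 bnds_Un)
qed

lemma sub_sub: "A \<subseteq> B ==> subt (sub B) A = sub A"
by (simp add: subtopology_subtopology inf.absorb2)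

lemma Res_bnds:
 assumes "bfam II" "JJ \<subseteq> II" "w : Fld C d (sub (bnds II))"
 shows "Res C d (sub (bnds II)) (bnds JJ) w : Fld C d (sub (bnds JJ))"
and "\<K> \<subseteq> JJ ==> Res C d (sub (bnds JJ)) (bnds \<K>) (Res C d (sub (bnds II)) (bnds JJ) w) = Res C d (sub (bnds II)) (bnds \<K>) w"
proof -
 note m = bfam_manifold(2)[OF assms(1)] and c = bfam_codim0[OF assms(1)]
 show "Res C d (sub (bnds II)) (bnds JJ) w : Fld C d (sub (bnds JJ))"
using Res[OF order_refl m c[OF assms(2)] assms(3)] by (simp add: sub_sub bnds_mono[OF assms(2)])
 show "Res C d (sub (bnds JJ)) (bnds \<K>) (Res C d (sub (bnds II)) (bnds JJ) w) = Res C d (sub (bnds II)) (bnds \<K>) w" if "\<K> \<subseteq> JJ"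
using Res_Res[OF order_refl m c[OF assms(2)] c[of \<K>] bnds_mono[OF that] assms(3)] that assms(2)
by (simp add: sub_sub bnds_mono[OF assms(2)])
qed

text \<open>\<open>disjoint_union\<close> recovers a field from its restrictions to two parts; one
  boundary is peeled off at a time, and the empty family is covered by uniqueness on the empty
  manifold.\<close>

lemma bfam_ext:
 assumes "bfam II" "w : Fld C d (sub (bnds II))" "w' : Fld C d (sub (bnds II))"
 "!!Z. Z : II ==> Res C d (sub (bnds II)) (bnd Z) w = Res C d (sub (bnds II)) (bnd Z) w'"
 shows "w = w'"
proof -
 have "finite II" using assms(1) by (simp add: bfam_def)
 thus ?thesis using assms
 proof (induction II arbitrary: w w' rule: finite_induct)
 case empty
 thus ?case using Fld_empty_unique[OF order_refl, of "sub (bnds {})"] by (simp add: bds_def)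
 next
 case (insert Z II)
 have b: "bfam ({Z} Un II)" using insert.prems(1) by simp
 have d: "{Z} Int II = {}" using insert.hyps by simp
 note gl = bfam_glues[OF b d]
 have bI: "bfam II" by (rule bfam_subset[OF b]) auto
 let ?B = "bnds (insert Z II)"
 have "Res C d (sub ?B) (bnds II) w = Res C d (sub ?B) (bnds II) w'"
 proof (rule insert.IH[OF bI])
 show "Res C d (sub ?B) (bnds II) w : Fld C d (sub (bnds II))" "Res C d (sub ?B) (bnds II) w' : Fld C d (sub (bnds II))"
using Res_bnds(1)[OF insert.prems(1) subset_insertI] insert.prems(2,3) by auto
 fix Z' assume Z': "Z' : II"
 hence "{Z'} \<subseteq> II" by simp
 thus "Res C d (sub (bnds II)) (bnd Z') (Res C d (sub ?B) (bnds II) w) = Res C d (sub (bnds II)) (bnd Z') (Res C d (sub ?B) (bnds II) w')"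
using Res_bnds(2)[OF insert.prems(1) subset_insertI, of _ "{Z'}"] insert.prems(2,3) insert.prems(4)[of Z'] Z' by (simp add: bnds_sing)
 qed
 moreover have "Res C d (sub ?B) (bnds {Z}) w = Res C d (sub ?B) (bnds {Z}) w'" using insert.prems(4)[of Z] by (simp add: bnds_sing)
 ultimately show ?case
using disjoint_union[OF order_refl gl, of w] disjoint_union[OF order_refl gl, of w'] insert.prems(2,3) by simp
 qed
qed

text \<open>Unlike a single field on a union of spheres, a function on the bounding sets restricts
  to subfamilies and merges with other decorations without any glueing.\<close>

definition decor :: "('p set => 'f) => 'p set set => bool" where
 "decor c II \<longleftrightarrow> (ALL Z:II. c Z : Fld C d (sub (bnd Z)))"

lemma Glue_bnds:
 assumes b: "bfam (JJ Un \<K>)" "JJ Int \<K> = {}" and x: "x : Fld C d (sub (bnds JJ))" and y: "y : Fld C d (sub (bnds \<K>))"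
 defines "w == Glue C d (sub (bnds (JJ Un \<K>))) (bnds JJ) (bnds \<K>) x y"
 shows "w : Fld C d (sub (bnds (JJ Un \<K>)))"
 "Z : JJ ==> Res C d (sub (bnds (JJ Un \<K>))) (bnd Z) w = Res C d (sub (bnds JJ)) (bnd Z) x"
 "Z : \<K> ==> Res C d (sub (bnds (JJ Un \<K>))) (bnd Z) w = Res C d (sub (bnds \<K>)) (bnd Z) y"
proof -
 note gl = bfam_glues[OF b]
 have b': "bfam (\<K> Un JJ)" "\<K> Int JJ = {}" using b by (simp_all add: Un_commute Int_commute)
 have gl': "glues_to d (sub (bnds (JJ Un \<K>))) (bnds \<K>) (bnds JJ)" using bfam_glues(1)[OF b'] by (simp add: Un_commute)
 have e: "subt (sub (bnds (JJ Un \<K>))) (bnds JJ) = sub (bnds JJ)" "subt (sub (bnds (JJ Un \<K>))) (bnds \<K>) = sub (bnds \<K>)"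
by (simp_all add: sub_sub bnds_mono)
 have m: "manifold d (sub (bnds JJ))" "manifold d (sub (bnds \<K>))"
using bfam_manifold(2)[OF bfam_subset[OF b(1)]] by auto
 have ag: "agree C d (sub (bnds (JJ Un \<K>))) (bnds JJ) (bnds \<K>) x y" "agree C d (sub (bnds (JJ Un \<K>))) (bnds \<K>) (bnds JJ) y x"
by (rule agree_disjoint; use m x y gl(2) e in "simp add: Int_commute")+
 show w: "w : Fld C d (sub (bnds (JJ Un \<K>)))" unfolding w_def by (rule Glue[OF _ gl(1)]) (use ag x y e in auto)
 have sym: "w = Glue C d (sub (bnds (JJ Un \<K>))) (bnds \<K>) (bnds JJ) y x"
unfolding w_def by (rule Glue_sym[OF _ gl(1)]) (use ag x y e in auto)
 have r: "Res C d (sub (bnds (JJ Un \<K>))) (bnds JJ) w = x"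
unfolding w_def by (rule Res_Glue[OF _ gl(1)]) (use ag x y e in auto)
 have r': "Res C d (sub (bnds (JJ Un \<K>))) (bnds \<K>) w = y"
unfolding sym by (rule Res_Glue[OF _ gl']) (use ag x y e in auto)
 show "Res C d (sub (bnds (JJ Un \<K>))) (bnd Z) w = Res C d (sub (bnds JJ)) (bnd Z) x" if "Z : JJ"
using Res_bnds(2)[OF b(1) _ w, of JJ "{Z}"] that by (simp add: r bnds_sing)
 show "Res C d (sub (bnds (JJ Un \<K>))) (bnd Z) w = Res C d (sub (bnds \<K>)) (bnd Z) y" if "Z : \<K>"
using Res_bnds(2)[OF b(1) _ w, of \<K> "{Z}"] that by (simp add: r' bnds_sing)
qed

lemma Res_singleton:
 assumes "good Z" "x : Fld C d (sub (bnd Z))" shows "Res C d (sub (bnd Z)) (bnd Z) x = x"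
using Res_id[OF order_refl manifold_bnd[OF assms(1)] assms(2)] bnd_subset(2)[of Z] by (simp add: inf.absorb2)

text \<open>Boundary fields are glued on one at a time. The family must be nonempty because the
  axioms provide no field on the empty manifold.\<close>

lemma bfam_exists:
 assumes "bfam II" "II ~= {}" "decor c II"
 shows "EX w:Fld C d (sub (bnds II)). ALL Z:II. Res C d (sub (bnds II)) (bnd Z) w = c Z"
proof -
 have "finite II" using assms(1) by (simp add: bfam_def)
 thus ?thesis using assms(2,1,3)
 proof (induction II rule: finite_ne_induct)
 case (singleton Z)
 thus ?case using Res_singleton[of Z "c Z"] by (auto simp: bnds_sing decor_def bfam_def)
 next
 case (insert Z II)
 have b: "bfam ({Z} Un II)" using insert.prems(1) by simp
 have d: "{Z} Int II = {}" using insert.hyps by simp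
 obtain w where w: "w : Fld C d (sub (bnds II))" "ALL Z:II. Res C d (sub (bnds II)) (bnd Z) w = c Z"
using insert.IH bfam_subset[OF insert.prems(1)] insert.prems(2) by (auto simp: decor_def)
 have c: "c Z : Fld C d (sub (bnds {Z}))" "good Z" using insert.prems by (auto simp: bnds_sing decor_def bfam_def)
 note g = Glue_bnds[OF b d c(1) w(1)]
 show ?case
using g w(2) Res_singleton[OF c(2)] c(1) by (intro bexI[OF _ g(1)[simplified]]) (auto simp: bnds_sing)
 qed
qed

text \<open>The choice is unique by \<open>bfam_ext\<close>, hence equal to the glueing of the
  pieces in any order.\<close>

definition bfield :: "('p set => 'f) => 'p set set => 'f" where
 "bfield c II = (SOME w. w : Fld C d (sub (bnds II)) & (ALL Z:II. Res C d (sub (bnds II)) (bnd Z) w = c Z))"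

lemma bfield:
 assumes "bfam II" "II ~= {}" "decor c II"
 shows "bfield c II : Fld C d (sub (bnds II))" "!!Z. Z : II ==> Res C d (sub (bnds II)) (bnd Z) (bfield c II) = c Z"
 "!!w. w : Fld C d (sub (bnds II)) ==> (!!Z. Z : II ==> Res C d (sub (bnds II)) (bnd Z) w = c Z) ==> w = bfield c II"
proof -
 have *: "bfield c II : Fld C d (sub (bnds II)) & (ALL Z:II. Res C d (sub (bnds II)) (bnd Z) (bfield c II) = c Z)"
unfolding bfield_def by (rule someI_ex) (use bfam_exists[OF assms] in blast)
 show "bfield c II : Fld C d (sub (bnds II))" "!!Z. Z : II ==> Res C d (sub (bnds II)) (bnd Z) (bfield c II) = c Z" using * by auto
 show "w = bfield c II" if "w : Fld C d (sub (bnds II))" "!!Z. Z : II ==> Res C d (sub (bnds II)) (bnd Z) w = c Z" for w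
by (rule bfam_ext[OF assms(1)]) (use * that in auto)
qed

lemma region_bfam:
 assumes "region S DD" shows "bfam (insert S DD)" "bnds (insert S DD) = bnd (hole S DD)"
proof -
 note r = regionD[OF assms]
 have g: "good Z" if "Z : insert S DD" for Z using that r(1) ballD(6)[OF pblob_ball[OF r(3)]] by auto
 have "bnd D Int bnd D' = {}" if "D : insert S DD" "D' : insert S DD" "D ~= D'" for D D'
using that r(7)[of D D'] bnd_disjoint[OF assms, of D] bnd_disjoint[OF assms, of D'] bnd_subset(1)[of D] bnd_subset(1)[of D'] by blast
 thus "bfam (insert S DD)" using g r(2) by (simp add: bfam_def)
 show "bnds (insert S DD) = bnd (hole S DD)" using region_cut(2)[OF assms] by (simp add: bnds_insert)
qed

section \<open>Fields on complements with prescribed boundary fields\<close>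

definition FM :: "('p set => 'f) => 'p set => 'p set set => ('r, 'f) module" where
 "FM c S DD = Fmod C (sub (hole S DD)) (bfield c (insert S DD))"

lemma FM:
 assumes r: "region S DD" and c: "decor c (insert S DD)"
 shows "rmod R (FM c S DD)"
 "x : cr (FM c S DD) \<longleftrightarrow> x : Fld C (Suc d) (sub (hole S DD)) \<and>
 (ALL Z:insert S DD. Res C d (sub (bnd (hole S DD))) (bnd Z) (Bdr C d (sub (hole S DD)) x) = c Z)"
 "x : cr (FM c S DD) ==> Bdr C d (sub (hole S DD)) x = bfield c (insert S DD)"
proof -
 note b = region_bfam[OF r] and g = region_cut(1)[OF r]
 note f = bfield[OF b(1) insert_not_empty c, unfolded b(2)]
 have co: "codim0 (Suc d) M (hole S DD)" using g by (simp add: good_codim0)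
 have fb: "bfield c (insert S DD) : Fld C d (bdry (Suc d) (sub (hole S DD)))" using f(1) by (simp add: bdry_bnd)
 show "rmod R (FM c S DD)" unfolding FM_def by (rule Fmod[OF co fb])
 have m: "manifold (Suc d) (sub (hole S DD))" using g by (simp add: good_def)
 have B: "Bdr C d (sub (hole S DD)) x : Fld C d (sub (bnd (hole S DD)))" if "x : Fld C (Suc d) (sub (hole S DD))" for x
using Bdr[OF order_refl m that] by (simp add: bdry_bnd)
 show "x : cr (FM c S DD) \<longleftrightarrow> x : Fld C (Suc d) (sub (hole S DD)) \<and>
 (ALL Z:insert S DD. Res C d (sub (bnd (hole S DD))) (bnd Z) (Bdr C d (sub (hole S DD)) x) = c Z)"
 proof -
 have "Bdr C d (sub (hole S DD)) x = bfield c (insert S DD) \<longleftrightarrow>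
 (ALL Z:insert S DD. Res C d (sub (bnd (hole S DD))) (bnd Z) (Bdr C d (sub (hole S DD)) x) = c Z)"
 if x: "x : Fld C (Suc d) (sub (hole S DD))"
using f(2) f(3)[OF B[OF x]] by metis
 thus ?thesis unfolding FM_def carrier_Fmod[OF co fb] mem_Collect_eq by metis
 qed
 show "x : cr (FM c S DD) ==> Bdr C d (sub (hole S DD)) x = bfield c (insert S DD)"
unfolding FM_def carrier_Fmod[OF co fb] by simp
qed

lemma bnd_Diff:
 assumes r: "region S DD" and E: "E : insert S DD" and int: "hole S DD Int B = bnd E"
 shows "bnd (hole S DD) - B = bnds (insert S DD - {E})"
proof -
 have "bnd (hole S DD) - B = bnd (hole S DD) - bnd E" using int bnd_subset(1)[of "hole S DD"] by blast
 also have "\<dots> = bnds (insert S DD) - bnd E" by (simp add: region_bfam(2)[OF r])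
 also have "\<dots> = bnds (insert S DD - {E})"
 proof -
 have "bnd Z Int bnd E = {}" if "Z : insert S DD - {E}" for Z
 proof -
 have "Z : insert S DD" "Z ~= E" using that by auto
 with region_bfam(1)[OF r, unfolded bfam_def] E show ?thesis by blast
 qed
 thus ?thesis using E by (auto simp: bds_def)
 qed
 finally show ?thesis .
qed

lemma bfield_Diff:
 assumes r: "region S DD" and c: "decor c (insert S DD)" and r': "region S' DD'" and c': "decor c (insert S' DD')"
and J: "JJ \<subseteq> insert S DD" "JJ \<subseteq> insert S' DD'"
 shows "Res C d (sub (bnd (hole S DD))) (bnds JJ) (bfield c (insert S DD)) = Res C d (sub (bnd (hole S' DD'))) (bnds JJ) (bfield c (insert S' DD'))"
proof -
 note b = region_bfam[OF r] and b' = region_bfam[OF r']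
 note f = bfield[OF b(1) insert_not_empty c] and f' = bfield[OF b'(1) insert_not_empty c']
 show ?thesis
unfolding b(2)[symmetric] b'(2)[symmetric]
 proof (rule bfam_ext[OF bfam_subset[OF b(1) J(1)] Res_bnds(1)[OF b(1) J(1) f(1)] Res_bnds(1)[OF b'(1) J(2) f'(1)]])
 fix Z assume Z: "Z : JJ"
 hence "{Z} \<subseteq> JJ" "Z : insert S DD" "Z : insert S' DD'" using J by auto
 note this(2,3) Res_bnds(2)[OF b(1) J(1) f(1) this(1)] Res_bnds(2)[OF b'(1) J(2) f'(1) this(1)]
 thus "Res C d (sub (bnds JJ)) (bnd Z) (Res C d (sub (bnds (insert S DD))) (bnds JJ) (bfield c (insert S DD))) =
 Res C d (sub (bnds JJ)) (bnd Z) (Res C d (sub (bnds (insert S' DD'))) (bnds JJ) (bfield c (insert S' DD')))"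
using f(2)[of Z] f'(2)[of Z] by (simp only: bnds_sing)
 qed
qed

text \<open>All boundary fields come from one decoration \<open>c\<close>, so the matching
  conditions of \<open>Glue_bilinear\<close> reduce to \<open>bfield_Diff\<close>.\<close>

lemma glue_bilinear:
 assumes r: "region S DD" and E: "E : DD" and r': "region E EE" and c: "decor c (insert S DD)" "decor c (insert E EE)"
 shows "mbilinear R (FM c S DD) (FM c E EE) (FM c S (DD - {E} Un EE))
 (Glue C (Suc d) (sub (hole S DD Un hole E EE)) (hole S DD) (hole E EE))"
proof -
 note i = region_insert[OF r E r'] and gl = region_glues(1)[OF r E r']
 let ?D = "DD - {E} Un EE" and ?W = "hole S DD Un hole E EE"
 have cD: "decor c (insert S ?D)" using c by (auto simp: decor_def)
 have fb: "bfield c (insert S DD) : Fld C d (bdry (Suc d) (sub (hole S DD)))" if "region S DD" "decor c (insert S DD)" for S DD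
using bfield(1)[OF region_bfam(1)[OF that(1)] _ that(2)] by (simp add: bdry_bnd region_bfam(2)[OF that(1)])
 have s: "subt (sub ?W) (hole S DD) = sub (hole S DD)" "subt (sub ?W) (hole E EE) = sub (hole E EE)" by (simp_all add: sub_sub)
 have E': "E : insert S DD" "E : insert E EE" using E by auto
 have i': "hole E EE Int hole S DD = bnd E" using i(3) by blast
 have "mbilinear R (Fmod C (subt (sub ?W) (hole S DD)) (bfield c (insert S DD))) (Fmod C (subt (sub ?W) (hole E EE)) (bfield c (insert E EE)))
 (Fmod C (sub ?W) (bfield c (insert S ?D))) (Glue C (Suc d) (sub ?W) (hole S DD) (hole E EE))"
 proof (rule Glue_bilinear[OF _ refl gl])
 show "codim0 (Suc d) M ?W" unfolding i(2) good_codim0[symmetric] by (rule region_cut(1)[OF i(1)])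
 show "bfield c (insert S DD) : Fld C d (bdry (Suc d) (subt (sub ?W) (hole S DD)))" unfolding s by (rule fb[OF r c(1)])
 show "bfield c (insert E EE) : Fld C d (bdry (Suc d) (subt (sub ?W) (hole E EE)))" unfolding s by (rule fb[OF r' c(2)])
 show "bfield c (insert S ?D) : Fld C d (bdry (Suc d) (sub ?W))" unfolding i(2) by (rule fb[OF i(1) cD])
 show "Res C d (bdry (Suc d) (subt (sub ?W) (hole S DD))) (hole S DD Int hole E EE) (bfield c (insert S DD)) =
 Res C d (bdry (Suc d) (subt (sub ?W) (hole E EE))) (hole S DD Int hole E EE) (bfield c (insert E EE))"
unfolding s bdry_bnd i(3) using bfield_Diff[OF r c(1) r' c(2), of "{E}"] E by (simp add: bnds_sing)
 show "Res C d (bdry (Suc d) (sub ?W)) (mboundary (Suc d) (subt (sub ?W) (hole S DD)) - hole E EE) (bfield c (insert S ?D)) =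
 Res C d (bdry (Suc d) (subt (sub ?W) (hole S DD))) (mboundary (Suc d) (subt (sub ?W) (hole S DD)) - hole E EE) (bfield c (insert S DD))"
unfolding s unfolding bdry_bnd bnd_def[symmetric] unfolding bnd_Diff[OF r E'(1) i(3)] unfolding i(2)
by (rule bfield_Diff[OF i(1) cD r c(1)]) (use regionD(5)[OF r] E in auto)
 show "Res C d (bdry (Suc d) (sub ?W)) (mboundary (Suc d) (subt (sub ?W) (hole E EE)) - hole S DD) (bfield c (insert S ?D)) =
 Res C d (bdry (Suc d) (subt (sub ?W) (hole E EE))) (mboundary (Suc d) (subt (sub ?W) (hole E EE)) - hole S DD) (bfield c (insert E EE))"
unfolding s unfolding bdry_bnd bnd_def[symmetric] unfolding bnd_Diff[OF r' E'(2) i'] unfolding i(2)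
by (rule bfield_Diff[OF i(1) cD r' c(2)]) auto
 qed
 thus ?thesis unfolding s unfolding FM_def i(2) .
qed

subsection \<open>Partial composition\<close>

definition scl :: "'r => 'p set \<times> ('f, 'r) gfield => 'p set \<times> ('f, 'r) gfield" where
 "scl a p = (fst p, gscale d R M C a (fst p) (snd p))"

text \<open>One step of \<open>fill\<close>, with both arguments carrying the piece they live on. A
  degenerate argument acts on the other one as a scalar.\<close>

definition ins :: "'p set \<times> ('f, 'r) gfield => 'p set \<times> ('f, 'r) gfield => 'p set \<times> ('f, 'r) gfield" where
 "ins p q = (case snd p of
 Field rr => (case snd q of
 Field \<xi> => (fst p Un fst q, Field (Glue C (Suc d) (sub (fst p Un fst q)) (fst p) (fst q) rr \<xi>))
 | Degen a c => scl a p)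
 | Degen a c => scl a q)"

lemma ins_simps:
 "ins (T, Field rr) (E', Field \<xi>) = (T Un E', Field (Glue C (Suc d) (sub (T Un E')) T E' rr \<xi>))"
 "ins (T, Field rr) (E', Degen a c) = scl a (T, Field rr)"
 "ins (T, Degen a c) q = scl a q"
by (simp_all add: ins_def)

lemma fill_ins: "fill d R M C X x p E = ins p (hole E (inside X E), x E)"
by (cases p) (auto simp: fill_def ins_def scl_def Let_def split: gfield.splits)

text \<open>Either a genuine complement or the degenerate pair with \<open>DD = {S}\<close>: a blob
  equal to \<open>S\<close> leaves no room for further ones.\<close>

definition ok :: "('p set => 'f) => 'p set => 'p set set => bool" where
 "ok c S DD \<longleftrightarrow> (region S DD \<or> good S & DD = {S}) & decor c (insert S DD)"

definition PM :: "('p set => 'f) => 'p set => 'p set set => ('r, ('f, 'r) gfield) module" where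
 "PM c S DD = (if S : DD then degen_module R (c S) else tag_module Field (FM c S DD))"

lemma okD:
 assumes "ok c S DD"
 shows "S : DD ==> DD = {S}" "S ~: DD ==> region S DD" "good S" "decor c (insert S DD)" "finite DD" "region S DD ==> S ~: DD"
using assms regionD(1,2,5) by (auto simp: ok_def)

lemma module_PM: "ok c S DD ==> rmod R (PM c S DD)"
using module_tag[OF module_ring[OF cring_R] inj_Degen, of "c S"] module_tag[OF FM(1) inj_Field, of S DD c] okD(2,4)[of c S DD]
by (cases "S : DD") (simp_all add: PM_def degen_module_def)

lemma smult_PM:
 assumes o: "ok c S DD" and r: "r : cr (PM c S DD)"
 shows "gscale d R M C a (hole S DD) r = a \<odot>\<^bsub>PM c S DD\<^esub> r"
proof (cases "S : DD")
 case True
 thus ?thesis using r by (auto simp: PM_def degen_simps gscale_def)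
next
 case False
 then obtain x where x: "r = Field x" "x : cr (FM c S DD)" using r by (auto simp: PM_def)
 show ?thesis using False x FM(3)[OF okD(2)[OF o False] okD(4)[OF o] x(2)] by (simp add: PM_def gscale_def) (simp add: FM_def)
qed

lemma ok_insert:
 assumes o: "ok c S DD" and E: "E : DD" and o': "ok c E EE"
 shows "ok c S (DD - {E} Un EE)"
proof (cases "S : DD")
 case True
 hence "DD = {S}" "E = S" using okD(1)[OF o] E by auto
 thus ?thesis using o' by simp
next
 case S: False
 have d: "decor c (insert S (DD - {E} Un EE))" using okD(4)[OF o] okD(4)[OF o'] by (auto simp: decor_def)
 show ?thesis
 proof (cases "E : EE")
 case True
 hence "DD - {E} Un EE = DD" using okD(1)[OF o'] E by auto
 thus ?thesis using o by simp
 next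
 case False
 thus ?thesis using d region_insert(1)[OF okD(2)[OF o S] E okD(2)[OF o' False]] by (simp add: ok_def)
 qed
qed

text \<open>A degenerate argument turns the operation into scalar multiplication, which is bilinear
  over a commutative ring. For two genuine fields it is bilinearity of glueing.\<close>

lemma ins_bilinear:
 assumes o: "ok c S DD" and E: "E : DD" and o': "ok c E EE"
 shows "mbilinear R (PM c S DD) (PM c E EE) (PM c S (DD - {E} Un EE)) (%r s. snd (ins (hole S DD, r) (hole E EE, s)))"
and "r : cr (PM c S DD) ==> s : cr (PM c E EE) ==> fst (ins (hole S DD, r) (hole E EE, s)) = hole S (DD - {E} Un EE)"
proof -
 have scaleL: "mbilinear R (degen_module R e) A A (%r s. case r of Degen a c => a \<odot>\<^bsub>A\<^esub> s | _ => undefined)"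
 if "rmod R A" for A :: "('r, ('f, 'r) gfield) module" and e
 proof -
 interpret module R A by (rule that)
 show ?thesis unfolding mbilinear_def mlinear_def
by (auto simp: degen_simps smult_l_distr smult_r_distr smult_assoc1[symmetric] m_comm)
 qed
 have scaleR: "mbilinear R A (degen_module R e) A (%r s. case s of Degen a c => a \<odot>\<^bsub>A\<^esub> r | _ => undefined)"
 if "rmod R A" for A :: "('r, ('f, 'r) gfield) module" and e
 proof -
 interpret module R A by (rule that)
 show ?thesis unfolding mbilinear_def mlinear_def
by (auto simp: degen_simps smult_l_distr smult_r_distr smult_assoc1[symmetric] m_comm)
 qed
 have cong: "mbilinear R A B D f" if "mbilinear R A B D g" "!!x y. x : cr A ==> y : cr B ==> f x y = g x y"
 "rmod R A" "rmod R B" for A :: "('r, ('f, 'r) gfield) module" and B D :: "('r, ('f, 'r) gfield) module" and f g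
unfolding mbilinear_def
 proof (intro conjI ballI)
 show "mlinear R B D (f x)" if "x : cr A" for x
using \<open>mbilinear R A B D g\<close> mlinear_cong[OF \<open>rmod R B\<close>, of "f x" "g x"] that \<open>!!x y. x : cr A ==> y : cr B ==> f x y = g x y\<close>
by (simp add: mbilinear_def)
 show "mlinear R A D (%x. f x y)" if "y : cr B" for y
using \<open>mbilinear R A B D g\<close> mlinear_cong[OF \<open>rmod R A\<close>, of "%x. f x y" "%x. g x y"] that \<open>!!x y. x : cr A ==> y : cr B ==> f x y = g x y\<close>
by (simp add: mbilinear_def)
 qed
 let ?D = "DD - {E} Un EE"
 have *: "mbilinear R (PM c S DD) (PM c E EE) (PM c S ?D) (%r s. snd (ins (hole S DD, r) (hole E EE, s))) \<and>
 (ALL r:cr (PM c S DD). ALL s:cr (PM c E EE). fst (ins (hole S DD, r) (hole E EE, s)) = hole S ?D)"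
 proof (cases "S : DD")
 case True
 hence D: "DD = {S}" "E = S" "?D = EE" using okD(1)[OF o] E by auto
 have P: "PM c S DD = degen_module R (c S)" using True by (simp add: PM_def)
 have i: "ins (hole S DD, r) (hole E EE, s) = (hole S EE, case r of Degen a c' => a \<odot>\<^bsub>PM c S EE\<^esub> s | _ => undefined)"
 if "r : cr (degen_module R (c S))" "s : cr (PM c S EE)" for r s
using that smult_PM[of c S EE s] o' D(2) by (auto simp: degen_simps ins_simps scl_def)
 have m: "rmod R (PM c S EE)" "rmod R (degen_module R (c S))" using module_PM[OF o'] module_PM[OF o] D(2) P by auto
 show ?thesis unfolding D(3) P unfolding D(2)
using cong[OF scaleL[OF m(1)] _ m(2) m(1), of "%r s. snd (ins (hole S DD, r) (hole E EE, s))"] i D(2) by auto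
 next
 case S: False
 note rS = okD(2)[OF o S]
 show ?thesis
 proof (cases "E : EE")
 case True
 hence D: "EE = {E}" "?D = DD" using okD(1)[OF o'] E by auto
 have P: "PM c E EE = degen_module R (c E)" using True by (simp add: PM_def)
 have i: "ins (hole S DD, r) (hole E EE, s) = (hole S DD, case s of Degen a c' => a \<odot>\<^bsub>PM c S DD\<^esub> r | _ => undefined)"
 if r: "r : cr (PM c S DD)" and s: "s : cr (degen_module R (c E))" for r s
 proof -
 obtain x where "r = Field x" using r S by (auto simp: PM_def)
 thus ?thesis using r s smult_PM[OF o r] by (auto simp: degen_simps ins_simps scl_def)
 qed
 have m: "rmod R (PM c S DD)" "rmod R (degen_module R (c E))" using module_PM[OF o'] module_PM[OF o] P by auto
 show ?thesis unfolding D(2) P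
using cong[OF scaleR[OF m(1)] _ m, of "%r s. snd (ins (hole S DD, r) (hole E EE, s))"] i by auto
 next
 case False
 note rE = okD(2)[OF o' False]
 note i = region_insert[OF rS E rE]
 have P: "PM c S DD = tag_module Field (FM c S DD)" "PM c E EE = tag_module Field (FM c E EE)" "PM c S ?D = tag_module Field (FM c S ?D)"
using S False regionD(5)[OF i(1)] by (simp_all add: PM_def)
 note b = glue_bilinear[OF rS E rE okD(4)[OF o] okD(4)[OF o']]
 show ?thesis unfolding P mbilinear_def
by (auto simp: mlinear_from_tag ins_simps i(2) intro!: mlinear_into_tag bilinD[OF b, unfolded i(2)])
 qed
 qed
 thus "mbilinear R (PM c S DD) (PM c E EE) (PM c S ?D) (%r s. snd (ins (hole S DD, r) (hole E EE, s)))" by blast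
 show "r : cr (PM c S DD) ==> s : cr (PM c E EE) ==> fst (ins (hole S DD, r) (hole E EE, s)) = hole S ?D" using * by blast
qed

text \<open>A typing judgement for the untyped operation \<open>ins\<close>: it records on which
  complement a pair lives and with which boundary fields, which is what the algebraic laws depend
  on.\<close>

definition ty :: "('p set => 'f) => 'p set => 'p set set => 'p set \<times> ('f, 'r) gfield => bool" where
 "ty c S DD p \<longleftrightarrow> ok c S DD & fst p = hole S DD & snd p : cr (PM c S DD)"

lemma ty_ins:
 assumes "ty c S DD p" "E : DD" "ty c E EE q" shows "ty c S (DD - {E} Un EE) (ins p q)"
proof -
 obtain r s where pq: "p = (hole S DD, r)" "q = (hole E EE, s)" using assms by (cases p; cases q) (auto simp: ty_def)
 have t: "ok c S DD" "ok c E EE" "r : cr (PM c S DD)" "s : cr (PM c E EE)" using assms pq by (auto simp: ty_def)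
 show ?thesis unfolding ty_def pq
using ok_insert[OF t(1) assms(2) t(2)] ins_bilinear(2)[OF t(1) assms(2) t(2,3,4)]
 lin_in[OF bilinD(1)[OF ins_bilinear(1)[OF t(1) assms(2) t(2)] t(3)] t(4)] by simp
qed

lemma scl_ins:
 assumes "ty c S DD p" "E : DD" "ty c E EE q" "a : cr R"
 shows "ins (scl a p) q = scl a (ins p q)" "ins p (scl a q) = scl a (ins p q)"
proof -
 obtain r s where pq: "p = (hole S DD, r)" "q = (hole E EE, s)" using assms by (cases p; cases q) (auto simp: ty_def)
 have t: "ok c S DD" "ok c E EE" "r : cr (PM c S DD)" "s : cr (PM c E EE)" using assms pq by (auto simp: ty_def)
 note t' = ty_ins[OF assms(1-3)]
 let ?D = "DD - {E} Un EE"
 have e: "scl a (ins p q) = (hole S ?D, a \<odot>\<^bsub>PM c S ?D\<^esub> snd (ins p q))"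
using t' smult_PM[of c S ?D "snd (ins p q)" a] by (simp add: scl_def ty_def)
 note bl = ins_bilinear[OF t(1) assms(2) t(2)]
 have sm: "a \<odot>\<^bsub>PM c S DD\<^esub> r : cr (PM c S DD)" "a \<odot>\<^bsub>PM c E EE\<^esub> s : cr (PM c E EE)"
using module.smult_closed[OF module_PM[OF t(1)] assms(4) t(3)] module.smult_closed[OF module_PM[OF t(2)] assms(4) t(4)] by auto
 show "ins (scl a p) q = scl a (ins p q)"
unfolding e unfolding pq scl_def using smult_PM[OF t(1,3)] bl(2)[OF sm(1) t(4)]
 lin_smult[OF bilinD(2)[OF bl(1) t(4)] assms(4) t(3)] by (simp add: prod_eq_iff)
 show "ins p (scl a q) = scl a (ins p q)"
unfolding e unfolding pq scl_def using smult_PM[OF t(2,4)] bl(2)[OF t(3) sm(2)]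
 lin_smult[OF bilinD(1)[OF bl(1) t(3)] assms(4) t(4)] by (simp add: prod_eq_iff)
qed

lemma ty_Degen: "ty c S DD (T, Degen a e) ==> a : cr R & e = c S & DD = {S} & T = hole S {S}"
using okD(1)[of c S DD] by (auto simp: ty_def PM_def degen_simps split: if_splits)

lemma ty_Field: "ty c S DD (T, Field rr) \<longleftrightarrow> region S DD & decor c (insert S DD) & T = hole S DD & rr : Fld C (Suc d) (sub T) \<and>
 (ALL Z:insert S DD. Res C d (sub (bnd T)) (bnd Z) (Bdr C d (sub T) rr) = c Z)"
using okD(2,4)[of c S DD] FM(2)[of S DD c] regionD(5)[of S DD]
by (auto simp: ty_def PM_def degen_simps ok_def split: if_splits)

lemma ty_FieldD:
 assumes "ty c S DD (T, Field rr)"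
 shows "region S DD" "T = hole S DD" "rr : Fld C (Suc d) (sub T)"
 "Z : insert S DD ==> Res C d (sub (bnd T)) (bnd Z) (Bdr C d (sub T) rr) = c Z"
using assms unfolding ty_Field by blast+

lemma agree_ty:
 assumes p: "ty c S DD (T, Field rr)" and E: "E : DD" and q: "ty c E EE (E', Field \<xi>)" and V: "T \<subseteq> V" "E' \<subseteq> V"
 shows "agree C (Suc d) (sub V) T E' rr \<xi>" "agree C (Suc d) (sub V) E' T \<xi> rr"
proof -
 have *: "T Int E' = bnd E" "E' Int T = bnd E"
using region_insert(3)[OF ty_FieldD(1)[OF p] E ty_FieldD(1)[OF q]] ty_FieldD(2)[OF p] ty_FieldD(2)[OF q] by blast+
 show "agree C (Suc d) (sub V) T E' rr \<xi>" "agree C (Suc d) (sub V) E' T \<xi> rr"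
unfolding agree_def sub_sub[OF V(1)] sub_sub[OF V(2)] bdry_bnd * using ty_FieldD(4)[OF p, of E] ty_FieldD(4)[OF q, of E] E by simp_all
qed

lemma glue_ty:
 assumes p: "ty c S DD (T, Field rr)" and E: "E : DD" and q: "ty c E EE (E', Field \<xi>)"
 shows "ty c S (DD - {E} Un EE) (T Un E', Field (Glue C (Suc d) (sub (T Un E')) T E' rr \<xi>))"
 "Glue C (Suc d) (sub (T Un E')) T E' rr \<xi> = Glue C (Suc d) (sub (T Un E')) E' T \<xi> rr"
 "glues_to (Suc d) (sub (T Un E')) T E'" "glues_to (Suc d) (sub (T Un E')) E' T"
proof -
 show "ty c S (DD - {E} Un EE) (T Un E', Field (Glue C (Suc d) (sub (T Un E')) T E' rr \<xi>))"
using ty_ins[OF p E q] by (simp add: ins_simps)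
 show gl: "glues_to (Suc d) (sub (T Un E')) T E'" "glues_to (Suc d) (sub (T Un E')) E' T"
using region_glues[of S DD E EE] p E q by (auto simp: ty_Field)
 show "Glue C (Suc d) (sub (T Un E')) T E' rr \<xi> = Glue C (Suc d) (sub (T Un E')) E' T \<xi> rr"
by (rule Glue_sym[OF order_refl gl(1)]) (use ty_FieldD(3)[OF p] ty_FieldD(3)[OF q] agree_ty[OF p E q] in "auto simp: sub_sub")
qed

text \<open>If an argument is degenerate, its scalar moves through \<open>ins\<close> by
  \<open>scl_ins\<close>. For three genuine fields this is associativity of glueing; the typing of
  the partial results supplies all agreement conditions.\<close>

lemma ins_assoc:
 assumes p: "ty c S DD p" and E: "E : DD" and q: "ty c E EE q" and F: "F : EE" and r: "ty c F \<F> r"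
 shows "ins (ins p q) r = ins p (ins q r)"
proof -
 obtain T x where pe: "p = (T, x)" by force
 obtain E' y where qe: "q = (E', y)" by force
 obtain F' z where re: "r = (F', z)" by force
 have F': "F : DD - {E} Un EE" using F by simp
 show ?thesis
 proof (cases x)
 case (Degen a e)
 hence "a : cr R" using ty_Degen p pe by blast
 thus ?thesis using scl_ins(1)[OF q F r] by (simp add: pe Degen ins_simps)
 next
 case x: (Field rr)
 show ?thesis
 proof (cases y)
 case (Degen a e)
 hence a: "a : cr R" "EE = {E}" "F = E" using ty_Degen q qe F by blast+
 thus ?thesis using scl_ins[OF p E r[unfolded a(3)] a(1)] by (simp add: pe qe x Degen ins_simps)
 next
 case y: (Field \<xi>)
 show ?thesis
 proof (cases z)
 case (Degen a e)
 hence "a : cr R" using ty_Degen r re by blast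
 hence "scl a (ins p q) = ins p (scl a q)" using scl_ins(2)[OF p E q] by simp
 thus ?thesis by (simp add: pe qe re x y Degen ins_simps)
 next
 case z: (Field \<zeta>)
 note P = p[unfolded pe x] and Q = q[unfolded qe y] and Z = r[unfolded re z]
 note g1 = glue_ty[OF P E Q] and g2 = glue_ty[OF Q F Z]
 note g3 = glue_ty[OF g1(1) F' Z] and g4 = glue_ty[OF P E g2(1)]
 let ?W = "T Un E' Un F'"
 have eq: "T Un (E' Un F') = ?W" by blast
 have "Glue C (Suc d) (sub ?W) (T Un E') F' (Glue C (Suc d) (subt (sub ?W) (T Un E')) T E' rr \<xi>) \<zeta> =
 Glue C (Suc d) (sub ?W) T (E' Un F') rr (Glue C (Suc d) (subt (sub ?W) (E' Un F')) E' F' \<xi> \<zeta>)"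
 proof (rule Glue_assoc[OF order_refl])
 show "agree C (Suc d) (sub ?W) T E' rr \<xi>" by (rule agree_ty(1)[OF P E Q]) auto
 show "agree C (Suc d) (sub ?W) E' F' \<xi> \<zeta>" by (rule agree_ty(1)[OF Q F Z]) auto
 have s: "subt (sub ?W) (T Un E') = sub (T Un E')" "subt (sub ?W) (E' Un F') = sub (E' Un F')" by (rule sub_sub, blast)+
 show "agree C (Suc d) (sub ?W) (T Un E') F' (Glue C (Suc d) (subt (sub ?W) (T Un E')) T E' rr \<xi>) \<zeta>"
unfolding s by (rule agree_ty(1)[OF g1(1) F' Z]) auto
 show "agree C (Suc d) (sub ?W) T (E' Un F') rr (Glue C (Suc d) (subt (sub ?W) (E' Un F')) E' F' \<xi> \<zeta>)"
unfolding s by (rule agree_ty(1)[OF P E g2(1)]) auto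
 show "glues_to (Suc d) (sub ?W) T (E' Un F')" using g4(3) by (simp only: eq)
 show "glues_to (Suc d) (subt (sub ?W) (T Un E')) T E'" "glues_to (Suc d) (subt (sub ?W) (E' Un F')) E' F'"
unfolding s by (rule g1(3), rule g2(3))
 show "glues_to (Suc d) (sub ?W) (T Un E') F'" by (rule g3(3))
 have "subt (sub ?W) T = sub T" "subt (sub ?W) E' = sub E'" "subt (sub ?W) F' = sub F'" by (auto intro!: sub_sub)
 thus "rr : Fld C (Suc d) (subt (sub ?W) T)" "\<xi> : Fld C (Suc d) (subt (sub ?W) E')" "\<zeta> : Fld C (Suc d) (subt (sub ?W) F')"
using ty_FieldD(3)[OF P] ty_FieldD(3)[OF Q] ty_FieldD(3)[OF Z] by simp_all
 qed
 moreover have "subt (sub ?W) (T Un E') = sub (T Un E')" "subt (sub ?W) (E' Un F') = sub (E' Un F')" by (auto intro!: sub_sub)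
 ultimately show ?thesis by (simp add: pe qe re x y z ins_simps eq)
 qed
 qed
 qed
qed

text \<open>Two different blobs exclude the degenerate case for \<open>S\<close>, so
  \<open>p\<close> is a genuine field. For genuine \<open>q\<close> and \<open>r\<close>, symmetry
  moves the piece of \<open>q\<close> to the left, and the claim becomes associativity for three
  pieces with the piece of \<open>p\<close> in the middle.\<close>

lemma ins_comm:
 assumes p: "ty c S DD p" and E: "E : DD" and q: "ty c E EE q" and F: "F : DD" and r: "ty c F \<F> r" and EF: "E ~= F"
 shows "ins (ins p q) r = ins (ins p r) q"
proof -
 obtain T x where pe: "p = (T, x)" by force
 obtain E' y where qe: "q = (E', y)" by force
 obtain F' z where re: "r = (F', z)" by force
 obtain rr where x: "x = Field rr" using ty_Degen p pe E F EF by (cases x) blast+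
 have F': "F : DD - {E} Un EE" and E'': "E : DD - {F} Un \<F>" using E F EF by auto
 \<comment> \<open>The case of one degenerate argument, used once for \<open>q\<close> and once for
   \<open>r\<close>.\<close>
 have *: "ins (ins p q) r = ins (ins p r) q" if y: "y = Degen a e" and a: "a : cr R" and p: "ty c S DD p" and F: "F : DD" and r: "ty c F \<F> r"
and qe: "q = (E', y)" and ir: "ins p r = (G, Field \<tau>)"
 for q r y a e F \<F> E' G \<tau>
using scl_ins(1)[OF p F r a] ir by (simp add: qe y pe x ins_simps)
 show ?thesis
 proof (cases y)
 case y: (Degen a e)
 have a: "a : cr R" using ty_Degen q qe y by blast
 show ?thesis
 proof (cases z)
 case (Field \<zeta>)
 thus ?thesis using *[OF y a p F r qe] by (simp add: pe x re ins_simps)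
 next
 case (Degen a' e')
 have "ins p r = (T, Field (a' \<odot>\<^bsub>Fmod C (sub T) (Bdr C d (sub T) rr)\<^esub> rr))" by (simp add: pe x re Degen ins_simps scl_def gscale_def)
 thus ?thesis by (rule *[OF y a p F r qe])
 qed
 next
 case y: (Field \<xi>)
 show ?thesis
 proof (cases z)
 case z: (Degen a e)
 have a: "a : cr R" using ty_Degen r re z by blast
 show ?thesis using *[OF z a p E q re] by (simp add: pe x qe y ins_simps)
 next
 case z: (Field \<zeta>)
 note P = p[unfolded pe x] and Q = q[unfolded qe y] and Z = r[unfolded re z]
 note g1 = glue_ty[OF P E Q] and g2 = glue_ty[OF P F Z]
 note g3 = glue_ty[OF g1(1) F' Z] and g4 = glue_ty[OF g2(1) E'' Q]
 let ?W = "E' Un T Un F'"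
 have eq: "T Un E' = E' Un T" "E' Un (T Un F') = ?W" "(T Un F') Un E' = ?W" "T Un E' Un F' = ?W" by blast+
 have s: "subt (sub ?W) (E' Un T) = sub (E' Un T)" "subt (sub ?W) (T Un F') = sub (T Un F')" by (auto intro!: sub_sub)
 have "Glue C (Suc d) (sub ?W) (E' Un T) F' (Glue C (Suc d) (subt (sub ?W) (E' Un T)) E' T \<xi> rr) \<zeta> =
 Glue C (Suc d) (sub ?W) E' (T Un F') \<xi> (Glue C (Suc d) (subt (sub ?W) (T Un F')) T F' rr \<zeta>)"
 proof (rule Glue_assoc[OF order_refl])
 show "agree C (Suc d) (sub ?W) E' T \<xi> rr" by (rule agree_ty(2)[OF P E Q]) auto
 show "agree C (Suc d) (sub ?W) T F' rr \<zeta>" by (rule agree_ty(1)[OF P F Z]) auto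
 have h: "Glue C (Suc d) (sub (E' Un T)) E' T \<xi> rr = Glue C (Suc d) (sub (T Un E')) T E' rr \<xi>" using g1(2) eq(1) by simp
 show "agree C (Suc d) (sub ?W) (E' Un T) F' (Glue C (Suc d) (subt (sub ?W) (E' Un T)) E' T \<xi> rr) \<zeta>"
 proof -
 have "agree C (Suc d) (sub ?W) (T Un E') F' (Glue C (Suc d) (sub (T Un E')) T E' rr \<xi>) \<zeta>"
by (rule agree_ty(1)[OF g1(1) F' Z]) auto
 thus ?thesis unfolding s h by (simp only: eq(1))
 qed
 show "agree C (Suc d) (sub ?W) E' (T Un F') \<xi> (Glue C (Suc d) (subt (sub ?W) (T Un F')) T F' rr \<zeta>)"
unfolding s by (rule agree_ty(2)[OF g2(1) E'' Q]) auto
 show "glues_to (Suc d) (sub ?W) E' (T Un F')" using g4(4) by (simp only: eq)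
 show "glues_to (Suc d) (subt (sub ?W) (E' Un T)) E' T" unfolding s using g1(4) by (simp only: eq)
 show "glues_to (Suc d) (subt (sub ?W) (T Un F')) T F'" unfolding s by (rule g2(3))
 show "glues_to (Suc d) (sub ?W) (E' Un T) F'" using g3(3) by (simp only: eq)
 have "subt (sub ?W) T = sub T" "subt (sub ?W) E' = sub E'" "subt (sub ?W) F' = sub F'" by (auto intro!: sub_sub)
 thus "rr : Fld C (Suc d) (subt (sub ?W) T)" "\<xi> : Fld C (Suc d) (subt (sub ?W) E')" "\<zeta> : Fld C (Suc d) (subt (sub ?W) F')"
using ty_FieldD(3)[OF P] ty_FieldD(3)[OF Q] ty_FieldD(3)[OF Z] by simp_all
 qed
 thus ?thesis using g1(2) g4(2) by (simp add: pe qe re x y z ins_simps s eq)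
 qed
 qed
qed

end

context field_theory
begin

subsection \<open>Iterated composition\<close>

text \<open>\<open>fill_all\<close> with each field bundled with its piece. The list is arbitrary,
  so independence of the order has to precede everything else.\<close>

definition Fill :: "'p set \<times> ('f, 'r) gfield => ('p set => 'p set \<times> ('f, 'r) gfield) => 'p set set => 'p set \<times> ('f, 'r) gfield" where
 "Fill p y AA = foldl (%p E. ins p (y E)) p (SOME Es. distinct Es & set Es = AA)"

lemma fill_all_Fill:
 "fill_all d R M C S DD X r x = snd (Fill (hole S DD, r) (%E. (hole E (inside X E), x E)) DD)"
proof -
 have "fill d R M C X x = (%p E. ins p (hole E (inside X E), x E))" by (intro ext fill_ins)
 thus ?thesis by (simp add: fill_all_def Fill_def)
qed

lemma some_list: "finite AA ==> distinct (SOME Es. distinct Es & set Es = AA) & set (SOME Es. distinct Es & set Es = AA) = AA"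
by (rule someI_ex) (use finite_distinct_list in blast)

lemma Fill_empty: "Fill p y {} = p"
using some_list[of "{} :: 'p set set"] by (simp add: Fill_def)

lemma Fill_cong:
 assumes "finite AA" "!!E. E : AA ==> y E = y' E" shows "Fill p y AA = Fill p y' AA"
unfolding Fill_def by (rule foldl_cong) (use some_list[OF assms(1)] assms(2) in auto)

lemma ok_disjoint:
 assumes "ok c S DD" "E : DD" "E' : DD" "E ~= E'" shows "E Int E' = {}" "E ~= {}" "E' ~= {}" "region S DD"
proof -
 show r: "region S DD" using assms okD(1,2)[OF assms(1)] by blast
 show "E Int E' = {}" by (rule regionD(7)[OF r assms(2-4)])
 show "E ~= {}" "E' ~= {}" using ballD(5)[OF pblob_ball[OF regionD(3)[OF r]]] assms by auto
qed

lemma ok_sub: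
 assumes "ok c E EE" "F : EE" "E ~= {}" shows "F \<subseteq> E" "F ~= {}"
proof -
 have *: "F \<subseteq> E & F ~= {}"
 proof (cases "E : EE")
 case True thus ?thesis using okD(1)[OF assms(1)] assms by auto
 next
 case False
 note r = okD(2)[OF assms(1) False]
 show ?thesis using pblob_subset[OF regionD(3)[OF r assms(2)]] ballD(5)[OF pblob_ball[OF regionD(3)[OF r assms(2)]]] by blast
 qed
 thus "F \<subseteq> E" "F ~= {}" by auto
qed

text \<open>Inner blobs are nonempty subsets of \<open>E\<close>, whereas the remaining blobs are
  disjoint from \<open>E\<close>. The set of open holes therefore never loses a hole by
  coincidence.\<close>

lemma ok_sep:
 assumes o: "ok c S DD" and E: "E : DD" and o': "ok c E EE" and F: "F : EE" shows "F ~: DD - {E}"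
proof
 assume "F : DD - {E}"
 hence F': "F : DD" "E ~= F" by auto
 note dj = ok_disjoint[OF o E F']
 show False using ok_sub[OF o' F dj(2)] dj(1) by blast
qed

lemma ok_sep2:
 assumes o: "ok c S DD" and E: "E : DD" "E' : DD" "E ~= E'" and o': "ok c E EE" "ok c E' EE'"
 shows "EE Int EE' = {}"
proof (rule ccontr)
 assume "EE Int EE' ~= {}"
 then obtain F where F: "F : EE" "F : EE'" by blast
 note dj = ok_disjoint[OF o E]
 show False using ok_sub[OF o'(1) F(1) dj(2)] ok_sub[OF o'(2) F(2) dj(3)] dj(1) by blast
qed

lemma tyD: "ty c S DD p ==> ok c S DD" "ty c S DD p ==> p = (hole S DD, snd p)" "ty c S DD p ==> snd p : cr (PM c S DD)"
by (auto simp: ty_def prod_eq_iff)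

context
 fixes c :: "'p set => 'f" and S DD p y h and \<B> :: "'p set set"
 assumes p: "ty c S DD p" and \<B>: "\<B> \<subseteq> DD" and y: "!!E. E : \<B> ==> ty c E (h E) (y E)"
begin

abbreviation "lfill == foldl (%p E. ins p (y E)) p"

lemma notin_h: "E : DD ==> E' : \<B> ==> E ~= E' ==> E ~: h E'"
using ok_sep[OF tyD(1)[OF p] _ tyD(1)[OF y]] \<B> by blast

lemma lfill_ty: "distinct Es ==> set Es \<subseteq> \<B> ==> ty c S (DD - set Es Un \<Union>(h ` set Es)) (lfill Es)"
proof (induction Es rule: rev_induct)
 case Nil thus ?case using p by simp
next
 case (snoc E Es)
 let ?Q = "DD - set Es Un \<Union>(h ` set Es)"
 have Q: "ty c S ?Q (lfill Es)" using snoc by simp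
 have E: "E : \<B>" "E : DD" "E ~: set Es" using snoc.prems \<B> by auto
 hence "E : ?Q" by blast
 note ty_ins[OF Q this y[OF E(1)]]
 moreover have "E ~: \<Union>(h ` set Es)" using notin_h[OF E(2)] snoc.prems E(3) by auto
 hence "?Q - {E} Un h E = DD - set (Es @ [E]) Un \<Union>(h ` set (Es @ [E]))" using E by auto
 ultimately show ?case by simp
qed

text \<open>By \<open>ins_comm\<close> an entry can pass every later one. Bringing the same entry to
  the end of two lists then proves order independence by induction.\<close>

lemma lfill_move:
 "distinct Es ==> set Es \<subseteq> \<B> ==> E : set Es ==> lfill Es = ins (lfill (remove1 E Es)) (y E)"
proof (induction Es rule: rev_induct)
 case Nil thus ?case by simp
next
 case (snoc G Es)
 show ?case
 proof (cases "E = G")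
 case True thus ?thesis using snoc.prems by (simp add: remove1_append remove1_idem)
 next
 case False
 hence E: "E : set Es" using snoc.prems by simp
 have IH: "lfill Es = ins (lfill (remove1 E Es)) (y E)" using snoc.IH snoc.prems E by simp
 have d: "distinct (remove1 E Es)" "set (remove1 E Es) = set Es - {E}" using snoc.prems by auto
 have Q: "ty c S (DD - (set Es - {E}) Un \<Union>(h ` (set Es - {E}))) (lfill (remove1 E Es))"
using lfill_ty[OF d(1)] d(2) snoc.prems by auto
 have EG: "E : \<B>" "G : \<B>" "G ~: set Es" using snoc.prems E by auto
 have "ins (ins (lfill (remove1 E Es)) (y E)) (y G) = ins (ins (lfill (remove1 E Es)) (y G)) (y E)"
by (rule ins_comm[OF Q _ y[OF EG(1)] _ y[OF EG(2)] False]) (use EG \<B> in auto)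
 thus ?thesis using IH E by (simp add: remove1_append)
 qed
qed

lemma lfill_indep:
 "distinct Es ==> distinct Fs ==> set Es = set Fs ==> set Es \<subseteq> \<B> ==> lfill Es = lfill Fs"
proof (induction Es arbitrary: Fs rule: rev_induct)
 case Nil thus ?case by simp
next
 case (snoc E Es)
 have "lfill Fs = ins (lfill (remove1 E Fs)) (y E)" by (rule lfill_move) (use snoc.prems in auto)
 moreover have "lfill Es = lfill (remove1 E Fs)"
by (rule snoc.IH) (use snoc.prems in "auto simp flip: snoc.prems(3)")
 ultimately show ?case by simp
qed

lemma finite_sub: "AA \<subseteq> \<B> ==> finite AA"
using okD(5)[OF tyD(1)[OF p]] \<B> by (meson finite_subset)

text \<open>This recursion over finite sets replaces the chosen list in all later arguments.\<close>

lemma Fill_insert: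
 assumes "insert E AA \<subseteq> \<B>" "E ~: AA" shows "Fill p y (insert E AA) = ins (Fill p y AA) (y E)"
proof -
 note l = some_list[OF finite_sub[OF assms(1)]] and l' = some_list[OF finite_sub[of AA]]
 have "Fill p y (insert E AA) = lfill ((SOME Es. distinct Es & set Es = AA) @ [E])"
unfolding Fill_def by (rule lfill_indep) (use l l' assms in auto)
 thus ?thesis by (simp add: Fill_def)
qed

lemma Fill_ty: "AA \<subseteq> \<B> ==> ty c S (DD - AA Un \<Union>(h ` AA)) (Fill p y AA)"
using lfill_ty[of "SOME Es. distinct Es & set Es = AA"] some_list[OF finite_sub[of AA]] by (simp add: Fill_def)

end

lemma Fill_Un:
 assumes p: "ty c S DD p" and AB: "AA Un \<B> \<subseteq> DD" "AA Int \<B> = {}" and y: "!!E. E : AA Un \<B> ==> ty c E (h E) (y E)"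
 shows "Fill p y (AA Un \<B>) = Fill (Fill p y AA) y \<B>"
proof -
 have t: "ty c S (DD - AA Un \<Union>(h ` AA)) (Fill p y AA)" by (rule Fill_ty[OF p AB(1) y]) auto
 have fB: "finite \<B>" using finite_subset[OF AB(1) okD(5)[OF tyD(1)[OF p]]] by simp
 have "Fill p y (AA Un \<B>') = Fill (Fill p y AA) y \<B>'" if "\<B>' \<subseteq> \<B>" for \<B>'
using finite_subset[OF that fB] that
 proof (induction \<B>' rule: finite_induct)
 case empty thus ?case by (simp add: Fill_empty)
 next
 case (insert E \<B>')
 have "Fill p y (insert E (AA Un \<B>')) = ins (Fill p y (AA Un \<B>')) (y E)"
by (rule Fill_insert[OF p AB(1) y]) (use insert AB in auto)
 moreover have "Fill (Fill p y AA) y (insert E \<B>') = ins (Fill (Fill p y AA) y \<B>') (y E)"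
by (rule Fill_insert[OF t, of "insert E \<B>'" h]) (use insert AB y in auto)
 ultimately show ?case using insert by simp
 qed
 thus ?thesis by blast
qed

lemma Fill_swap:
 assumes q: "ty c S \<Q> q" and E: "E : \<Q>" and e: "ty c E EE e" and H: "\<H> \<subseteq> \<Q> - {E}" and z: "!!F. F : \<H> ==> ty c F (g F) (z F)"
 shows "Fill (ins q e) z \<H> = ins (Fill q z \<H>) e"
proof -
 have HQ: "\<H> \<subseteq> \<Q>" using H by blast
 note qe = ty_ins[OF q E e]
 have HQ': "\<H> \<subseteq> \<Q> - {E} Un EE" using H by blast
 have "Fill (ins q e) z AA = ins (Fill q z AA) e" if "AA \<subseteq> \<H>" for AA
using finite_subset[OF that finite_subset[OF HQ okD(5)[OF tyD(1)[OF q]]]] that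
 proof (induction AA rule: finite_induct)
 case empty thus ?case by (simp add: Fill_empty)
 next
 case (insert F AA)
 have A: "AA \<subseteq> \<H>" and F: "F : \<H>" "E ~= F" using insert.prems H by auto
 note t = Fill_ty[OF q HQ z A]
 have "Fill (ins q e) z (insert F AA) = ins (Fill (ins q e) z AA) (z F)" by (rule Fill_insert[OF qe HQ' z insert.prems insert.hyps(2)])
 also have "\<dots> = ins (ins (Fill q z AA) e) (z F)" using insert by simp
 also have "\<dots> = ins (ins (Fill q z AA) (z F)) e"
by (rule ins_comm[OF t _ e _ z[OF F(1)] F(2)]) (use E H F A insert.hyps in auto)
 also have "\<dots> = ins (Fill q z (insert F AA)) e" using Fill_insert[OF q HQ z insert.prems insert.hyps(2)] by simp
 finally show ?case .
 qed
 thus ?thesis by blast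
qed

lemma Fill_nest:
 assumes q: "ty c S \<Q> q" and E: "E : \<Q>" and e: "ty c E EE e" and G: "\<G> \<subseteq> EE" and z: "!!F. F : \<G> ==> ty c F (g F) (z F)"
 shows "Fill (ins q e) z \<G> = ins q (Fill e z \<G>)"
proof -
 note qe = ty_ins[OF q E e]
 have G': "\<G> \<subseteq> \<Q> - {E} Un EE" using G by blast
 have "Fill (ins q e) z AA = ins q (Fill e z AA)" if "AA \<subseteq> \<G>" for AA
using finite_subset[OF that finite_subset[OF G okD(5)[OF tyD(1)[OF e]]]] that
 proof (induction AA rule: finite_induct)
 case empty thus ?case by (simp add: Fill_empty)
 next
 case (insert F AA)
 have A: "AA \<subseteq> \<G>" and F: "F : \<G>" using insert.prems by auto
 note t = Fill_ty[OF e G z A]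
 have "Fill (ins q e) z (insert F AA) = ins (Fill (ins q e) z AA) (z F)" by (rule Fill_insert[OF qe G' z insert.prems insert.hyps(2)])
 also have "\<dots> = ins (ins q (Fill e z AA)) (z F)" using insert by simp
 also have "\<dots> = ins q (ins (Fill e z AA) (z F))"
by (rule ins_assoc[OF q E t _ z[OF F]]) (use F G insert.hyps in auto)
 also have "\<dots> = ins q (Fill e z (insert F AA))" using Fill_insert[OF e G z insert.prems insert.hyps(2)] by simp
 finally show ?case .
 qed
 thus ?thesis by blast
qed

text \<open>The combinatorial core of operad associativity. For one further blob \<open>E\<close>,
  the fields inside it are absorbed into its own field by \<open>Fill_nest\<close>, and filling the
  other blobs is moved past it by \<open>Fill_swap\<close>. Inner blobs of different blobs are
  distinct, so the index set splits disjointly.\<close>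

lemma Fill_assoc:
 assumes p: "ty c S DD p" and AD: "AA \<subseteq> DD" and y: "!!E. E : AA ==> ty c E (h E) (y E)"
and z: "!!E F. E : AA ==> F : h E ==> ty c F (g F) (z F)"
 shows "Fill (Fill p y AA) z (\<Union>(h ` AA)) = Fill p (%E. Fill (y E) z (h E)) AA"
using finite_subset[OF AD okD(5)[OF tyD(1)[OF p]]] AD y z
proof (induction AA rule: finite_induct)
 case empty thus ?case by (simp add: Fill_empty)
next
 case (insert E AA)
 let ?y' = "%E. Fill (y E) z (h E)" and ?H = "\<Union>(h ` AA)"
 have A: "AA \<subseteq> DD" and E: "E : DD" using insert.prems by auto
 have yA: "!!E. E : AA ==> ty c E (h E) (y E)" and yE: "ty c E (h E) (y E)" using insert.prems(2) by auto
 have zE: "!!F. F : h E ==> ty c F (g F) (z F)" and zH: "!!F. F : ?H ==> ty c F (g F) (z F)" using insert.prems(3) by auto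
 have y': "ty c G (\<Union>(g ` h G)) (?y' G)" if "G : insert E AA" for G
using Fill_ty[OF insert.prems(2)[OF that] order_refl insert.prems(3)[OF that] order_refl] by simp
 let ?q = "Fill p y AA" and ?Q = "DD - AA Un ?H"
 have q: "ty c S ?Q ?q" by (rule Fill_ty[OF p A yA order_refl])
 have EQ: "E : ?Q" using E insert.hyps by blast
 have EH: "E ~: ?H" using notin_h[OF p A yA E] insert.hyps by auto
 have dj: "h E Int ?H = {}"
using ok_sep2[OF tyD(1)[OF p] E _ _ tyD(1)[OF yE] tyD(1)[OF yA]] A insert.hyps by fastforce
 have "Fill (Fill p y (insert E AA)) z (\<Union>(h ` insert E AA)) = Fill (ins ?q (y E)) z (h E Un ?H)"
using Fill_insert[OF p insert.prems(1,2) order_refl insert.hyps(2)] by simp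
 also have "\<dots> = Fill (Fill (ins ?q (y E)) z (h E)) z ?H"
 proof (rule Fill_Un[OF ty_ins[OF q EQ yE] _ dj])
 show "h E Un ?H \<subseteq> ?Q - {E} Un h E" using EH by auto
 show "ty c F (g F) (z F)" if "F : h E Un ?H" for F using that zE[of F] zH[of F] by (rule UnE)
 qed
 also have "Fill (ins ?q (y E)) z (h E) = ins ?q (?y' E)" by (rule Fill_nest[OF q EQ yE order_refl zE])
 also have "Fill (ins ?q (?y' E)) z ?H = ins (Fill ?q z ?H) (?y' E)"
by (rule Fill_swap[OF q EQ y' _ zH]) (use EH in auto)
 also have "Fill ?q z ?H = Fill p ?y' AA" by (rule insert.IH[OF A yA insert.prems(3)[OF insertI2]])
 also have "ins (Fill p ?y' AA) (?y' E) = Fill p ?y' (insert E AA)" by (rule Fill_insert[OF p insert.prems(1) y' order_refl insert.hyps(2), symmetric])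
 finally show ?case .
qed

lemma scl_one: "ty c S DD p ==> scl \<one>\<^bsub>R\<^esub> p = p"
using smult_PM[of c S DD "snd p" "\<one>\<^bsub>R\<^esub>"] module.smult_one[OF module_PM] by (simp add: ty_def scl_def prod_eq_iff)

lemma ty_unit:
 assumes "good F" "c F : Fld C d (sub (bnd F))" shows "ty c F {F} (hole F {F}, Degen \<one>\<^bsub>R\<^esub> (c F))"
using assms cring.axioms(1)[OF cring_R] ring.ring_simprules(6)
by (auto simp: ty_def ok_def decor_def PM_def degen_simps)

text \<open>For a genuine field the unit acts as the scalar \<open>1\<close>. A degenerate
  \<open>p\<close> is a multiple of the field on the same sphere and rescales the unit to
  itself.\<close>

lemma ins_unit:
 assumes "ty c S DD p" "F : DD" shows "ins p (hole F {F}, Degen \<one>\<^bsub>R\<^esub> (c F)) = p"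
proof -
 interpret cring R by (rule cring_R)
 obtain T r where pe: "p = (T, r)" by force
 show ?thesis
 proof (cases r)
 case (Field rr) thus ?thesis using scl_one[OF assms(1)] by (simp add: pe ins_simps)
 next
 case (Degen a e)
 thus ?thesis using ty_Degen assms unfolding pe by (fastforce simp: ins_simps scl_def gscale_def)
 qed
qed

lemma Fill_singleton: "Fill p y {E} = ins p (y E)"
proof -
 have "length (SOME Es. distinct Es & set Es = {E}) = 1" using some_list[of "{E}"] distinct_card by fastforce
 then obtain G where G: "(SOME Es. distinct Es & set Es = {E}) = [G]" by (auto simp: length_Suc_conv)
 hence "G = E" using some_list[of "{E}"] by simp
 thus ?thesis using G by (simp add: Fill_def)
qed

lemma Fill_unit_left: "ty c E EE (y E) ==> Fill (T, Degen \<one>\<^bsub>R\<^esub> e) y {E} = y E"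
by (simp add: Fill_singleton ins_simps scl_one)

lemma Fill_unit_right:
 assumes p: "ty c S DD p" and A: "AA \<subseteq> DD" and g: "!!F. F : AA ==> good F"
 shows "Fill p (%F. (hole F {F}, Degen \<one>\<^bsub>R\<^esub> (c F))) AA = p"
proof -
 have u: "ty c F {F} (hole F {F}, Degen \<one>\<^bsub>R\<^esub> (c F))" if "F : AA" for F
by (rule ty_unit) (use that A g okD(4)[OF tyD(1)[OF p]] in "auto simp: decor_def")
 have "Fill p (%F. (hole F {F}, Degen \<one>\<^bsub>R\<^esub> (c F))) \<B> = p" if "\<B> \<subseteq> AA" for \<B>
using finite_subset[OF that finite_subset[OF A okD(5)[OF tyD(1)[OF p]]]] that
 proof (induction \<B> rule: finite_induct)
 case (insert F \<B>)
 thus ?case using Fill_insert[OF p A u, of F \<B>] ins_unit[OF p, of F] A by auto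
 qed (simp add: Fill_empty)
 thus ?thesis by blast
qed

text \<open>The order is immaterial, so \<open>F\<close> is filled last and the dependence on
  \<open>u\<close> is that of a single \<open>ins\<close>.\<close>

lemma Fill_linear_arg:
 assumes p: "ty c S DD p" and A: "AA \<subseteq> DD" and y: "!!E. E : AA ==> ty c E (h E) (y E)" and F: "F : AA"
 shows "mlinear R (PM c F (h F)) (PM c S (DD - AA Un \<Union>(h ` AA))) (%u. snd (Fill p (y(F := (hole F (h F), u))) AA))"
proof -
 let ?q = "Fill p y (AA - {F})" and ?Q = "DD - (AA - {F}) Un \<Union>(h ` (AA - {F}))"
 have q: "ty c S ?Q ?q" by (rule Fill_ty[OF p A y]) auto
 have FQ: "F : ?Q" using F A by blast
 have oF: "ok c F (h F)" by (rule tyD(1)[OF y[OF F]])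
 have "F ~: \<Union>(h ` (AA - {F}))" using notin_h[OF p A y] F A by blast
 hence e: "?Q - {F} Un h F = DD - AA Un \<Union>(h ` AA)" using F by auto
 have eq: "snd (Fill p (y(F := (hole F (h F), u))) AA) = snd (ins (hole S ?Q, snd ?q) (hole F (h F), u))" if u: "u : cr (PM c F (h F))" for u
 proof -
 let ?y = "y(F := (hole F (h F), u))"
 have yt: "ty c E (h E) (?y E)" if "E : AA" for E using y[OF that] oF u by (simp add: ty_def)
 have "Fill p ?y (insert F (AA - {F})) = ins (Fill p ?y (AA - {F})) (?y F)" by (rule Fill_insert[OF p A yt]) (use F in auto)
 moreover have "Fill p ?y (AA - {F}) = ?q" by (rule Fill_cong) (use finite_subset[OF A okD(5)[OF tyD(1)[OF p]]] in auto)
 ultimately show ?thesis using F tyD(2)[OF q] by (simp add: insert_absorb)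
 qed
 show ?thesis
using bilinD(1)[OF ins_bilinear(1)[OF tyD(1)[OF q] FQ oF] tyD(3)[OF q]] unfolding e
by (subst mlinear_cong[OF module_PM[OF oF] eq])
qed

lemma Fill_linear:
 assumes o: "ok c S DD" and A: "AA \<subseteq> DD" and y: "!!E. E : AA ==> ty c E (h E) (y E)"
 shows "mlinear R (PM c S DD) (PM c S (DD - AA Un \<Union>(h ` AA))) (%r. snd (Fill (hole S DD, r) y AA))"
using finite_subset[OF A okD(5)[OF o]] A y
proof (induction AA rule: finite_induct)
 case empty thus ?case by (simp add: Fill_empty lin_id)
next
 case (insert E AA)
 let ?Q = "DD - AA Un \<Union>(h ` AA)"
 have A: "AA \<subseteq> DD" and E: "E : DD" and yA: "!!E. E : AA ==> ty c E (h E) (y E)" and yE: "ty c E (h E) (y E)"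
using insert.prems by auto
 have t: "ty c S DD (hole S DD, r)" if "r : cr (PM c S DD)" for r using o that by (simp add: ty_def)
 have q: "ty c S ?Q (Fill (hole S DD, r) y AA)" if "r : cr (PM c S DD)" for r
by (rule Fill_ty[OF t[OF that] A yA order_refl])
 interpret R: cring R by (rule cring_R)
 have z: "\<zero>\<^bsub>PM c S DD\<^esub> : cr (PM c S DD)"
 proof -
 interpret module R "PM c S DD" by (rule module_PM[OF o])
 show ?thesis by simp
 qed
 have oQ: "ok c S ?Q" by (rule tyD(1)[OF q[OF z]])
 have EQ: "E : ?Q" using E insert.hyps by blast
 have "E ~: \<Union>(h ` AA)" using notin_h[OF t[OF z] A yA E] insert.hyps by auto
 hence e: "?Q - {E} Un h E = DD - insert E AA Un \<Union>(h ` insert E AA)" using insert.hyps by auto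
 have eq: "snd (Fill (hole S DD, r) y (insert E AA)) = snd (ins (hole S ?Q, snd (Fill (hole S DD, r) y AA)) (hole E (h E), snd (y E)))"
 if r: "r : cr (PM c S DD)" for r
using Fill_insert[OF t[OF r] insert.prems order_refl insert.hyps(2)] tyD(2)[OF q[OF r]] tyD(2)[OF yE] by simp
 have "mlinear R (PM c S DD) (PM c S (?Q - {E} Un h E)) (%r. snd (ins (hole S ?Q, snd (Fill (hole S DD, r) y AA)) (hole E (h E), snd (y E))))"
by (rule lin_comp[OF insert.IH[OF A yA] bilinD(2)[OF ins_bilinear(1)[OF oQ EQ tyD(1)[OF yE]] tyD(3)[OF yE]]])
 thus ?case unfolding e by (subst mlinear_cong[OF module_PM[OF o] eq])
qed

text \<open>Translates the boundary field in the definitions, a glueing of \<open>c S\<close> with a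
  decoration of all blobs, into \<open>bfield\<close>: both have the same restriction to every
  sphere.\<close>

lemma bfield_Glue:
 assumes r: "region S AA" and c: "decor c (insert S AA)" and y: "y : Fld C d (sub (bnds AA))"
 "!!Z. Z : AA ==> Res C d (sub (bnds AA)) (bnd Z) y = c Z"
 shows "Glue C d (sub (bnd S Un bnds AA)) (bnd S) (bnds AA) (c S) y = bfield c (insert S AA)"
proof -
 have b: "bfam ({S} Un AA)" and dj: "{S} Int AA = {}" using region_bfam(1)[OF r] regionD(5)[OF r] by auto
 have cS: "c S : Fld C d (sub (bnds {S}))" using c by (simp add: decor_def bnds_sing)
 note g = Glue_bnds[OF b dj cS y(1)]
 have e: "bnd S Un bnds AA = bnds ({S} Un AA)" "bnd S = bnds {S}" by (simp_all add: bds_def)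
 have "Glue C d (sub (bnds ({S} Un AA))) (bnds {S}) (bnds AA) (c S) y = bfield c ({S} Un AA)"
 proof (rule bfield(3)[OF b _ _ g(1)])
 show "decor c ({S} Un AA)" using c by simp
 fix Z assume Z: "Z : {S} Un AA"
 show "Res C d (sub (bnds ({S} Un AA))) (bnd Z) (Glue C d (sub (bnds ({S} Un AA))) (bnds {S}) (bnds AA) (c S) y) = c Z"
 proof (cases "Z = S")
 case True
 thus ?thesis using g(2)[of S] Res_singleton[OF regionD(1)[OF r], of "c S"] cS by (simp add: bnds_sing)
 next
 case False
 thus ?thesis using g(3)[of Z] y(2)[of Z] Z by simp
 qed
 qed simp
 thus ?thesis unfolding e(1) by (simp add: bnds_sing)
qed

lemma bfield_singleton: "good E ==> decor c {E} ==> bfield c {E} = c E"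
using bfield(3)[of "{E}" c "c E"] Res_singleton[of E "c E"] by (simp add: bfam_def decor_def bnds_sing)

end

section \<open>Configurations of blobs\<close>

lemma tag_sub:
 assumes "inj t" "V \<subseteq> cr F"
 shows "x : t ` V ==> y : t ` V ==> x \<oplus>\<^bsub>tag_module t (F\<lparr>carrier := V\<rparr>)\<^esub> y = x \<oplus>\<^bsub>tag_module t F\<^esub> y"
and "x : t ` V ==> a \<odot>\<^bsub>tag_module t (F\<lparr>carrier := V\<rparr>)\<^esub> x = a \<odot>\<^bsub>tag_module t F\<^esub> x"
proof -
 show "x \<oplus>\<^bsub>tag_module t (F\<lparr>carrier := V\<rparr>)\<^esub> y = x \<oplus>\<^bsub>tag_module t F\<^esub> y" if xy: "x : t ` V" "y : t ` V"
 proof -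
 obtain u v where "x = t u" "u : V" "y = t v" "v : V" using xy by blast
 thus ?thesis using add_tag[OF assms(1), of u F v] add_tag[OF assms(1), of u "F\<lparr>carrier := V\<rparr>" v] assms(2) by (simp add: subset_iff)
 qed
 show "a \<odot>\<^bsub>tag_module t (F\<lparr>carrier := V\<rparr>)\<^esub> x = a \<odot>\<^bsub>tag_module t F\<^esub> x" if x: "x : t ` V"
 proof -
 obtain u where "x = t u" "u : V" using x by blast
 thus ?thesis using smult_tag[OF assms(1), of u F a] smult_tag[OF assms(1), of u "F\<lparr>carrier := V\<rparr>" a] assms(2) by (simp add: subset_iff)
 qed
qed

locale blob_theory = field_theory d M C R
 for d :: nat and M :: "'p topology" and C :: "('p, 'f, 'r) fields" and R :: "'r ring" +
 fixes U :: "'p set => 'f => 'f set" and b :: 'f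
 assumes connected: "connected_space M" and nonempty: "topspace M ~= {}"
and relations: "local_relations d R M C U" and b_Fld: "b : Fld C d (bdry (Suc d) M)"
begin

abbreviation "MM == topspace M"
abbreviation "dec == decorated d M C"
abbreviation "cc == contains_conf d M C"
abbreviation "dco == deco_on d M C"
abbreviation "tpc == top_contains d M C b"
abbreviation "ff == field_factor d R M C U"
abbreviation "fam == field_families d R M C U"
abbreviation "filla == fill_all d R M C"
abbreviation "Mv == M_val d R M C b"

section \<open>Containment of configurations and compatible decorations\<close>

lemma b_bnd: "b : Fld C d (sub (bnd MM))"
using b_Fld bdry_bnd[of MM] by simp

lemma blob_top: "blob d M MM D \<longleftrightarrow> pblob MM D \<or> D = MM & ball MM"
by (rule blob_connected_iff) (use connected nonempty in "auto simp: connectedin_topspace")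

lemma dec_iff: "dec X \<longleftrightarrow> X = Empty \<or> finite (blobs X) & blobs X ~= {} & (ALL D:blobs X. pblob MM D \<or> D = MM & ball MM) \<and>
 pairwise disjnt (blobs X) & deco X : Fld C d (sub (bnds (blobs X)))"
by (auto simp: decorated_def blob_config_def blob_top)

lemma decD:
 assumes "dec X"
 shows "finite (blobs X)" "D : blobs X ==> ball D" "D : blobs X ==> D' : blobs X ==> D ~= D' ==> D Int D' = {}"
 "D : blobs X ==> good D" "D : blobs X ==> D ~= {}" "bfam (blobs X)" "X ~= Empty ==> deco X : Fld C d (sub (bnds (blobs X)))"
 "D : blobs X ==> blob d M MM D" "X ~= Empty ==> blobs X ~= {}" "D : blobs X ==> X ~= Empty"
proof -
 show f: "finite (blobs X)" and b: "D : blobs X ==> ball D" for D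
using assms pblob_ball unfolding dec_iff by auto
 show g: "D : blobs X ==> good D" "D : blobs X ==> D ~= {}" for D using b ballD(5,6) by auto
 show dj: "D : blobs X ==> D' : blobs X ==> D ~= D' ==> D Int D' = {}" for D D'
using assms unfolding dec_iff pairwise_def disjnt_def by (cases X) auto
 have "bnd D Int bnd D' = {}" if "D : blobs X" "D' : blobs X" "D ~= D'" for D D'
using dj[OF that] bnd_subset(1)[of D] bnd_subset(1)[of D'] by blast
 thus "bfam (blobs X)" unfolding bfam_def using f g by simp
 show "X ~= Empty ==> deco X : Fld C d (sub (bnds (blobs X)))" "X ~= Empty ==> blobs X ~= {}" using assms unfolding dec_iff by auto
 show "D : blobs X ==> blob d M MM D" using assms unfolding dec_iff blob_top by (cases X) auto
 show "D : blobs X ==> X ~= Empty" by auto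
qed

lemma in_unique: "dec X ==> D : blobs X ==> E : blobs X ==> F \<subseteq> D ==> F \<subseteq> E ==> F ~= {} ==> D = E"
using decD(3)[of X D E] by blast

text \<open>Equality is allowed: a blob may reappear unchanged in the smaller configuration, and
  this is the source of degenerate complements.\<close>

definition nested :: "'p set => 'p set => bool" where
 "nested E D \<longleftrightarrow> pblob E D \<or> D = E"

lemma nested_subset: "nested E D ==> D \<subseteq> E"
using pblob_subset unfolding nested_def by blast

text \<open>By \<open>blob_Union_iff\<close> containment is tested blob by blob, each smaller blob
  lying in a single larger one.\<close>

lemma cc_iff: "cc X' X \<longleftrightarrow> dec X' & dec X & (X = Empty \<or> X' ~= Empty & (ALL D:blobs X. EX E:blobs X'. nested E D) \<and>
 (ALL E:blobs X Int blobs X'. dco X (bnd E) = dco X' (bnd E)))"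
proof -
 have "blob_config d M (\<Union>(blobs X')) (blobs X) \<longleftrightarrow> (ALL D:blobs X. EX E:blobs X'. nested E D)" if "dec X'" "dec X" "X ~= Empty"
 proof -
 have "blob d M (\<Union>(blobs X')) D \<longleftrightarrow> (EX E:blobs X'. nested E D)" for D
unfolding nested_def by (rule blob_Union_iff) (use decD[OF that(1)] in auto)
 thus ?thesis using that(2,3) by (auto simp: blob_config_def dec_iff)
 qed
 thus ?thesis unfolding contains_conf_def by blast
qed

lemma ccD:
 assumes "cc X' X"
 shows "dec X'" "dec X" "D : blobs X ==> EX E:blobs X'. nested E D" "D : blobs X ==> D : blobs X' ==> dco X (bnd D) = dco X' (bnd D)"
 "X ~= Empty ==> X' ~= Empty"
using assms unfolding cc_iff by auto

lemma cc_refl: "dec X ==> cc X X"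
unfolding cc_iff nested_def by blast

text \<open>Blobs are handled by \<open>pblob_trans\<close>. For decorations, a blob common to
  \<open>X\<close> and \<open>Z\<close> is squeezed by one of \<open>Y\<close>, which must then
  equal it, so the two given agreements compose.\<close>

lemma cc_trans:
 assumes XY: "cc X Y" and YZ: "cc Y Z" shows "cc X Z"
proof (cases "Z = Empty")
 case True thus ?thesis using ccD(1)[OF XY] ccD(2)[OF YZ] unfolding cc_iff by blast
next
 case False
 have F: "EX E F. E : blobs Y & F : blobs X & nested E D & nested F E & nested F D" if D: "D : blobs Z" for D
 proof -
 obtain E where E: "E : blobs Y" "nested E D" using ccD(3)[OF YZ D] by blast
 obtain F where F: "F : blobs X" "nested F E" using ccD(3)[OF XY E(1)] by blast
 have "nested F D" using E(2) F(2) pblob_trans[OF decD(4)[OF ccD(1)[OF XY] F(1)], of E D] unfolding nested_def by blast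
 thus ?thesis using E F by blast
 qed
 have "dco Z (bnd D) = dco X (bnd D)" if D: "D : blobs Z" "D : blobs X" for D
 proof -
 obtain E F where EF: "E : blobs Y" "F : blobs X" "nested E D" "nested F E" "nested F D" using F[OF D(1)] by blast
 have "F = D" by (rule in_unique[OF ccD(1)[OF XY] EF(2) D(2) nested_subset[OF EF(5)] order_refl decD(5)[OF ccD(2)[OF YZ] D(1)]])
 hence "E = D" using nested_subset[OF EF(3)] nested_subset[OF EF(4)] by blast
 thus ?thesis using ccD(4)[OF XY, of D] ccD(4)[OF YZ, of D] EF(1) D by simp
 qed
 thus ?thesis unfolding cc_iff using F ccD(1)[OF XY] ccD(2)[OF YZ] ccD(5)[OF YZ False] ccD(5)[OF XY] by blast
qed

lemma dco_Fld: "dec X ==> AA \<subseteq> blobs X ==> X ~= Empty ==> dco X (bnds AA) : Fld C d (sub (bnds AA))"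
unfolding deco_on_def by (rule Res_bnds(1)[OF decD(6) _ decD(7)])

lemma dco_Res: "dec X ==> AA \<subseteq> blobs X ==> D : AA ==> Res C d (sub (bnds AA)) (bnd D) (dco X (bnds AA)) = dco X (bnd D)"
using Res_bnds(2)[OF decD(6), of X AA "deco X" "{D}"] decD(7,10)[of X] by (auto simp: deco_on_def bnds_sing)

lemma top_blob: "dec X ==> MM : blobs X ==> blobs X = {MM}"
using decD(5)[of X] decD(3)[of X MM] ballD(1)[OF decD(2)[of X]] by blast

lemma dco_single: "dec X ==> blobs X = {D} ==> dco X (bnd D) = deco X"
using Res_singleton[of D "deco X"] decD(4)[of X D] decD(7,10)[of X] by (auto simp: deco_on_def bnds_sing)

lemma tpcD: "tpc X ==> dec X" "tpc X ==> MM : blobs X ==> dco X (bnd MM) = b"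
using top_blob dco_single unfolding top_contains_def by auto

lemma tpc_down:
 assumes "tpc X" "cc X Y" shows "tpc Y"
unfolding top_contains_def
proof (intro conjI impI)
 show "dec Y" by (rule ccD(2)[OF assms(2)])
 assume Y: "blobs Y = {MM}"
 then obtain E where E: "E : blobs X" "nested E MM" using ccD(3)[OF assms(2), of MM] by auto
 hence "E = MM" using nested_subset ballD(1)[OF decD(2)[OF ccD(1)[OF assms(2)] E(1)]] by blast
 thus "deco Y = b" using tpcD(2)[OF assms(1)] ccD(4)[OF assms(2), of MM] E(1) Y dco_single[OF \<open>dec Y\<close> Y] by simp
qed

definition compat :: "('p set => 'f) => ('p, 'f) dconf => bool" where
 "compat c X \<longleftrightarrow> (ALL D:blobs X. c D = dco X (bnd D))"

text \<open>Pairwise comparable configurations agree on shared blobs, so all their decorations come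
  from one function on sets. If \<open>M\<close> itself occurs as a blob, its field is
  \<open>b\<close> by the top condition; otherwise the default value \<open>b\<close>
  applies.\<close>

lemma compat_ex:
 assumes "!!X Y. X : \<X> ==> Y : \<X> ==> cc X Y \<or> cc Y X"
 obtains c where "!!X. X : \<X> ==> compat c X" "(!!X. X : \<X> ==> tpc X) ==> c MM = b"
proof -
 define P where "P D X \<longleftrightarrow> X : \<X> & D : blobs X" for D X
 define c where "c D = (if EX X. P D X then dco (SOME X. P D X) (bnd D) else b)" for D
 have sm: "P D (SOME X. P D X)" if "P D X" for D X using that by (rule someI)
 have "compat c X" if X: "X : \<X>" for X
unfolding compat_def
 proof
 fix D assume D: "D : blobs X"
 let ?Y = "SOME X. P D X"
 have "P D X" using D X by (simp add: P_def)
 hence Y: "?Y : \<X>" "D : blobs ?Y" and ex: "EX X. P D X" using sm[of D X] unfolding P_def by auto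
 show "c D = dco X (bnd D)"
using assms[OF X Y(1)] ccD(4)[of X ?Y D] ccD(4)[of ?Y X D] Y(2) D ex by (auto simp: c_def)
 qed
 moreover have "c MM = b" if t: "!!X. X : \<X> ==> tpc X"
 proof (cases "EX X. P MM X")
 case True
 hence "P MM (SOME X. P MM X)" using sm by blast
 thus ?thesis using True tpcD(2)[OF t] unfolding P_def c_def by auto
 qed (simp add: c_def)
 ultimately show thesis using that by blast
qed

lemma decor_compat: "dec X ==> compat c X ==> AA \<subseteq> blobs X ==> decor c AA"
using dco_Fld[of X "{D}" for D] decD(10)[of X] unfolding decor_def compat_def by (auto simp: bnds_sing subset_iff)

lemma inside_self: "dec X ==> E : blobs X ==> inside X E = {E}"
using in_unique[of X _ E] decD(5)[of X] unfolding inside_def by blast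

lemma inside_nested:
 assumes c: "cc X' X" and E: "E : blobs X'" and D: "D : inside X E" shows "nested E D"
proof -
 have D': "D : blobs X" "D \<subseteq> E" using D by (auto simp: inside_def)
 obtain E' where E': "E' : blobs X'" "nested E' D" using ccD(3)[OF c D'(1)] by blast
 have "E' = E" by (rule in_unique[OF ccD(1)[OF c] E'(1) E nested_subset[OF E'(2)] D'(2) decD(5)[OF ccD(2)[OF c] D'(1)]])
 thus ?thesis using E' by simp
qed

lemma ok_subconfig:
 assumes X: "dec X" and c: "compat c X" and S: "good S" "c S : Fld C d (sub (bnd S))" and A: "AA \<subseteq> blobs X" "!!D. D : AA ==> nested S D" "S ~= {}"
 shows "ok c S AA"
proof -
 have d: "decor c (insert S AA)" using decor_compat[OF X c A(1)] S(2) by (simp add: decor_def)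
 show ?thesis
 proof (cases "S : AA")
 case True
 have "D = S" if "D : AA" for D
using in_unique[OF X, of D S D] True that A(1) nested_subset[OF A(2)[OF that]] decD(5)[OF X, of D] by blast
 hence "AA = {S}" using True by blast
 thus ?thesis using d S(1) by (simp add: ok_def)
 next
 case False
 hence p: "pblob S D" if "D : AA" for D using A(2)[OF that] that unfolding nested_def by blast
 have "pairwise disjnt AA" using decD(3)[OF X] A(1) unfolding pairwise_def disjnt_def by blast
 hence "region S AA" unfolding region_def using S(1) finite_subset[OF A(1) decD(1)[OF X]] p by blast
 thus ?thesis using d by (simp add: ok_def)
 qed
qed

lemma ok_inside:
 assumes "cc X' X" "E : blobs X'" "compat c X'" "compat c X" shows "ok c E (inside X E)"
proof (rule ok_subconfig[OF ccD(2)[OF assms(1)] assms(4) decD(4)[OF ccD(1)[OF assms(1)] assms(2)]])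
 show "c E : Fld C d (sub (bnd E))" using decor_compat[OF ccD(1)[OF assms(1)] assms(3) order_refl] assms(2) by (simp add: decor_def)
 show "inside X E \<subseteq> blobs X" by (auto simp: inside_def)
 show "E ~= {}" by (rule decD(5)[OF ccD(1)[OF assms(1)] assms(2)])
qed (rule inside_nested[OF assms(1,2)])

lemma ok_top:
 assumes "tpc X" "compat c X" "c MM = b" shows "ok c MM (blobs X)"
by (rule ok_subconfig[OF tpcD(1)[OF assms(1)] assms(2) good_top])
 (use assms(3) b_bnd nonempty decD(8)[OF tpcD(1)[OF assms(1)]] in "auto simp: blob_top nested_def")

lemma inside_UN:
 assumes "cc X' X" "cc X Y" shows "E : blobs X' ==> \<Union>(inside Y ` inside X E) = inside Y E" "\<Union>(inside Y ` blobs X) = blobs Y"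
proof -
 have ex: "EX G:blobs X. D \<subseteq> G" if "D : blobs Y" for D using ccD(3)[OF assms(2) that] nested_subset by blast
 show "\<Union>(inside Y ` blobs X) = blobs Y" using ex by (auto simp: inside_def)
 assume E: "E : blobs X'"
 have "D : \<Union>(inside Y ` inside X E)" if D: "D : inside Y E" for D
 proof -
 have DY: "D : blobs Y" "D \<subseteq> E" using D by (auto simp: inside_def)
 obtain G where G: "G : blobs X" "D \<subseteq> G" using ex[OF DY(1)] by blast
 obtain E' where E': "E' : blobs X'" "G \<subseteq> E'" using ccD(3)[OF assms(1) G(1)] nested_subset by blast
 have "E' = E" by (rule in_unique[OF ccD(1)[OF assms(1)] E'(1) E order_trans[OF G(2) E'(2)] DY(2) decD(5)[OF ccD(2)[OF assms(2)] DY(1)]])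
 hence "G : inside X E" "D : inside Y G" using G E' DY by (auto simp: inside_def)
 thus ?thesis by blast
 qed
 thus "\<Union>(inside Y ` inside X E) = inside Y E" by (auto simp: inside_def)
qed

lemma cut_fields_PM:
 assumes X: "dec X" and c: "compat c X" and A: "AA \<subseteq> blobs X" "AA ~= {}" and o: "ok c S AA"
 shows "cut_fields d R M C S (c S) AA X = PM c S AA"
proof (cases "S : AA")
 case False
 note r = okD(2)[OF o False]
 have "Glue C d (sub (bnd S Un bnds AA)) (bnd S) (bnds AA) (c S) (dco X (bnds AA)) = bfield c (insert S AA)"
 proof (rule bfield_Glue[OF r okD(4)[OF o]])
 show "dco X (bnds AA) : Fld C d (sub (bnds AA))" using dco_Fld[OF X A(1)] decD(10)[OF X] A by blast
 show "Res C d (sub (bnds AA)) (bnd Z) (dco X (bnds AA)) = c Z" if "Z : AA" for Z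
using dco_Res[OF X A(1) that] c A(1) that by (auto simp: compat_def)
 qed
 thus ?thesis using False by (simp add: cut_fields_def PM_def FM_def)
qed (simp add: cut_fields_def PM_def)

lemma PM_empty: "good E ==> decor c {E} ==> PM c E {} = tag_module Field (Fmod C (sub E) (c E))"
by (simp add: PM_def FM_def bfield_singleton)

lemma U_sub: "blob d M MM D ==> c : Fld C d (sub (bnd D)) ==> submodule (U D c) R (Fmod C (sub D) c)"
using relations unfolding local_relations_def by blast

lemma ff_eq:
 assumes "cc X' X" "E : blobs X'" "compat c X'" "compat c X"
 shows "ff X' X E = (if inside X E = {} then tag_module Field ((Fmod C (sub E) (c E))\<lparr>carrier := U E (c E)\<rparr>) else PM c E (inside X E))"
proof -
 have "c E = dco X' (bnd E)" using assms(2,3) by (simp add: compat_def)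
 moreover have "inside X E \<subseteq> blobs X" by (auto simp: inside_def)
 ultimately show ?thesis
using cut_fields_PM[OF ccD(2)[OF assms(1)] assms(4) _ _ ok_inside[OF assms]] by (simp add: field_factor_def Let_def)
qed

text \<open>If no blob lies in \<open>E\<close>, the factor is only the submodule of local relations
  inside all fields on \<open>E\<close>. Its operations are those of \<open>PM\<close>, so maps are
  built in the ambient modules and then restricted, as soon as their values are known to be
  relations.\<close>

lemma ffD:
 assumes as: "cc X' X" "E : blobs X'" "compat c X'" "compat c X"
 shows "rmod R (ff X' X E)" "cr (ff X' X E) \<subseteq> cr (PM c E (inside X E))"
 "mlinear R A (PM c E (inside X E)) f ==> (!!x. x : cr A ==> f x : cr (ff X' X E)) ==> mlinear R A (ff X' X E) f"
 "mlinear R (PM c E (inside X E)) B g ==> mlinear R (ff X' X E) B g"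
proof -
 note o = ok_inside[OF as]
 have *: "rmod R (ff X' X E) & cr (ff X' X E) \<subseteq> cr (PM c E (inside X E)) \<and>
 (ALL x:cr (ff X' X E). ALL y:cr (ff X' X E). x \<oplus>\<^bsub>ff X' X E\<^esub> y = x \<oplus>\<^bsub>PM c E (inside X E)\<^esub> y) \<and>
 (ALL a. ALL x:cr (ff X' X E). a \<odot>\<^bsub>ff X' X E\<^esub> x = a \<odot>\<^bsub>PM c E (inside X E)\<^esub> x)"
 proof (cases "inside X E = {}")
 case False
 thus ?thesis using module_PM[OF o] ff_eq[OF as] by simp
 next
 case True
 let ?F = "Fmod C (sub E) (c E)"
 have gE: "good E" and bE: "blob d M MM E" using decD(4,8)[OF ccD(1)[OF as(1)] as(2)] by auto
 have dE: "decor c {E}" using okD(4)[OF o] by (simp add: decor_def)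
 have U: "submodule (U E (c E)) R ?F" using U_sub[OF bE] dE by (simp add: decor_def)
 have P: "PM c E (inside X E) = tag_module Field ?F" using PM_empty[OF gE dE] True by simp
 have f: "ff X' X E = tag_module Field (?F\<lparr>carrier := U E (c E)\<rparr>)" using ff_eq[OF as] True by simp
 have "codim0 (Suc d) M E" "c E : Fld C d (bdry (Suc d) (sub E))" using gE dE by (simp_all add: good_codim0 bdry_bnd decor_def)
 hence mF: "rmod R ?F" by (rule Fmod)
 show ?thesis unfolding P f
 proof (intro conjI ballI allI)
 show "rmod R (tag_module Field (?F\<lparr>carrier := U E (c E)\<rparr>))" by (rule module_tag[OF submodule_module[OF mF U] inj_Field])
 show "cr (tag_module Field (?F\<lparr>carrier := U E (c E)\<rparr>)) \<subseteq> cr (tag_module Field ?F)" using submodule_subset[OF U] by auto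
 qed (rule tag_sub[OF inj_Field submodule_subset[OF U]]; simp)+
 qed
 thus m: "rmod R (ff X' X E)" and s: "cr (ff X' X E) \<subseteq> cr (PM c E (inside X E))" by blast+
 show "mlinear R (ff X' X E) B g" if g: "mlinear R (PM c E (inside X E)) B g"
 proof (rule mlinearI)
 show "g x : cr B" if "x : cr (ff X' X E)" for x using lin_in[OF g] that s by blast
 show "g (x \<oplus>\<^bsub>ff X' X E\<^esub> y) = g x \<oplus>\<^bsub>B\<^esub> g y" if "x : cr (ff X' X E)" "y : cr (ff X' X E)" for x y
using lin_add[OF g] * that s by (simp add: subset_iff)
 show "g (a \<odot>\<^bsub>ff X' X E\<^esub> x) = a \<odot>\<^bsub>B\<^esub> g x" if "a : cr R" "x : cr (ff X' X E)" for a x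
using lin_smult[OF g] * that s by (simp add: subset_iff)
 qed
 show "mlinear R A (ff X' X E) f" if f: "mlinear R A (PM c E (inside X E)) f" and cl: "!!x. x : cr A ==> f x : cr (ff X' X E)"
 proof (rule mlinearI)
 show "f x : cr (ff X' X E)" if "x : cr A" for x by (rule cl[OF that])
 show "f (x \<oplus>\<^bsub>A\<^esub> y) = f x \<oplus>\<^bsub>ff X' X E\<^esub> f y" if "x : cr A" "y : cr A" for x y
using lin_add[OF f that] * cl that by simp
 show "f (a \<odot>\<^bsub>A\<^esub> x) = a \<odot>\<^bsub>ff X' X E\<^esub> f x" if "a : cr R" "x : cr A" for a x
using lin_smult[OF f that] * cl that by simp
 qed
qed

section \<open>Filling the blobs of a configuration\<close>

definition prs :: "('p, 'f) dconf => ('p set => ('f, 'r) gfield) => 'p set => 'p set \<times> ('f, 'r) gfield" where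
 "prs X x = (%E. (hole E (inside X E), x E))"

lemma filla_def: "filla S DD X r x = snd (Fill (hole S DD, r) (prs X x) DD)"
by (simp add: fill_all_Fill prs_def)

lemma filla_cong: "finite DD ==> (!!F. F : DD ==> x F = x' F) ==> filla S DD X r x = filla S DD X r x'"
unfolding filla_def by (rule arg_cong[of _ _ snd], rule Fill_cong) (auto simp: prs_def)

lemma fam_mem: "x : fam X' X ==> E : blobs X' ==> x E : cr (ff X' X E)"
by (auto simp: field_families_def)

lemma ty_prs:
 assumes "cc X' X" "compat c X'" "compat c X" "x : fam X' X" "E : blobs X'"
 shows "ty c E (inside X E) (prs X x E)"
unfolding ty_def prs_def using ok_inside[OF assms(1,5,2,3)] ffD(2)[OF assms(1,5,2,3)] fam_mem[OF assms(4,5)] by auto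

context
 fixes c :: "'p set => 'f" and X Y S DD
 assumes XY: "cc X Y" and cX: "compat c X" and cY: "compat c Y" and o: "ok c S DD" and D: "DD \<subseteq> blobs X"
begin

lemma ty_base: "r : cr (PM c S DD) ==> ty c S DD (hole S DD, r)"
using o by (simp add: ty_def)

lemma filla_ty:
 assumes x: "x : fam X Y" and r: "r : cr (PM c S DD)"
 shows "ty c S (\<Union>(inside Y ` DD)) (Fill (hole S DD, r) (prs Y x) DD)"
and "Fill (hole S DD, r) (prs Y x) DD = (hole S (\<Union>(inside Y ` DD)), filla S DD Y r x)"
and "filla S DD Y r x : cr (PM c S (\<Union>(inside Y ` DD)))"
proof -
 show t: "ty c S (\<Union>(inside Y ` DD)) (Fill (hole S DD, r) (prs Y x) DD)"
using Fill_ty[OF ty_base[OF r] order_refl ty_prs[OF XY cX cY x subsetD[OF D]] order_refl] by simp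
 show "Fill (hole S DD, r) (prs Y x) DD = (hole S (\<Union>(inside Y ` DD)), filla S DD Y r x)"
unfolding filla_def by (rule tyD(2)[OF t])
 show "filla S DD Y r x : cr (PM c S (\<Union>(inside Y ` DD)))"
unfolding filla_def by (rule tyD(3)[OF t])
qed

lemma filla_linear:
 assumes x: "x : fam X Y"
 shows "mlinear R (PM c S DD) (PM c S (\<Union>(inside Y ` DD))) (%r. filla S DD Y r x)"
using Fill_linear[OF o order_refl ty_prs[OF XY cX cY x]] D unfolding filla_def by (simp add: subset_iff)

lemma filla_linear_arg:
 assumes x: "x : fam X Y" and r: "r : cr (PM c S DD)" and F: "F : DD"
 shows "mlinear R (ff X Y F) (PM c S (\<Union>(inside Y ` DD))) (%u. filla S DD Y r (x(F := u)))"
proof -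
 have "(prs Y x)(F := (hole F (inside Y F), u)) = prs Y (x(F := u))" for u by (auto simp: prs_def)
 hence "mlinear R (PM c F (inside Y F)) (PM c S (\<Union>(inside Y ` DD))) (%u. filla S DD Y r (x(F := u)))"
using Fill_linear_arg[OF ty_base[OF r] order_refl ty_prs[OF XY cX cY x] F] D unfolding filla_def by (simp add: subset_iff)
 thus ?thesis using ffD(4)[OF XY _ cX cY] F D by blast
qed

lemma filla_assoc:
 assumes YZ: "cc Y Z" and cZ: "compat c Z" and y: "y : fam X Y" and z: "z : fam Y Z" and r: "r : cr (PM c S DD)"
 shows "filla S DD Z r (\<lambda>F\<in>blobs X. filla F (inside Y F) Z (y F) z) = filla S (\<Union>(inside Y ` DD)) Z (filla S DD Y r y) z"
proof -
 have yt: "ty c F (inside Y F) (prs Y y F)" if "F : DD" for F using ty_prs[OF XY cX cY y] that D by blast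
 have zt: "ty c G (inside Z G) (prs Z z G)" if "F : DD" "G : inside Y F" for F G
using ty_prs[OF YZ cY cZ z, of G] that by (auto simp: inside_def)
 note fa = Fill_assoc[OF ty_base[OF r] order_refl yt zt]
 have e: "Fill (prs Y y F) (prs Z z) (inside Y F) = prs Z (\<lambda>F\<in>blobs X. filla F (inside Y F) Z (y F) z) F" if F: "F : DD" for F
 proof -
 have FX: "F : blobs X" using F D by blast
 have t: "ty c F (inside Z F) (Fill (prs Y y F) (prs Z z) (inside Y F))"
using Fill_ty[OF yt[OF F] order_refl zt[OF F] order_refl] inside_UN(1)[OF XY YZ FX] by simp
 show ?thesis using tyD(2)[OF t] FX by (simp add: prs_def filla_def)
 qed
 have "filla S DD Z r (\<lambda>F\<in>blobs X. filla F (inside Y F) Z (y F) z) = snd (Fill (hole S DD, r) (%F. Fill (prs Y y F) (prs Z z) (inside Y F)) DD)"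
unfolding filla_def by (rule arg_cong[of _ _ snd], rule Fill_cong) (use okD(5)[OF o] e in "auto simp: filla_def")
 also have "\<dots> = snd (Fill (Fill (hole S DD, r) (prs Y y) DD) (prs Z z) (\<Union>(inside Y ` DD)))" by (simp only: fa)
 also have "\<dots> = filla S (\<Union>(inside Y ` DD)) Z (filla S DD Y r y) z"
unfolding filla_ty(2)[OF y r] by (simp only: filla_def)
 finally show ?thesis .
qed

text \<open>With nothing left inside the blobs, a chosen \<open>F\<close> is filled last; everything
  else forms a field \<open>q\<close> on the complement of \<open>F\<close> alone.\<close>

lemma filla_last:
 assumes x: "x : fam X Y" and r: "r : cr (PM c S DD)" and F: "F : DD" and e: "!!G. G : DD ==> inside Y G = {}"
 shows "EX q. ty c S {F} q & filla S DD Y r x = snd (ins q (F, x F))"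
proof -
 have yt: "ty c F (inside Y F) (prs Y x F)" if "F : DD" for F using ty_prs[OF XY cX cY x] that D by blast
 let ?q = "Fill (hole S DD, r) (prs Y x) (DD - {F})"
 have "\<Union>(inside Y ` (DD - {F})) = {}" "DD - (DD - {F}) = {F}" using e F by auto
 hence "ty c S {F} ?q" using Fill_ty[OF ty_base[OF r] order_refl yt, of "DD - {F}"] by auto
 moreover have "Fill (hole S DD, r) (prs Y x) (insert F (DD - {F})) = ins ?q (prs Y x F)"
by (rule Fill_insert[OF ty_base[OF r] order_refl yt]) (use F in auto)
 ultimately show ?thesis using F e[OF F] unfolding filla_def by (intro exI[of _ ?q]) (simp add: insert_absorb prs_def)
qed

end

lemma filla_unit_right:
 assumes X: "dec X" and c: "compat c X" and o: "ok c S DD" and D: "DD \<subseteq> blobs X" and r: "r : cr (PM c S DD)"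
 shows "filla S DD X r (\<lambda>E\<in>blobs X. Degen \<one>\<^bsub>R\<^esub> (dco X (bnd E))) = r"
proof -
 have "Fill (hole S DD, r) (prs X (\<lambda>E\<in>blobs X. Degen \<one>\<^bsub>R\<^esub> (dco X (bnd E)))) DD = Fill (hole S DD, r) (%F. (hole F {F}, Degen \<one>\<^bsub>R\<^esub> (c F))) DD"
by (rule Fill_cong) (use okD(5)[OF o] D c in "auto simp: prs_def compat_def inside_self[OF X] subset_iff")
 also have "\<dots> = (hole S DD, r)"
by (rule Fill_unit_right[of c S DD]) (use o r D decD(4)[OF X] in "auto simp: ty_def")
 finally show ?thesis unfolding filla_def by simp
qed

lemma filla_unit_left:
 assumes "cc X' X" "compat c X'" "compat c X" "x : fam X' X" "E : blobs X'"
 shows "filla E (inside X' E) X (Degen \<one>\<^bsub>R\<^esub> e) x = x E"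
using Fill_unit_left[of c E "inside X E" "prs X x" "hole E {E}" e] ty_prs[OF assms] unfolding filla_def inside_self[OF ccD(1)[OF assms(1)] assms(5)]
by (simp add: prs_def)

text \<open>Puts the last filling step into the shape of the generators of \<open>U(M;b)\<close> and
  of the closure axiom for relations: a scalar multiple if \<open>F = S\<close>, otherwise a glueing
  with the relation as first argument, obtained by symmetry.\<close>

lemma ins_U:
 assumes q: "ty c S {F} q" and F: "blob d M MM F" "good F" and u: "u : U F (c F)" and cF: "c F : Fld C d (sub (bnd F))"
 shows "F = S ==> EX a:cr R. snd (ins q (F, Field u)) = Field (a \<odot>\<^bsub>Fmod C (sub S) (c S)\<^esub> u)"
and "F ~= S ==> EX rr:cr (Fmod C (sub (hole S {F})) (Glue C d (sub (bnd S Un bnd F)) (bnd S) (bnd F) (c S) (c F))).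
 snd q = Field rr & snd (ins q (F, Field u)) = Field (Glue C (Suc d) (sub S) F (hole S {F}) u rr)"
proof -
 have dF: "decor c {F}" using cF by (simp add: decor_def)
 have uF: "u : cr (Fmod C (sub F) (c F))" using submodule_subset[OF U_sub[OF F(1) cF]] u by blast
 have oF: "ok c F {}" using F(2) dF by (simp add: ok_def region_empty)
 have tF: "ty c F {} (F, Field u)" unfolding ty_def using oF uF PM_empty[OF F(2) dF] by simp
 obtain T r where qe: "q = (T, r)" by force
 show "EX a:cr R. snd (ins q (F, Field u)) = Field (a \<odot>\<^bsub>Fmod C (sub S) (c S)\<^esub> u)" if FS: "F = S"
 proof -
 obtain a where a: "r = Degen a (c S)" "a : cr R" using q FS unfolding qe ty_def PM_def by (auto simp: degen_simps)
 have "snd (ins q (F, Field u)) = a \<odot>\<^bsub>PM c F {}\<^esub> Field u"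
using smult_PM[OF oF, of "Field u" a] tyD(3)[OF tF] by (simp add: qe a ins_simps scl_def)
 thus ?thesis using a uF FS PM_empty[OF F(2) dF] by auto
 qed
 assume FS: "F ~= S"
 then obtain rr where rr: "r = Field rr" "rr : cr (FM c S {F})" using q unfolding qe ty_def PM_def by auto
 note Q = q[unfolded qe rr(1)]
 note rg = ty_FieldD(1)[OF Q]
 have T: "T = hole S {F}" by (rule ty_FieldD(2)[OF Q])
 have "T Un F = S" using region_insert(2)[OF rg singletonI region_empty[OF F(2)]] T by simp
 moreover note glue_ty(2)[OF Q singletonI tF]
 moreover have "FM c S {F} = Fmod C (sub (hole S {F})) (Glue C d (sub (bnd S Un bnd F)) (bnd S) (bnd F) (c S) (c F))"
using bfield_Glue[OF rg okD(4)[OF tyD(1)[OF q]], of "c F"] cF Res_singleton[OF F(2) cF] by (simp add: FM_def bnds_sing)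
 ultimately show "EX rr:cr (Fmod C (sub (hole S {F})) (Glue C d (sub (bnd S Un bnd F)) (bnd S) (bnd F) (c S) (c F))).
 snd q = Field rr & snd (ins q (F, Field u)) = Field (Glue C (Suc d) (sub S) F (hole S {F}) u rr)"
using rr by (auto simp: qe ins_simps T)
qed

text \<open>The delicate case is that no blob of \<open>Y\<close> is left in \<open>E\<close>, where
  the result must be a local relation. If \<open>E\<close> contains no blob of \<open>X\<close>
  either, then \<open>r\<close> already is one. Otherwise one blob \<open>F\<close> of
  \<open>X\<close> is enough: the rest is absorbed into a field around it, and the closure axiom
  applies to the relation in \<open>F\<close>.\<close>

lemma filla_ff:
 assumes XY: "cc W X" "cc X Y" and c: "compat c W" "compat c X" "compat c Y" and E: "E : blobs W" and r: "r : cr (ff W X E)" and x: "x : fam X Y"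
 shows "filla E (inside X E) Y r x : cr (ff W Y E)"
proof -
 note o = ok_inside[OF XY(1) E c(1,2)] and WY = cc_trans[OF XY]
 have D: "inside X E \<subseteq> blobs X" by (auto simp: inside_def)
 have rP: "r : cr (PM c E (inside X E))" using r ffD(2)[OF XY(1) E c(1,2)] by blast
 have UN: "\<Union>(inside Y ` inside X E) = inside Y E" by (rule inside_UN(1)[OF XY E])
 show ?thesis
 proof (cases "inside Y E = {}")
 case False
 thus ?thesis using filla_ty(3)[OF XY(2) c(2,3) o D x rP] ff_eq[OF WY E c(1,3)] UN by simp
 next
 case True
 have f: "cr (ff W Y E) = Field ` U E (c E)" using ff_eq[OF WY E c(1,3)] True by simp
 show ?thesis
 proof (cases "inside X E = {}")
 case 1: True
 thus ?thesis using r ff_eq[OF XY(1) E c(1,2)] f by (simp add: filla_def Fill_empty)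
 next
 case False
 then obtain F where F: "F : inside X E" by blast
 have e: "inside Y G = {}" if "G : inside X E" for G using UN True that by blast
 obtain q where q: "ty c E {F} q" "filla E (inside X E) Y r x = snd (ins q (F, x F))"
using filla_last[OF XY(2) c(2,3) o D x rP F e] by blast
 have FX: "F : blobs X" using F D by blast
 obtain u where u: "x F = Field u" "u : U F (c F)" using fam_mem[OF x FX] ff_eq[OF XY(2) FX c(2,3)] e[OF F] by auto
 have bF: "blob d M MM F" "good F" using decD(4,8)[OF ccD(1)[OF XY(2)] FX] by auto
 have bE: "blob d M MM E" "good E" using decD(4,8)[OF ccD(1)[OF XY(1)] E] by auto
 have cF: "c F : Fld C d (sub (bnd F))" and cE: "c E : Fld C d (sub (bnd E))" using okD(4)[OF o] F by (auto simp: decor_def)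
 show ?thesis
 proof (cases "F = E")
 case FE: True
 obtain a where "a : cr R" "snd (ins q (F, Field u)) = Field (a \<odot>\<^bsub>Fmod C (sub E) (c E)\<^esub> u)" using ins_U(1)[OF q(1) bF u(2) cF FE] by blast
 thus ?thesis using submodule_smult[OF U_sub[OF bE(1) cE]] u FE q(2) f by auto
 next
 case FE: False
 obtain rr where rr: "rr : cr (Fmod C (sub (hole E {F})) (Glue C d (sub (bnd E Un bnd F)) (bnd E) (bnd F) (c E) (c F)))"
 "snd (ins q (F, Field u)) = Field (Glue C (Suc d) (sub E) F (hole E {F}) u rr)" using ins_U(2)[OF q(1) bF u(2) cF FE] by blast
 have "F \<subseteq> E - bnd E" using inside_nested[OF XY(1) E F] FE pblob_subset unfolding nested_def by blast
 hence "Glue C (Suc d) (sub E) F (hole E {F}) u rr : U E (c E)"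
using relations rr(1) bE(1) bF(1) cE cF u(2) unfolding local_relations_def by blast
 thus ?thesis using rr(2) u(1) q(2) f by simp
 qed
 qed
 qed
qed

lemma Mv_PM:
 assumes "tpc X" "compat c X" "c MM = b" shows "Mv X = PM c MM (blobs X)"
proof (cases "X = Empty")
 case True
 thus ?thesis using PM_empty[OF good_top, of c] okD(4)[OF ok_top[OF assms]] assms(3) by (simp add: M_val_def)
next
 case False
 thus ?thesis
using cut_fields_PM[OF tpcD(1)[OF assms(1)] assms(2) order_refl decD(9)[OF tpcD(1)[OF assms(1)] False] ok_top[OF assms]] assms(3) by (simp add: M_val_def)
qed

end

section \<open>The operad and the module of fields\<close>

lemma spans_carrier: "rmod R A ==> spans R A ((%r. r) ` cr A)"
by (auto simp: spans_def)

lemma trilinear_eqI: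
 assumes A: "rmod R A" and B: "rmod R B" and D: "rmod R D" and K: "rmod R K"
and S: "spans R A S" "spans R B S'" "spans R D S''"
and f: "!!y z. y : cr B ==> z : cr D ==> mlinear R A K (%x. f x y z)"
 "!!x z. x : cr A ==> z : cr D ==> mlinear R B K (%y. f x y z)"
 "!!x y. x : cr A ==> y : cr B ==> mlinear R D K (%z. f x y z)"
and g: "!!y z. y : cr B ==> z : cr D ==> mlinear R A K (%x. g x y z)"
 "!!x z. x : cr A ==> z : cr D ==> mlinear R B K (%y. g x y z)"
 "!!x y. x : cr A ==> y : cr B ==> mlinear R D K (%z. g x y z)"
and eq: "!!x y z. x : S ==> y : S' ==> z : S'' ==> f x y z = g x y z"
and x: "x : cr A" and y: "y : cr B" and z: "z : cr D"
 shows "f x y z = g x y z"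
proof -
 note s = subsetD[OF spans_subset[OF S(1)]] subsetD[OF spans_subset[OF S(2)]]
 have 1: "f x y z = g x y z" if "x : S" "y : S'" "z : cr D" for x y z
by (rule spans_eqI[OF D K S(3) f(3)[OF s(1)[OF that(1)] s(2)[OF that(2)]] g(3)[OF s(1)[OF that(1)] s(2)[OF that(2)]] eq[OF that(1,2)] that(3)])
 have 2: "f x y z = g x y z" if "x : S" "y : cr B" "z : cr D" for x y z
by (rule spans_eqI[OF B K S(2) f(2)[OF s(1)[OF that(1)] that(3)] g(2)[OF s(1)[OF that(1)] that(3)] 1[OF that(1) _ that(3)] that(2)])
 show ?thesis
by (rule spans_eqI[OF A K S(1) f(1)[OF y z] g(1)[OF y z] 2[OF _ y z] x])
qed

context blob_theory
begin

abbreviation "FT == field_tensor d R M C U"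
abbreviation "FP == field_pure d R M C U"
abbreviation "G == %X0 X1 X2. Gam (F_bar d R M C U) (X0, X1, X2)"
abbreviation "N == %X1 X2. Act (M_bar d R M C U b) (X1, X2)"

text \<open>Four configurations are what associativity requires; shorter chains are obtained by
  repeating entries.\<close>

lemma chain_compat:
 assumes "cc W X" "cc X Y" "cc Y Z"
 obtains c where "compat c W" "compat c X" "compat c Y" "compat c Z" "tpc W ==> c MM = b"
proof -
 have r: "cc W W" "cc X X" "cc Y Y" "cc Z Z" using cc_refl ccD(1)[OF assms(1)] ccD(1,2)[OF assms(2)] ccD(2)[OF assms(3)] by auto
 note t = cc_trans[OF assms(1,2)] cc_trans[OF assms(2,3)] cc_trans[OF cc_trans[OF assms(1,2)] assms(3)]
 obtain c where c: "!!V. V : {W, X, Y, Z} ==> compat c V" "(!!V. V : {W, X, Y, Z} ==> tpc V) ==> c MM = b"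
using compat_ex[of "{W, X, Y, Z}"] assms r t by blast
 have top: "c MM = b" if "tpc W"
by (rule c(2)) (use that tpc_down[OF that assms(1)] tpc_down[OF that t(1)] tpc_down[OF that t(3)] in auto)
 show thesis by (rule that[OF c(1) c(1) c(1) c(1) top]) simp_all
qed

lemma ff_mod: "cc X' X ==> E : blobs X' ==> rmod R (ff X' X E)"
proof -
 assume X: "cc X' X" and E: "E : blobs X'"
 obtain c where "compat c X'" "compat c X" using chain_compat[OF cc_refl[OF ccD(1)[OF X]] cc_refl[OF ccD(1)[OF X]] X] by blast
 thus ?thesis using ffD(1)[OF X E] by blast
qed

lemma fam_PiE: "fam X' X = Pi\<^sub>E (blobs X') (%E. cr (ff X' X E))"
by (simp add: field_families_def)

lemma FT_facts:
 assumes "cc X' X"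
 shows "rmod R (FT X' X)" "x : fam X' X ==> FP X' X x : cr (FT X' X)" "spans R (FT X' X) (FP X' X ` fam X' X)"
 "multilin R (blobs X') (ff X' X) (FT X' X) (FP X' X)"
 "rmod R B ==> multilin R (blobs X') (ff X' X) B v ==> EX h. mlinear R (FT X' X) B h & (ALL x:fam X' X. h (FP X' X x) = v x)"
proof -
 note m = ff_mod[OF assms]
 show "rmod R (FT X' X)" unfolding field_tensor_def by (rule module_tensor[OF cring_R m])
 show "x : fam X' X ==> FP X' X x : cr (FT X' X)" unfolding field_tensor_def field_pure_def fam_PiE by (rule pure_tensor_closed[OF cring_R m])
 show "spans R (FT X' X) (FP X' X ` fam X' X)" unfolding field_tensor_def field_pure_def fam_PiE by (rule spans_tensor[OF cring_R m])
 show "multilin R (blobs X') (ff X' X) (FT X' X) (FP X' X)" unfolding field_tensor_def field_pure_def by (rule multilin_pure_tensor[OF cring_R m])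
 show "EX h. mlinear R (FT X' X) B h & (ALL x:fam X' X. h (FP X' X x) = v x)" if B: "rmod R B" and v: "multilin R (blobs X') (ff X' X) B v"
using tensor_lift[OF cring_R m B v] unfolding field_tensor_def field_pure_def fam_PiE by metis
qed

definition merge :: "('p, 'f) dconf => ('p, 'f) dconf => ('p, 'f) dconf => ('p set => ('f, 'r) gfield) => ('p set => ('f, 'r) gfield) => 'p set => ('f, 'r) gfield" where
 "merge W X Y r x = (\<lambda>E\<in>blobs W. filla E (inside X E) Y (r E) x)"

lemma merge_fam:
 assumes "cc W X" "cc X Y" "r : fam W X" "x : fam X Y" shows "merge W X Y r x : fam W Y"
proof -
 obtain c where c: "compat c W" "compat c X" "compat c Y" using chain_compat[OF cc_refl[OF ccD(1)[OF assms(1)]] assms(1,2)] by blast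
 show ?thesis unfolding fam_PiE merge_def using filla_ff[OF assms(1,2) c _ fam_mem[OF assms(3)] assms(4)] by auto
qed

lemma fam_upd: "x : fam X' X ==> E : blobs X' ==> u : cr (ff X' X E) ==> x(E := u) : fam X' X"
unfolding fam_PiE by (auto simp: PiE_iff extensional_def)

lemma inside_sub: "inside X E \<subseteq> blobs X"
by (auto simp: inside_def)

lemma finite_inside: "dec X ==> finite (inside X E)"
using finite_subset[OF inside_sub decD(1)] .

text \<open>Changing \<open>r\<close> at \<open>E\<close> affects only the factor of
  \<open>E\<close>. Changing \<open>x\<close> at \<open>k\<close> affects only the factor of the
  blob \<open>j\<close> around \<open>k\<close>, which is unique by disjointness. As factors may be
  modules of relations, \<open>filla_ff\<close> is needed besides linearity.\<close>

lemma merge_multilin: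
 assumes WX: "cc W X" and XY: "cc X Y" and v: "multilin R (blobs W) (ff W Y) K v"
 shows "x : fam X Y ==> multilin R (blobs W) (ff W X) K (%r. v (merge W X Y r x))"
and "r : fam W X ==> multilin R (blobs X) (ff X Y) K (%x. v (merge W X Y r x))"
proof -
 note WY = cc_trans[OF WX XY]
 obtain c where c: "compat c W" "compat c X" "compat c Y" using chain_compat[OF cc_refl[OF ccD(1)[OF WX]] WX XY] by blast
 show "multilin R (blobs W) (ff W X) K (%r. v (merge W X Y r x))" if x: "x : fam X Y"
 proof (rule multilin_reindex[OF v])
 fix r assume "r : Pi\<^sub>E (blobs W) (%i. cr (ff W X i))"
 hence r: "r : fam W X" by (simp add: fam_PiE)
 show "merge W X Y r x : Pi\<^sub>E (blobs W) (%j. cr (ff W Y j))" using merge_fam[OF WX XY r x] by (simp add: fam_PiE)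
 fix k assume k: "k : blobs W"
 have lin: "mlinear R (ff W X k) (ff W Y k) (%u. filla k (inside X k) Y u x)"
 proof (rule ffD(3)[OF WY k c(1,3)])
 show "mlinear R (ff W X k) (PM c k (inside Y k)) (%u. filla k (inside X k) Y u x)"
using ffD(4)[OF WX k c(1,2) filla_linear[OF XY c(2,3) ok_inside[OF WX k c(1,2)] inside_sub x]] inside_UN(1)[OF WX XY k] by simp
 show "filla k (inside X k) Y u x : cr (ff W Y k)" if "u : cr (ff W X k)" for u
by (rule filla_ff[OF WX XY c k that x])
 qed
 have eq: "merge W X Y (r(k := u)) x = (merge W X Y r x)(k := filla k (inside X k) Y u x)" for u
using k by (auto simp: merge_def fun_eq_iff restrict_def)
 show "EX j:blobs W. EX l. mlinear R (ff W X k) (ff W Y j) l & (ALL u:cr (ff W X k). merge W X Y (r(k := u)) x = (merge W X Y r x)(j := l u))"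
by (rule bexI[OF _ k], rule exI, rule conjI, rule lin, rule ballI, rule eq)
 qed (rule ff_mod[OF WX])
 show "multilin R (blobs X) (ff X Y) K (%x. v (merge W X Y r x))" if r: "r : fam W X"
 proof (rule multilin_reindex[OF v])
 fix x assume "x : Pi\<^sub>E (blobs X) (%i. cr (ff X Y i))"
 hence x: "x : fam X Y" by (simp add: fam_PiE)
 show "merge W X Y r x : Pi\<^sub>E (blobs W) (%j. cr (ff W Y j))" using merge_fam[OF WX XY r x] by (simp add: fam_PiE)
 fix k assume k: "k : blobs X"
 obtain j where j: "j : blobs W" "k \<subseteq> j" using ccD(3)[OF WX k] nested_subset by blast
 have kj: "k : inside X j" using k j by (simp add: inside_def)
 have rj: "r j : cr (PM c j (inside X j))" using fam_mem[OF r j(1)] ffD(2)[OF WX j(1) c(1,2)] by blast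
 have lin: "mlinear R (ff X Y k) (ff W Y j) (%u. filla j (inside X j) Y (r j) (x(k := u)))"
 proof (rule ffD(3)[OF WY j(1) c(1,3)])
 show "mlinear R (ff X Y k) (PM c j (inside Y j)) (%u. filla j (inside X j) Y (r j) (x(k := u)))"
using filla_linear_arg[OF XY c(2,3) ok_inside[OF WX j(1) c(1,2)] inside_sub x rj kj] inside_UN(1)[OF WX XY j(1)] by simp
 show "filla j (inside X j) Y (r j) (x(k := u)) : cr (ff W Y j)" if "u : cr (ff X Y k)" for u
by (rule filla_ff[OF WX XY c j(1) fam_mem[OF r j(1)] fam_upd[OF x k that]])
 qed
 have eq: "merge W X Y r (x(k := u)) = (merge W X Y r x)(j := filla j (inside X j) Y (r j) (x(k := u)))" for u
 proof
 fix E
 show "merge W X Y r (x(k := u)) E = ((merge W X Y r x)(j := filla j (inside X j) Y (r j) (x(k := u)))) E"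
 proof (cases "E : blobs W & E ~= j")
 case True
 have "k ~: inside X E"
using in_unique[OF ccD(1)[OF WX], of E j k] True j decD(5)[OF ccD(2)[OF WX] k] by (auto simp: inside_def)
 hence "filla E (inside X E) Y (r E) (x(k := u)) = filla E (inside X E) Y (r E) x"
by (intro filla_cong finite_inside[OF ccD(2)[OF WX]]) auto
 thus ?thesis using True by (simp add: merge_def)
 next
 case False
 thus ?thesis by (cases "E = j") (use j(1) in "simp_all add: merge_def")
 qed
 qed
 show "EX j:blobs W. EX l. mlinear R (ff X Y k) (ff W Y j) l & (ALL u:cr (ff X Y k). merge W X Y r (x(k := u)) = (merge W X Y r x)(j := l u))"
by (rule bexI[OF _ j(1)], rule exI, rule conjI, rule lin, rule ballI, rule eq)
 qed (rule ff_mod[OF XY])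
qed

text \<open>The description defining \<open>Gam\<close> is justified by multilinearity of
  \<open>merge\<close> in each argument, which lets the values on pure tensors extend linearly in
  that variable.\<close>

lemma G_facts:
 assumes WX: "cc W X" and XY: "cc X Y"
 shows "mbilinear R (FT W X) (FT X Y) (FT W Y) (G W X Y)"
and "r : fam W X ==> x : fam X Y ==> G W X Y (FP W X r) (FP X Y x) = FP W Y (merge W X Y r x)"
proof -
 note WY = cc_trans[OF WX XY]
 note m = FT_facts(1)[OF WX] FT_facts(1)[OF XY] FT_facts(1)[OF WY] FT_facts(3)[OF WX] FT_facts(3)[OF XY]
 have G: "G W X Y = bilinear_ext R (FT W X) (FT X Y) (FT W Y) (fam W X) (FP W X) (fam X Y) (FP X Y) (%r x. FP W Y (merge W X Y r x))"
by (simp add: F_bar_def merge_def)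
 note be = bilinear_ext[OF m, where v = "%r x. FP W Y (merge W X Y r x)",
 OF FT_facts(5)[OF WX m(3) merge_multilin(1)[OF WX XY FT_facts(4)[OF WY]]] FT_facts(5)[OF XY m(3) merge_multilin(2)[OF WX XY FT_facts(4)[OF WY]]]]
 show "mbilinear R (FT W X) (FT X Y) (FT W Y) (G W X Y)" unfolding G by (rule be(1))
 show "r : fam W X ==> x : fam X Y ==> G W X Y (FP W X r) (FP X Y x) = FP W Y (merge W X Y r x)" unfolding G by (rule be(2))
qed

lemma G_assoc:
 assumes WX: "cc W X" and XY: "cc X Y" and YZ: "cc Y Z"
and x: "x : cr (FT W X)" and y: "y : cr (FT X Y)" and z: "z : cr (FT Y Z)"
 shows "G W X Z x (G X Y Z y z) = G W Y Z (G W X Y x y) z"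
proof -
 note WY = cc_trans[OF WX XY] and XZ = cc_trans[OF XY YZ] and WZ = cc_trans[OF WX cc_trans[OF XY YZ]]
 obtain c where c: "compat c W" "compat c X" "compat c Y" "compat c Z" using chain_compat[OF WX XY YZ] by blast
 note b1 = G_facts(1)[OF WX XZ] and b2 = G_facts(1)[OF XY YZ] and b3 = G_facts(1)[OF WY YZ] and b4 = G_facts(1)[OF WX XY]
 have p: "G W X Z (FP W X r) (G X Y Z (FP X Y s) (FP Y Z t)) = G W Y Z (G W X Y (FP W X r) (FP X Y s)) (FP Y Z t)"
 if r: "r : fam W X" and s: "s : fam X Y" and t: "t : fam Y Z" for r s t
 proof -
 have "filla E (inside X E) Z (r E) (merge X Y Z s t) = filla E (inside Y E) Z (merge W X Y r s E) t" if E: "E : blobs W" for E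
using filla_assoc[OF XY c(2,3) ok_inside[OF WX E c(1,2)] inside_sub YZ c(4) s t, of "r E"]
 fam_mem[OF r E] ffD(2)[OF WX E c(1,2)] inside_UN(1)[OF WX XY E] E by (auto simp: merge_def)
 hence "merge W X Z r (merge X Y Z s t) = merge W Y Z (merge W X Y r s) t"
unfolding merge_def[of W X Z] merge_def[of W Y Z] by (auto simp: fun_eq_iff restrict_def)
 thus ?thesis
using r s t merge_fam[OF XY YZ s t] merge_fam[OF WX XY r s]
by (simp add: G_facts(2)[OF XY YZ] G_facts(2)[OF WX XZ] G_facts(2)[OF WX XY] G_facts(2)[OF WY YZ])
 qed
 note cl2 = lin_in[OF bilinD(1)[OF b2]] and cl4 = lin_in[OF bilinD(1)[OF b4]]
 show ?thesis
by (rule trilinear_eqI[OF FT_facts(1)[OF WX] FT_facts(1)[OF XY] FT_facts(1)[OF YZ] FT_facts(1)[OF WZ]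
 FT_facts(3)[OF WX] FT_facts(3)[OF XY] FT_facts(3)[OF YZ], where f = "%x y z. G W X Z x (G X Y Z y z)" and g = "%x y z. G W Y Z (G W X Y x y) z"])
 (use x y z p cl2 cl4 in "auto intro: bilinD(2)[OF b1] bilinD(1)[OF b3] lin_comp[OF bilinD(2)[OF b2] bilinD(1)[OF b1]]
 lin_comp[OF bilinD(1)[OF b2] bilinD(1)[OF b1]] lin_comp[OF bilinD(2)[OF b4] bilinD(2)[OF b3]]
 lin_comp[OF bilinD(1)[OF b4] bilinD(2)[OF b3]]")
qed

definition un :: "('p, 'f) dconf => 'p set => ('f, 'r) gfield" where
 "un X = (\<lambda>E\<in>blobs X. Degen \<one>\<^bsub>R\<^esub> (dco X (bnd E)))"

lemma un_fam:
 assumes X: "dec X" shows "un X : fam X X"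
proof -
 obtain c where c: "compat c X" using chain_compat[OF cc_refl[OF X] cc_refl[OF X] cc_refl[OF X]] by blast
 have "Degen \<one>\<^bsub>R\<^esub> (dco X (bnd E)) : cr (ff X X E)" if E: "E : blobs X" for E
using ff_eq[OF cc_refl[OF X] E c c] inside_self[OF X E] c E cring.axioms(1)[OF cring_R]
by (simp add: PM_def degen_simps compat_def ring.ring_simprules(6))
 thus ?thesis by (simp add: fam_PiE un_def)
qed

lemma G_units:
 assumes XY: "cc X Y"
 shows "x : cr (FT X Y) ==> G X X Y (FP X X (un X)) x = x" and "x : cr (FT X Y) ==> G X Y Y x (FP Y Y (un Y)) = x"
proof -
 note X = ccD(1)[OF XY] and Y = ccD(2)[OF XY]
 obtain c where c: "compat c X" "compat c Y" using chain_compat[OF cc_refl[OF X] cc_refl[OF X] XY] by blast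
 note rX = cc_refl[OF X] and rY = cc_refl[OF Y]
 note m = FT_facts(1)[OF XY] and sp = FT_facts(3)[OF XY]
 show "G X X Y (FP X X (un X)) x = x" if x: "x : cr (FT X Y)"
 proof (rule spans_eqI[OF m m sp bilinD(1)[OF G_facts(1)[OF rX XY] FT_facts(2)[OF rX un_fam[OF X]]] lin_id _ x])
 fix t assume "t : FP X Y ` fam X Y"
 then obtain s where s: "t = FP X Y s" "s : fam X Y" by blast
 have "filla E (inside X E) Y (un X E) s = s E" if E: "E : blobs X" for E
using filla_unit_left[OF XY c s(2) E] E by (simp add: un_def)
 hence "merge X X Y (un X) s = s" using s(2) by (auto simp: merge_def fun_eq_iff fam_PiE PiE_iff extensional_def restrict_def)
 thus "G X X Y (FP X X (un X)) t = t" using G_facts(2)[OF rX XY un_fam[OF X] s(2)] s(1) by simp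
 qed
 show "G X Y Y x (FP Y Y (un Y)) = x" if x: "x : cr (FT X Y)"
 proof (rule spans_eqI[OF m m sp bilinD(2)[OF G_facts(1)[OF XY rY] FT_facts(2)[OF rY un_fam[OF Y]]] lin_id _ x])
 fix t assume "t : FP X Y ` fam X Y"
 then obtain s where s: "t = FP X Y s" "s : fam X Y" by blast
 have "filla E (inside Y E) Y (s E) (un Y) = s E" if E: "E : blobs X" for E
using filla_unit_right[OF Y c(2) ok_inside[OF XY E c] inside_sub, of "s E"] fam_mem[OF s(2) E] ffD(2)[OF XY E c] by (auto simp: un_def)
 hence "merge X Y Y s (un Y) = s" using s(2) by (auto simp: merge_def fun_eq_iff fam_PiE PiE_iff extensional_def restrict_def)
 thus "G X Y Y t (FP Y Y (un Y)) = t" using G_facts(2)[OF XY rY s(2) un_fam[OF Y]] s(1) by simp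
 qed
qed

lemma Mv_mod: "tpc X ==> rmod R (Mv X)"
proof -
 assume X: "tpc X"
 note r = cc_refl[OF tpcD(1)[OF X]]
 obtain c where c: "compat c X" "c MM = b" using chain_compat[OF r r r] X by blast
 show ?thesis unfolding Mv_PM[OF X c] by (rule module_PM[OF ok_top[OF X c]])
qed

text \<open>The module variable is not a tensor product: all its elements serve as generators, and
  linearity in it comes from \<open>filla_linear\<close>.\<close>

lemma N_facts:
 assumes tX: "tpc X" and XY: "cc X Y"
 shows "mbilinear R (Mv X) (FT X Y) (Mv Y) (N X Y)"
and "r : cr (Mv X) ==> x : fam X Y ==> N X Y r (FP X Y x) = filla MM (blobs X) Y r x"
and "r : cr (Mv X) ==> x : fam X Y ==> filla MM (blobs X) Y r x : cr (Mv Y)"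
proof -
 note r = cc_refl[OF tpcD(1)[OF tX]] and tY = tpc_down[OF tX XY]
 obtain c where c: "compat c X" "compat c Y" "c MM = b" using chain_compat[OF r r XY] tX by blast
 note o = ok_top[OF tX c(1,3)] and PX = Mv_PM[OF tX c(1,3)] and PY = Mv_PM[OF tY c(2,3)]
 note UN = inside_UN(2)[OF r XY]
 note fx = filla_linear[OF XY c(1,2) o order_refl, unfolded UN, folded PX PY]
 note fr = filla_linear_arg[OF XY c(1,2) o order_refl, unfolded UN, folded PX PY]
 note cl = filla_ty(3)[OF XY c(1,2) o order_refl, unfolded UN, folded PX PY]
 show "r : cr (Mv X) ==> x : fam X Y ==> filla MM (blobs X) Y r x : cr (Mv Y)" by (rule cl)
 have ml: "multilin R (blobs X) (ff X Y) (Mv Y) (%x. filla MM (blobs X) Y r x)" if "r : cr (Mv X)" for r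
unfolding multilin_def fam_PiE[symmetric] using cl[OF _ that] fr[OF _ that] by blast
 have N: "N X Y = bilinear_ext R (Mv X) (FT X Y) (Mv Y) (cr (Mv X)) (%r. r) (fam X Y) (FP X Y) (%r x. filla MM (blobs X) Y r x)"
by (simp add: M_bar_def)
 have l: "EX ph. mlinear R (Mv X) (Mv Y) ph & (ALL g:cr (Mv X). ph g = filla MM (blobs X) Y g h)" if "h : fam X Y" for h
using fx[OF that] by blast
 note be = bilinear_ext[OF Mv_mod[OF tX] FT_facts(1)[OF XY] Mv_mod[OF tY] spans_carrier[OF Mv_mod[OF tX]] FT_facts(3)[OF XY],
 where v = "%r x. filla MM (blobs X) Y r x", OF l FT_facts(5)[OF XY Mv_mod[OF tY] ml]]
 show "mbilinear R (Mv X) (FT X Y) (Mv Y) (N X Y)" unfolding N by (rule be(1))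
 show "r : cr (Mv X) ==> x : fam X Y ==> N X Y r (FP X Y x) = filla MM (blobs X) Y r x" unfolding N by (rule be(2))
qed

lemma N_assoc:
 assumes tX: "tpc X" and XY: "cc X Y" and YZ: "cc Y Z"
and x: "x : cr (Mv X)" and y: "y : cr (FT X Y)" and z: "z : cr (FT Y Z)"
 shows "N X Z x (G X Y Z y z) = N Y Z (N X Y x y) z"
proof -
 note r = cc_refl[OF tpcD(1)[OF tX]] and tY = tpc_down[OF tX XY] and XZ = cc_trans[OF XY YZ]
 note tZ = tpc_down[OF tX XZ]
 obtain c where c: "compat c X" "compat c Y" "compat c Z" "c MM = b" using chain_compat[OF r XY YZ] tX by blast
 note o = ok_top[OF tX c(1,4)] and PX = Mv_PM[OF tX c(1,4)]
 note b1 = N_facts(1)[OF tX XZ] and b2 = G_facts(1)[OF XY YZ] and b3 = N_facts(1)[OF tY YZ] and b4 = N_facts(1)[OF tX XY]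
 have p: "N X Z r (G X Y Z (FP X Y s) (FP Y Z t)) = N Y Z (N X Y r (FP X Y s)) (FP Y Z t)"
 if r: "r : cr (Mv X)" and s: "s : fam X Y" and t: "t : fam Y Z" for r s t
using filla_assoc[OF XY c(1,2) o order_refl YZ c(3) s t, of r] r s t merge_fam[OF XY YZ s t] N_facts(3)[OF tX XY r s]
 inside_UN(2)[OF \<open>cc X X\<close> XY]
by (simp add: G_facts(2)[OF XY YZ] N_facts(2)[OF tX XZ] N_facts(2)[OF tX XY] N_facts(2)[OF tY YZ] PX merge_def)
 note cl2 = lin_in[OF bilinD(1)[OF b2]] and cl4 = lin_in[OF bilinD(1)[OF b4]]
 show ?thesis
by (rule trilinear_eqI[OF Mv_mod[OF tX] FT_facts(1)[OF XY] FT_facts(1)[OF YZ] Mv_mod[OF tZ]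
 spans_carrier[OF Mv_mod[OF tX]] FT_facts(3)[OF XY] FT_facts(3)[OF YZ], where f = "%x y z. N X Z x (G X Y Z y z)" and g = "%x y z. N Y Z (N X Y x y) z"])
 (use x y z p cl2 cl4 in "auto intro: bilinD(2)[OF b1] bilinD(1)[OF b3] lin_comp[OF bilinD(2)[OF b2] bilinD(1)[OF b1]]
 lin_comp[OF bilinD(1)[OF b2] bilinD(1)[OF b1]] lin_comp[OF bilinD(2)[OF b4] bilinD(2)[OF b3]]
 lin_comp[OF bilinD(1)[OF b4] bilinD(2)[OF b3]]")
qed

lemma N_unit:
 assumes tX: "tpc X" and x: "x : cr (Mv X)" shows "N X X x (FP X X (un X)) = x"
proof -
 note X = tpcD(1)[OF tX] and r = cc_refl[OF tpcD(1)[OF tX]]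
 obtain c where c: "compat c X" "c MM = b" using chain_compat[OF r r r] tX by blast
 show ?thesis
using filla_unit_right[OF X c(1) ok_top[OF tX c] order_refl, of x] N_facts(2)[OF tX r x un_fam[OF X]] x
by (simp add: Mv_PM[OF tX c] un_def)
qed

lemma cat_eqs: "Blob_bar d M C = pre_cat cc" "Mdl_bar d M C b = pre_mod cc tpc"
by (simp_all add: Blob_bar_def pre_cat_def Mdl_bar_def pre_mod_def)

lemma cc_refls: "cc X Y ==> cc X X" "cc X Y ==> cc Y Y" "tpc X ==> cc X X"
using cc_refl ccD(1,2) tpcD(1) by blast+

lemma F_sel: "Val (F_bar d R M C U) (X', X) = FT X' X" "Unt (F_bar d R M C U) (X', X) = FP X' X' (un X')"
and M_sel: "MVal (M_bar d R M C U b) X = Mv X"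
by (simp_all add: F_bar_def M_bar_def un_def)

lemma pre_bar_fields: "pre_bar cc tpc R (F_bar d R M C U) (M_bar d R M C U b)"
proof -
 interpret L: left_operadic_module "pre_cat cc" "pre_mod cc tpc"
by (rule left_operadic_module_pre) (auto intro: cc_trans cc_refls tpc_down)
 have op: "unital_operad (pre_cat cc) R (F_bar d R M C U)"
 proof (intro unital_operad.intro unital_operad_axioms.intro, goal_cases)
 case 1 show ?case by (rule L.unary_operadic_category_axioms)
 next
 case (2 T) thus ?case by (cases T) (simp add: F_sel FT_facts(1))
 next
 case (3 h A B) thus ?case by - (clarsimp simp: F_sel, rule G_facts(1); assumption)
 next
 case (4 f A B g K x y z) thus ?case by - (clarsimp simp: F_sel, rule G_assoc; assumption)
 next
 case (5 T)
 then obtain X Y where T: "T = (X, Y)" "cc X Y" by (cases T) auto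
 thus ?case using FT_facts(2)[OF cc_refls(1) un_fam[OF ccD(1)], OF T(2) T(2)] by (simp add: F_sel)
 next
 case (6 T x) thus ?case by (cases T) (simp add: F_sel G_units(1))
 next
 case (7 f S T x) thus ?case by - (clarsimp simp: F_sel, rule G_units(2); assumption)
 qed
 have "unital_pmodule (pre_cat cc) (pre_mod cc tpc) R (F_bar d R M C U) (M_bar d R M C U b)"
 proof (intro unital_pmodule.intro unital_pmodule_axioms.intro, goal_cases)
 case 1 show ?case by (rule op)
 next
 case 2 show ?case by (rule L.left_operadic_module_axioms)
 next
 case (3 L) thus ?case by (simp add: M_sel Mv_mod)
 next
 case (4 a L S) thus ?case by - (clarsimp simp: F_sel M_sel, rule N_facts(1); assumption)
 next
 case (5 a L B g K x y z) thus ?case by - (clarsimp simp: F_sel M_sel, rule N_assoc; assumption)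
 next
 case (6 a L T x) thus ?case by - (clarsimp simp: F_sel M_sel, rule N_unit; assumption)
 qed
 thus ?thesis by (rule pre_bar.intro, intro pre_bar_axioms.intro) (auto intro: cring_R cc_trans cc_refls tpc_down)
qed

end

section \<open>The augmentation in degree zero\<close>

lemma module_iso_trans:
 assumes "module_iso R A B" "module_iso R B D" shows "module_iso R A D"
proof -
 obtain f g where f: "mlinear R A B f" "bij_betw f (cr A) (cr B)" and g: "mlinear R B D g" "bij_betw g (cr B) (cr D)"
using assms by (auto simp: module_iso_def)
 show ?thesis unfolding module_iso_def
using lin_comp[OF f(1) g(1)] bij_betw_trans[OF f(2) g(2)] by (auto simp: comp_def)
qed

lemma module_iso_untag:
 assumes "inj t" shows "module_iso R (tag_module t A) A"
unfolding module_iso_def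
proof (intro exI conjI)
 show "mlinear R (tag_module t A) A (inv_into UNIV t)" by (rule mlinear_untag[OF assms]) (simp add: assms)
 show "bij_betw (inv_into UNIV t) (cr (tag_module t A)) (cr A)"
by (rule bij_betw_byWitness[where f' = t]) (use assms in auto)
qed

text \<open>Degree zero involves one action per tower, so the statement is kept free of operad laws
  and applies directly to the restricted categories. The image is a span because pure tensors
  generate each summand and summands generate the direct sum.\<close>

lemma bar_aug_zero:
 fixes R :: "'r ring" and P :: "('o, 'm, 'r, 'v) operad" and N :: "('l, 'a, 'r, 'v, 'w) pmodule"
 assumes R: "cring R" and NL: "rmod R (MVal N L)"
and V: "!!t. t : towers Op Mo 0 L ==> rmod R (Val P (Tgt Mo (snd t)))"
and W: "!!t. t : towers Op Mo 0 L ==> rmod R (MVal N (MFib Mo (snd t)))"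
and act: "!!t. t : towers Op Mo 0 L ==> mbilinear R (MVal N (MFib Mo (snd t))) (Val P (Tgt Mo (snd t))) (MVal N L) (Act N (snd t))"
 defines "gens == {Act N (snd t) m p |t m p. t : towers Op Mo 0 L & m : cr (MVal N (MFib Mo (snd t))) & p : cr (Val P (Tgt Mo (snd t)))}"
 shows "rmod R (bar Op Mo R P N 0 L)"
and "mlinear R (bar Op Mo R P N 0 L) (MVal N L) (bar_aug Op Mo R P N L)"
and "bar_aug Op Mo R P N L ` cr (bar Op Mo R P N 0 L) = mspan R (MVal N L) gens"
proof -
 let ?T = "towers Op Mo 0 L" and ?f = "bar_factor Op Mo P N" and ?A = "bar_summand Op Mo R P N"
 let ?B = "bar Op Mo R P N 0 L" and ?v = "%t x. Act N (snd t) (projr (x (1::nat))) (projl (x 0))"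
 have f0: "?f t 0 = tag_module Inl (Val P (Tgt Mo (snd t)))" and f1: "?f t 1 = tag_module Inr (MVal N (MFib Mo (snd t)))"
and At: "?A t = tensor R {..1} (?f t)" if "t : ?T" for t
using that by (simp_all add: bar_factor_def level_def towers_def bar_summand_def)
 have i01: "{..1::nat} = {0, 1}" by auto
 have mf: "rmod R (?f t i)" if t: "t : ?T" and i: "i : {..1}" for t i
 proof -
 have "i = 0 \<or> i = 1" using i by auto
 thus ?thesis using f0[OF t] f1[OF t] module_tag[OF V[OF t], of Inl] module_tag[OF W[OF t], of Inr] by auto
 qed
 have mA: "rmod R (?A t)" if t: "t : ?T" for t unfolding At[OF t] by (rule module_tensor[OF R mf[OF t]])
 show mB: "rmod R ?B" unfolding bar_def by (rule module_direct_sum[OF R mA])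
 have mult: "multilin R {..1} (?f t) (MVal N L) (?v t)" if t: "t : ?T" for t
unfolding multilin_def
 proof (intro conjI ballI)
 fix x assume "x : (\<Pi>\<^sub>E i\<in>{..1}. cr (?f t i))"
 hence "x 0 : cr (?f t 0)" "x 1 : cr (?f t 1)" by (auto simp: PiE_iff)
 hence x: "projl (x 0) : cr (Val P (Tgt Mo (snd t)))" "projr (x 1) : cr (MVal N (MFib Mo (snd t)))"
unfolding f0[OF t] f1[OF t] by auto
 show "?v t x : cr (MVal N L)" by (rule lin_in[OF bilinD(1)[OF act[OF t] x(2)] x(1)])
 fix k :: nat assume "k : {..1}"
 hence "k = 0 \<or> k = 1" by auto
 thus "mlinear R (?f t k) (MVal N L) (%u. ?v t (x(k := u)))"
 proof
 assume k: "k = 0"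
 show ?thesis unfolding k f0[OF t] using mlinear_projl[OF bilinD(1)[OF act[OF t] x(2)]] by simp
 next
 assume k: "k = 1"
 show ?thesis unfolding k f1[OF t] using mlinear_projr[OF bilinD(2)[OF act[OF t] x(1)]] by simp
 qed
 qed
 have "ALL t:?T. EX h. mlinear R (?A t) (MVal N L) h & (ALL x:\<Pi>\<^sub>E i\<in>{..1}. cr (?f t i). h (pure_tensor R {..1} (?f t) x) = ?v t x)"
 proof
 fix t assume t: "t : ?T"
 show "EX h. mlinear R (?A t) (MVal N L) h & (ALL x:\<Pi>\<^sub>E i\<in>{..1}. cr (?f t i). h (pure_tensor R {..1} (?f t) x) = ?v t x)"
unfolding At[OF t]
 proof (rule tensor_lift[OF R mf[OF t] NL mult[OF t]])
 fix h assume a: "mlinear R (tensor R {..1} (?f t)) (MVal N L) h"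
and e: "!!x. x : (\<Pi>\<^sub>E i\<in>{..1}. cr (?f t i)) ==> h (pure_tensor R {..1} (?f t) x) = ?v t x"
 show "EX h. mlinear R (tensor R {..1} (?f t)) (MVal N L) h & (ALL x:\<Pi>\<^sub>E i\<in>{..1}. cr (?f t i). h (pure_tensor R {..1} (?f t) x) = ?v t x)"
by (rule exI, rule conjI, rule a, rule ballI, rule e)
 qed
 qed
 then obtain H where H: "!!t. t : ?T ==> mlinear R (?A t) (MVal N L) (H t)"
 "!!t x. t : ?T ==> x : (\<Pi>\<^sub>E i\<in>{..1}. cr (?f t i)) ==> H t (pure_tensor R {..1} (?f t) x) = ?v t x"
unfolding bchoice_iff by blast
 have "EX h. mlinear R ?B (MVal N L) h & (ALL t:?T. ALL u:cr (?A t). h (summand_incl ?T ?A t u) = H t u)"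
unfolding bar_def
 proof (rule direct_sum_lift[where I = ?T and A = ?A, OF R mA NL H(1)])
 fix h assume a: "mlinear R (direct_sum ?T ?A) (MVal N L) h"
and e: "!!t u. t : ?T ==> u : cr (?A t) ==> h (summand_incl ?T ?A t u) = H t u"
 show "EX h. mlinear R (direct_sum ?T ?A) (MVal N L) h & (ALL t:?T. ALL u:cr (?A t). h (summand_incl ?T ?A t u) = H t u)"
by (rule exI, rule conjI, rule a, intro ballI, rule e)
 qed
 then obtain h where h: "mlinear R ?B (MVal N L) h" "!!t u. t : ?T ==> u : cr (?A t) ==> h (summand_incl ?T ?A t u) = H t u"
by blast
 let ?gs = "bar_gens Op Mo P N 0 L" and ?g = "bar_gen Op Mo R P N 0 L"
 have gs: "?gs = (SIGMA t:?T. \<Pi>\<^sub>E i\<in>{..1}. cr (?f t i))" by (simp add: bar_gens_def)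
 have g: "?g (t, x) = summand_incl ?T ?A t (pure_tensor R {..1} (?f t) x)" for t x by (simp add: bar_gen_def)
 have sp: "spans R ?B (?g ` ?gs)"
 proof -
 have "spans R (direct_sum ?T ?A) (\<Union>t\<in>?T. summand_incl ?T ?A t ` (pure_tensor R {..1} (?f t) ` (\<Pi>\<^sub>E i\<in>{..1}. cr (?f t i))))"
 proof (rule spans_direct_sum[OF R mA])
 show "spans R (?A t) (pure_tensor R {..1} (?f t) ` (\<Pi>\<^sub>E i\<in>{..1}. cr (?f t i)))" if t: "t : ?T" for t
unfolding At[OF t] by (rule spans_tensor[OF R mf[OF t]])
 qed
 moreover have "(\<Union>t\<in>?T. summand_incl ?T ?A t ` (pure_tensor R {..1} (?f t) ` (\<Pi>\<^sub>E i\<in>{..1}. cr (?f t i)))) = ?g ` ?gs"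
 proof (rule subset_antisym; rule subsetI)
 fix z assume "z : (\<Union>t\<in>?T. summand_incl ?T ?A t ` (pure_tensor R {..1} (?f t) ` (\<Pi>\<^sub>E i\<in>{..1}. cr (?f t i))))"
 then obtain t x where tx: "t : ?T" "x : (\<Pi>\<^sub>E i\<in>{..1}. cr (?f t i))" "z = ?g (t, x)" unfolding g by blast
 have "(t, x) : ?gs" unfolding gs using tx by blast
 thus "z : ?g ` ?gs" using tx(3) by blast
 next
 fix z assume "z : ?g ` ?gs"
 then obtain t x where "t : ?T" "x : (\<Pi>\<^sub>E i\<in>{..1}. cr (?f t i))" "z = ?g (t, x)" unfolding gs by blast
 thus "z : (\<Union>t\<in>?T. summand_incl ?T ?A t ` (pure_tensor R {..1} (?f t) ` (\<Pi>\<^sub>E i\<in>{..1}. cr (?f t i))))"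
unfolding g by blast
 qed
 ultimately show ?thesis by (simp add: bar_def)
 qed
 let ?w = "%(t, x). ?v t x" and ?e = "bar_aug Op Mo R P N L"
 have hg: "h (?g y) = ?w y" if yg: "y : ?gs" for y
 proof -
 obtain t x where y: "y = (t, x)" "t : ?T" "x : (\<Pi>\<^sub>E i\<in>{..1}. cr (?f t i))" using yg unfolding gs by blast
 thus ?thesis using h(2)[OF y(2)] H(2)[OF y(2,3)] pure_tensor_closed[OF R mf[OF y(2)] y(3)] by (simp add: g At)
 qed
 note le = linear_ext[OF mB NL sp h(1), where v = ?w, OF hg]
 show lin: "mlinear R ?B (MVal N L) ?e" unfolding bar_aug_def by (rule le(1))
 have eg: "?e (?g (t, x)) = ?v t x" if "t : ?T" "x : (\<Pi>\<^sub>E i\<in>{..1}. cr (?f t i))" for t x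
unfolding bar_aug_def using le(2)[of "(t, x)"] that by (simp add: gs)
 have gc: "gens \<subseteq> cr (MVal N L)"
unfolding gens_def using lin_in[OF bilinD(1)[OF act]] by blast
 note sub = submodule_mspan[OF NL gc]
 show "?e ` cr ?B = mspan R (MVal N L) gens"
 proof
 have "?g y : {z : cr ?B. ?e z : mspan R (MVal N L) gens}" if y': "y : ?gs" for y
 proof -
 obtain t x where y: "y = (t, x)" "t : ?T" "x : (\<Pi>\<^sub>E i\<in>{..1}. cr (?f t i))" using y' unfolding gs by blast
 have "x 0 : cr (?f t 0)" "x 1 : cr (?f t 1)" using y(3) by (auto simp: PiE_iff)
 then obtain p m where pm: "x 0 = Inl p" "p : cr (Val P (Tgt Mo (snd t)))" "x 1 = Inr m" "m : cr (MVal N (MFib Mo (snd t)))"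
unfolding f0[OF y(2)] f1[OF y(2)] carrier_tag by blast
 have v: "?v t x = Act N (snd t) m p" using pm by simp
 have "?v t x : gens" unfolding v gens_def using y(2) pm by blast
 thus ?thesis using eg[OF y(2,3)] mspan_superset[of gens R "MVal N L"] subsetD[OF spans_subset[OF sp], of "?g y"] y' y(1) by auto
 qed
 hence "z : {z : cr ?B. ?e z : mspan R (MVal N L) gens}" if "z : cr ?B" for z
by (intro spansD[OF sp submodule_preimage[OF mB NL lin sub] _ that]) blast
 thus "?e ` cr ?B \<subseteq> mspan R (MVal N L) gens" by blast
 show "mspan R (MVal N L) gens \<subseteq> ?e ` cr ?B"
 proof (rule mspan_least[OF submodule_image[OF mB NL lin submodule_carrier[OF mB]]], rule subsetI)
 fix z assume "z : gens"
 then obtain t m p where z: "z = Act N (snd t) m p" "t : ?T" "m : cr (MVal N (MFib Mo (snd t)))" "p : cr (Val P (Tgt Mo (snd t)))"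
unfolding gens_def by blast
 let ?x = "\<lambda>i\<in>{..1::nat}. if i = 0 then Inl p else Inr m"
 have x: "?x : (\<Pi>\<^sub>E i\<in>{..1}. cr (?f t i))"
unfolding i01 using z f0[OF z(2)] f1[OF z(2)] by auto
 have "?g (t, ?x) : cr ?B" using spans_subset[OF sp] z(2) x unfolding gs by blast
 moreover have "?e (?g (t, ?x)) = z" using eg[OF z(2) x] z(1) by simp
 ultimately show "z : ?e ` cr ?B" by blast
 qed
 qed
qed

text \<open>In degree zero the degenerate part is the span of the empty set, so cosets are
  singletons and nothing changes under normalization.\<close>

lemma nbar_aug_zero:
 fixes R :: "'r ring" and P :: "('o, 'm, 'r, 'v) operad" and N :: "('l, 'a, 'r, 'v, 'w) pmodule"
 assumes B: "rmod R (bar Op Mo R P N 0 L)" and NL: "rmod R (MVal N L)"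
and e: "mlinear R (bar Op Mo R P N 0 L) (MVal N L) (bar_aug Op Mo R P N L)"
 shows "rmod R (nbar Op Mo R P N 0 L)"
and "mlinear R (nbar Op Mo R P N 0 L) (MVal N L) (nbar_aug Op Mo R P N L)"
and "nbar_aug Op Mo R P N L ` cr (nbar Op Mo R P N 0 L) = bar_aug Op Mo R P N L ` cr (bar Op Mo R P N 0 L)"
proof -
 let ?B = "bar Op Mo R P N 0 L"
 note s0 = submodule_singleton_zero[OF B]
 have "mspan R ?B {} = {\<zero>\<^bsub>?B\<^esub>}"
using mspan_least[OF s0, of "{}"] submodule_zero[OF B submodule_mspan[OF B, of "{}"]] by auto
 hence nb: "nbar Op Mo R P N 0 L = mquot ?B {\<zero>\<^bsub>?B\<^esub>}" by (simp add: nbar_def degenerate_part_def)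
 show mn: "rmod R (nbar Op Mo R P N 0 L)" unfolding nb by (rule module_mquot[OF B s0])
 have ne: "nbar_aug Op Mo R P N L (mproj ?B {\<zero>\<^bsub>?B\<^esub>} x) = bar_aug Op Mo R P N L x" if "x : cr ?B" for x
by (simp add: nbar_aug_def mproj_zero_submodule[OF B that])
 have cn: "cr (nbar Op Mo R P N 0 L) = mproj ?B {\<zero>\<^bsub>?B\<^esub>} ` cr ?B" unfolding nb by (rule carrier_mquot[OF B s0])
 obtain h where h: "mlinear R (mquot ?B {\<zero>\<^bsub>?B\<^esub>}) (MVal N L) h" "!!x. x : cr ?B ==> h (mproj ?B {\<zero>\<^bsub>?B\<^esub>} x) = bar_aug Op Mo R P N L x"
using mquot_lift[OF B s0 NL e] lin_zero[OF B NL e] by auto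
 have "nbar_aug Op Mo R P N L K = h K" if "K : cr (nbar Op Mo R P N 0 L)" for K
using that h(2) ne unfolding cn by auto
 thus "mlinear R (nbar Op Mo R P N 0 L) (MVal N L) (nbar_aug Op Mo R P N L)"
using mlinear_cong[OF mn, of "nbar_aug Op Mo R P N L" h] h(1) nb by simp
 show "nbar_aug Op Mo R P N L ` cr (nbar Op Mo R P N 0 L) = bar_aug Op Mo R P N L ` cr ?B"
unfolding cn image_image using ne by (auto simp: image_iff)
qed

section \<open>The augmentation over the restricted categories\<close>

context blob_theory
begin

abbreviation "FMb == Fmod C M b"
abbreviation "SG == skein_generators d R M C U b"
abbreviation "FO == F_bar d R M C U"
abbreviation "NO == M_bar d R M C U b"
abbreviation "BO == Blob d M C"
abbreviation "MO == Mdl d M C b"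

lemma Fmb: "rmod R FMb" "Mv Empty = tag_module Field FMb"
using Fmod[of MM b] good_top b_Fld by (simp_all add: good_codim0 M_val_def)

lemma tpc_Empty: "tpc Empty"
by (simp add: top_contains_def decorated_def)

lemma cc_Empty: "dec X ==> cc X Empty"
unfolding cc_iff using tpcD(1)[OF tpc_Empty] by simp

text \<open>Discarding arrows with target \<open>(Empty, Empty)\<close> is exactly the condition on
  \<open>X\<close>. In the full category the choice \<open>X = Empty\<close> would contribute every
  field through the action of the unit.\<close>

lemma towers_zero: "t : towers BO MO 0 Empty \<longleftrightarrow> (EX X. t = ([], X, Empty) & tpc X & X ~= Empty)"
proof -
 have sel: "MArr MO = {(X', X). tpc X' & cc X' X & tpc X & (X', X) ~= (Empty, Empty)}" "Src MO = (%(X', X). X)"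
by (auto simp: Mdl_def Mdl_bar_def)
 show ?thesis unfolding towers_def sel
using tpc_Empty cc_Empty tpcD(1) by (cases t) (auto simp: split_paired_all)
qed

lemma Mdl_sel: "Tgt MO (X', X) = (X', X)" "MFib MO (X', X) = X'"
by (simp_all add: Mdl_def Mdl_bar_def)

text \<open>\<open>filla_last\<close> over the empty configuration. The final conclusion keeps hold
  of \<open>r\<close> when \<open>F\<close> is the only blob, as required for realizing a prescribed
  generator.\<close>

lemma filla_one:
 assumes tX: "tpc X" and X: "X ~= Empty" and r: "r : cr (Mv X)" and x: "x : fam X Empty" and F: "F : blobs X"
 obtains q u c where "compat c X" "c MM = b" "ty c MM {F} q" "filla MM (blobs X) Empty r x = snd (ins q (F, Field u))" "x F = Field u" "u : U F (c F)"
 "c F : Fld C d (sub (bnd F))" "blobs X = {F} ==> snd q = r"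
proof -
 note dX = tpcD(1)[OF tX] and rX = cc_refl[OF tpcD(1)[OF tX]] and XE = cc_Empty[OF tpcD(1)[OF tX]]
 obtain c where c: "compat c X" "compat c Empty" "c MM = b" using chain_compat[OF rX rX XE] tX by blast
 note o = ok_top[OF tX c(1,3)]
 have rP: "r : cr (PM c MM (blobs X))" using r by (simp add: Mv_PM[OF tX c(1,3)])
 have e: "inside Empty G = {}" for G :: "'p set" by (simp add: inside_def)
 obtain u where u: "x F = Field u" "u : U F (c F)" using fam_mem[OF x F] ff_eq[OF XE F c(1,2)] by (auto simp: e)
 have cF: "c F : Fld C d (sub (bnd F))" using okD(4)[OF o] F by (simp add: decor_def)
 show thesis
 proof (cases "blobs X = {F}")
 case True
 have "filla MM (blobs X) Empty r x = snd (ins (hole MM {F}, r) (F, Field u))"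
unfolding filla_def True Fill_singleton by (simp add: prs_def e u(1))
 moreover have "ty c MM {F} (hole MM {F}, r)" using o rP True by (simp add: ty_def)
 ultimately show thesis using that[OF c(1,3)] u cF by simp
 next
 case False
 obtain q where "ty c MM {F} q" "filla MM (blobs X) Empty r x = snd (ins q (F, x F))"
using filla_last[OF XE c(1,2) o order_refl x rP F e] by blast
 thus thesis using that[OF c(1,3)] u cF False by simp
 qed
qed

text \<open>A generator of \<open>U(M;b)\<close> is an action along a configuration with one blob.
  Conversely, an action along any nonempty configuration, applied to a pure tensor, inserts the
  relation of one chosen blob into a field that has absorbed the others.\<close>

lemma skein_gens_eq:
 "mspan R (Mv Empty) {N X Empty m p |X m p. tpc X & X ~= Empty & m : cr (Mv X) & p : cr (FT X Empty)} = Field ` mspan R FMb SG"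
 (is "mspan R _ ?gens = Field ` ?W")
and skein_gens_carrier: "SG \<subseteq> cr FMb"
proof -
 note mE = Mv_mod[OF tpc_Empty]
 have Nc: "N X Empty m p : cr (Mv Empty)" if "tpc X" "m : cr (Mv X)" "p : cr (FT X Empty)" for X m p
by (rule lin_in[OF bilinD(1)[OF N_facts(1)[OF that(1) cc_Empty[OF tpcD(1)[OF that(1)]]] that(2)] that(3)])
 have gc: "?gens \<subseteq> cr (Mv Empty)" using Nc by blast
 have SG: "EX X m p. Field g = N X Empty m p & tpc X & X ~= Empty & m : cr (Mv X) & p : cr (FT X Empty)" if g: "g : SG" for g
 proof -
 \<comment> \<open>Treats both kinds of generators at once: \<open>m\<close> is the field on the
   complement, degenerate if \<open>D\<close> is all of \<open>M\<close>.\<close>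
 have key: "EX X m p. Field g = N X Empty m p & tpc X & X ~= Empty & m : cr (Mv X) & p : cr (FT X Empty)"
 if tX: "tpc (Conf {D} e)" and m: "m : cr (Mv (Conf {D} e))" and u: "u : U D e"
and eq: "!!q c. c MM = b ==> c D = e ==> ty c MM {D} q ==> snd q = m ==> snd (ins q (D, Field u)) = Field g" for D e m u
 proof -
 let ?X = "Conf {D} e" and ?x = "(\<lambda>E\<in>{D}. Field u) :: 'p set => ('f, 'r) gfield"
 note dX = tpcD(1)[OF tX] and XE = cc_Empty[OF tpcD(1)[OF tX]]
 have de: "dco ?X (bnd D) = e" using dco_single[OF dX, of D] by simp
 have "?x : fam ?X Empty" using u de by (simp add: fam_PiE field_factor_def Let_def inside_def)
 hence x: "?x : fam ?X Empty" .
 obtain q v c where q: "compat c ?X" "c MM = b" "ty c MM {D} q" "filla MM (blobs ?X) Empty m ?x = snd (ins q (D, Field v))" "?x D = Field v"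
 "snd q = m" by (rule filla_one[OF tX _ m x, of D]) auto
 have "c D = e" using q(1) de by (simp add: compat_def)
 hence "Field g = N ?X Empty m (FP ?X Empty ?x)"
using eq[OF q(2) _ q(3,6)] q(4,5) N_facts(2)[OF tX XE m x] by simp
 thus ?thesis using tX m FT_facts(2)[OF XE x] by blast
 qed
 from g consider (1) D e u r where "g = Glue C (Suc d) M D (hole MM {D}) u r" "blob d M MM D" "D ~= MM" "e : Fld C d (sub (bnd D))" "u : U D e"
 "r : cr (Fmod C (sub (hole MM {D})) (Glue C d (sub (bnd MM Un bnd D)) (bnd MM) (bnd D) b e))"
 | (2) a u where "g = a \<odot>\<^bsub>FMb\<^esub> u" "blob d M MM MM" "a : cr R" "u : U MM b"
unfolding skein_generators_def by blast
 thus ?thesis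
 proof cases
 case 1
 have dec: "dec (Conf {D} e)" using 1(2,4) by (simp add: decorated_def blob_config_def bnds_sing)
 hence tX: "tpc (Conf {D} e)" using 1(3) by (simp add: top_contains_def)
 have de: "dco (Conf {D} e) (bnd D) = e" using dco_single[OF dec, of D] by simp
 have m: "Field r : cr (Mv (Conf {D} e))"
using 1(3,6) de by (auto simp: M_val_def cut_fields_def bnds_sing)
 show ?thesis
 proof (rule key[OF tX m 1(5)])
 fix q c assume c: "c MM = b" "c D = e" and q: "ty c MM {D} q" "snd q = Field r"
 have gD: "good D" using decD(4)[OF dec, of D] by simp
 obtain rr where "snd q = Field rr" "snd (ins q (D, Field u)) = Field (Glue C (Suc d) (sub MM) D (hole MM {D}) u rr)"
using ins_U(2)[OF q(1) 1(2) gD _ _ 1(3)] 1(4,5) c by blast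
 thus "snd (ins q (D, Field u)) = Field g" using q(2) 1(1) by simp
 qed
 next
 case 2
 have dec: "dec (Conf {MM} b)" using 2(2) b_bnd by (simp add: decorated_def blob_config_def bnds_sing)
 hence tX: "tpc (Conf {MM} b)" by (simp add: top_contains_def)
 have m: "Degen a b : cr (Mv (Conf {MM} b))"
using 2(3) by (simp add: M_val_def cut_fields_def degen_simps)
 show ?thesis
 proof (rule key[OF tX m 2(4)])
 fix q c assume c: "c MM = b" and q: "ty c MM {MM} q" "snd q = Degen a b"
 obtain T where "q = (T, Degen a b)" using q(2) by (cases q) auto
 hence "ins q (MM, Field u) = scl a (MM, Field u)" by (simp add: ins_simps)
 moreover have "Bdr C d M u = b"
using submodule_subset[OF U_sub[OF 2(2), of b]] b_bnd 2(4) carrier_Fmod[of MM b] good_top b_Fld by (auto simp: good_codim0)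
 ultimately show "snd (ins q (MM, Field u)) = Field g" using 2(1) by (simp add: scl_def gscale_def)
 qed
 qed
 qed
 have SG': "Field g : ?gens" if "g : SG" for g using SG[OF that] by blast
 have "Field g : cr (Mv Empty)" if "g : SG" for g using SG'[OF that] gc by blast
 thus SGc: "SG \<subseteq> cr FMb" unfolding Fmb(2) by auto
 note sW = submodule_mspan[OF Fmb(1) SGc]
 have lt: "mlinear R FMb (Mv Empty) Field" unfolding Fmb(2) by (rule mlinear_tag) simp
 have sFW: "submodule (Field ` ?W) R (Mv Empty)" by (rule submodule_image[OF Fmb(1) mE lt sW])
 show "mspan R (Mv Empty) ?gens = Field ` ?W"
 proof
 show "mspan R (Mv Empty) ?gens \<subseteq> Field ` ?W"
 proof (rule mspan_least[OF sFW], rule subsetI)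
 fix z assume "z : ?gens"
 then obtain X m p where z: "z = N X Empty m p" "tpc X" "X ~= Empty" "m : cr (Mv X)" "p : cr (FT X Empty)" by blast
 note dX = tpcD(1)[OF z(2)]
 note XE = cc_Empty[OF dX]
 \<comment> \<open>The \<open>p\<close> for which the claim holds form a submodule, so pure tensors
   suffice.\<close>
 have "p : {p : cr (FT X Empty). N X Empty m p : Field ` ?W}"
 proof (rule spansD[OF FT_facts(3)[OF XE] submodule_preimage[OF FT_facts(1)[OF XE] mE bilinD(1)[OF N_facts(1)[OF z(2) XE] z(4)] sFW] _ z(5)], rule subsetI)
 fix t assume "t : FP X Empty ` fam X Empty"
 then obtain x where x: "t = FP X Empty x" "x : fam X Empty" by blast
 obtain F where F: "F : blobs X" using decD(9)[OF dX z(3)] by blast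
 obtain q u c where q: "c MM = b" "ty c MM {F} q" "filla MM (blobs X) Empty m x = snd (ins q (F, Field u))" "u : U F (c F)" "c F : Fld C d (sub (bnd F))"
by (rule filla_one[OF z(2,3,4) x(2) F])
 note bF = decD(8)[OF dX F] and gF = decD(4)[OF dX F]
 have "EX g:SG. snd (ins q (F, Field u)) = Field g"
 proof (cases "F = MM")
 case True
 obtain a where "a : cr R" "snd (ins q (F, Field u)) = Field (a \<odot>\<^bsub>FMb\<^esub> u)"
using ins_U(1)[OF q(2) bF gF q(4,5) True] q(1) by auto
 moreover have "a \<odot>\<^bsub>FMb\<^esub> u : SG" if "a : cr R" for a
unfolding skein_generators_def using that bF q(1,4) True by blast
 ultimately show ?thesis by blast
 next
 case False
 obtain rr where rr: "rr : cr (Fmod C (sub (hole MM {F})) (Glue C d (sub (bnd MM Un bnd F)) (bnd MM) (bnd F) b (c F)))"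
 "snd (ins q (F, Field u)) = Field (Glue C (Suc d) M F (hole MM {F}) u rr)"
using ins_U(2)[OF q(2) bF gF q(4,5) False] q(1) by auto
 have "Glue C (Suc d) M F (hole MM {F}) u rr : SG"
unfolding skein_generators_def using bF False q(4,5) rr(1) by blast
 thus ?thesis using rr(2) by blast
 qed
 hence "N X Empty m t : Field ` ?W"
using N_facts(2)[OF z(2) XE z(4) x(2)] x(1) q(3) mspan_superset[of SG R FMb] by auto
 thus "t : {p : cr (FT X Empty). N X Empty m p : Field ` ?W}" using FT_facts(2)[OF XE x(2)] x(1) by simp
 qed
 thus "z : Field ` ?W" using z(1) by simp
 qed
 have "?W \<subseteq> {x : cr FMb. Field x : mspan R (Mv Empty) ?gens}"
 proof (rule mspan_least[OF submodule_preimage[OF Fmb(1) mE lt submodule_mspan[OF mE gc]]], rule subsetI)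
 fix g assume g: "g : SG"
 show "g : {x : cr FMb. Field x : mspan R (Mv Empty) ?gens}"
using subsetD[OF SGc g] subsetD[OF mspan_superset SG'[OF g]] by simp
 qed
 thus "Field ` ?W \<subseteq> mspan R (Mv Empty) ?gens" by blast
 qed
qed

text \<open>Values of the module of fields carry the tag \<open>Field\<close>, so the quotient map
  to the skein module is composed with the untagging \<open>?u\<close>.\<close>

lemma skein_homology:
 assumes A: "rmod R A" and e: "mlinear R A (Mv Empty) e" and im: "e ` cr A = Field ` mspan R FMb SG"
 shows "module_iso R (homology_at A e (Mv Empty) (%_. ()) zero_module) (skein_module d R M C U b)"
proof -
 let ?W = "mspan R FMb SG" and ?u = "%y :: ('f, 'r) gfield. inv_into UNIV Field y"
 note sW = submodule_mspan[OF Fmb(1) skein_gens_carrier]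
 have u: "mlinear R (Mv Empty) FMb ?u" unfolding Fmb(2) by (rule mlinear_untag) simp_all
 show ?thesis unfolding skein_module_def
 proof (rule homology_at_cokernel[OF A Mv_mod[OF tpc_Empty] module_mquot[OF Fmb(1) sW] e lin_comp[OF u mlinear_proj[OF Fmb(1) sW]]])
 show "e ` cr A = {x : cr (Mv Empty). mproj FMb ?W (?u x) = \<zero>\<^bsub>mquot FMb ?W\<^esub>}"
 proof -
 have k: "mproj FMb ?W x = \<zero>\<^bsub>mquot FMb ?W\<^esub> \<longleftrightarrow> x : ?W" if "x : cr FMb" for x
by (rule proj_eq_zero_iff[OF Fmb(1) sW that])
 show ?thesis unfolding im Fmb(2)
 proof (rule subset_antisym; rule subsetI)
 fix y :: "('f, 'r) gfield" assume "y : Field ` ?W"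
 then obtain x where x: "y = Field x" "x : ?W" by blast
 hence "x : cr FMb" using submodule_subset[OF sW] by blast
 thus "y : {x : cr (tag_module Field FMb). mproj FMb ?W (?u x) = \<zero>\<^bsub>mquot FMb ?W\<^esub>}"
using x k[of x] by simp
 next
 fix y :: "('f, 'r) gfield" assume y: "y : {x : cr (tag_module Field FMb). mproj FMb ?W (?u x) = \<zero>\<^bsub>mquot FMb ?W\<^esub>}"
 then obtain x where x: "y = Field x" "x : cr FMb" by auto
 hence "x : ?W" using y k[of x] by simp
 thus "y : Field ` ?W" using x(1) by blast
 qed
 qed
 show "(%x. mproj FMb ?W (?u x)) ` cr (Mv Empty) = cr (mquot FMb ?W)"
unfolding Fmb(2) carrier_mquot[OF Fmb(1) sW] by (simp add: image_image)
 qed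
qed

lemma blob_aug:
 "rmod R (bar BO MO R FO NO 0 Empty)"
 "mlinear R (bar BO MO R FO NO 0 Empty) (Mv Empty) (bar_aug BO MO R FO NO Empty)"
 "bar_aug BO MO R FO NO Empty ` cr (bar BO MO R FO NO 0 Empty) = Field ` mspan R FMb SG"
proof -
 have NL: "rmod R (MVal NO Empty)" by (simp add: M_sel Mv_mod tpc_Empty)
 have V: "rmod R (Val FO (Tgt MO (snd t)))" and W: "rmod R (MVal NO (MFib MO (snd t)))"
and act: "mbilinear R (MVal NO (MFib MO (snd t))) (Val FO (Tgt MO (snd t))) (MVal NO Empty) (Act NO (snd t))"
 if t': "t : towers BO MO 0 Empty" for t
 proof -
 obtain X where t: "t = ([], X, Empty)" "tpc X" using t' towers_zero by blast
 note XE = cc_Empty[OF tpcD(1)[OF t(2)]]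
 show "rmod R (Val FO (Tgt MO (snd t)))" using FT_facts(1)[OF XE] by (simp add: t(1) Mdl_sel F_sel)
 show "rmod R (MVal NO (MFib MO (snd t)))" using Mv_mod[OF t(2)] by (simp add: t(1) Mdl_sel M_sel)
 show "mbilinear R (MVal NO (MFib MO (snd t))) (Val FO (Tgt MO (snd t))) (MVal NO Empty) (Act NO (snd t))"
using N_facts(1)[OF t(2) XE] by (simp add: t(1) Mdl_sel F_sel M_sel)
 qed
 note z = bar_aug_zero[OF cring_R NL V W act]
 show "rmod R (bar BO MO R FO NO 0 Empty)" by (rule z(1))
 show "mlinear R (bar BO MO R FO NO 0 Empty) (Mv Empty) (bar_aug BO MO R FO NO Empty)"
using z(2) by (simp add: M_sel)
 have "{Act NO (snd t) m p |t m p. t : towers BO MO 0 Empty & m : cr (MVal NO (MFib MO (snd t))) \<and>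
 p : cr (Val FO (Tgt MO (snd t)))} =
 {N X Empty m p |X m p. tpc X & X ~= Empty & m : cr (Mv X) & p : cr (FT X Empty)}" (is "?L = ?R")
 proof (rule subset_antisym; rule subsetI)
 fix y assume "y : ?L"
 then obtain t m p where y: "y = Act NO (snd t) m p" "t : towers BO MO 0 Empty" "m : cr (MVal NO (MFib MO (snd t)))"
 "p : cr (Val FO (Tgt MO (snd t)))" by blast
 obtain X where t: "t = ([], X, Empty)" "tpc X" "X ~= Empty" using y(2) towers_zero by blast
 show "y : ?R" using y t by (simp add: Mdl_sel F_sel M_sel) blast
 next
 fix y assume "y : ?R"
 then obtain X m p where y: "y = N X Empty m p" "tpc X" "X ~= Empty" "m : cr (Mv X)" "p : cr (FT X Empty)" by blast
 have "([], X, Empty) : towers BO MO 0 Empty" using towers_zero y(2,3) by blast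
 hence "EX t m' p'. y = Act NO (snd t) m' p' & t : towers BO MO 0 Empty & m' : cr (MVal NO (MFib MO (snd t))) \<and>
 p' : cr (Val FO (Tgt MO (snd t)))"
using y by (intro exI[of _ "([], X, Empty)"] exI[of _ m] exI[of _ p]) (simp add: Mdl_sel F_sel M_sel)
 thus "y : ?L" by blast
 qed
 thus "bar_aug BO MO R FO NO Empty ` cr (bar BO MO R FO NO 0 Empty) = Field ` mspan R FMb SG"
using z(3) skein_gens_eq by (simp only: M_sel)
qed

end

theorem theoremB:
  fixes d :: nat and R :: "'r ring" and M :: "'p topology" and C :: "('p, 'f, 'r) fields"
    and U :: "'p set \<Rightarrow> 'f \<Rightarrow> 'f set" and b :: 'f
  assumes "cring R"
    and "manifold (Suc d) M" and "connected_space M" and "topspace M \<noteq> {}"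
    and "system_of_fields d C" and "linearly_enriched d C R M" and "local_relations d R M C U"
    and "b \<in> Fld C d (bdry (Suc d) M)"
  shows
    "(let \<B> = Blob_bar d M C; \<M> = Mdl_bar d M C b; P = F_bar d R M C U; N = M_bar d R M C U b in
        Empty \<in> MObj \<M> \<and>
        free_acyclic_resolution TYPE('k) \<B> \<M> R P N
          (bar \<B> \<M> R P N) (bar_diff \<B> \<M> R P N) (bar_aug \<B> \<M> R P N) \<and>
        module_iso R
          (homology_at (bar \<B> \<M> R P N 1 Empty) (bar_diff \<B> \<M> R P N 1 Empty)
             (bar \<B> \<M> R P N 0 Empty) (\<lambda>_. ()) zero_module)
          (Fmod C M b) \<and>
        free_acyclic_resolution TYPE('k) \<B> \<M> R P N
          (nbar \<B> \<M> R P N) (nbar_diff \<B> \<M> R P N) (nbar_aug \<B> \<M> R P N) \<and>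
        module_iso R
          (homology_at (nbar \<B> \<M> R P N 1 Empty) (nbar_diff \<B> \<M> R P N 1 Empty)
             (nbar \<B> \<M> R P N 0 Empty) (\<lambda>_. ()) zero_module)
          (Fmod C M b)) \<and>
     (let \<B> = Blob d M C; \<M> = Mdl d M C b; P = F_bar d R M C U; N = M_bar d R M C U b in
        Empty \<in> MObj \<M> \<and>
        module_iso R
          (homology_at (bar \<B> \<M> R P N 0 Empty) (bar_aug \<B> \<M> R P N Empty)
             (MVal N Empty) (\<lambda>_. ()) zero_module)
          (skein_module d R M C U b) \<and>
        module_iso R
          (homology_at (nbar \<B> \<M> R P N 0 Empty) (nbar_aug \<B> \<M> R P N Empty)
             (MVal N Empty) (\<lambda>_. ()) zero_module)
          (skein_module d R M C U b))"
proof -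
 interpret blob_theory d M C R U b
using assms by (simp add: blob_theory_def field_theory_def mfd_def field_theory_axioms_def blob_theory_axioms_def)
 have E: "Empty : MObj (Mdl_bar d M C b)" "Empty : MObj (Mdl d M C b)"
using tpc_Empty by (simp_all add: Mdl_def Mdl_bar_def)
 note pb = pre_bar_fields
 \<comment> \<open>\<open>cat_eqs\<close> identifies the abstract preorder construction with the
   categories of blobs.\<close>
 note res = pre_bar.bar_resolutions[OF pb, folded cat_eqs]
 note H0 = pre_bar.bar_H0[OF pb tpc_Empty, folded cat_eqs, unfolded M_sel Fmb(2)]
 have iso: "module_iso R (tag_module Field FMb) FMb" for R :: "'r ring" by (rule module_iso_untag) simp
 have NL: "rmod R (MVal NO Empty)" by (simp add: M_sel Mv_mod tpc_Empty)
 note na = nbar_aug_zero[OF blob_aug(1) NL, unfolded M_sel, OF blob_aug(2)]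
 show ?thesis
unfolding Let_def M_sel
using E res module_iso_trans[OF H0(1) iso] module_iso_trans[OF H0(2) iso]
 skein_homology[OF blob_aug] skein_homology[OF na(1,2) na(3)[unfolded blob_aug(3)]]
by (intro conjI) assumption+
qed

end
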